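(* For every real $\alpha\geq 1$, the operator $h_\alpha$ in $L_2(\mathbb{R}_+)$ is self-adjoint. If $\alpha<1$ is real, then $h_{\alpha,\vartheta}$ is a self-adjoint extension of $h_\alpha$ for every $\vartheta\in\mathbb{R}$ and, conversely, every self-adjoint extension of $h_\alpha$ is equal to $h_{\alpha,\vartheta}$ for some $\vartheta\in\mathbb{R}$. Moreover, for $\alpha<1$ and $\vartheta,\vartheta'\in\mathbb{R}$, we have $h_{\alpha,\vartheta}=h_{\alpha,\vartheta'}$ if and only if $\vartheta-\vartheta'\in\pi\mathbb{Z}$.
   Context: $\mathbb{R}_+=(0,\infty)$; $L_2(\mathbb{R}_+)$ is the Hilbert space of classes $[f]$ of square-integrable complex functions on $\mathbb{R}_+$ (Lebesgue measure). For a map $F$ whose values are maps, $F(x|y)$ denotes $(F(x))(y)$. Generalized eigenfunctions. For $\kappa,z\in\mathbb{C}$, $r>0$ put $\mathfrak u^\kappa(z|r)=r^{1/2+\kappa}\mathcal X_\kappa(r^2z)$, where $\mathcal X_\kappa(\zeta)=2^{-\kappa}\sum_{n=0}^\infty\frac{(-1)^n\zeta^n}{\Gamma(\kappa+n+1)\,n!\,2^{2n}}$ (with $1/\Gamma=0$ at the poles of $\Gamma$). Let $\vartheta_\kappa=\pi\kappa/2$, and $\mathrm{sinc}\,w=w^{-1}\sin w$ for $w\ne0$, $\mathrm{sinc}\,0=1$. Put $\mathfrak a^\kappa(z)=\frac{\mathfrak u^\kappa(z)-\mathfrak u^{-\kappa}(z)}{\kappa}\cos\vartheta_\kappa$ for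 $\kappa\neq0$, $\mathfrak a^0(z|r)=\lim_{\kappa\to0}\mathfrak a^\kappa(z|r)$, and $\mathfrak b^\kappa(z)=\frac{\pi}{2}(\mathfrak u^\kappa(z)+\mathfrak u^{-\kappa}(z))\,\mathrm{sinc}\,\vartheta_\kappa$. Both are even in $\kappa$, so $\mathcal A^\alpha(z)$ and $\mathcal B^\alpha(z)$ are well defined for $\alpha\in\mathbb{C}$ by $\mathcal A^{\kappa^2}(z)=\mathfrak a^\kappa(z)$, $\mathcal B^{\kappa^2}(z)=\mathfrak b^\kappa(z)$. Put $\mathcal U^\alpha_\vartheta(z)=\mathcal A^\alpha(z)\cos\vartheta+\mathcal B^\alpha(z)\sin\vartheta$. Operators. Let $\mathcal D$ be the space of complex continuously differentiable functions on $\mathbb{R}_+$ whose derivative is absolutely continuous on every segment $[a,b]\subset\mathbb{R}_+$. For $\alpha\in\mathbb{R}$ and $f\in\mathcal D$ let $(\mathscr L_\alpha f)(r)=-f''(r)+\frac{\alpha-1/4}{r^2}f(r)$ for a.e. $r>0$. Let $\Delta_\alpha=\{f\in\mathcal D: f\text{ and }\mathscr L_\alpha f\text{ are square-integrable on }\mathbb{R}_+\}$. For a linear subspace $Z\subset\Delta_\alpha$ let $H_\alpha(Z)$ be the operator in $L_2(\mathbb{R}_+)$ with domain $\{[f]:f\in Z\}$ and $H_\alpha(Z)[f]=\mathscr L_\alpha f$. The operator $h_\alpha$ is the closure of the symmetric operator $H_\alpha(C_0^\infty(\mathbb{R}_+))$, where $C_0^\infty(\mathbb{R}_+)$ is the space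 of smooth functions on $\mathbb{R}_+$ with compact support. Let $W_r(f,g)=f(r)g'(r)-f'(r)g(r)$. For $\alpha<1$, $\vartheta\in\mathbb{R}$ and $f\in\Delta_\alpha$ the limit $\lim_{r\downarrow0}W_r(\mathcal U^\alpha_\vartheta(0),f)$ exists, and $h_{\alpha,\vartheta}=H_\alpha(Z_{\alpha,\vartheta})$ with $Z_{\alpha,\vartheta}=\{f\in\Delta_\alpha:\lim_{r\downarrow0}W_r(\mathcal U^\alpha_\vartheta(0),f)=0\}$. *)

theory Defs
  imports "HOL-Analysis.Analysis"
begin

section \<open>The Hilbert space of square-integrable functions on the positive half-line\<close>

abbreviation half_line :: "real measure" where
  "half_line \<equiv> lebesgue_on {0<..}"

text \<open>Functions on the half-line are represented by total functions on the reals; every notion below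
  depends only on their values at positive arguments.\<close>

definition square_integrable :: "(real \<Rightarrow> complex) \<Rightarrow> bool" where
  "square_integrable f \<longleftrightarrow>
     f \<in> borel_measurable half_line \<and> integrable half_line (\<lambda>r. (cmod (f r))\<^sup>2)"

lemma square_integrable_zero: "square_integrable (\<lambda>_. 0)"
  by (simp add: square_integrable_def)

lemma square_integrable_add:
  assumes "square_integrable f" "square_integrable g"
  shows "square_integrable (\<lambda>r. f r + g r)"
proof -
  have [measurable]: "f \<in> borel_measurable half_line" "g \<in> borel_measurable half_line"
    and i: "integrable half_line (\<lambda>r. (cmod (f r))\<^sup>2)" "integrable half_line (\<lambda>r. (cmod (g r))\<^sup>2)"
    using assms by (auto simp: square_integrable_def)
  have bound: "(cmod (x + y))\<^sup>2 \<le> 2 * (cmod x)\<^sup>2 + 2 * (cmod y)\<^sup>2" for x y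
  proof -
    have "(cmod (x + y))\<^sup>2 \<le> (cmod x + cmod y)\<^sup>2"
      by (intro power_mono norm_triangle_ineq) auto
    also have "\<dots> \<le> 2 * (cmod x)\<^sup>2 + 2 * (cmod y)\<^sup>2"
      using sum_squares_bound[of "cmod x" "cmod y"] by (simp add: power2_sum)
    finally show ?thesis .
  qed
  have "integrable half_line (\<lambda>r. (cmod (f r + g r))\<^sup>2)"
    by (rule Bochner_Integration.integrable_bound[where
          f = "\<lambda>r. 2 * (cmod (f r))\<^sup>2 + 2 * (cmod (g r))\<^sup>2"])
       (use i bound in \<open>auto\<close>)
  then show ?thesis by (simp add: square_integrable_def)
qed

lemma square_integrable_mult:
  assumes "square_integrable f"
  shows "square_integrable (\<lambda>r. c * f r)"
  using assms by (auto simp: square_integrable_def norm_mult power_mult_distrib)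

lemma borel_measurable_mult_cnj:
  assumes "f \<in> borel_measurable half_line" "g \<in> borel_measurable half_line"
  shows "(\<lambda>r. f r * cnj (g r)) \<in> borel_measurable half_line"
proof -
  have "cnj \<in> borel_measurable borel"
    by (intro borel_measurable_continuous_onI continuous_intros)
  from measurable_compose[OF assms(2) this] assms(1) show ?thesis by simp
qed

lemma integrable_mult_cnj:
  assumes "square_integrable f" "square_integrable g"
  shows "integrable half_line (\<lambda>r. f r * cnj (g r))"
proof -
  have [measurable]: "f \<in> borel_measurable half_line" "g \<in> borel_measurable half_line"
    and i: "integrable half_line (\<lambda>r. (cmod (f r))\<^sup>2)" "integrable half_line (\<lambda>r. (cmod (g r))\<^sup>2)"
    using assms by (auto simp: square_integrable_def)
  have bound: "cmod (x * cnj y) \<le> (cmod x)\<^sup>2 + (cmod y)\<^sup>2" for x y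
  proof -
    have "2 * (cmod x * cmod y) \<le> (cmod x)\<^sup>2 + (cmod y)\<^sup>2"
      using sum_squares_bound[of "cmod x" "cmod y"] by simp
    then show ?thesis by (simp add: norm_mult) (smt (verit) mult_nonneg_nonneg norm_ge_zero)
  qed
  show ?thesis
    by (rule Bochner_Integration.integrable_bound[where
          f = "\<lambda>r. (cmod (f r))\<^sup>2 + (cmod (g r))\<^sup>2"])
       (use i bound in \<open>auto intro: borel_measurable_mult_cnj\<close>)
qed

definition l2_rel :: "(real \<Rightarrow> complex) \<Rightarrow> (real \<Rightarrow> complex) \<Rightarrow> bool" where
  "l2_rel f g \<longleftrightarrow> square_integrable f \<and> square_integrable g \<and> (AE r in half_line. f r = g r)"

quotient_type l2 = "real \<Rightarrow> complex" / partial: l2_rel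
proof (rule part_equivpI)
  show "\<exists>f. l2_rel f f"
    using square_integrable_zero by (auto simp: l2_rel_def)
  show "symp l2_rel"
    by (auto simp: symp_def l2_rel_def)
  show "transp l2_rel"
    by (auto simp: transp_def l2_rel_def)
qed

text \<open>\<open>l2_class f\<close> is the class $[f]$; it is meaningful only for square-integrable \<open>f\<close>.\<close>

abbreviation l2_class :: "(real \<Rightarrow> complex) \<Rightarrow> l2" where
  "l2_class \<equiv> abs_l2"

lemma l2_class_eq_iff:
  assumes "square_integrable f" "square_integrable g"
  shows "l2_class f = l2_class g \<longleftrightarrow> (AE r in half_line. f r = g r)"
  using Quotient3_rel[OF Quotient3_l2, of f g] assms by (simp add: l2_rel_def)

lemma l2_class_cases:
  obtains f where "square_integrable f" "x = l2_class f"
proof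
  show "square_integrable (rep_l2 x)"
    using Quotient3_rep_reflp[OF Quotient3_l2, of x] by (simp add: l2_rel_def)
  show "x = l2_class (rep_l2 x)"
    using Quotient3_abs_rep[OF Quotient3_l2, of x] by simp
qed

lift_definition scaleC_l2 :: "complex \<Rightarrow> l2 \<Rightarrow> l2" is "\<lambda>c f r. c * f r"
  by (auto simp: l2_rel_def intro: square_integrable_mult)

lift_definition cinner_l2 :: "l2 \<Rightarrow> l2 \<Rightarrow> complex"
  is "\<lambda>f g. integral\<^sup>L half_line (\<lambda>r. f r * cnj (g r))"
proof -
  fix f f' g g' assume *: "l2_rel f f'" "l2_rel g g'"
  have [measurable]: "f \<in> borel_measurable half_line" "g \<in> borel_measurable half_line"
    "f' \<in> borel_measurable half_line" "g' \<in> borel_measurable half_line"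
    using * by (auto simp: l2_rel_def square_integrable_def)
  show "integral\<^sup>L half_line (\<lambda>r. f r * cnj (g r)) = integral\<^sup>L half_line (\<lambda>r. f' r * cnj (g' r))"
    by (rule integral_cong_AE) (use * in \<open>auto simp: l2_rel_def intro: borel_measurable_mult_cnj\<close>)
qed

text \<open>The real Hilbert space structure underlying the complex one provides the norm and the topology.\<close>

instantiation l2 :: real_inner
begin

lift_definition zero_l2 :: l2 is "\<lambda>_. 0"
  by (simp add: l2_rel_def square_integrable_zero)

lift_definition plus_l2 :: "l2 \<Rightarrow> l2 \<Rightarrow> l2" is "\<lambda>f g r. f r + g r"
  by (auto simp: l2_rel_def intro: square_integrable_add)

definition "uminus_l2 x = scaleC_l2 (-1) x"
definition "minus_l2 (x :: l2) y = x + - y"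
definition "scaleR_l2 a x = scaleC_l2 (complex_of_real a) x"
definition "inner_l2 x y = Re (cinner_l2 x y)"
definition "norm_l2 (x :: l2) = sqrt (inner x x)"
definition "sgn_l2 (x :: l2) = inverse (norm x) *\<^sub>R x"
definition "dist_l2 (x :: l2) y = norm (x - y)"
definition uniformity_l2_def:
  "(uniformity :: (l2 \<times> l2) filter) = (INF e\<in>{0<..}. principal {(x, y). dist x y < e})"
definition open_l2_def:
  "open_l2 (U :: l2 set) \<longleftrightarrow> (\<forall>x\<in>U. \<forall>\<^sub>F (x', y) in uniformity. x' = x \<longrightarrow> y \<in> U)"

instance
proof
  fix x y z :: l2 and a b :: real
  show "x + y + z = x + (y + z)"
    by transfer (auto simp: l2_rel_def add.assoc intro!: square_integrable_add)
  show "x + y = y + x"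
    by transfer (auto simp: l2_rel_def add.commute intro!: square_integrable_add)
  show "0 + x = x"
    by transfer (auto simp: l2_rel_def)
  show "- x + x = 0"
    unfolding uminus_l2_def
    by transfer (auto simp: l2_rel_def square_integrable_zero)
  show "x - y = x + - y"
    by (simp add: minus_l2_def)
  show "a *\<^sub>R (x + y) = a *\<^sub>R x + a *\<^sub>R y"
    unfolding scaleR_l2_def
    by transfer (auto simp: l2_rel_def distrib_left intro!: square_integrable_add square_integrable_mult)
  show "(a + b) *\<^sub>R x = a *\<^sub>R x + b *\<^sub>R x"
    unfolding scaleR_l2_def
    by transfer (auto simp: l2_rel_def distrib_right intro!: square_integrable_add square_integrable_mult)
  show "a *\<^sub>R b *\<^sub>R x = (a * b) *\<^sub>R x"
    unfolding scaleR_l2_def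
    by transfer (auto simp: l2_rel_def mult.assoc intro!: square_integrable_mult)
  show "1 *\<^sub>R x = x"
    unfolding scaleR_l2_def by transfer (auto simp: l2_rel_def)
  show "sgn x = inverse (norm x) *\<^sub>R x" by (simp add: sgn_l2_def)
  show "dist x y = norm (x - y)" by (simp add: dist_l2_def)
  show "norm x = sqrt (inner x x)" by (simp add: norm_l2_def)
  show "inner x y = inner y x"
  proof -
    have "cinner_l2 x y = cnj (cinner_l2 y x)"
      by transfer (subst Bochner_Integration.integral_cnj[symmetric], simp add: mult.commute)
    then show ?thesis by (simp add: inner_l2_def)
  qed
  show "inner (x + y) z = inner x z + inner y z"
  proof -
    have "cinner_l2 (x + y) z = cinner_l2 x z + cinner_l2 y z"
      by transfer (auto simp: l2_rel_def distrib_right integrable_mult_cnj)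
    then show ?thesis by (simp add: inner_l2_def)
  qed
  show "inner (a *\<^sub>R x) y = a * inner x y"
  proof -
    have "cinner_l2 (a *\<^sub>R x) y = a * cinner_l2 x y"
      unfolding scaleR_l2_def by transfer (auto simp: mult.assoc)
    then show ?thesis by (simp add: inner_l2_def)
  qed
  obtain f where f: "square_integrable f" "x = l2_class f"
    by (rule l2_class_cases)
  have "cinner_l2 x x = integral\<^sup>L half_line (\<lambda>r. f r * cnj (f r))"
    using f by (simp add: cinner_l2.abs_eq l2_rel_def)
  also have "(\<lambda>r. f r * cnj (f r)) = (\<lambda>r. of_real ((cmod (f r))\<^sup>2))"
    by (simp only: complex_norm_square)
  finally have self: "inner x x = integral\<^sup>L half_line (\<lambda>r. (cmod (f r))\<^sup>2)"
    unfolding inner_l2_def by (simp only: integral_complex_of_real Re_complex_of_real)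
  show "0 \<le> inner x x"
    by (simp add: self)
  have "inner x x = 0 \<longleftrightarrow> (AE r in half_line. (cmod (f r))\<^sup>2 = 0)"
    unfolding self
    by (rule integral_nonneg_eq_0_iff_AE) (use f in \<open>auto simp: square_integrable_def\<close>)
  also have "\<dots> \<longleftrightarrow> x = 0"
    unfolding f(2) zero_l2_def using l2_class_eq_iff[OF f(1) square_integrable_zero] by simp
  finally show "inner x x = 0 \<longleftrightarrow> x = 0" .
qed (rule uniformity_l2_def open_l2_def)+

end


section \<open>Unbounded operators, given by their graphs\<close>

type_synonym l2_operator = "(l2 \<times> l2) set"

definition linear_operator :: "l2_operator \<Rightarrow> bool" where
  "linear_operator T \<longleftrightarrow> single_valued T \<and> (0, 0) \<in> T \<and>
     (\<forall>(x, y)\<in>T. \<forall>(x', y')\<in>T. (x + x', y + y') \<in> T) \<and>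
     (\<forall>c. \<forall>(x, y)\<in>T. (scaleC_l2 c x, scaleC_l2 c y) \<in> T)"

definition densely_defined :: "l2_operator \<Rightarrow> bool" where
  "densely_defined T \<longleftrightarrow> closure (Domain T) = UNIV"

definition adjoint_operator :: "l2_operator \<Rightarrow> l2_operator" where
  "adjoint_operator T = {(u, v). \<forall>(x, y)\<in>T. cinner_l2 y u = cinner_l2 x v}"

definition self_adjoint :: "l2_operator \<Rightarrow> bool" where
  "self_adjoint T \<longleftrightarrow> linear_operator T \<and> densely_defined T \<and> adjoint_operator T = T"

abbreviation extends :: "l2_operator \<Rightarrow> l2_operator \<Rightarrow> bool" where
  "extends T S \<equiv> S \<subseteq> T"


section \<open>Generalized eigenfunctions\<close>

definition X_fun :: "complex \<Rightarrow> complex \<Rightarrow> complex" where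
  "X_fun \<kappa> \<zeta> = 2 powr (-\<kappa>) *
     (\<Sum>n. (-1) ^ n * \<zeta> ^ n * rGamma (\<kappa> + of_nat n + 1) / (fact n * 2 ^ (2 * n)))"

definition u_fun :: "complex \<Rightarrow> complex \<Rightarrow> real \<Rightarrow> complex" where
  "u_fun \<kappa> z r = of_real r powr (1 / 2 + \<kappa>) * X_fun \<kappa> ((of_real r)\<^sup>2 * z)"

definition theta :: "complex \<Rightarrow> complex" where
  "theta \<kappa> = of_real pi * \<kappa> / 2"

definition csinc :: "complex \<Rightarrow> complex" where
  "csinc w = (if w = 0 then 1 else sin w / w)"

definition a_fun_nonzero :: "complex \<Rightarrow> complex \<Rightarrow> real \<Rightarrow> complex" where
  "a_fun_nonzero \<kappa> z r = (u_fun \<kappa> z r - u_fun (-\<kappa>) z r) / \<kappa> * cos (theta \<kappa>)"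

definition a_fun :: "complex \<Rightarrow> complex \<Rightarrow> real \<Rightarrow> complex" where
  "a_fun \<kappa> z r =
     (if \<kappa> = 0 then Lim (at 0) (\<lambda>\<kappa>'. a_fun_nonzero \<kappa>' z r) else a_fun_nonzero \<kappa> z r)"

definition b_fun :: "complex \<Rightarrow> complex \<Rightarrow> real \<Rightarrow> complex" where
  "b_fun \<kappa> z r = of_real pi / 2 * (u_fun \<kappa> z r + u_fun (-\<kappa>) z r) * csinc (theta \<kappa>)"

text \<open>Both functions are even in \<open>\<kappa>\<close>, so any square root of \<open>\<alpha>\<close> may be used; see
  \<open>A_fun_square\<close> and \<open>B_fun_square\<close>.\<close>

definition A_fun :: "complex \<Rightarrow> complex \<Rightarrow> real \<Rightarrow> complex" where
  "A_fun \<alpha> z r = a_fun (csqrt \<alpha>) z r"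

definition B_fun :: "complex \<Rightarrow> complex \<Rightarrow> real \<Rightarrow> complex" where
  "B_fun \<alpha> z r = b_fun (csqrt \<alpha>) z r"

lemma a_fun_minus: "a_fun (-\<kappa>) z r = a_fun \<kappa> z r"
  by (cases "\<kappa> = 0") (auto simp: a_fun_def a_fun_nonzero_def theta_def field_simps)

lemma b_fun_minus: "b_fun (-\<kappa>) z r = b_fun \<kappa> z r"
  by (simp add: b_fun_def csinc_def theta_def add.commute)

lemma csqrt_square_cases: "csqrt (\<kappa>\<^sup>2) = \<kappa> \<or> csqrt (\<kappa>\<^sup>2) = - \<kappa>"
  using power2_eq_iff[of "csqrt (\<kappa>\<^sup>2)" \<kappa>] by simp

lemma A_fun_square: "A_fun (\<kappa>\<^sup>2) z r = a_fun \<kappa> z r"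
  using csqrt_square_cases[of \<kappa>] by (auto simp: A_fun_def a_fun_minus)

lemma B_fun_square: "B_fun (\<kappa>\<^sup>2) z r = b_fun \<kappa> z r"
  using csqrt_square_cases[of \<kappa>] by (auto simp: B_fun_def b_fun_minus)

definition U_fun :: "complex \<Rightarrow> complex \<Rightarrow> complex \<Rightarrow> real \<Rightarrow> complex" where
  "U_fun \<alpha> \<theta> z r = A_fun \<alpha> z r * cos \<theta> + B_fun \<alpha> z r * sin \<theta>"


section \<open>The Schroedinger operators with inverse-square potential\<close>

definition D1 :: "(real \<Rightarrow> complex) \<Rightarrow> real \<Rightarrow> complex" where
  "D1 f r = vector_derivative f (at r)"

definition absolutely_continuous_on :: "real set \<Rightarrow> (real \<Rightarrow> complex) \<Rightarrow> bool" where
  "absolutely_continuous_on S f \<longleftrightarrow>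
     (\<forall>\<epsilon>>0. \<exists>\<delta>>0. \<forall>P. finite P \<longrightarrow> (\<forall>(s, t)\<in>P. s \<le> t \<and> {s..t} \<subseteq> S) \<longrightarrow>
        disjoint_family_on (\<lambda>(s, t). {s<..<t}) P \<longrightarrow>
        (\<Sum>(s, t)\<in>P. t - s) < \<delta> \<longrightarrow> (\<Sum>(s, t)\<in>P. cmod (f t - f s)) < \<epsilon>)"

definition D_space :: "(real \<Rightarrow> complex) set" where
  "D_space = {f. f C1_differentiable_on {0<..} \<and>
     (\<forall>a b. 0 < a \<and> a \<le> b \<longrightarrow> absolutely_continuous_on {a..b} (D1 f))}"

text \<open>For \<open>f \<in> D_space\<close> the second derivative exists almost everywhere; on the exceptional null set
  \<open>D1 (D1 f)\<close> is arbitrary, which does not affect square-integrability or the class in \<open>l2\<close>.\<close>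

definition L_expr :: "real \<Rightarrow> (real \<Rightarrow> complex) \<Rightarrow> real \<Rightarrow> complex" where
  "L_expr \<alpha> f r = - D1 (D1 f) r + of_real ((\<alpha> - 1 / 4) / r\<^sup>2) * f r"

definition Delta :: "real \<Rightarrow> (real \<Rightarrow> complex) set" where
  "Delta \<alpha> = {f \<in> D_space. square_integrable f \<and> square_integrable (L_expr \<alpha> f)}"

definition H_op :: "real \<Rightarrow> (real \<Rightarrow> complex) set \<Rightarrow> l2_operator" where
  "H_op \<alpha> Z = {(l2_class f, l2_class (L_expr \<alpha> f)) | f. f \<in> Z}"

definition C0_infty :: "(real \<Rightarrow> complex) set" where
  "C0_infty = {f. (\<forall>n. \<forall>r>0. (D1 ^^ n) f differentiable (at r)) \<and>
     (\<exists>K. compact K \<and> K \<subseteq> {0<..} \<and> (\<forall>r>0. r \<notin> K \<longrightarrow> f r = 0))}"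

text \<open>The closure is that of the graph in the product topology.\<close>

definition h_op :: "real \<Rightarrow> l2_operator" where
  "h_op \<alpha> = closure (H_op \<alpha> C0_infty)"

definition wronskian :: "(real \<Rightarrow> complex) \<Rightarrow> (real \<Rightarrow> complex) \<Rightarrow> real \<Rightarrow> complex" where
  "wronskian f g r = f r * D1 g r - D1 f r * g r"

definition Z_space :: "real \<Rightarrow> real \<Rightarrow> (real \<Rightarrow> complex) set" where
  "Z_space \<alpha> \<theta> = {f \<in> Delta \<alpha>.
     (wronskian (U_fun (of_real \<alpha>) (of_real \<theta>) 0) f \<longlongrightarrow> 0) (at_right 0)}"

definition h_bc :: "real \<Rightarrow> real \<Rightarrow> l2_operator" where
  "h_bc \<alpha> \<theta> = H_op \<alpha> (Z_space \<alpha> \<theta>)"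

end

theory Submission
  imports Defs
begin

text \<open>The adjoint of the restriction of the operator to test functions is the maximal operator on \<open>Delta \<alpha>\<close>: if
  \<open>-u'' + q u = v\<close> weakly, then \<open>u\<close> differs from a second antiderivative of \<open>q u - v\<close> by an affine function. Green's
  formula expresses the failure of symmetry of the maximal operator as the limit at the origin of the
  Wronskian of \<open>f\<close> and \<open>cnj g\<close>; nothing is contributed at infinity. Let \<open>A\<close>, \<open>B\<close> be solutions at energy zero. The
  Wronskian of \<open>f\<close> and \<open>cnj g\<close>, times that of \<open>A\<close> and \<open>B\<close>, is an alternating expression in the
  Wronskians of \<open>f\<close>, \<open>g\<close> with \<open>A\<close>, \<open>B\<close>.

  For \<open>\<alpha> \<ge> 1\<close> one solution is not square-integrable at the origin, which forces the limit to vanish, so the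
  maximal operator is symmetric and equals the closure. For \<open>\<alpha> < 1\<close> the Wronskians of \<open>f\<close> with the real solutions
  \<open>A\<close>, \<open>B\<close> have limits that form an arbitrary vector of boundary values in the complex plane squared, and self-adjoint
  extensions correspond to real lines in the space of boundary values.

  The domain of the maximal operator is described by absolute continuity, so the fundamental theorem
  of calculus for absolutely continuous functions is needed; it follows from the Jordan decomposition, the
  Radon-Nikodym theorem and the Lebesgue differentiation theorem, the latter from Vitali's covering theorem.\<close>

section \<open>Lebesgue differentiation\<close>

text \<open>Solutions at energy zero are \<open>r powr (1/2 + \<kappa>)\<close> and
  \<open>r powr (1/2 - \<kappa>)\<close> with \<kappa>^2 = \<alpha>. The second is square-integrable
  near 0 exactly if Re \<kappa> < 1, hence the threshold \<alpha> = 1. For \<alpha> < 0 the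
  exponents are complex conjugates, and at \<alpha> = 0 they coincide and a logarithm appears;
  \<open>A_fun\<close> and \<open>B_fun\<close> are real in all cases, and only real solutions let
  conjugation pass through the Wronskians. The boundary term at infinity has a limit by
  integrability alone, so one sequence suffices to see that it is 0: along it f and g tend to 0
  while their derivatives stay bounded. The maximal operator lies in the double adjoint once it is
  symmetric; that the double adjoint lies in the closure is an orthogonality argument on graphs,
  which requires \<open>l2\<close> to be complete. A self-adjoint extension is a restriction of the
  maximal operator. Symmetry on a pair (f, f) makes the ratio of the boundary values of f real,
  which yields an angle; symmetry against f gives all other elements the same angle. The resulting
  inclusion of self-adjoint operators is an equality because adjoints reverse it.\<close>

lemma integrable_imp_small_on_small_sets:
  fixes f :: "'a \<Rightarrow> 'b::{banach, second_countable_topology}"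
  assumes f: "integrable M f" and "e > 0"
  obtains d :: real where "d > 0"
    "\<And>B. B \<in> sets M \<Longrightarrow> emeasure M B < ennreal d \<Longrightarrow> (\<integral>\<^sup>+x\<in>B. norm (f x) \<partial>M) < ennreal e"
proof -
  \<comment> \<open>Truncation: \<open>min (norm (f x)) n\<close> contributes at most
    \<open>n * emeasure M B\<close>, and the integral of the excess \<open>g n\<close> over the
    whole space tends to 0 by dominated convergence.\<close>
  define g where "g n x = norm (f x) - min (norm (f x)) (real n)" for n x
  have [measurable]: "f \<in> borel_measurable M" using f by simp
  have "(\<lambda>n. integral\<^sup>L M (g n)) \<longlonglongrightarrow> integral\<^sup>L M (\<lambda>x. 0::real)"
  proof (rule integral_dominated_convergence[where w = "\<lambda>x. norm (f x)"])
    show "AE x in M. (\<lambda>n. g n x) \<longlonglongrightarrow> 0"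
    proof (rule AE_I2)
      fix x
      obtain N :: nat where N: "norm (f x) \<le> real N" using real_arch_simple by blast
      have "eventually (\<lambda>n. g n x = 0) sequentially"
        using N by (auto simp: g_def eventually_sequentially intro!: exI[of _ N])
      then show "(\<lambda>n. g n x) \<longlonglongrightarrow> 0" by (rule tendsto_eventually)
    qed
  qed (use f in \<open>auto simp: g_def[abs_def]\<close>)
  then have "eventually (\<lambda>n. integral\<^sup>L M (g n) < e / 2) sequentially"
    using \<open>e > 0\<close> by (intro order_tendstoD) auto
  then obtain n where n: "integral\<^sup>L M (g n) < e / 2" by (auto simp: eventually_sequentially)
  have int_g: "integrable M (g n)"
    by (rule Bochner_Integration.integrable_bound[where f = "\<lambda>x. norm (f x)"])
       (use f in \<open>auto simp: g_def[abs_def]\<close>)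
  have g_nonneg: "0 \<le> g n x" for x by (auto simp: g_def)
  show thesis
  proof
    \<comment> \<open>Chosen so that n times it is at most e / 2, the other half being the integral
      of \<open>g n\<close>; the + 1 covers n = 0.\<close>
    show "0 < e / (2 * (real n + 1))" using \<open>e > 0\<close> by simp
    fix B assume [measurable]: "B \<in> sets M" and B: "emeasure M B < ennreal (e / (2 * (real n + 1)))"
    have "(\<integral>\<^sup>+x\<in>B. norm (f x) \<partial>M) \<le> (\<integral>\<^sup>+x. ennreal (real n) * indicator B x + ennreal (g n x) \<partial>M)"
    proof (rule nn_integral_mono)
      fix x
      have "norm (f x) \<le> real n + g n x" by (auto simp: g_def)
      then have "ennreal (norm (f x)) \<le> ennreal (real n) + ennreal (g n x)"
        using g_nonneg[of x] by (metis ennreal_leI ennreal_plus of_nat_0_le_iff)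
      then show "ennreal (norm (f x)) * indicator B x \<le> ennreal (real n) * indicator B x + ennreal (g n x)"
        by (auto simp: indicator_def)
    qed
    also have "\<dots> = ennreal (real n) * emeasure M B + ennreal (integral\<^sup>L M (g n))"
      using nn_integral_eq_integral[OF int_g] g_nonneg int_g
      by (subst nn_integral_add) (auto simp: nn_integral_cmult)
    also have "\<dots> \<le> ennreal (real n) * ennreal (e / (2 * (real n + 1))) + ennreal (integral\<^sup>L M (g n))"
      using B by (intro add_mono mult_left_mono) auto
    also have "\<dots> = ennreal (real n * (e / (2 * (real n + 1))) + integral\<^sup>L M (g n))"
      using g_nonneg \<open>e > 0\<close> by (subst ennreal_plus) (auto simp: integral_nonneg_AE simp flip: ennreal_mult)
    also have "\<dots> < ennreal e"
    proof (rule ennreal_lessI)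
      have "real n * (e / (2 * (real n + 1))) \<le> e / 2"
        using \<open>e > 0\<close> by (simp add: field_simps)
      with n show "real n * (e / (2 * (real n + 1))) + integral\<^sup>L M (g n) < e" by linarith
    qed (use \<open>e > 0\<close> in auto)
    finally show "(\<integral>\<^sup>+x\<in>B. norm (f x) \<partial>M) < ennreal e" .
  qed
qed

text \<open>Cover the set by disjoint intervals on which \<open>h - p\<close> has mean above \<open>r - p\<close>, inside an open set barely larger
  than \<open>{x. h x \<le> p}\<close>: only the small part where \<open>h > p\<close> contributes to these means.\<close>

lemma negligible_upper_derivative_gt:
  fixes h :: "real \<Rightarrow> real"
  assumes h: "integrable lebesgue h" and pr: "p < r"
  shows "negligible {x. h x \<le> p \<and> (\<forall>d>0. \<exists>u v. u \<le> x \<and> x \<le> v \<and> u < v \<and> v - u < d \<and>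
            r * (v - u) < (LINT y:{u..v}|lebesgue. h y))}" (is "negligible ?E")
proof -
  define E where "E = ?E"
  have Ep: "h x \<le> p" if "x \<in> E" for x using that by (simp add: E_def)
  have Ed: "\<exists>u v. u \<le> x \<and> x \<le> v \<and> u < v \<and> v - u < d \<and> r * (v - u) < (LINT y:{u..v}|lebesgue. h y)"
    if "x \<in> E" "d > 0" for x d using that by (auto simp: E_def)
  have [measurable]: "h \<in> borel_measurable lebesgue" using h by simp
  \<comment> \<open>On a bounded \<open>V\<close> the constant \<open>p\<close> is integrable, so
    \<open>h - p\<close> cut off to \<open>V\<close> is an integrable function; the union over
    \<open>M\<close> recovers \<open>E\<close>.\<close>
  have "negligible (E \<inter> {-real M<..<real M})" for M :: nat
    unfolding negligible_outer_le
  proof (intro allI impI)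
    fix e :: real assume "e > 0"
    define V where "V = {-real M<..<real M}"
    define A where "A = {x. h x \<le> p} \<inter> V"
    have "{x. h x \<le> p} = h -` {..p} \<inter> space lebesgue" by auto
    then have "{x. h x \<le> p} \<in> sets lebesgue"
      by (metis \<open>h \<in> borel_measurable lebesgue\<close> atMost_borel measurable_sets)
    then have A[measurable]: "A \<in> sets lebesgue" unfolding A_def V_def by auto
    have V_lm: "V \<in> lmeasurable" by (simp add: V_def)
    define k where "k x = indicator V x * (h x - p)" for x
    have k: "integrable lebesgue k"
    proof -
      have "integrable lebesgue (\<lambda>x. indicator V x *\<^sub>R h x - p * indicator V x)"
        using V_lm h
        by (intro Bochner_Integration.integrable_diff integrable_mult_indicator integrable_mult_right)
           (auto simp: fmeasurable_def integrable_indicator_iff)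
      then show ?thesis unfolding k_def by (simp add: algebra_simps)
    qed
    have [measurable]: "k \<in> borel_measurable lebesgue" using k by simp
    have "0 < e * (r - p)" using \<open>e > 0\<close> pr by simp
    then obtain d where d: "d > 0" "\<And>B. B \<in> sets lebesgue \<Longrightarrow> emeasure lebesgue B < ennreal d \<Longrightarrow>
        (\<integral>\<^sup>+x\<in>B. norm (k x) \<partial>lebesgue) < ennreal (e * (r - p))"
      using integrable_imp_small_on_small_sets[OF k] by metis
    obtain U0 where U0: "open U0" "A \<subseteq> U0" "(U0 - A) \<in> lmeasurable" "emeasure lebesgue (U0 - A) < ennreal d"
      using sets_lebesgue_outer_open[OF A d(1)] by blast
    define U where "U = U0 \<inter> V"
    have U: "open U" "A \<subseteq> U" "U \<subseteq> V" using U0 by (auto simp: U_def V_def A_def)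
    have UA: "emeasure lebesgue (U - A) < ennreal d"
      using U0 by (auto simp: U_def V_def intro!: le_less_trans[OF emeasure_mono U0(4)])
    define K where "K = {(u, v). u < v \<and> {u..v} \<subseteq> U \<and> r * (v - u) < (LINT y:{u..v}|lebesgue. h y)}"
    \<comment> \<open>Vitali's theorem is about balls, so an interval is passed to it as midpoint
      and half-length.\<close>
    define c where "c = (\<lambda>(u::real, v). (u + v) / 2)"
    define \<rho> where "\<rho> = (\<lambda>(u::real, v). (v - u) / 2)"
    have cb: "cball (c i) (\<rho> i) = {fst i..snd i}" for i
      by (cases i) (auto simp: c_def \<rho>_def cball_eq_atLeastAtMost field_simps)
    obtain C where C: "countable C" "C \<subseteq> K"
      and disj: "pairwise (\<lambda>i j. disjnt (cball (c i) (\<rho> i)) (cball (c j) (\<rho> j))) C"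
      and neg: "negligible ((E \<inter> V) - (\<Union>i\<in>C. cball (c i) (\<rho> i)))"
    proof (rule Vitali_covering_theorem_cballs[of K \<rho> "E \<inter> V" c])
      show "0 < \<rho> i" if "i \<in> K" for i using that by (auto simp: K_def \<rho>_def)
      fix x d' :: real assume x: "x \<in> E \<inter> V" and "0 < d'"
      then have "x \<in> U" using U(2) Ep by (auto simp: A_def)
      then obtain s where s: "s > 0" "ball x s \<subseteq> U" using U(1) open_contains_ball by blast
      obtain u v where uv: "u \<le> x" "x \<le> v" "u < v" "v - u < min s d'"
          "r * (v - u) < (LINT y:{u..v}|lebesgue. h y)"
        using Ed[of x "min s d'"] x s(1) \<open>0 < d'\<close> by auto
      have "{u..v} \<subseteq> ball x s" using uv by (auto simp: dist_real_def)
      then show "\<exists>i. i \<in> K \<and> x \<in> cball (c i) (\<rho> i) \<and> \<rho> i < d'"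
        using uv s(2) by (intro exI[of _ "(u, v)"]) (auto simp: K_def cb, auto simp: \<rho>_def)
    qed
    define W where "W = (\<Union>i\<in>C. {fst i..snd i})"
    have W[measurable]: "W \<in> sets lebesgue" unfolding W_def
      using C(1) by (intro sets.countable_UN'') auto
    have dj: "disjoint_family_on (\<lambda>i. {fst i..snd i}) C"
      using disj by (auto simp: disjoint_family_on_def pairwise_def cb disjnt_def)
    have CU: "{fst i..snd i} \<subseteq> U" if "i \<in> C" for i
    proof -
      have "i \<in> K" using that C(2) by blast
      then show ?thesis by (cases i) (simp add: K_def)
    qed
    have Um[measurable]: "U \<in> sets lebesgue" using U(1) by (auto simp: borel_open)
    have dj': "disjoint_family_on (\<lambda>i. {fst i..snd i} - A) C"
      using dj unfolding disjoint_family_on_def by blast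
    \<comment> \<open>As a measure, \<open>N\<close> adds the contributions of the disjoint
      intervals up to a single value, bounded by that on \<open>U - A\<close>.\<close>
    define N where "N = density lebesgue (\<lambda>x. ennreal (norm (k x)))"
    have "ennreal (r - p) * emeasure lebesgue W =
        ennreal (r - p) * (\<integral>\<^sup>+i. emeasure lebesgue {fst i..snd i} \<partial>count_space C)"
      unfolding W_def using C(1) dj by (subst emeasure_UN_countable) auto
    also have "\<dots> = (\<integral>\<^sup>+i. ennreal (r - p) * emeasure lebesgue {fst i..snd i} \<partial>count_space C)"
      by (simp add: nn_integral_cmult)
    also have "\<dots> \<le> (\<integral>\<^sup>+i. emeasure N ({fst i..snd i} - A) \<partial>count_space C)"
    proof (rule nn_integral_mono)
      fix i assume "i \<in> space (count_space C)"
      then obtain u v where i: "i = (u, v)" "u < v" "{u..v} \<subseteq> U"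
          "r * (v - u) < (LINT y:{u..v}|lebesgue. h y)"
        using C(2) by (cases i) (auto simp: K_def)
      define B where "B = {u..v}"
      have B[measurable]: "B \<in> sets lebesgue" by (simp add: B_def)
      have BV: "B \<subseteq> V" using i(3) U(3) by (auto simp: B_def)
      have ik: "set_integrable lebesgue S k" if "S \<in> sets lebesgue" for S
        using integrable_mult_indicator[OF that k] by (simp add: set_integrable_def)
      have iabs: "integrable lebesgue (\<lambda>x. indicat_real (B - A) x *\<^sub>R \<bar>k x\<bar>)"
        using k by (intro integrable_mult_indicator) auto
      have "(LINT y:B|lebesgue. k y) = (LINT y:B|lebesgue. h y - p)"
        using BV by (intro set_lebesgue_integral_cong) (auto simp: k_def)
      also have "\<dots> = (LINT y:B|lebesgue. h y) - (LINT y:B|lebesgue. p)"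
      proof (rule set_integral_diff)
        show "set_integrable lebesgue B h" using integrable_mult_indicator[OF B h] by (simp add: set_integrable_def)
        show "set_integrable lebesgue B (\<lambda>_. p)"
          using lmeasurable_cbox[of u v]
          by (auto simp: B_def set_integrable_def lmeasurable_iff_integrable
                intro!: Bochner_Integration.integrable_mult_left)
      qed
      also have "(LINT y:B|lebesgue. p) = p * (v - u)"
        using i(2) by (simp add: B_def set_lebesgue_integral_def)
      finally have "(r - p) * (v - u) \<le> (LINT y:B|lebesgue. k y)"
        using i(4) by (simp add: B_def algebra_simps)
      \<comment> \<open>Since \<open>k\<close> is at most 0 on \<open>A\<close>, discarding
        \<open>A\<close> can only enlarge the integral.\<close>
      also have "\<dots> \<le> (LINT y:B - A|lebesgue. \<bar>k y\<bar>)"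
      proof -
        have "k y \<le> 0" if "y \<in> A" for y using that by (auto simp: k_def A_def)
        then show ?thesis unfolding set_lebesgue_integral_def
          using ik[OF B] iabs
          by (intro integral_mono) (auto simp: set_integrable_def indicator_def)
      qed
      also have "ennreal \<dots> = emeasure N (B - A)"
      proof -
        have "ennreal (LINT y:B - A|lebesgue. \<bar>k y\<bar>) = (\<integral>\<^sup>+y. ennreal (indicator (B - A) y *\<^sub>R \<bar>k y\<bar>) \<partial>lebesgue)"
          unfolding set_lebesgue_integral_def using iabs by (intro nn_integral_eq_integral[symmetric]) auto
        also have "\<dots> = emeasure N (B - A)"
          unfolding N_def by (subst emeasure_density) (auto intro!: nn_integral_cong simp: indicator_def)
        finally show ?thesis .
      qed
      finally show "ennreal (r - p) * emeasure lebesgue {fst i..snd i} \<le> emeasure N ({fst i..snd i} - A)"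
        using i pr by (simp add: B_def ennreal_mult' ennreal_leI)
    qed
    also have "\<dots> = emeasure N (\<Union>i\<in>C. {fst i..snd i} - A)"
      using C(1) dj'
      by (subst emeasure_UN_countable) (auto simp: N_def)
    also have "\<dots> \<le> emeasure N (U - A)"
      using CU Um by (intro emeasure_mono) (auto simp: N_def)
    also have "\<dots> < ennreal (e * (r - p))"
      using d(2)[OF _ UA] Um by (simp add: N_def emeasure_density)
    finally have "ennreal (r - p) * emeasure lebesgue W < ennreal (r - p) * ennreal e"
      using \<open>e > 0\<close> pr by (simp add: ennreal_mult' mult.commute)
    then have We: "emeasure lebesgue W < ennreal e"
      by (meson linorder_not_less mult_left_mono zero_le)
    have "W \<in> lmeasurable" using We by (auto simp: fmeasurable_def intro: less_trans)
    moreover have nn: "(E \<inter> V) - W \<in> null_sets lebesgue"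
      using neg by (simp add: W_def cb negligible_iff_null_sets)
    ultimately have "(E \<inter> V - W) \<union> W \<in> lmeasurable"
      by (intro fmeasurable.Un) (auto simp: negligible_iff_null_sets[symmetric] negligible_imp_measurable)
    moreover have "measure lebesgue ((E \<inter> V - W) \<union> W) \<le> e"
      using We nn \<open>e > 0\<close> by (subst Un_commute, subst measure_Un_null_set) (auto simp: measure_def enn2real_leI less_imp_le)
    ultimately show "\<exists>T. E \<inter> {- real M<..<real M} \<subseteq> T \<and> T \<in> lmeasurable \<and> measure lebesgue T \<le> e"
      unfolding V_def[symmetric] by (intro exI[of _ "(E \<inter> V - W) \<union> W"]) auto
  qed
  then have "negligible (\<Union>M. E \<inter> {-real M<..<real M})"
    by (intro negligible_countable_Union) (auto)
  moreover have "E \<subseteq> (\<Union>M. E \<inter> {-real M<..<real M})"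
  proof
    fix x assume x: "x \<in> E"
    obtain M where "\<bar>x\<bar> < real M" using reals_Archimedean2 by blast
    then show "x \<in> (\<Union>M. E \<inter> {-real M<..<real M})" using x by (auto intro!: exI[of _ M])
  qed
  ultimately show ?thesis unfolding E_def by (rule negligible_subset)
qed

text \<open>Between \<open>h x\<close> and \<open>h x + e\<close> there is room for rationals p < r,
  so the bad points lie in countably many of the sets of
  \<open>negligible_upper_derivative_gt\<close>.\<close>

lemma lebesgue_differentiation_upper:
  fixes h :: "real \<Rightarrow> real"
  assumes h: "integrable lebesgue h"
  obtains N where "negligible N" "\<And>x e. x \<notin> N \<Longrightarrow> e > 0 \<Longrightarrow> \<exists>d>0. \<forall>u v. u \<le> x \<longrightarrow> x \<le> v \<longrightarrow> u < v \<longrightarrow> v - u < d \<longrightarrow>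
      (LINT y:{u..v}|lebesgue. h y) \<le> (h x + e) * (v - u)"
proof
  define E where "E p r = {x. h x \<le> p \<and> (\<forall>d>0. \<exists>u v. u \<le> x \<and> x \<le> v \<and> u < v \<and> v - u < d \<and>
            r * (v - u) < (LINT y:{u..v}|lebesgue. h y))}" for p r
  have negE: "negligible (E p r)" if "p < r" for p r
    unfolding E_def by (rule negligible_upper_derivative_gt[OF h that])
  define N where "N = \<Union> ((\<lambda>(p, r). E p r) ` ((\<rat> \<times> \<rat>) \<inter> {(p, r). p < r}))"
  show "negligible N" unfolding N_def
  proof (rule negligible_countable_Union)
    show "countable ((\<lambda>(p, r). E p r) ` ((\<rat> \<times> \<rat>) \<inter> {(p, r). p < r}))"
      by (intro countable_image countable_Int1 countable_SIGMA countable_rat)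
  qed (use negE in auto)
  fix x e :: real assume x: "x \<notin> N" and "e > 0"
  obtain p where p: "p \<in> \<rat>" "h x < p" "p < h x + e" using Rats_dense_in_real[of "h x" "h x + e"] \<open>e > 0\<close> by auto
  obtain r where r: "r \<in> \<rat>" "p < r" "r < h x + e" using Rats_dense_in_real[of p "h x + e"] p by auto
  have "x \<notin> E p r" using x p r by (auto simp: N_def)
  then obtain d where d: "d > 0" "\<And>u v. u \<le> x \<Longrightarrow> x \<le> v \<Longrightarrow> u < v \<Longrightarrow> v - u < d \<Longrightarrow>
        (LINT y:{u..v}|lebesgue. h y) \<le> r * (v - u)"
    using p by (force simp: E_def not_less)
  show "\<exists>d>0. \<forall>u v. u \<le> x \<longrightarrow> x \<le> v \<longrightarrow> u < v \<longrightarrow> v - u < d \<longrightarrow>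
      (LINT y:{u..v}|lebesgue. h y) \<le> (h x + e) * (v - u)"
  proof (intro exI conjI allI impI)
    fix u v assume "u \<le> x" "x \<le> v" "u < v" "v - u < d"
    then have "(LINT y:{u..v}|lebesgue. h y) \<le> r * (v - u)" by (rule d(2))
    also have "\<dots> \<le> (h x + e) * (v - u)" using r \<open>u < v\<close> by (intro mult_right_mono) auto
    finally show "(LINT y:{u..v}|lebesgue. h y) \<le> (h x + e) * (v - u)" .
  qed (rule d(1))
qed

text \<open>The lower estimate is the upper estimate for \<open>- h\<close>.\<close>

lemma lebesgue_differentiation_real:
  fixes h :: "real \<Rightarrow> real"
  assumes h: "integrable lebesgue h"
  obtains N where "negligible N" "\<And>x e. x \<notin> N \<Longrightarrow> e > 0 \<Longrightarrow> \<exists>d>0. \<forall>u v. u \<le> x \<longrightarrow> x \<le> v \<longrightarrow> u < v \<longrightarrow> v - u < d \<longrightarrow>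
      \<bar>(LINT y:{u..v}|lebesgue. h y) - h x * (v - u)\<bar> \<le> e * (v - u)"
proof -
  obtain N1 where N1: "negligible N1" "\<And>x e. x \<notin> N1 \<Longrightarrow> e > 0 \<Longrightarrow> \<exists>d>0. \<forall>u v. u \<le> x \<longrightarrow> x \<le> v \<longrightarrow> u < v \<longrightarrow> v - u < d \<longrightarrow>
      (LINT y:{u..v}|lebesgue. h y) \<le> (h x + e) * (v - u)"
    using lebesgue_differentiation_upper[OF h] by blast
  have "integrable lebesgue (\<lambda>x. - h x)" using h by simp
  from lebesgue_differentiation_upper[OF this]
  obtain N2 where N2: "negligible N2" "\<And>x e. x \<notin> N2 \<Longrightarrow> e > 0 \<Longrightarrow> \<exists>d>0. \<forall>u v. u \<le> x \<longrightarrow> x \<le> v \<longrightarrow> u < v \<longrightarrow> v - u < d \<longrightarrow>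
      (LINT y:{u..v}|lebesgue. - h y) \<le> (- h x + e) * (v - u)"
    by blast
  have uminus: "(LINT y:{u..v}|lebesgue. - h y) = - (LINT y:{u..v}|lebesgue. h y)" for u v
    by (simp add: set_lebesgue_integral_def)
  show thesis
  proof
    show "negligible (N1 \<union> N2)" using N1 N2 by simp
    fix x e :: real assume "x \<notin> N1 \<union> N2" "e > 0"
    with N1(2)[of x e] N2(2)[of x e] obtain d1 d2 where d: "d1 > 0" "d2 > 0"
      "\<And>u v. u \<le> x \<Longrightarrow> x \<le> v \<Longrightarrow> u < v \<Longrightarrow> v - u < d1 \<Longrightarrow>
        (LINT y:{u..v}|lebesgue. h y) \<le> (h x + e) * (v - u)"
      "\<And>u v. u \<le> x \<Longrightarrow> x \<le> v \<Longrightarrow> u < v \<Longrightarrow> v - u < d2 \<Longrightarrow>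
        (LINT y:{u..v}|lebesgue. - h y) \<le> (- h x + e) * (v - u)"
      by auto
    show "\<exists>d>0. \<forall>u v. u \<le> x \<longrightarrow> x \<le> v \<longrightarrow> u < v \<longrightarrow> v - u < d \<longrightarrow>
      \<bar>(LINT y:{u..v}|lebesgue. h y) - h x * (v - u)\<bar> \<le> e * (v - u)"
    proof (intro exI conjI allI impI)
      show "0 < min d1 d2" using d by simp
      fix u v assume "u \<le> x" "x \<le> v" "u < v" "v - u < min d1 d2"
      then have "(LINT y:{u..v}|lebesgue. h y) \<le> (h x + e) * (v - u)"
        "- (LINT y:{u..v}|lebesgue. h y) \<le> (- h x + e) * (v - u)"
        using d(3)[of u v] d(4)[of u v] by (auto simp: uminus)
      then show "\<bar>(LINT y:{u..v}|lebesgue. h y) - h x * (v - u)\<bar> \<le> e * (v - u)"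
        by (simp add: abs_le_iff algebra_simps)
    qed
  qed
qed

text \<open>Intervals containing \<open>x\<close> are what the covering argument yields; those with
  \<open>x\<close> as an endpoint give the two one-sided difference quotients.\<close>

lemma has_vector_derivative_if_increments:
  fixes g :: "real \<Rightarrow> 'a::real_normed_vector"
  assumes "\<And>e. e > 0 \<Longrightarrow> \<exists>d>0. \<forall>u v. u \<le> x \<longrightarrow> x \<le> v \<longrightarrow> u < v \<longrightarrow> v - u < d \<longrightarrow>
      norm (g v - g u - (v - u) *\<^sub>R D) \<le> e * (v - u)"
  shows "(g has_vector_derivative D) (at x)"
  unfolding has_vector_derivative_def has_derivative_at_alt
proof (intro conjI allI impI)
  show "bounded_linear (\<lambda>x. x *\<^sub>R D)" by (rule bounded_linear_scaleR_left)
  fix e :: real assume "e > 0"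
  with assms obtain d where d: "d > 0" "\<And>u v. u \<le> x \<Longrightarrow> x \<le> v \<Longrightarrow> u < v \<Longrightarrow> v - u < d \<Longrightarrow>
      norm (g v - g u - (v - u) *\<^sub>R D) \<le> e * (v - u)" by blast
  show "\<exists>d>0. \<forall>y. norm (y - x) < d \<longrightarrow> norm (g y - g x - (y - x) *\<^sub>R D) \<le> e * norm (y - x)"
  proof (intro exI conjI allI impI)
    fix y assume y: "norm (y - x) < d"
    consider "y = x" | "y > x" | "y < x" by linarith
    then show "norm (g y - g x - (y - x) *\<^sub>R D) \<le> e * norm (y - x)"
    proof cases
      case 2 then show ?thesis using d(2)[of x y] y by auto
    next
      case 3
      have "norm (g y - g x - (y - x) *\<^sub>R D) = norm (g x - g y - (x - y) *\<^sub>R D)"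
        by (subst norm_minus_cancel[symmetric]) (simp add: algebra_simps)
      then show ?thesis using d(2)[of y x] y 3 by auto
    qed auto
  qed (rule d(1))
qed

theorem lebesgue_differentiation:
  fixes h :: "real \<Rightarrow> complex"
  assumes h: "integrable lebesgue h" and g: "\<And>u v. a < u \<Longrightarrow> u \<le> v \<Longrightarrow> v < b \<Longrightarrow> g v - g u = (LINT y:{u..v}|lebesgue. h y)"
  shows "negligible {x \<in> {a<..<b}. \<not> (g has_vector_derivative h x) (at x)}"
proof -
  have re: "integrable lebesgue (\<lambda>x. Re (h x))" and im: "integrable lebesgue (\<lambda>x. Im (h x))"
    using h by auto
  obtain N1 where N1: "negligible N1" "\<And>x e. x \<notin> N1 \<Longrightarrow> e > 0 \<Longrightarrow> \<exists>d>0. \<forall>u v. u \<le> x \<longrightarrow> x \<le> v \<longrightarrow> u < v \<longrightarrow> v - u < d \<longrightarrow>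
      \<bar>(LINT y:{u..v}|lebesgue. Re (h y)) - Re (h x) * (v - u)\<bar> \<le> e * (v - u)"
    using lebesgue_differentiation_real[OF re] by blast
  obtain N2 where N2: "negligible N2" "\<And>x e. x \<notin> N2 \<Longrightarrow> e > 0 \<Longrightarrow> \<exists>d>0. \<forall>u v. u \<le> x \<longrightarrow> x \<le> v \<longrightarrow> u < v \<longrightarrow> v - u < d \<longrightarrow>
      \<bar>(LINT y:{u..v}|lebesgue. Im (h y)) - Im (h x) * (v - u)\<bar> \<le> e * (v - u)"
    using lebesgue_differentiation_real[OF im] by blast
  have ri: "Re (LINT y:{u..v}|lebesgue. h y) = (LINT y:{u..v}|lebesgue. Re (h y))"
    "Im (LINT y:{u..v}|lebesgue. h y) = (LINT y:{u..v}|lebesgue. Im (h y))" for u v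
    unfolding set_lebesgue_integral_def using integrable_mult_indicator[OF _ h, of "{u..v}"]
    by (auto simp flip: integral_Re integral_Im simp: scaleR_conv_of_real)
  have "(g has_vector_derivative h x) (at x)" if x: "x \<in> {a<..<b} - (N1 \<union> N2)" for x
  proof (rule has_vector_derivative_if_increments)
    fix e :: real assume "e > 0"
    then have "e / 2 > 0" by simp
    with N1(2)[of x "e / 2"] N2(2)[of x "e / 2"] x obtain d1 d2 where d: "d1 > 0" "d2 > 0"
      "\<And>u v. u \<le> x \<Longrightarrow> x \<le> v \<Longrightarrow> u < v \<Longrightarrow> v - u < d1 \<Longrightarrow>
        \<bar>(LINT y:{u..v}|lebesgue. Re (h y)) - Re (h x) * (v - u)\<bar> \<le> e / 2 * (v - u)"
      "\<And>u v. u \<le> x \<Longrightarrow> x \<le> v \<Longrightarrow> u < v \<Longrightarrow> v - u < d2 \<Longrightarrow>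
        \<bar>(LINT y:{u..v}|lebesgue. Im (h y)) - Im (h x) * (v - u)\<bar> \<le> e / 2 * (v - u)"
      by auto
    show "\<exists>d>0. \<forall>u v. u \<le> x \<longrightarrow> x \<le> v \<longrightarrow> u < v \<longrightarrow> v - u < d \<longrightarrow>
      norm (g v - g u - (v - u) *\<^sub>R h x) \<le> e * (v - u)"
    proof (intro exI conjI allI impI)
      \<comment> \<open>The last two entries keep \<open>u\<close> and \<open>v\<close> inside the
        interval on which the increments of \<open>g\<close> are known.\<close>
      show "0 < Min {d1, d2, x - a, b - x}" using d x by simp
      fix u v assume uv: "u \<le> x" "x \<le> v" "u < v" "v - u < Min {d1, d2, x - a, b - x}"
      define w where "w = g v - g u - (v - u) *\<^sub>R h x"
      have w: "w = (LINT y:{u..v}|lebesgue. h y) - (v - u) *\<^sub>R h x"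
        unfolding w_def using uv by (subst g) auto
      have "norm w \<le> \<bar>Re w\<bar> + \<bar>Im w\<bar>" by (rule cmod_le)
      also have "\<dots> \<le> e / 2 * (v - u) + e / 2 * (v - u)"
        using d(3)[of u v] d(4)[of u v] uv by (intro add_mono) (auto simp: w ri mult.commute)
      finally show "norm (g v - g u - (v - u) *\<^sub>R h x) \<le> e * (v - u)"
        by (simp add: w_def algebra_simps)
    qed
  qed
  then have "{x \<in> {a<..<b}. \<not> (g has_vector_derivative h x) (at x)} \<subseteq> N1 \<union> N2" by blast
  then show ?thesis using N1(1) N2(1) negligible_Un negligible_subset by blast
qed

section \<open>Absolutely continuous functions\<close>

text \<open>Passes from sets of pairs to indexed families. In a family a degenerate interval may
  occur repeatedly; such indices contribute nothing and are left out of \<open>J\<close>, on which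
  disjointness makes the indexing injective.\<close>

lemma absolutely_continuous_onD:
  assumes "absolutely_continuous_on S g" "e > 0"
  shows "\<exists>d>0. \<forall>I (s :: 'i \<Rightarrow> real) t. finite I \<longrightarrow> (\<forall>i\<in>I. s i \<le> t i \<and> {s i..t i} \<subseteq> S) \<longrightarrow>
       disjoint_family_on (\<lambda>i. {s i<..<t i}) I \<longrightarrow> (\<Sum>i\<in>I. t i - s i) < d \<longrightarrow>
       (\<Sum>i\<in>I. cmod (g (t i) - g (s i))) < e"
proof -
  obtain d where d: "d > 0" "\<And>P. finite P \<Longrightarrow> (\<forall>(s, t)\<in>P. s \<le> t \<and> {s..t} \<subseteq> S) \<Longrightarrow>
        disjoint_family_on (\<lambda>(s, t). {s<..<t}) P \<Longrightarrow>
        (\<Sum>(s, t)\<in>P. t - s) < d \<Longrightarrow> (\<Sum>(s, t)\<in>P. cmod (g t - g s)) < e"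
    using assms unfolding absolutely_continuous_on_def by meson
  show ?thesis
  proof (intro exI conjI allI impI)
    fix I and s t :: "'i \<Rightarrow> real"
    assume I: "finite I" "\<forall>i\<in>I. s i \<le> t i \<and> {s i..t i} \<subseteq> S"
      "disjoint_family_on (\<lambda>i. {s i<..<t i}) I" "(\<Sum>i\<in>I. t i - s i) < d"
    define J where "J = {i \<in> I. s i < t i}"
    define P where "P = (\<lambda>i. (s i, t i)) ` J"
    have J: "finite J" "J \<subseteq> I" using I(1) by (auto simp: J_def)
    have ne: "s i = t i" if "i \<in> I - J" for i using I(2) that by (force simp: J_def)
    have inj: "inj_on (\<lambda>i. (s i, t i)) J"
    proof (rule inj_onI, rule ccontr)
      fix i j assume ij: "i \<in> J" "j \<in> J" "(s i, t i) = (s j, t j)" "i \<noteq> j"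
      then have "{s i<..<t i} \<inter> {s j<..<t j} = {}" using I(3) J(2) by (meson disjoint_family_on_def subsetD)
      then have "{s i<..<t i} = {}" using ij by simp
      then show False using ij by (simp add: J_def)
    qed
    have sum: "(\<Sum>(s, t)\<in>P. f s t) = (\<Sum>i\<in>I. f (s i) (t i))" if "\<And>x. f x x = 0" for f :: "real \<Rightarrow> real \<Rightarrow> real"
    proof -
      have "(\<Sum>(s, t)\<in>P. f s t) = (\<Sum>i\<in>J. f (s i) (t i))"
        unfolding P_def by (subst sum.reindex[OF inj]) (simp add: o_def)
      also have "\<dots> = (\<Sum>i\<in>I. f (s i) (t i))"
        using I(1) J(2) ne that by (intro sum.mono_neutral_left) (auto)
      finally show ?thesis .
    qed
    have "(\<Sum>(s, t)\<in>P. cmod (g t - g s)) < e"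
    proof (rule d(2))
      show "disjoint_family_on (\<lambda>(s, t). {s<..<t}) P"
        unfolding disjoint_family_on_def
      proof (intro ballI impI)
        fix p q assume "p \<in> P" "q \<in> P" "p \<noteq> q"
        then obtain i j where "i \<in> J" "j \<in> J" "i \<noteq> j" "p = (s i, t i)" "q = (s j, t j)" by (auto simp: P_def)
        moreover then have "{s i<..<t i} \<inter> {s j<..<t j} = {}"
          using I(3) J(2) by (meson disjoint_family_on_def subsetD)
        ultimately show "(case p of (s, t) \<Rightarrow> {s<..<t}) \<inter> (case q of (s, t) \<Rightarrow> {s<..<t}) = {}" by simp
      qed
    qed (use J I sum[of "\<lambda>s t. t - s"] in \<open>auto simp: P_def\<close>)
    then show "(\<Sum>i\<in>I. cmod (g (t i) - g (s i))) < e"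
      by (subst (asm) sum) auto
  qed (rule d(1))
qed

text \<open>One comparison principle for differences, real and imaginary parts and, with
  \<open>C\<close> a common bound of the factors, products.\<close>

lemma absolutely_continuous_onI:
  assumes f: "absolutely_continuous_on S f" and g: "absolutely_continuous_on S g"
    and bound: "\<And>s t. s \<le> t \<Longrightarrow> {s..t} \<subseteq> S \<Longrightarrow>
        cmod (k t - k s) \<le> C * cmod (f t - f s) + C * cmod (g t - g s)" and "C > 0"
  shows "absolutely_continuous_on S k"
  unfolding absolutely_continuous_on_def
proof (intro allI impI)
  fix e :: real assume "e > 0"
  then have e: "e / (2 * C) > 0" using \<open>C > 0\<close> by simp
  obtain d1 where d1: "d1 > 0" "\<And>P. finite P \<Longrightarrow> (\<forall>(s, t)\<in>P. s \<le> t \<and> {s..t} \<subseteq> S) \<Longrightarrow>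
        disjoint_family_on (\<lambda>(s, t). {s<..<t}) P \<Longrightarrow>
        (\<Sum>(s, t)\<in>P. t - s) < d1 \<Longrightarrow> (\<Sum>(s, t)\<in>P. cmod (f t - f s)) < e / (2 * C)"
    using f e unfolding absolutely_continuous_on_def by meson
  obtain d2 where d2: "d2 > 0" "\<And>P. finite P \<Longrightarrow> (\<forall>(s, t)\<in>P. s \<le> t \<and> {s..t} \<subseteq> S) \<Longrightarrow>
        disjoint_family_on (\<lambda>(s, t). {s<..<t}) P \<Longrightarrow>
        (\<Sum>(s, t)\<in>P. t - s) < d2 \<Longrightarrow> (\<Sum>(s, t)\<in>P. cmod (g t - g s)) < e / (2 * C)"
    using g e unfolding absolutely_continuous_on_def by meson
  show "\<exists>d>0. \<forall>P. finite P \<longrightarrow> (\<forall>(s, t)\<in>P. s \<le> t \<and> {s..t} \<subseteq> S) \<longrightarrow>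
        disjoint_family_on (\<lambda>(s, t). {s<..<t}) P \<longrightarrow>
        (\<Sum>(s, t)\<in>P. t - s) < d \<longrightarrow> (\<Sum>(s, t)\<in>P. cmod (k t - k s)) < e"
  proof (intro exI conjI allI impI)
    show "0 < min d1 d2" using d1 d2 by simp
    fix P assume P: "finite P" "\<forall>(s, t)\<in>P. s \<le> t \<and> {s..t} \<subseteq> S"
        "disjoint_family_on (\<lambda>(s, t). {s<..<t}) P" "(\<Sum>(s, t)\<in>P. t - s) < min d1 d2"
    have "(\<Sum>(s, t)\<in>P. cmod (k t - k s)) \<le> (\<Sum>(s, t)\<in>P. C * cmod (f t - f s) + C * cmod (g t - g s))"
      using P(2) bound by (intro sum_mono) auto
    also have "\<dots> = C * (\<Sum>(s, t)\<in>P. cmod (f t - f s)) + C * (\<Sum>(s, t)\<in>P. cmod (g t - g s))"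
      by (simp add: sum.distrib sum_distrib_left case_prod_unfold)
    also have "\<dots> < C * (e / (2 * C)) + C * (e / (2 * C))"
      using d1(2)[OF P(1-3)] d2(2)[OF P(1-3)] P(4) \<open>C > 0\<close>
      by (intro add_strict_mono mult_strict_left_mono) simp_all
    also have "\<dots> = e" using \<open>C > 0\<close> by (simp add: field_simps)
    finally show "(\<Sum>(s, t)\<in>P. cmod (k t - k s)) < e" .
  qed
qed

lemma absolutely_continuous_on_imp_continuous_on:
  assumes "absolutely_continuous_on {a..b} g"
  shows "continuous_on {a..b} g"
  unfolding continuous_on_iff
proof (intro ballI allI impI)
  fix x e :: real assume x: "x \<in> {a..b}" and "e > 0"
  from absolutely_continuous_onD[OF assms \<open>e > 0\<close>]
  obtain d where d: "d > 0" and
    d': "\<forall>I (s :: nat \<Rightarrow> real) t. finite I \<longrightarrow> (\<forall>i\<in>I. s i \<le> t i \<and> {s i..t i} \<subseteq> {a..b}) \<longrightarrow>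
       disjoint_family_on (\<lambda>i. {s i<..<t i}) I \<longrightarrow> (\<Sum>i\<in>I. t i - s i) < d \<longrightarrow>
       (\<Sum>i\<in>I. cmod (g (t i) - g (s i))) < e" by blast
  note d = d d'[rule_format]
  have one: "cmod (g v - g u) < e" if "u \<le> v" "{u..v} \<subseteq> {a..b}" "v - u < d" for u v
    using d(2)[of "{0}" "\<lambda>_. u" "\<lambda>_. v"] that by (auto simp: disjoint_family_on_def)
  show "\<exists>d>0. \<forall>x'\<in>{a..b}. dist x' x < d \<longrightarrow> dist (g x') (g x) < e"
  proof (intro exI conjI ballI impI)
    fix y assume "y \<in> {a..b}" "dist y x < d"
    then show "dist (g y) (g x) < e"
      using one[of x y] one[of y x] x by (cases "x \<le> y") (auto simp: dist_norm norm_minus_commute)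
  qed (rule d(1))
qed

lemma disjoint_intervals_total_length:
  fixes s t :: "'i \<Rightarrow> real"
  assumes "finite I" "\<And>i. i \<in> I \<Longrightarrow> x \<le> s i \<and> s i \<le> t i \<and> t i \<le> y"
    "disjoint_family_on (\<lambda>i. {s i<..<t i}) I" "x \<le> y"
  shows "(\<Sum>i\<in>I. t i - s i) \<le> y - x"
proof -
  have "(\<Sum>i\<in>I. t i - s i) = (\<Sum>i\<in>I. measure lebesgue {s i<..<t i})"
    using assms(2) by (intro sum.cong) auto
  also have "\<dots> = measure lebesgue (\<Union>i\<in>I. {s i<..<t i})"
    using assms(1,3) emeasure_lborel_Ioo assms(2)
    by (subst measure_finite_Union) (auto simp: less_top[symmetric])
  also have "\<dots> \<le> measure lebesgue {x..y}"
    using assms by (intro measure_mono_fmeasurable) (force, auto)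
  also have "\<dots> = y - x" using assms(4) by simp
  finally show ?thesis .
qed

text \<open>The families range over the whole interval and are clipped at \<open>x\<close>. Hence an increment of the positive
  variation is a supremum of sums over families clipped to \<open>[x, y]\<close>, which makes absolute continuity immediate
  and avoids splitting families at intermediate points.\<close>

definition interval_families :: "real \<Rightarrow> real \<Rightarrow> (nat set \<times> (nat \<Rightarrow> real) \<times> (nat \<Rightarrow> real)) set" where
  "interval_families a b = {(I, s, t). finite I \<and> (\<forall>i\<in>I. a \<le> s i \<and> s i \<le> t i \<and> t i \<le> b) \<and>
     disjoint_family_on (\<lambda>i. {s i<..<t i}) I}"

definition clipped_sum :: "(real \<Rightarrow> real) \<Rightarrow> nat set \<times> (nat \<Rightarrow> real) \<times> (nat \<Rightarrow> real) \<Rightarrow> real \<Rightarrow> real" where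
  "clipped_sum g F x = (case F of (I, s, t) \<Rightarrow> \<Sum>i\<in>I. g (min (t i) x) - g (min (s i) x))"

definition positive_variation :: "(real \<Rightarrow> real) \<Rightarrow> real \<Rightarrow> real \<Rightarrow> real \<Rightarrow> real" where
  "positive_variation g a b x = (SUP F\<in>interval_families a b. clipped_sum g F x)"

text \<open>For each point u the difference of \<open>g (min u y)\<close> and
  \<open>g (min u x)\<close> depends only on u clamped to [x, y], up to the constant
  \<open>g x\<close>. So the increment is a sum over a family of total length at most y - x.\<close>

lemma clipped_sum_diff:
  assumes "x \<le> y"
  shows "clipped_sum g (I, s, t) y - clipped_sum g (I, s, t) x =
    (\<Sum>i\<in>I. g (max x (min (t i) y)) - g (max x (min (s i) y)))"
proof -
  have "g (min u y) - g (min u x) = g (max x (min u y)) - g x" for u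
    using assms by (auto simp: min_def max_def)
  then have "g (max x (min (t i) y)) - g (max x (min (s i) y)) =
      (g (min (t i) y) - g (min (s i) y)) - (g (min (t i) x) - g (min (s i) x))" for i
    by (smt (verit))
  then show ?thesis unfolding clipped_sum_def by (simp add: sum_subtractf)
qed

lemma clip_family:
  assumes "(I, s, t) \<in> interval_families a b" "x \<le> y" "i \<in> I"
  shows "x \<le> max x (min (s i) y)" "max x (min (s i) y) \<le> max x (min (t i) y)" "max x (min (t i) y) \<le> y"
    "{max x (min (s i) y)<..<max x (min (t i) y)} \<subseteq> {s i<..<t i}"
  using assms by (auto simp: interval_families_def)

lemma clip_family_disjoint:
  assumes "(I, s, t) \<in> interval_families a b" "x \<le> y"
  shows "disjoint_family_on (\<lambda>i. {max x (min (s i) y)<..<max x (min (t i) y)}) I"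
proof -
  have "disjoint_family_on (\<lambda>i. {s i<..<t i}) I" using assms(1) by (simp add: interval_families_def)
  then show ?thesis using clip_family(4)[OF assms] unfolding disjoint_family_on_def by blast
qed

section \<open>Positive variation of a real absolutely continuous function\<close>

locale real_ac =
  fixes g :: "real \<Rightarrow> real" and a b :: real
  assumes ab: "a \<le> b" and ac: "absolutely_continuous_on {a..b} (\<lambda>x. complex_of_real (g x))"
begin

text \<open>Absolute values are dropped because only upward increments are estimated. The index type
  stays free: later families are indexed by naturals, by integers and by pairs.\<close>

lemma ac_sum:
  assumes "e > 0"
  shows "\<exists>d>0. \<forall>I (s :: 'i \<Rightarrow> real) t. finite I \<longrightarrow> (\<forall>i\<in>I. a \<le> s i \<and> s i \<le> t i \<and> t i \<le> b) \<longrightarrow>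
       disjoint_family_on (\<lambda>i. {s i<..<t i}) I \<longrightarrow> (\<Sum>i\<in>I. t i - s i) < d \<longrightarrow>
       (\<Sum>i\<in>I. g (t i) - g (s i)) < e"
proof -
  obtain d where d: "d > 0" and
    d': "\<forall>I (s :: 'i \<Rightarrow> real) t. finite I \<longrightarrow> (\<forall>i\<in>I. s i \<le> t i \<and> {s i..t i} \<subseteq> {a..b}) \<longrightarrow>
       disjoint_family_on (\<lambda>i. {s i<..<t i}) I \<longrightarrow> (\<Sum>i\<in>I. t i - s i) < d \<longrightarrow>
       (\<Sum>i\<in>I. cmod (complex_of_real (g (t i)) - complex_of_real (g (s i)))) < e"
    using absolutely_continuous_onD[OF ac assms] by blast
  note d = d d'[rule_format]
  show ?thesis
  proof (intro exI conjI allI impI)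
    fix I and s t :: "'i \<Rightarrow> real"
    assume I: "finite I" "\<forall>i\<in>I. a \<le> s i \<and> s i \<le> t i \<and> t i \<le> b"
       "disjoint_family_on (\<lambda>i. {s i<..<t i}) I" "(\<Sum>i\<in>I. t i - s i) < d"
    have "(\<Sum>i\<in>I. g (t i) - g (s i)) \<le> (\<Sum>i\<in>I. cmod (complex_of_real (g (t i)) - complex_of_real (g (s i))))"
      by (intro sum_mono) (auto simp flip: of_real_diff)
    also have "\<dots> < e" using I by (intro d(2)) auto
    finally show "(\<Sum>i\<in>I. g (t i) - g (s i)) < e" .
  qed (rule d(1))
qed

text \<open>Advancing \<open>x\<close> by less than \<open>d\<close> raises a clipped sum by at most
  1, and at \<open>a\<close> it is 0; finitely many steps of length d / 2 reach \<open>b\<close>.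
  Since \<open>d\<close> does not depend on the family, neither does the bound.\<close>

lemma clipped_sum_bounded: "\<exists>B. \<forall>F\<in>interval_families a b. \<forall>x\<in>{a..b}. clipped_sum g F x \<le> B"
proof -
  obtain d where d: "d > 0" and
    d': "\<forall>I (s :: nat \<Rightarrow> real) t. finite I \<longrightarrow> (\<forall>i\<in>I. a \<le> s i \<and> s i \<le> t i \<and> t i \<le> b) \<longrightarrow>
       disjoint_family_on (\<lambda>i. {s i<..<t i}) I \<longrightarrow> (\<Sum>i\<in>I. t i - s i) < d \<longrightarrow>
       (\<Sum>i\<in>I. g (t i) - g (s i)) < 1"
    using ac_sum[where 'i = "nat", of "1"] by auto
  note d = d d'[rule_format]
  have step: "clipped_sum g F y \<le> clipped_sum g F x + 1"
    if F: "F \<in> interval_families a b" and xy: "a \<le> x" "x \<le> y" "y \<le> b" "y - x < d" for F x y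
  proof -
    obtain I s t where Ist: "F = (I, s, t)" by (cases F)
    note F' = F[unfolded Ist]
    have fin: "finite I" using F' by (simp add: interval_families_def)
    have c: "x \<le> max x (min (s i) y) \<and> max x (min (s i) y) \<le> max x (min (t i) y) \<and> max x (min (t i) y) \<le> y"
      if "i \<in> I" for i using clip_family(1-3)[OF F' xy(2) that] by blast
    have c': "a \<le> max x (min (s i) y) \<and> max x (min (s i) y) \<le> max x (min (t i) y) \<and> max x (min (t i) y) \<le> b"
      if "i \<in> I" for i using c[OF that] xy(1,3) by linarith
    note dj = clip_family_disjoint[OF F' xy(2)]
    have "(\<Sum>i\<in>I. max x (min (t i) y) - max x (min (s i) y)) < d"
      using disjoint_intervals_total_length[OF fin c dj xy(2)] xy(4) by linarith
    from d(2)[OF fin c' dj this]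
    have "(\<Sum>i\<in>I. g (max x (min (t i) y)) - g (max x (min (s i) y))) < 1" .
    then show ?thesis using clipped_sum_diff[OF xy(2), of g I s t] by (simp add: Ist)
  qed
  have base: "clipped_sum g F a = 0" if "F \<in> interval_families a b" for F
  proof -
    obtain I s t where Ist: "F = (I, s, t)" by (cases F)
    have "min (t i) a = a" "min (s i) a = a" if "i \<in> I" for i
      using that \<open>F \<in> interval_families a b\<close> by (auto simp: Ist interval_families_def)
    then show ?thesis by (simp add: Ist clipped_sum_def)
  qed
  have "clipped_sum g F x \<le> real n" if "F \<in> interval_families a b" "a \<le> x" "x \<le> b" "x - a \<le> real n * (d / 2)" for F x n
    using that
  proof (induction n arbitrary: x)
    case 0
    then show ?case using base by auto
  next
    case (Suc n)
    define x' where "x' = max a (x - d / 2)"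
    have "clipped_sum g F x' \<le> real n"
      using Suc.prems d(1) by (intro Suc.IH) (auto simp: x'_def algebra_simps max_def)
    moreover have "clipped_sum g F x \<le> clipped_sum g F x' + 1"
      using Suc.prems d(1) by (intro step) (auto simp: x'_def max_def)
    ultimately show ?case by simp
  qed
  moreover obtain n :: nat where n: "(b - a) / (d / 2) \<le> real n" using real_arch_simple by blast
  then have "b - a \<le> real n * (d / 2)" using d(1) by (simp add: field_simps)
  ultimately show ?thesis by (intro exI[of _ "real n"]) (force)
qed

lemma bdd: "x \<in> {a..b} \<Longrightarrow> bdd_above ((\<lambda>F. clipped_sum g F x) ` interval_families a b)"
  using clipped_sum_bounded by (meson bdd_above.I2)

lemma empty_family: "({}, \<lambda>_. 0, \<lambda>_. 0) \<in> interval_families a b"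
  by (simp add: interval_families_def disjoint_family_on_def)

lemma clipped_sum_le: "F \<in> interval_families a b \<Longrightarrow> x \<in> {a..b} \<Longrightarrow> clipped_sum g F x \<le> positive_variation g a b x"
  unfolding positive_variation_def using bdd by (intro cSUP_upper) auto

lemma clipped_sum_near:
  assumes "x \<in> {a..b}" "e > 0"
  obtains F where "F \<in> interval_families a b" "clipped_sum g F x > positive_variation g a b x - e"
proof -
  have "positive_variation g a b x - e < (SUP F\<in>interval_families a b. clipped_sum g F x)"
    using assms(2) unfolding positive_variation_def by linarith
  then obtain F where "F \<in> interval_families a b" "positive_variation g a b x - e < clipped_sum g F x"
    using empty_family bdd[OF assms(1)] by (subst (asm) less_cSUP_iff) blast+
  then show ?thesis using that by blast
qed

text \<open>A family that nearly attains the variation at \<open>x\<close> is clipped there and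
  extended by the interval from x to z. Taking z = x gives monotonicity, and z = y gives the gain
  \<open>g y - g x\<close>; so both the variation and its difference with \<open>g\<close>
  increase.\<close>

lemma positive_variation_increment:
  assumes xy: "a \<le> x" "x \<le> y" "y \<le> b"
  shows "positive_variation g a b x + max 0 (g y - g x) \<le> positive_variation g a b y"
proof (rule field_le_epsilon)
  fix e :: real assume "e > 0"
  obtain I s t where F: "(I, s, t) \<in> interval_families a b"
    and near: "clipped_sum g (I, s, t) x > positive_variation g a b x - e"
    proof -
    have "x \<in> {a..b}" using xy by auto
    from clipped_sum_near[OF this \<open>e > 0\<close>] obtain F where "F \<in> interval_families a b"
      "clipped_sum g F x > positive_variation g a b x - e" by blast
    then show ?thesis using that by (cases F) blast
  qed
  have I: "finite I" using F by (simp add: interval_families_def)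
  obtain n where n: "n \<notin> I" using I ex_new_if_finite[of I] by auto
  define s' where "s' i = (if i = n then x else min (s i) x)" for i
  define t' where "t' z i = (if i = n then z else min (t i) x)" for z i
  have new: "positive_variation g a b x + (g z - g x) \<le> positive_variation g a b y + e" if z: "x \<le> z" "z \<le> y" for z
  proof -
    have dj: "disjoint_family_on (\<lambda>i. {s' i<..<t' z i}) (insert n I)"
      unfolding disjoint_family_on_def
    proof (intro ballI impI)
      fix i j assume ij: "i \<in> insert n I" "j \<in> insert n I" "i \<noteq> j"
      have "{s i<..<t i} \<inter> {s j<..<t j} = {}" if "i \<in> I" "j \<in> I"
        using F ij(3) that by (auto simp: interval_families_def disjoint_family_on_def)
      then show "{s' i<..<t' z i} \<inter> {s' j<..<t' z j} = {}"
        using ij n by (cases "i = n"; cases "j = n") (auto simp: s'_def t'_def)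
    qed
    have F': "(insert n I, s', t' z) \<in> interval_families a b"
      using F dj xy z n by (auto simp: interval_families_def s'_def t'_def min_def)
    have "clipped_sum g (insert n I, s', t' z) y = clipped_sum g (I, s, t) x + (g z - g x)"
    proof -
      have "(\<Sum>i\<in>I. g (min (t' z i) y) - g (min (s' i) y)) = (\<Sum>i\<in>I. g (min (t i) x) - g (min (s i) x))"
        using n xy by (intro sum.cong) (auto simp: s'_def t'_def min_def)
      then show ?thesis using I n z xy by (simp add: clipped_sum_def s'_def t'_def)
    qed
    then show ?thesis using clipped_sum_le[OF F', of y] near xy by auto
  qed
  show "positive_variation g a b x + max 0 (g y - g x) \<le> positive_variation g a b y + e"
    using new[of x] new[of y] xy by (auto simp: max_def)
qed

text \<open>For every interval of \<open>P\<close> a near-optimal family is clamped to it; all of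
  these together form one family, indexed by \<open>Sigma P J\<close>, that is no longer than
  \<open>P\<close>, and absolute continuity of \<open>g\<close> applies to it.\<close>

lemma positive_variation_ac: "absolutely_continuous_on {a..b} (\<lambda>x. complex_of_real (positive_variation g a b x))"
  unfolding absolutely_continuous_on_def
proof (intro allI impI)
  fix e :: real assume "e > 0"
  then have "e / 2 > 0" by simp
  obtain d where d: "d > 0" and
    d': "\<forall>I (s :: (real \<times> real) \<times> nat \<Rightarrow> real) t. finite I \<longrightarrow> (\<forall>i\<in>I. a \<le> s i \<and> s i \<le> t i \<and> t i \<le> b) \<longrightarrow>
       disjoint_family_on (\<lambda>i. {s i<..<t i}) I \<longrightarrow> (\<Sum>i\<in>I. t i - s i) < d \<longrightarrow>
       (\<Sum>i\<in>I. g (t i) - g (s i)) < e / 2"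
    using ac_sum[where 'i = "(real \<times> real) \<times> nat", of "e / 2"] \<open>e > 0\<close> by auto
  note d = d d'[rule_format]
  let ?p = "positive_variation g a b"
  show "\<exists>d>0. \<forall>P. finite P \<longrightarrow> (\<forall>(s, t)\<in>P. s \<le> t \<and> {s..t} \<subseteq> {a..b}) \<longrightarrow>
        disjoint_family_on (\<lambda>(s, t). {s<..<t}) P \<longrightarrow>
        (\<Sum>(s, t)\<in>P. t - s) < d \<longrightarrow> (\<Sum>(s, t)\<in>P. cmod (complex_of_real (?p t) - complex_of_real (?p s))) < e"
  proof (intro exI conjI allI impI)
    fix P :: "(real \<times> real) set"
    assume P: "finite P" "\<forall>(s, t)\<in>P. s \<le> t \<and> {s..t} \<subseteq> {a..b}"
        "disjoint_family_on (\<lambda>(s, t). {s<..<t}) P" "(\<Sum>(s, t)\<in>P. t - s) < d"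
    have Pin: "fst p \<le> snd p" "a \<le> fst p" "snd p \<le> b" if "p \<in> P" for p
      using P(2) that by (auto simp: case_prod_unfold subset_iff)
    \<comment> \<open>The \<open>card P\<close> approximation errors add up to at most e / 2; the +
      1 covers the empty \<open>P\<close>.\<close>
    define \<eta> where "\<eta> = e / (2 * (real (card P) + 1))"
    have "\<eta> > 0" using \<open>e > 0\<close> by (simp add: \<eta>_def)
    have "\<exists>F. F \<in> interval_families a b \<and> ?p (snd p) - ?p (fst p) \<le> clipped_sum g F (snd p) - clipped_sum g F (fst p) + \<eta>"
      if "p \<in> P" for p
    proof -
      have in_ab: "snd p \<in> {a..b}" "fst p \<in> {a..b}" using Pin[OF that] by auto
      obtain F where F: "F \<in> interval_families a b" "clipped_sum g F (snd p) > ?p (snd p) - \<eta>"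
        using clipped_sum_near[OF in_ab(1) \<open>\<eta> > 0\<close>] by blast
      then show ?thesis using clipped_sum_le[OF F(1) in_ab(2)] by (intro exI[of _ F]) auto
    qed
    then obtain F where F: "\<And>p. p \<in> P \<Longrightarrow> F p \<in> interval_families a b"
      "\<And>p. p \<in> P \<Longrightarrow> ?p (snd p) - ?p (fst p) \<le> clipped_sum g (F p) (snd p) - clipped_sum g (F p) (fst p) + \<eta>"
      by metis
    define J where "J p = fst (F p)" for p
    define s where "s = (\<lambda>(p, i). max (fst p) (min (fst (snd (F p)) i) (snd p)))"
    define t where "t = (\<lambda>(p, i). max (fst p) (min (snd (snd (F p)) i) (snd p)))"
    have F': "(J p, fst (snd (F p)), snd (snd (F p))) \<in> interval_families a b" if "p \<in> P" for p
      using F(1)[OF that] by (simp add: J_def)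
    have fin: "finite (J p)" if "p \<in> P" for p using F'[OF that] by (simp add: interval_families_def)
    have st: "fst p \<le> s (p, i)" "s (p, i) \<le> t (p, i)" "t (p, i) \<le> snd p" if "p \<in> P" "i \<in> J p" for p i
      using clip_family(1-3)[OF F' Pin(1), of p p i] that by (auto simp: s_def t_def)
    have dj: "disjoint_family_on (\<lambda>i. {s (p, i)<..<t (p, i)}) (J p)" if "p \<in> P" for p
      using clip_family_disjoint[OF F' Pin(1), of p p] that by (simp add: s_def t_def)
    have main: "(\<Sum>x\<in>Sigma P J. g (t x) - g (s x)) < e / 2"
    proof (rule d(2))
      show "finite (Sigma P J)" using P(1) fin by blast
      show "a \<le> s x \<and> s x \<le> t x \<and> t x \<le> b" if "x \<in> Sigma P J" for x
      proof -
        obtain p i where x: "x = (p, i)" "p \<in> P" "i \<in> J p" using \<open>x \<in> Sigma P J\<close> by blast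
        show ?thesis using st[OF x(2,3)] Pin[OF x(2)] unfolding x(1) by linarith
      qed
      show "disjoint_family_on (\<lambda>x. {s x<..<t x}) (Sigma P J)"
        unfolding disjoint_family_on_def
      proof (intro ballI impI)
        fix x y assume xy: "x \<in> Sigma P J" "y \<in> Sigma P J" "x \<noteq> y"
        obtain p i q j where pq: "x = (p, i)" "y = (q, j)" by (cases x, cases y)
        show "{s x<..<t x} \<inter> {s y<..<t y} = {}"
        proof (cases "p = q")
          case True
          then have "p \<in> P" "i \<in> J p" "j \<in> J p" "i \<noteq> j" using xy pq by auto
          then show ?thesis using dj unfolding disjoint_family_on_def pq True[symmetric] by blast
        next
          case False
          have "{fst p<..<snd p} \<inter> {fst q<..<snd q} = {}"
            using P(3) xy(1,2) pq False unfolding disjoint_family_on_def case_prod_unfold by blast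
          moreover have "{s x<..<t x} \<subseteq> {fst p<..<snd p}" "{s y<..<t y} \<subseteq> {fst q<..<snd q}"
            using st[of p i] st[of q j] xy(1,2) pq by (simp_all add: greaterThanLessThan_subseteq_greaterThanLessThan)
          ultimately show ?thesis by blast
        qed
      qed
      have "(\<Sum>x\<in>Sigma P J. t x - s x) = (\<Sum>p\<in>P. \<Sum>i\<in>J p. t (p, i) - s (p, i))"
        using P(1) fin by (subst sum.Sigma) auto
      also have "\<dots> \<le> (\<Sum>p\<in>P. snd p - fst p)"
        using fin st dj Pin by (intro sum_mono disjoint_intervals_total_length) blast+
      also have "\<dots> < d" using P(4) by (simp add: case_prod_unfold)
      finally show "(\<Sum>x\<in>Sigma P J. t x - s x) < d" .
    qed
    have "(\<Sum>(s, t)\<in>P. cmod (complex_of_real (?p t) - complex_of_real (?p s))) = (\<Sum>p\<in>P. ?p (snd p) - ?p (fst p))"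
      unfolding case_prod_unfold
    proof (intro sum.cong refl)
      fix p assume "p \<in> P"
      then show "cmod (complex_of_real (?p (snd p)) - complex_of_real (?p (fst p))) = ?p (snd p) - ?p (fst p)"
        using positive_variation_increment[of "fst p" "snd p"] Pin[of p] by (simp flip: of_real_diff)
    qed
    also have "\<dots> \<le> (\<Sum>p\<in>P. (\<Sum>i\<in>J p. g (t (p, i)) - g (s (p, i))) + \<eta>)"
    proof (intro sum_mono)
      fix p assume p: "p \<in> P"
      show "?p (snd p) - ?p (fst p) \<le> (\<Sum>i\<in>J p. g (t (p, i)) - g (s (p, i))) + \<eta>"
        using F(2)[OF p] clipped_sum_diff[OF Pin(1)[OF p], of g "J p" "fst (snd (F p))" "snd (snd (F p))"]
        by (simp add: J_def s_def t_def)
    qed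
    also have "\<dots> = (\<Sum>x\<in>Sigma P J. g (t x) - g (s x)) + real (card P) * \<eta>"
      using P(1) fin by (simp add: sum.distrib sum.Sigma case_prod_unfold)
    also have "\<dots> < e / 2 + e / 2"
    proof (rule add_less_le_mono[OF main])
      show "real (card P) * \<eta> \<le> e / 2" using \<open>e > 0\<close> by (simp add: \<eta>_def field_simps)
    qed
    finally show "(\<Sum>(s, t)\<in>P. cmod (complex_of_real (?p t) - complex_of_real (?p s))) < e" by simp
  qed (rule d(1))
qed

end

section \<open>Densities of real absolutely continuous functions\<close>

context real_ac
begin

text \<open>The Stieltjes measure of \<open>g\<close>, continued by constants outside [a, b], has no
  mass on Lebesgue null sets, and \<open>h\<close> is its Radon-Nikodym density.\<close>

lemma mono_ac_density:
  assumes mono: "\<And>x y. a \<le> x \<Longrightarrow> x \<le> y \<Longrightarrow> y \<le> b \<Longrightarrow> g x \<le> g y"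
  shows "\<exists>h :: real \<Rightarrow> real. integrable lebesgue h \<and>
    (\<forall>u v. a \<le> u \<longrightarrow> u \<le> v \<longrightarrow> v \<le> b \<longrightarrow> (LINT y:{u..v}|lebesgue. h y) = g v - g u)"
proof -
  define c where "c x = max a (min x b)" for x
  define G where "G x = g (c x)" for x
  define \<mu> where "\<mu> = interval_measure G"
  have c: "a \<le> c x" "c x \<le> b" "x \<le> y \<Longrightarrow> c x \<le> c y" "x \<le> y \<Longrightarrow> c y - c x \<le> y - x" for x y
    using ab by (auto simp: c_def)
  have G_mono: "G x \<le> G y" if "x \<le> y" for x y
    using that c by (auto simp: G_def intro!: mono)
  have "continuous_on {a..b} (\<lambda>x. Re (complex_of_real (g x)))"
    by (intro continuous_on_Re absolutely_continuous_on_imp_continuous_on ac)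
  then have g_cont: "continuous_on {a..b} g" by simp
  have "continuous_on UNIV G" unfolding G_def
    by (intro continuous_on_compose2[OF g_cont]) (use ab in \<open>auto simp: c c_def intro!: continuous_intros\<close>)
  then have G_cont: "continuous (at_right x) G" for x
    by (simp add: continuous_on_eq_continuous_at continuous_at_imp_continuous_at_within)
  have Ioc: "emeasure \<mu> {u<..v} = ennreal (G v - G u)" if "u \<le> v" for u v
    unfolding \<mu>_def using that G_mono G_cont by (intro emeasure_interval_measure_Ioc) auto
  have sets_\<mu>[measurable_cong]: "sets \<mu> = sets borel" by (simp add: \<mu>_def)
  \<comment> \<open>The null set is covered by an open \<open>U\<close> of length below
    \<open>d\<close>, and \<open>U\<close> is exhausted by finite unions of grid cells, to which the
    condition on \<open>g\<close> applies.\<close>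
  have small: "emeasure \<mu> N \<le> ennreal e" if N: "N \<in> sets borel" "emeasure lborel N = 0" and "e > 0" for N e
  proof -
    obtain d where d: "d > 0" and
      d': "\<forall>I (s :: int \<Rightarrow> real) t. finite I \<longrightarrow> (\<forall>i\<in>I. a \<le> s i \<and> s i \<le> t i \<and> t i \<le> b) \<longrightarrow>
         disjoint_family_on (\<lambda>i. {s i<..<t i}) I \<longrightarrow> (\<Sum>i\<in>I. t i - s i) < d \<longrightarrow>
         (\<Sum>i\<in>I. g (t i) - g (s i)) < e"
      using ac_sum[where 'i = int, OF \<open>e > 0\<close>] by auto
    obtain U where U: "open U" "N \<subseteq> U" "emeasure lborel (U - N) < ennreal d"
      using outer_regular_lborel[OF N(1) d] by blast
    have "emeasure lborel U \<le> emeasure lborel N + emeasure lborel (U - N)"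
      using N U emeasure_subadditive[of N lborel "U - N"] by (simp add: Un_absorb1)
    then have Ud: "emeasure lborel U < ennreal d" using N(2) U(3) by auto
    \<comment> \<open>Cells of mesh 1 / k whose closure lies in \<open>U\<close>. The bound k * k
      keeps \<open>J k\<close> finite while the range covered, about [-k, k], grows with k.\<close>
    define J where "J k = {j :: int. \<bar>j\<bar> \<le> int k * int k \<and> {j / real k..(j + 1) / real k} \<subseteq> U}" for k :: nat
    define I where "I k j = {j / real k<..(j + 1) / real k}" for k :: nat and j :: int
    define U' where "U' k = (\<Union>j\<in>J k. I k j)" for k
    have I_sets: "I k j \<in> sets borel" for k j by (simp add: I_def)
    have finJ: "finite (J k)" for k
      by (rule finite_subset[of _ "{- (int k * int k)..int k * int k}"]) (auto simp: J_def)
    have I_disj: "I k i \<inter> I k j = {}" if "i \<noteq> j" for k i j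
    proof (rule ccontr)
      assume "I k i \<inter> I k j \<noteq> {}"
      then obtain x where x: "x \<in> I k i" "x \<in> I k j" by blast
      show False
      proof (cases "k = 0")
        case False
        then have "real_of_int i < x * k" "x * k \<le> real_of_int i + 1" "real_of_int j < x * k" "x * k \<le> real_of_int j + 1"
          using x by (auto simp: I_def field_simps)
        then show False using that by linarith
      qed (use x in \<open>auto simp: I_def\<close>)
    qed
    have dj: "disjoint_family_on (I k) (J k)" for k
      using I_disj by (auto simp: disjoint_family_on_def)
    have U'_le: "emeasure \<mu> (U' k) \<le> ennreal e" for k
    proof -
      define s where "s j = c (real_of_int j / real k)" for j
      define t where "t j = c ((real_of_int j + 1) / real k)" for j
      have le: "real_of_int j / real k \<le> (real_of_int j + 1) / real k" for j
        by (simp add: divide_right_mono)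
      have "(\<Sum>j\<in>J k. t j - s j) \<le> (\<Sum>j\<in>J k. (real_of_int j + 1) / real k - real_of_int j / real k)"
        unfolding s_def t_def by (intro sum_mono c(4) le)
      also have "ennreal \<dots> = (\<Sum>j\<in>J k. ennreal ((real_of_int j + 1) / real k - real_of_int j / real k))"
        using le by (subst sum_ennreal) auto
      also have "\<dots> = (\<Sum>j\<in>J k. emeasure lborel (I k j))"
        using le by (intro sum.cong refl) (simp add: I_def)
      also have "\<dots> = emeasure lborel (U' k)"
        unfolding U'_def using finJ dj by (intro sum_emeasure) (auto simp: I_sets)
      also have "\<dots> \<le> emeasure lborel U"
        using U(1) by (intro emeasure_mono) (auto simp: U'_def I_def J_def)
      finally have "ennreal (\<Sum>j\<in>J k. t j - s j) < ennreal d"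
        using Ud by (smt (verit) ennreal_leI le_less_trans order_trans)
      then have len: "(\<Sum>j\<in>J k. t j - s j) < d" using d by (simp add: ennreal_less_iff sum_nonneg c le s_def t_def)
      have "emeasure \<mu> (U' k) = (\<Sum>j\<in>J k. emeasure \<mu> (I k j))"
        unfolding U'_def using finJ dj by (intro sum_emeasure[symmetric]) (auto simp: I_sets sets_\<mu>)
      also have "\<dots> = (\<Sum>j\<in>J k. ennreal (g (t j) - g (s j)))"
        using le by (intro sum.cong refl) (simp add: I_def Ioc G_def s_def t_def)
      also have "\<dots> = ennreal (\<Sum>j\<in>J k. g (t j) - g (s j))"
        using le c by (intro sum_ennreal) (auto simp: s_def t_def intro!: mono)
      also have "\<dots> \<le> ennreal e"
      proof (intro ennreal_leI less_imp_le d'[rule_format])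
        show "disjoint_family_on (\<lambda>i. {s i<..<t i}) (J k)"
        proof -
          have "{s j<..<t j} \<subseteq> I k j" for j
            using ab by (auto simp: s_def t_def c_def I_def)
          then show ?thesis using dj[of k] unfolding disjoint_family_on_def by blast
        qed
      qed (use finJ len c le in \<open>auto simp: s_def t_def\<close>)
      finally show ?thesis .
    qed
    \<comment> \<open>The sets \<open>U' k\<close> need not increase with k. The intersections of
      their tails do, and each lies in some \<open>U' n\<close>, so continuity from below
      applies.\<close>
    define V where "V n = (\<Inter>k\<in>{n..}. U' k)" for n
    have U'_sets[measurable]: "U' k \<in> sets borel" for k
      unfolding U'_def using finJ by (auto simp: I_def)
    have V_sets: "V n \<in> sets borel" for n unfolding V_def by measurable
    have "U \<subseteq> (\<Union>n. V n)"
    proof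
      fix x assume "x \<in> U"
      then obtain r where r: "r > 0" "ball x r \<subseteq> U" using U(1) open_contains_ball by blast
      obtain n :: nat where n: "real n > max (1 / r) (\<bar>x\<bar> + 1)" using reals_Archimedean2 by blast
      have "x \<in> U' k" if "k \<ge> n" for k
      proof -
        have k: "real k > 1 / r" "real k > \<bar>x\<bar> + 1" "real k > 0" using n that by auto
        have kr: "1 / real k < r" using k r(1) by (simp add: field_simps)
        define j where "j = \<lceil>x * k\<rceil> - 1"
        have j: "real_of_int j < x * k" "x * k \<le> real_of_int j + 1" unfolding j_def by linarith+
        have j': "real_of_int j / k < x" "x \<le> (real_of_int j + 1) / k"
          using j k(3) by (auto simp: field_simps)
        have j'': "(real_of_int j + 1) / k = real_of_int j / k + 1 / k" by (simp add: add_divide_distrib)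
        have "{real_of_int j / k..(real_of_int j + 1) / k} \<subseteq> ball x r"
          using j' kr unfolding j'' by (auto simp: dist_real_def)
        moreover have "\<bar>j\<bar> \<le> int k * int k"
        proof -
          have "\<bar>x * k\<bar> + 1 \<le> (\<bar>x\<bar> + 1) * k" using k by (simp add: abs_mult algebra_simps)
          also have "\<dots> \<le> real k * real k" using k by (intro mult_right_mono) auto
          finally have "\<bar>real_of_int j\<bar> \<le> real k * real k" using j by linarith
          then have "real_of_int \<bar>j\<bar> \<le> real_of_int (int k * int k)" by simp
          then show ?thesis by linarith
        qed
        ultimately have "j \<in> J k" using r(2) by (auto simp: J_def)
        then show ?thesis using j' by (auto simp: U'_def I_def)
      qed
      then show "x \<in> (\<Union>n. V n)" by (auto simp: V_def)
    qed
    then have "emeasure \<mu> N \<le> emeasure \<mu> (\<Union>n. V n)"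
      using U(2) V_sets by (intro emeasure_mono) (auto simp: sets_\<mu>)
    also have "\<dots> = (SUP n. emeasure \<mu> (V n))"
      using V_sets by (intro SUP_emeasure_incseq[symmetric]) (auto simp: sets_\<mu> incseq_def V_def)
    also have "\<dots> \<le> ennreal e"
    proof (rule SUP_least)
      fix n
      have "emeasure \<mu> (V n) \<le> emeasure \<mu> (U' n)"
        using U'_sets by (intro emeasure_mono) (auto simp: V_def sets_\<mu>)
      then show "emeasure \<mu> (V n) \<le> ennreal e" using U'_le[of n] by simp
    qed
    finally show ?thesis .
  qed
  have "absolutely_continuous lborel \<mu>"
    unfolding absolutely_continuous_def
  proof
    fix N :: "real set" assume "N \<in> null_sets lborel"
    then have N: "N \<in> sets borel" "emeasure lborel N = 0" by (auto simp: null_sets_def)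
    have "emeasure \<mu> N = 0" using small[OF N]
      by (metis ennreal_0 ennreal_le_epsilon le_zero_eq add.left_neutral ennreal_less_top)
    then show "N \<in> null_sets \<mu>" using N by (auto simp: null_sets_def sets_\<mu>)
  qed
  moreover have "sets \<mu> = sets lborel" by (simp add: sets_\<mu>)
  ultimately obtain f where f[measurable]: "f \<in> borel_measurable lborel" and f_dens: "density lborel f = \<mu>"
    using sigma_finite_measure.Radon_Nikodym[OF sigma_finite_lborel] by blast
  have f_int: "(\<integral>\<^sup>+x\<in>{u<..v}. f x \<partial>lborel) = ennreal (g v - g u)" if "a \<le> u" "u \<le> v" "v \<le> b" for u v
  proof -
    have "(\<integral>\<^sup>+x\<in>{u<..v}. f x \<partial>lborel) = emeasure \<mu> {u<..v}"
      unfolding f_dens[symmetric] by (subst emeasure_density) auto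
    then show ?thesis using that by (simp add: Ioc G_def c_def)
  qed
  \<comment> \<open>\<open>enn2real\<close> sends infinity to 0, which is harmless because
    \<open>f\<close> is finite almost everywhere on the interval.\<close>
  define h where "h x = enn2real (f x * indicator {a<..b} x)" for x
  have h_meas[measurable]: "h \<in> borel_measurable lborel" unfolding h_def by measurable
  have "(\<integral>\<^sup>+x. f x * indicator {a<..b} x \<partial>lborel) \<noteq> \<infinity>" using f_int[of a b] ab by simp
  then have "AE x in lborel. f x * indicator {a<..b} x \<noteq> \<infinity>"
    by (intro nn_integral_PInf_AE) auto
  then have fh: "AE x in lborel. ennreal (h x) = f x * indicator {a<..b} x"
    by eventually_elim (auto simp: h_def less_top)
  have h_nn: "(\<integral>\<^sup>+x\<in>{u<..v}. ennreal (h x) \<partial>lborel) = ennreal (g v - g u)" if "a \<le> u" "u \<le> v" "v \<le> b" for u v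
  proof -
    have "(\<integral>\<^sup>+x\<in>{u<..v}. ennreal (h x) \<partial>lborel) = (\<integral>\<^sup>+x\<in>{u<..v}. f x \<partial>lborel)"
      by (rule nn_integral_cong_AE, use fh in eventually_elim) (use that in \<open>auto simp: indicator_def\<close>)
    then show ?thesis using f_int[OF that] by simp
  qed
  have h0: "0 \<le> h x" for x by (simp add: h_def)
  have h_eq: "ennreal (h x) = ennreal (h x) * indicator {a<..b} x" for x by (auto simp: h_def indicator_def)
  have h_int: "integrable lborel h"
  proof (rule integrableI_nonneg)
    have "(\<integral>\<^sup>+x. ennreal (h x) \<partial>lborel) = ennreal (g b - g a)"
      using h_nn[of a b] ab by (subst h_eq) auto
    then show "(\<integral>\<^sup>+x. ennreal (h x) \<partial>lborel) < \<infinity>" by simp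
  qed (use h0 in auto)
  show ?thesis
  proof (intro exI conjI allI impI)
    show "integrable lebesgue h" using h_int by (simp add: integrable_completion)
    fix u v assume uv: "a \<le> u" "u \<le> v" "v \<le> b"
    have ennn: "(\<integral>\<^sup>+x. ennreal (indicator {u<..v} x *\<^sub>R h x) \<partial>lborel) = ennreal (g v - g u)"
      unfolding h_nn[OF uv, symmetric] by (intro nn_integral_cong) (auto simp: indicator_def)
    have "(LINT y:{u..v}|lebesgue. h y) = (LINT y:{u..v}|lborel. h y)"
      unfolding set_lebesgue_integral_def by (intro integral_completion) measurable
    also have "\<dots> = (LINT y:{u<..v}|lborel. h y)"
    proof (rule set_integral_cong_set)
      show "AE x in lborel. (x \<in> {u<..v}) = (x \<in> {u..v})"
        using AE_lborel_singleton[of u] by eventually_elim auto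
    qed (auto simp: set_borel_measurable_def)
    also have "\<dots> = g v - g u" unfolding set_lebesgue_integral_def
      using h0 mono[OF uv] ennn by (subst integral_eq_nn_integral) (auto simp: indicator_def)
    finally show "(LINT y:{u..v}|lebesgue. h y) = g v - g u" .
  qed
qed

text \<open>By \<open>positive_variation_increment\<close> the function is a difference of two
  increasing ones, and both are absolutely continuous.\<close>

lemma ac_density_real:
  "\<exists>h :: real \<Rightarrow> real. integrable lebesgue h \<and>
    (\<forall>u v. a \<le> u \<longrightarrow> u \<le> v \<longrightarrow> v \<le> b \<longrightarrow> (LINT y:{u..v}|lebesgue. h y) = g v - g u)"
proof -
  let ?p = "positive_variation g a b"
  interpret p: real_ac ?p a b
    using ab positive_variation_ac by unfold_locales
  interpret n: real_ac "\<lambda>x. ?p x - g x" a b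
  proof
    show "absolutely_continuous_on {a..b} (\<lambda>x. complex_of_real (?p x - g x))"
    proof (rule absolutely_continuous_onI[OF positive_variation_ac ac, where C = 1])
      fix s t
      have "\<bar>(?p t - g t) - (?p s - g s)\<bar> \<le> \<bar>?p t - ?p s\<bar> + \<bar>g t - g s\<bar>" by linarith
      then show "cmod (complex_of_real (?p t - g t) - complex_of_real (?p s - g s))
         \<le> 1 * cmod (complex_of_real (?p t) - complex_of_real (?p s)) + 1 * cmod (complex_of_real (g t) - complex_of_real (g s))"
        by (simp flip: of_real_diff)
    qed auto
  qed (rule ab)
  obtain h1 where h1: "integrable lebesgue h1"
    "\<And>u v. a \<le> u \<Longrightarrow> u \<le> v \<Longrightarrow> v \<le> b \<Longrightarrow> (LINT y:{u..v}|lebesgue. h1 y) = ?p v - ?p u"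
    using p.mono_ac_density positive_variation_increment by fastforce
  obtain h2 where h2: "integrable lebesgue h2"
    "\<And>u v. a \<le> u \<Longrightarrow> u \<le> v \<Longrightarrow> v \<le> b \<Longrightarrow> (LINT y:{u..v}|lebesgue. h2 y) = (?p v - g v) - (?p u - g u)"
  proof -
    have "?p x - g x \<le> ?p y - g y" if "a \<le> x" "x \<le> y" "y \<le> b" for x y
      using positive_variation_increment[OF that] by linarith
    from n.mono_ac_density[OF this] show ?thesis using that by blast
  qed
  show ?thesis
  proof (intro exI conjI allI impI)
    show "integrable lebesgue (\<lambda>x. h1 x - h2 x)" using h1 h2 by simp
    fix u v assume uv: "a \<le> u" "u \<le> v" "v \<le> b"
    have "(LINT y:{u..v}|lebesgue. h1 y - h2 y) = (LINT y:{u..v}|lebesgue. h1 y) - (LINT y:{u..v}|lebesgue. h2 y)"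
      using h1(1) h2(1) by (intro set_integral_diff) (auto simp: set_integrable_def intro!: integrable_mult_indicator[where 'b=real, simplified])
    then show "(LINT y:{u..v}|lebesgue. h1 y - h2 y) = g v - g u" using h1(2) h2(2) uv by simp
  qed
qed

end

lemma ac_density:
  assumes ab: "a \<le> b" and ac: "absolutely_continuous_on {a..b} g"
  shows "\<exists>h :: real \<Rightarrow> complex. integrable lebesgue h \<and>
    (\<forall>u v. a \<le> u \<longrightarrow> u \<le> v \<longrightarrow> v \<le> b \<longrightarrow> (LINT y:{u..v}|lebesgue. h y) = g v - g u)"
proof -
  interpret r: real_ac "\<lambda>x. Re (g x)" a b
  proof
    show "absolutely_continuous_on {a..b} (\<lambda>x. complex_of_real (Re (g x)))"
      by (rule absolutely_continuous_onI[OF ac ac, where C = 1])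
         (auto simp flip: of_real_diff minus_complex.sel intro: order.trans[OF abs_Re_le_cmod])
  qed (rule ab)
  interpret i: real_ac "\<lambda>x. Im (g x)" a b
  proof
    show "absolutely_continuous_on {a..b} (\<lambda>x. complex_of_real (Im (g x)))"
      by (rule absolutely_continuous_onI[OF ac ac, where C = 1])
         (auto simp flip: of_real_diff minus_complex.sel intro: order.trans[OF abs_Im_le_cmod])
  qed (rule ab)
  obtain h1 where h1: "integrable lebesgue h1"
    "\<And>u v. a \<le> u \<Longrightarrow> u \<le> v \<Longrightarrow> v \<le> b \<Longrightarrow> (LINT y:{u..v}|lebesgue. h1 y) = Re (g v) - Re (g u)"
    using r.ac_density_real by blast
  obtain h2 where h2: "integrable lebesgue h2"
    "\<And>u v. a \<le> u \<Longrightarrow> u \<le> v \<Longrightarrow> v \<le> b \<Longrightarrow> (LINT y:{u..v}|lebesgue. h2 y) = Im (g v) - Im (g u)"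
    using i.ac_density_real by blast
  define h where "h x = Complex (h1 x) (h2 x)" for x
  have h_eq: "h = (\<lambda>x. complex_of_real (h1 x) + \<i> * complex_of_real (h2 x))"
    by (auto simp: h_def complex_eq_iff)
  have h: "integrable lebesgue h" unfolding h_eq using h1(1) h2(1) by auto
  show ?thesis
  proof (intro exI[of _ h] conjI allI impI h)
    fix u v assume uv: "a \<le> u" "u \<le> v" "v \<le> b"
    have i: "integrable lebesgue (\<lambda>x. indicat_real {u..v} x *\<^sub>R h x)"
      using h by (intro integrable_mult_indicator) auto
    have "Re (LINT y:{u..v}|lebesgue. h y) = Re (g v - g u)"
      using h1(2)[OF uv] i unfolding set_lebesgue_integral_def
      by (subst integral_Re[symmetric]) (auto simp: h_def)
    moreover have "Im (LINT y:{u..v}|lebesgue. h y) = Im (g v - g u)"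
      using h2(2)[OF uv] i unfolding set_lebesgue_integral_def
      by (subst integral_Im[symmetric]) (auto simp: h_def)
    ultimately show "(LINT y:{u..v}|lebesgue. h y) = g v - g u" by (simp add: complex_eq_iff)
  qed
qed

text \<open>Almost everywhere \<open>g\<close> has the density \<open>h\<close> as its derivative,
  and there \<open>D1 g\<close> agrees with \<open>h\<close>; elsewhere the arbitrary values of
  \<open>D1 g\<close> do not affect integrals.\<close>

theorem ac_fundamental_theorem:
  assumes ab: "a \<le> b" and ac: "absolutely_continuous_on {a..b} g"
  shows "negligible {x \<in> {a<..<b}. \<not> (g has_vector_derivative D1 g x) (at x)}"
    and "D1 g absolutely_integrable_on {a..b}"
    and "(D1 g has_integral g b - g a) {a..b}"
proof -
  obtain h where h: "integrable lebesgue h"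
    "\<And>u v. a \<le> u \<Longrightarrow> u \<le> v \<Longrightarrow> v \<le> b \<Longrightarrow> (LINT y:{u..v}|lebesgue. h y) = g v - g u"
    using ac_density[OF assms] by blast
  have neg: "negligible {x \<in> {a<..<b}. \<not> (g has_vector_derivative h x) (at x)}"
    using h by (intro lebesgue_differentiation) auto
  then show "negligible {x \<in> {a<..<b}. \<not> (g has_vector_derivative D1 g x) (at x)}"
    by (rule negligible_subset) (auto simp: D1_def vector_derivative_at)
  \<comment> \<open>The endpoints are added because differentiability is controlled only in the open
    interval.\<close>
  define N where "N = {x \<in> {a<..<b}. \<not> (g has_vector_derivative h x) (at x)} \<union> {a, b}"
  have N: "negligible N" using neg by (auto simp: N_def)
  have D1h: "D1 g x = h x" if "x \<in> {a..b} - N" for x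
    using that by (auto simp: N_def D1_def intro!: vector_derivative_at)
  have hab: "h absolutely_integrable_on {a..b}"
    using h(1) by (auto simp: set_integrable_def intro!: integrable_mult_indicator)
  show "D1 g absolutely_integrable_on {a..b}"
    by (rule absolutely_integrable_spike[OF hab N D1h])
  have "(h has_integral g b - g a) {a..b}"
    using h(2)[of a b] ab has_integral_set_lebesgue[OF hab] by simp
  then show "(D1 g has_integral g b - g a) {a..b}"
    by (rule has_integral_spike[OF N D1h, rotated]) auto
qed

section \<open>Antiderivatives on the half-line\<close>

text \<open>Local absolute continuity in integral form: it says that \<open>g\<close> is absolutely
  continuous on compact subintervals of the half-line and that \<open>h\<close> is its derivative
  almost everywhere; see \<open>antiderivative_ac\<close> and \<open>antiderivative_deriv\<close>.
  The density \<open>h\<close> may be changed on null sets.\<close>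

definition antiderivative :: "(real \<Rightarrow> complex) \<Rightarrow> (real \<Rightarrow> complex) \<Rightarrow> bool" where
  "antiderivative g h \<longleftrightarrow>
     (\<forall>a b. 0 < a \<longrightarrow> a \<le> b \<longrightarrow> h absolutely_integrable_on {a..b} \<and> (h has_integral g b - g a) {a..b})"

lemma antiderivativeD:
  assumes "antiderivative g h" "0 < a" "a \<le> b"
  shows "h absolutely_integrable_on {a..b}" "(h has_integral g b - g a) {a..b}"
    "(LINT x:{a..b}|lebesgue. h x) = g b - g a"
proof -
  show *: "h absolutely_integrable_on {a..b}" "(h has_integral g b - g a) {a..b}"
    using assms by (auto simp: antiderivative_def)
  show "(LINT x:{a..b}|lebesgue. h x) = g b - g a"
    using has_integral_set_lebesgue[OF *(1)] *(2) by (rule has_integral_unique)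
qed

lemma AE_half_line_iff: "(AE x in half_line. P x) \<longleftrightarrow> negligible {x. 0 < x \<and> \<not> P x}"
proof -
  have "(AE x in half_line. P x) \<longleftrightarrow> (AE x in lebesgue. 0 < x \<longrightarrow> P x)"
    using AE_restrict_space_iff[of "{0<..}" lebesgue P] by simp
  also have "\<dots> \<longleftrightarrow> negligible {x. 0 < x \<and> \<not> P x}"
  proof
    assume "AE x in lebesgue. 0 < x \<longrightarrow> P x"
    then have "\<exists>N\<in>null_sets lebesgue. {x \<in> space lebesgue. \<not> (0 < x \<longrightarrow> P x)} \<subseteq> N"
      by (simp only: eventually_ae_filter)
    then obtain N where N: "N \<in> null_sets lebesgue" "{x \<in> space lebesgue. \<not> (0 < x \<longrightarrow> P x)} \<subseteq> N" by blast
    have "{x. 0 < x \<and> \<not> P x} \<subseteq> N" using N(2) by auto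
    then show "negligible {x. 0 < x \<and> \<not> P x}"
      using N(1) negligible_iff_null_sets negligible_subset by blast
  next
    assume "negligible {x. 0 < x \<and> \<not> P x}"
    then show "AE x in lebesgue. 0 < x \<longrightarrow> P x"
      using AE_I'[of "{x. 0 < x \<and> \<not> P x}" lebesgue] by (auto simp: negligible_iff_null_sets)
  qed
  finally show ?thesis .
qed

lemma countable_cover_half_line: "{0<..} = (\<Union>n::nat. {1 / (real n + 1)<..<real n + 1})"
proof
  show "{0<..} \<subseteq> (\<Union>n::nat. {1 / (real n + 1)<..<real n + 1})"
  proof
    fix x :: real assume "x \<in> {0<..}"
    then have x: "x > 0" by simp
    obtain n :: nat where n: "max x (1 / x) < real n" using reals_Archimedean2 by blast
    then have "1 / (real n + 1) < x" "x < real n + 1" using x by (auto simp: field_simps)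
    then show "x \<in> (\<Union>n::nat. {1 / (real n + 1)<..<real n + 1})" by auto
  qed
qed (auto intro: less_trans[rotated])

text \<open>The density is only locally integrable, so the differentiation theorem is applied to its
  restrictions to compact intervals that exhaust the half-line.\<close>

lemma antiderivative_deriv:
  assumes "antiderivative g h"
  shows "AE x in half_line. (g has_vector_derivative h x) (at x)"
proof -
  have neg: "negligible {x \<in> {a<..<b}. \<not> (g has_vector_derivative h x) (at x)}" if "0 < a" "a \<le> b" for a b
  proof -
    define k where "k x = indicator {a..b} x *\<^sub>R h x" for x
    have k: "integrable lebesgue k"
      using antiderivativeD(1)[OF assms that] by (simp add: k_def[abs_def] set_integrable_def)
    have "negligible {x \<in> {a<..<b}. \<not> (g has_vector_derivative k x) (at x)}"
    proof (rule lebesgue_differentiation[OF k])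
      fix u v assume uv: "a < u" "u \<le> v" "v < b"
      have "(LINT y:{u..v}|lebesgue. k y) = (LINT y:{u..v}|lebesgue. h y)"
        using uv by (intro set_lebesgue_integral_cong) (auto simp: k_def)
      then show "g v - g u = (LINT y:{u..v}|lebesgue. k y)"
        using antiderivativeD(3)[OF assms] uv that by simp
    qed
    then show ?thesis by (rule negligible_subset) (auto simp: k_def)
  qed
  define A where "A n = {x \<in> {1 / (real n + 1)<..<real n + 1}. \<not> (g has_vector_derivative h x) (at x)}" for n
  have "negligible (A n)" for n
  proof -
    have "1 / (real n + 1) \<le> real n + 1" by (simp add: field_simps)
    then show ?thesis using neg[of "1 / (real n + 1)" "real n + 1"] by (simp add: A_def)
  qed
  then have "negligible (\<Union>n. A n)"
    by (intro negligible_countable_Union) auto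
  moreover have "{x. 0 < x \<and> \<not> (g has_vector_derivative h x) (at x)} = (\<Union>n. A n)"
    using countable_cover_half_line unfolding A_def by blast
  ultimately show ?thesis by (simp add: AE_half_line_iff)
qed

lemma D1_eqI: "(f has_vector_derivative D) (at x) \<Longrightarrow> D1 f x = D"
  by (simp add: D1_def vector_derivative_at)

lemma has_vector_derivative_cong_half_line:
  assumes "\<And>y. y > 0 \<Longrightarrow> f y = g y" "x > 0"
  shows "(f has_vector_derivative D) (at x) \<longleftrightarrow> (g has_vector_derivative D) (at x)"
  using has_vector_derivative_transform_within_open[of f D x "{0<..}" g]
    has_vector_derivative_transform_within_open[of g D x "{0<..}" f] assms by auto

lemma D1_cong_half_line:
  assumes "\<And>y. y > 0 \<Longrightarrow> f y = g y" "x > 0"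
  shows "D1 f x = D1 g x"
  unfolding D1_def vector_derivative_def using has_vector_derivative_cong_half_line[OF assms] by simp

lemma antiderivative_D1_AE:
  assumes "antiderivative g h"
  shows "AE x in half_line. D1 g x = h x"
  using antiderivative_deriv[OF assms] by eventually_elim (rule D1_eqI)

lemma antiderivative_cong_AE:
  assumes g: "antiderivative g h" and ae: "AE x in half_line. h x = k x"
  shows "antiderivative g k"
  unfolding antiderivative_def
proof (intro allI impI)
  fix a b :: real assume ab: "0 < a" "a \<le> b"
  have N: "negligible {x. 0 < x \<and> h x \<noteq> k x}" using ae by (simp add: AE_half_line_iff)
  show "k absolutely_integrable_on {a..b} \<and> (k has_integral g b - g a) {a..b}"
  proof
    have eq: "k x = h x" if "x \<in> {a..b} - {x. 0 < x \<and> h x \<noteq> k x}" for x using that ab by auto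
    show "k absolutely_integrable_on {a..b}"
      by (rule absolutely_integrable_spike[OF antiderivativeD(1)[OF g ab] N eq])
    show "(k has_integral g b - g a) {a..b}"
      by (rule has_integral_spike[OF N eq antiderivativeD(2)[OF g ab]])
  qed
qed

lemma antiderivative_if_ac:
  assumes "\<And>a b. 0 < a \<Longrightarrow> a \<le> b \<Longrightarrow> absolutely_continuous_on {a..b} g"
  shows "antiderivative g (D1 g)"
  unfolding antiderivative_def using ac_fundamental_theorem(2,3) assms by blast

text \<open>The integral of a fixed integrable function over a set is small when the set is small;
  disjoint intervals are summed through the measure \<open>M\<close>.\<close>

lemma antiderivative_ac:
  assumes g: "antiderivative g h" and ab: "0 < a" "a \<le> b"
  shows "absolutely_continuous_on {a..b} g"
  unfolding absolutely_continuous_on_def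
proof (intro allI impI)
  fix e :: real assume "e > 0"
  define k where "k x = indicator {a..b} x *\<^sub>R h x" for x
  have k: "integrable lebesgue k"
    using antiderivativeD(1)[OF g ab] by (simp add: k_def[abs_def] set_integrable_def)
  then have [measurable]: "k \<in> borel_measurable lebesgue" by simp
  obtain d where d: "d > 0"
    "\<And>B. B \<in> sets lebesgue \<Longrightarrow> emeasure lebesgue B < ennreal d \<Longrightarrow> (\<integral>\<^sup>+x\<in>B. norm (k x) \<partial>lebesgue) < ennreal e"
    using integrable_imp_small_on_small_sets[OF k \<open>e > 0\<close>] by metis
  define M where "M = density lebesgue (\<lambda>x. ennreal (norm (k x)))"
  show "\<exists>d>0. \<forall>P. finite P \<longrightarrow> (\<forall>(s, t)\<in>P. s \<le> t \<and> {s..t} \<subseteq> {a..b}) \<longrightarrow>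
        disjoint_family_on (\<lambda>(s, t). {s<..<t}) P \<longrightarrow>
        (\<Sum>(s, t)\<in>P. t - s) < d \<longrightarrow> (\<Sum>(s, t)\<in>P. cmod (g t - g s)) < e"
  proof (intro exI conjI allI impI)
    fix P :: "(real \<times> real) set"
    assume P: "finite P" "\<forall>(s, t)\<in>P. s \<le> t \<and> {s..t} \<subseteq> {a..b}"
      "disjoint_family_on (\<lambda>(s, t). {s<..<t}) P" "(\<Sum>(s, t)\<in>P. t - s) < d"
    define B where "B p = {fst p<..<snd p}" for p :: "real \<times> real"
    have Pin: "fst p \<le> snd p" "a \<le> fst p" "snd p \<le> b" if "p \<in> P" for p
      using P(2) that by (auto simp: case_prod_unfold subset_iff)
    have B_sets: "B p \<in> sets lebesgue" for p by (simp add: B_def)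
    have dj: "disjoint_family_on B P" using P(3) by (simp add: B_def case_prod_unfold disjoint_family_on_def)
    have UB: "(\<Union>p\<in>P. B p) \<in> sets lebesgue" using P(1) B_sets by auto
    have "emeasure lebesgue (\<Union>p\<in>P. B p) = (\<Sum>p\<in>P. emeasure lebesgue (B p))"
      using P(1) dj B_sets by (intro sum_emeasure[symmetric]) auto
    also have "\<dots> = (\<Sum>p\<in>P. ennreal (snd p - fst p))"
      using Pin by (intro sum.cong) (auto simp: B_def)
    also have "\<dots> = ennreal (\<Sum>(s, t)\<in>P. t - s)"
      using Pin by (subst sum_ennreal) (auto simp: case_prod_unfold)
    also have "\<dots> < ennreal d"
      using P(4) d(1) by (intro ennreal_lessI) auto
    finally have "(\<integral>\<^sup>+x\<in>(\<Union>p\<in>P. B p). norm (k x) \<partial>lebesgue) < ennreal e"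
      using d(2)[OF UB] by blast
    then have Me: "emeasure M (\<Union>p\<in>P. B p) < ennreal e"
      using UB by (simp add: M_def emeasure_density)
    have "ennreal (\<Sum>(s, t)\<in>P. cmod (g t - g s)) = (\<Sum>p\<in>P. ennreal (cmod (g (snd p) - g (fst p))))"
      by (subst sum_ennreal) (auto simp: case_prod_unfold)
    also have "\<dots> \<le> (\<Sum>p\<in>P. emeasure M (B p))"
    proof (rule sum_mono)
      fix p assume p: "p \<in> P"
      have kB: "integrable lebesgue (\<lambda>x. indicator (B p) x *\<^sub>R k x)"
        using k B_sets by (intro integrable_mult_indicator)
      have "(k has_integral (LINT x:B p|lebesgue. k x)) {fst p<..<snd p}"
        using has_integral_set_lebesgue[of "B p" k] kB by (simp add: set_integrable_def B_def)
      then have "(k has_integral (LINT x:B p|lebesgue. k x)) {fst p..snd p}"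
        by (simp add: has_integral_Icc_iff_Ioo)
      moreover have "(k has_integral (g (snd p) - g (fst p))) {fst p..snd p}"
        using antiderivativeD(2)[OF g, of "fst p" "snd p"] Pin[OF p] ab
        by (subst has_integral_cong[of _ _ h]) (auto simp: k_def)
      ultimately have "g (snd p) - g (fst p) = (LINT x:B p|lebesgue. k x)"
        by (rule has_integral_unique[symmetric])
      then have "ennreal (cmod (g (snd p) - g (fst p))) \<le> (\<integral>\<^sup>+x. norm (indicator (B p) x *\<^sub>R k x) \<partial>lebesgue)"
        using integral_norm_bound_ennreal[OF kB] by (simp add: set_lebesgue_integral_def)
      also have "\<dots> = emeasure M (B p)"
        unfolding M_def using B_sets
        by (subst emeasure_density) (auto intro!: nn_integral_cong simp: indicator_def)
      finally show "ennreal (cmod (g (snd p) - g (fst p))) \<le> emeasure M (B p)" .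
    qed
    also have "\<dots> = emeasure M (\<Union>p\<in>P. B p)"
      using P(1) dj B_sets by (intro sum_emeasure) (auto simp: M_def)
    finally have "ennreal (\<Sum>(s, t)\<in>P. cmod (g t - g s)) < ennreal e" using Me by simp
    then show "(\<Sum>(s, t)\<in>P. cmod (g t - g s)) < e"
      by (simp add: ennreal_less_iff sum_nonneg case_prod_unfold)
  qed (rule d(1))
qed

lemma antiderivative_continuous_on:
  assumes g: "antiderivative g h"
  shows "continuous_on {0<..} g"
proof -
  have "continuous_on {1 / (real n + 1)<..<real n + 1} g" for n
  proof -
    have "1 / (real n + 1) \<le> real n + 1" by (simp add: field_simps)
    then have "continuous_on {1 / (real n + 1)..real n + 1} g"
      by (intro absolutely_continuous_on_imp_continuous_on antiderivative_ac[OF g]) auto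
    then show ?thesis by (rule continuous_on_subset) auto
  qed
  then show ?thesis unfolding countable_cover_half_line by (intro continuous_on_open_UN) auto
qed

text \<open>Integration by parts for absolutely continuous functions: the product of two bounded
  such functions is one again, and the product rule holds wherever both factors are
  differentiable.\<close>

lemma antiderivative_mult:
  assumes f: "antiderivative f f'" and g: "antiderivative g g'"
  shows "antiderivative (\<lambda>x. f x * g x) (\<lambda>x. f x * g' x + f' x * g x)"
proof -
  have "absolutely_continuous_on {a..b} (\<lambda>x. f x * g x)" if ab: "0 < a" "a \<le> b" for a b
  proof -
    note acf = antiderivative_ac[OF f ab] and acg = antiderivative_ac[OF g ab]
    obtain A where A: "\<And>x. x \<in> {a..b} \<Longrightarrow> cmod (f x) \<le> A"
      using compact_imp_bounded[OF compact_continuous_image[OF absolutely_continuous_on_imp_continuous_on[OF acf]]]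
      unfolding bounded_iff by blast
    obtain B where B: "\<And>x. x \<in> {a..b} \<Longrightarrow> cmod (g x) \<le> B"
      using compact_imp_bounded[OF compact_continuous_image[OF absolutely_continuous_on_imp_continuous_on[OF acg]]]
      unfolding bounded_iff by blast
    define C where "C = \<bar>A\<bar> + \<bar>B\<bar> + 1"
    show ?thesis
    proof (rule absolutely_continuous_onI[OF acf acg, where C = C])
      fix s t :: real assume st: "s \<le> t" "{s..t} \<subseteq> {a..b}"
      then have "cmod (f t) \<le> C" "cmod (g s) \<le> C"
        using A[of t] B[of s] by (auto simp: C_def)
      moreover have "f t * g t - f s * g s = (f t - f s) * g s + f t * (g t - g s)"
        by (simp add: algebra_simps)
      ultimately show "cmod (f t * g t - f s * g s) \<le> C * cmod (f t - f s) + C * cmod (g t - g s)"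
        by (auto simp: norm_mult intro!: order.trans[OF norm_triangle_ineq] add_mono mult_right_mono)
           (simp add: mult.commute mult_right_mono)
    qed (simp add: C_def)
  qed
  then have "antiderivative (\<lambda>x. f x * g x) (D1 (\<lambda>x. f x * g x))"
    by (rule antiderivative_if_ac)
  moreover have "AE x in half_line. D1 (\<lambda>x. f x * g x) x = f x * g' x + f' x * g x"
    using antiderivative_deriv[OF f] antiderivative_deriv[OF g]
    by eventually_elim (intro D1_eqI has_vector_derivative_mult)
  ultimately show ?thesis by (rule antiderivative_cong_AE)
qed

lemma antiderivative_if_C1:
  assumes "\<And>x. x > 0 \<Longrightarrow> (f has_vector_derivative f' x) (at x)" "continuous_on {0<..} f'"
  shows "antiderivative f f'"
  unfolding antiderivative_def
proof (intro allI impI conjI)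
  fix a b :: real assume ab: "0 < a" "a \<le> b"
  show "f' absolutely_integrable_on {a..b}"
    using ab by (intro absolutely_integrable_continuous_real continuous_on_subset[OF assms(2)]) auto
  show "(f' has_integral f b - f a) {a..b}"
  proof (rule fundamental_theorem_of_calculus[OF ab(2)])
    fix x assume "x \<in> {a..b}"
    then show "(f has_vector_derivative f' x) (at x within {a..b})"
      using ab by (intro has_vector_derivative_at_within[OF assms(1)]) auto
  qed
qed

lemma antiderivative_add:
  assumes f: "antiderivative f f'" and g: "antiderivative g g'"
  shows "antiderivative (\<lambda>x. f x + g x) (\<lambda>x. f' x + g' x)"
  unfolding antiderivative_def
proof (intro allI impI conjI)
  fix a b :: real assume ab: "0 < a" "a \<le> b"
  show "(\<lambda>x. f' x + g' x) absolutely_integrable_on {a..b}"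
    using antiderivativeD(1)[OF f ab] antiderivativeD(1)[OF g ab] by (rule set_integral_add(1))
  have "((\<lambda>x. f' x + g' x) has_integral (f b - f a) + (g b - g a)) {a..b}"
    by (intro has_integral_add antiderivativeD(2)[OF f ab] antiderivativeD(2)[OF g ab])
  then show "((\<lambda>x. f' x + g' x) has_integral f b + g b - (f a + g a)) {a..b}"
    by (simp add: algebra_simps)
qed

lemma antiderivative_mult_const:
  assumes f: "antiderivative f f'"
  shows "antiderivative (\<lambda>x. c * f x) (\<lambda>x. c * f' x)"
  unfolding antiderivative_def
proof (intro allI impI conjI)
  fix a b :: real assume ab: "0 < a" "a \<le> b"
  show "(\<lambda>x. c * f' x) absolutely_integrable_on {a..b}"
    using antiderivativeD(1)[OF f ab] by (rule set_integrable_mult_right)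
  show "((\<lambda>x. c * f' x) has_integral c * f b - c * f a) {a..b}"
    using has_integral_mult_right[OF antiderivativeD(2)[OF f ab], of c] by (simp add: algebra_simps)
qed

lemma antiderivative_diff:
  "antiderivative f f' \<Longrightarrow> antiderivative g g' \<Longrightarrow> antiderivative (\<lambda>x. f x - g x) (\<lambda>x. f' x - g' x)"
  using antiderivative_add[OF _ antiderivative_mult_const[of g g' "-1"], of f f'] by simp

lemma antiderivative_cnj:
  assumes "antiderivative f f'"
  shows "antiderivative (\<lambda>x. cnj (f x)) (\<lambda>x. cnj (f' x))"
  unfolding antiderivative_def
proof (intro allI impI conjI)
  fix a b :: real assume ab: "0 < a" "a \<le> b"
  show "(\<lambda>x. cnj (f' x)) absolutely_integrable_on {a..b}"
    using absolutely_integrable_linear[OF antiderivativeD(1)[OF assms ab] bounded_linear_cnj] by (simp add: o_def)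
  show "((\<lambda>x. cnj (f' x)) has_integral cnj (f b) - cnj (f a)) {a..b}"
    using has_integral_linear[OF antiderivativeD(2)[OF assms ab] bounded_linear_cnj] by (simp add: o_def)
qed

lemma antiderivative_exists:
  assumes "\<And>a b. 0 < a \<Longrightarrow> a \<le> b \<Longrightarrow> h absolutely_integrable_on {a..b}"
  shows "\<exists>g. antiderivative g h"
proof
  define g where "g x = (if 1 \<le> x then integral {1..x} h else - integral {x..1} h)" for x
  have io: "h integrable_on {a..b}" if "0 < a" "a \<le> b" for a b
    using assms[OF that] set_lebesgue_integral_eq_integral(1) by blast
  show "antiderivative g h"
    unfolding antiderivative_def
  proof (intro allI impI conjI)
    fix a b :: real assume ab: "0 < a" "a \<le> b"
    show "h absolutely_integrable_on {a..b}" by (rule assms[OF ab])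
    have "integral {a..b} h = g b - g a"
    proof -
      consider "1 \<le> a" | "a < 1" "1 \<le> b" | "b < 1" by linarith
      then show ?thesis
      proof cases
        case 1
        then show ?thesis using ab Henstock_Kurzweil_Integration.integral_combine[of 1 a b h] io[of 1 b] by (cases "a = 1") (auto simp: g_def algebra_simps)
      next
        case 2
        then show ?thesis using ab Henstock_Kurzweil_Integration.integral_combine[of a 1 b h] io[of a b] by (auto simp: g_def algebra_simps)
      next
        case 3
        then show ?thesis using ab Henstock_Kurzweil_Integration.integral_combine[of a b 1 h] io[of a 1] by (auto simp: g_def algebra_simps)
      qed
    qed
    then show "(h has_integral g b - g a) {a..b}"
      using integrable_integral[OF io[OF ab]] by simp
  qed
qed

lemma antiderivative_has_vector_derivative:
  assumes "antiderivative f f'" "continuous_on {0<..} f'" "x > 0"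
  shows "(f has_vector_derivative f' x) (at x)"
proof -
  define a where "a = x / 2"
  have a: "0 < a" "a < x" using assms(3) by (auto simp: a_def)
  have "((\<lambda>u. integral {a..u} f') has_vector_derivative f' x) (at x within {a..x + 1})"
    using a by (intro integral_has_vector_derivative continuous_on_subset[OF assms(2)]) auto
  then have "((\<lambda>u. integral {a..u} f') has_vector_derivative f' x) (at x)"
    using a by (simp add: at_within_Icc_at)
  then have "((\<lambda>u. f a + integral {a..u} f') has_vector_derivative f' x) (at x)"
    using has_vector_derivative_add[OF has_vector_derivative_const] by fastforce
  then show ?thesis
  proof (rule has_vector_derivative_transform_within_open[where S = "{a<..}"])
    fix y assume "y \<in> {a<..}"
    then show "f a + integral {a..y} f' = f y"
      using antiderivativeD(2)[OF assms(1) a(1), of y] by (simp add: integral_unique)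
  qed (use a in auto)
qed

section \<open>Functions of \<open>D_space\<close> as iterated antiderivatives\<close>

lemma D_spaceD:
  assumes "f \<in> D_space"
  shows "\<And>x. x > 0 \<Longrightarrow> (f has_vector_derivative D1 f x) (at x)"
    "continuous_on {0<..} (D1 f)" "antiderivative f (D1 f)" "antiderivative (D1 f) (D1 (D1 f))"
proof -
  obtain D where D: "\<And>x. x > 0 \<Longrightarrow> (f has_vector_derivative D x) (at x)" "continuous_on {0<..} D"
    using assms by (auto simp: D_space_def C1_differentiable_on_def)
  have D1D: "D1 f x = D x" if "x > 0" for x using D1_eqI[OF D(1)[OF that]] .
  show 1: "(f has_vector_derivative D1 f x) (at x)" if "x > 0" for x using D(1) D1D that by simp
  show 2: "continuous_on {0<..} (D1 f)" using D(2) D1D by (subst continuous_on_cong[OF refl, of _ _ D]) auto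
  show "antiderivative f (D1 f)" using 1 2 by (rule antiderivative_if_C1)
  show "antiderivative (D1 f) (D1 (D1 f))"
    using assms by (intro antiderivative_if_ac) (auto simp: D_space_def)
qed

lemma D_spaceI:
  assumes "\<And>x. x > 0 \<Longrightarrow> (f has_vector_derivative f' x) (at x)" "antiderivative f' f''"
  shows "f \<in> D_space" "\<And>x. x > 0 \<Longrightarrow> D1 f x = f' x" "AE x in half_line. D1 (D1 f) x = f'' x"
proof -
  show D1: "D1 f x = f' x" if "x > 0" for x using D1_eqI[OF assms(1)[OF that]] .
  have "antiderivative (D1 f) f''"
    using assms(2) D1 unfolding antiderivative_def by auto
  then show "f \<in> D_space" "AE x in half_line. D1 (D1 f) x = f'' x"
    using assms(1) antiderivative_continuous_on[OF assms(2)] antiderivative_ac antiderivative_D1_AE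
    by (auto simp: D_space_def C1_differentiable_on_def)
qed

section \<open>Limits of antiderivatives at the two ends of the half-line\<close>

lemma antiderivative_tendsto_0:
  assumes W: "antiderivative W k" and k: "k absolutely_integrable_on {0<..b}" and "0 < b"
  shows "(W \<longlongrightarrow> W b - (LINT x:{0<..b}|lebesgue. k x)) (at_right 0)"
proof -
  have "((\<lambda>a. W b - (LINT x:{a..b}|lebesgue. k x)) \<longlongrightarrow> W b - (LINT x:{0<..b}|lebesgue. k x)) (at_right 0)"
    using assms by (intro tendsto_intros tendsto_set_lebesgue_integral_at_right) auto
  moreover have "eventually (\<lambda>a. W b - (LINT x:{a..b}|lebesgue. k x) = W a) (at_right 0)"
    using eventually_at_right_real[OF \<open>0 < b\<close>] by eventually_elim (use antiderivativeD(3)[OF W] in auto)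
  ultimately show ?thesis by (rule Lim_transform_eventually)
qed

lemma antiderivative_tendsto_at_top:
  assumes W: "antiderivative W k" and k: "k absolutely_integrable_on {a..}" and "0 < a"
  shows "(W \<longlongrightarrow> W a + (LINT x:{a..}|lebesgue. k x)) at_top"
proof -
  have ki: "integrable lebesgue (\<lambda>x. indicator {a..} x *\<^sub>R k x)" using k by (simp add: set_integrable_def)
  have "((\<lambda>b. LINT x:{a..b}|lebesgue. k x) \<longlongrightarrow> (LINT x:{a..}|lebesgue. k x)) at_top"
  \<comment> \<open>Dominated convergence is a statement about sequences, along which limits at
    \<open>at_top\<close> can be tested.\<close>
  proof (rule tendsto_at_topI_sequentially)
    fix X :: "nat \<Rightarrow> real" assume X: "filterlim X at_top sequentially"
    have eq: "indicator {a..b} x *\<^sub>R k x = indicator {..b} x *\<^sub>R indicator {a..} x *\<^sub>R k x" for b x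
      by (auto simp: indicator_def)
    have m: "(\<lambda>x. indicator {a..} x *\<^sub>R k x) \<in> borel_measurable lebesgue" using ki by simp
    show "(\<lambda>n. LINT x:{a..X n}|lebesgue. k x) \<longlonglongrightarrow> (LINT x:{a..}|lebesgue. k x)"
      unfolding set_lebesgue_integral_def
    proof (rule integral_dominated_convergence[where w = "\<lambda>x. norm (indicator {a..} x *\<^sub>R k x)"])
      show "AE x in lebesgue. (\<lambda>n. indicator {a..X n} x *\<^sub>R k x) \<longlonglongrightarrow> indicator {a..} x *\<^sub>R k x"
      proof (rule AE_I2)
        fix x
        have "eventually (\<lambda>n. X n \<ge> x) sequentially" using X by (auto simp: filterlim_at_top)
        then have "eventually (\<lambda>n. indicator {a..X n} x *\<^sub>R k x = indicator {a..} x *\<^sub>R k x) sequentially"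
          by eventually_elim (auto simp: indicator_def)
        then show "(\<lambda>n. indicator {a..X n} x *\<^sub>R k x) \<longlonglongrightarrow> indicator {a..} x *\<^sub>R k x"
          by (rule tendsto_eventually)
      qed
      show "(\<lambda>x. indicator {a..X n} x *\<^sub>R k x) \<in> borel_measurable lebesgue" for n
        unfolding eq by (intro borel_measurable_scaleR[OF _ m] borel_measurable_indicator) auto
      show "integrable lebesgue (\<lambda>x. norm (indicator {a..} x *\<^sub>R k x))"
        using ki by (rule integrable_norm)
    qed (use m in \<open>auto simp: indicator_def\<close>)
  qed
  then have "((\<lambda>b. W a + (LINT x:{a..b}|lebesgue. k x)) \<longlongrightarrow> W a + (LINT x:{a..}|lebesgue. k x)) at_top"
    by (intro tendsto_intros)
  moreover have "eventually (\<lambda>b. W a + (LINT x:{a..b}|lebesgue. k x) = W b) at_top"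
    using eventually_ge_at_top[of a] by eventually_elim (use antiderivativeD(3)[OF W \<open>0 < a\<close>] in auto)
  ultimately show ?thesis by (rule Lim_transform_eventually)
qed

lemma integrable_half_line_iff: "integrable half_line k \<longleftrightarrow> k absolutely_integrable_on {0<..}"
  by (simp add: integrable_restrict_space set_integrable_def)

lemma integral_half_line:
  fixes k :: "real \<Rightarrow> complex"
  shows "integral\<^sup>L half_line k = (LINT x:{0<..}|lebesgue. k x)"
  by (simp add: integral_restrict_space set_lebesgue_integral_def)

text \<open>The form in which boundary terms arise: integrability alone makes both limits exist, and
  only their difference is determined, so one of them has to be found by other means.\<close>

lemma antiderivative_integral_half_line:
  assumes W: "antiderivative W k" and k: "integrable half_line k"
  obtains l where "(W \<longlongrightarrow> l) (at_right 0)" "(W \<longlongrightarrow> l + integral\<^sup>L half_line k) at_top"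
proof
  have k': "k absolutely_integrable_on {0<..}" using k by (simp add: integrable_half_line_iff)
  then have k01: "k absolutely_integrable_on {0<..1}" and k1: "k absolutely_integrable_on {1..}"
    by (auto intro: set_integrable_subset)
  show "(W \<longlongrightarrow> W 1 - (LINT x:{0<..1}|lebesgue. k x)) (at_right 0)"
    using W k01 by (intro antiderivative_tendsto_0) auto
  have m: "set_borel_measurable lebesgue {0<..} k" using k' by (auto simp: set_integrable_def set_borel_measurable_def)
  have "(LINT x:{0<..}|lebesgue. k x) = (LINT x:{0<..1} \<union> {1..}|lebesgue. k x)"
    by (rule arg_cong[where f = "\<lambda>S. LINT x:S|lebesgue. k x"]) auto
  also have "\<dots> = (LINT x:{0<..1}|lebesgue. k x) + (LINT x:{1..}|lebesgue. k x)"
  proof (rule set_integral_Un_AE)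
    show "AE x::real in lebesgue. \<not> (x \<in> {0<..1} \<and> x \<in> {1..})"
      using AE_completion[OF AE_lborel_singleton[of "1::real"]] by (rule eventually_mono) auto
  qed (use k01 k1 in auto)
  finally show "(W \<longlongrightarrow> W 1 - (LINT x:{0<..1}|lebesgue. k x) + integral\<^sup>L half_line k) at_top"
    using antiderivative_tendsto_at_top[OF W k1] by (simp add: integral_half_line)
qed

section \<open>Completeness and orthogonal projection\<close>

lemma l2_rel_refl: "square_integrable f \<Longrightarrow> l2_rel f f"
  by (simp add: l2_rel_def)

lemma cinner_l2_class:
  "square_integrable f \<Longrightarrow> square_integrable g \<Longrightarrow>
    cinner_l2 (l2_class f) (l2_class g) = integral\<^sup>L half_line (\<lambda>r. f r * cnj (g r))"
  by (simp add: cinner_l2.abs_eq l2_rel_refl)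

lemma l2_class_add:
  "square_integrable f \<Longrightarrow> square_integrable g \<Longrightarrow> l2_class f + l2_class g = l2_class (\<lambda>r. f r + g r)"
  by (simp add: plus_l2.abs_eq l2_rel_refl)

lemma l2_class_scaleC:
  "square_integrable f \<Longrightarrow> scaleC_l2 c (l2_class f) = l2_class (\<lambda>r. c * f r)"
  by (simp add: scaleC_l2.abs_eq l2_rel_refl)

lemma square_integrable_diff:
  "square_integrable f \<Longrightarrow> square_integrable g \<Longrightarrow> square_integrable (\<lambda>r. f r - g r)"
  using square_integrable_add[of f "\<lambda>r. (-1) * g r"] square_integrable_mult[of g "-1"] by simp

lemma l2_class_diff:
  "square_integrable f \<Longrightarrow> square_integrable g \<Longrightarrow> l2_class f - l2_class g = l2_class (\<lambda>r. f r - g r)"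
  unfolding minus_l2_def uminus_l2_def
  using square_integrable_mult[of g "-1"] by (simp add: l2_class_scaleC l2_class_add)

lemma norm_l2_class:
  assumes "square_integrable f"
  shows "(norm (l2_class f))\<^sup>2 = integral\<^sup>L half_line (\<lambda>r. (cmod (f r))\<^sup>2)"
proof -
  have "(norm (l2_class f))\<^sup>2 = inner (l2_class f) (l2_class f)"
    by (simp add: power2_norm_eq_inner)
  also have "\<dots> = Re (integral\<^sup>L half_line (\<lambda>r. f r * cnj (f r)))"
    using assms by (simp add: inner_l2_def cinner_l2_class)
  also have "(\<lambda>r. f r * cnj (f r)) = (\<lambda>r. of_real ((cmod (f r))\<^sup>2))"
    by (simp only: complex_norm_square)
  finally show ?thesis by (simp only: integral_complex_of_real Re_complex_of_real)
qed

lemma nn_integral_l2_class: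
  assumes "square_integrable f"
  shows "(\<integral>\<^sup>+r. ennreal ((cmod (f r))\<^sup>2) \<partial>half_line) = ennreal ((norm (l2_class f))\<^sup>2)"
  using assms by (subst nn_integral_eq_integral) (auto simp: square_integrable_def norm_l2_class[OF assms])

lemma square_integrable_nn:
  assumes "f \<in> borel_measurable half_line" "(\<integral>\<^sup>+r. ennreal ((cmod (f r))\<^sup>2) \<partial>half_line) \<le> ennreal C" "C \<ge> 0"
  shows "square_integrable f" "norm (l2_class f) \<le> sqrt C"
proof -
  have "integrable half_line (\<lambda>r. (cmod (f r))\<^sup>2)"
    using assms by (intro integrableI_nonneg) (auto intro: le_less_trans)
  then show *: "square_integrable f" using assms(1) by (simp add: square_integrable_def)
  have "(norm (l2_class f))\<^sup>2 \<le> C"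
    using assms nn_integral_l2_class[OF *] by (simp add: ennreal_le_iff)
  then show "norm (l2_class f) \<le> sqrt C" by (rule real_le_rsqrt)
qed

lemma square_integrable_cmod:
  assumes "square_integrable f"
  shows "square_integrable (\<lambda>r. complex_of_real (cmod (f r)))"
    "norm (l2_class (\<lambda>r. complex_of_real (cmod (f r)))) = norm (l2_class f)"
proof -
  show *: "square_integrable (\<lambda>r. complex_of_real (cmod (f r)))"
    using assms by (auto simp: square_integrable_def)
  show "norm (l2_class (\<lambda>r. complex_of_real (cmod (f r)))) = norm (l2_class f)"
    by (rule power2_eq_imp_eq) (use norm_l2_class[OF *] norm_l2_class[OF assms] in simp_all)
qed

text \<open>Riesz-Fischer. The sums \<open>G n\<close> of the absolute differences have norm at most
  2, so by monotone convergence their supremum is finite almost everywhere and the representatives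
  converge pointwise; Fatou's lemma then bounds the distance to the limit.\<close>

lemma rapidly_cauchy_l2_convergent:
  fixes X :: "nat \<Rightarrow> l2"
  assumes X: "\<And>n m. n \<le> m \<Longrightarrow> norm (X m - X n) \<le> (1 / 2) ^ n"
  shows "convergent X"
proof -
  have "\<exists>f. square_integrable f \<and> X n = l2_class f" for n by (metis l2_class_cases)
  then obtain f where f: "\<And>n. square_integrable (f n)" and Xf: "\<And>n. X n = l2_class (f n)" by metis
  have f_meas[measurable]: "f n \<in> borel_measurable half_line" for n using f by (simp add: square_integrable_def)
  \<comment> \<open>The moduli are cast to complex numbers so that they are again representatives of
    elements of \<open>l2\<close> and the triangle inequality applies to their sums.\<close>
  define d where "d k r = complex_of_real (cmod (f (Suc k) r - f k r))" for k r
  have d: "square_integrable (d k)" "norm (l2_class (d k)) \<le> (1 / 2) ^ k" for k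
  proof -
    have sq: "square_integrable (\<lambda>r. f (Suc k) r - f k r)" using f by (intro square_integrable_diff)
    show "square_integrable (d k)" unfolding d_def[abs_def] by (rule square_integrable_cmod(1)[OF sq])
    have "norm (l2_class (d k)) = norm (l2_class (\<lambda>r. f (Suc k) r - f k r))"
      unfolding d_def[abs_def] by (rule square_integrable_cmod(2)[OF sq])
    also have "\<dots> = norm (X (Suc k) - X k)" using f by (simp add: Xf l2_class_diff)
    finally show "norm (l2_class (d k)) \<le> (1 / 2) ^ k" using X[of k "Suc k"] by simp
  qed
  define G where "G n r = (\<Sum>k<n. d k r)" for n r
  have G: "square_integrable (G n) \<and> norm (l2_class (G n)) \<le> (\<Sum>k<n. (1 / 2) ^ k)" for n
  proof (induction n)
    case 0
    have "G 0 = (\<lambda>_. 0)" by (auto simp: G_def)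
    then show ?case using square_integrable_zero by (simp add: zero_l2_def[symmetric])
  next
    case (Suc n)
    have eq: "G (Suc n) = (\<lambda>r. G n r + d n r)" by (auto simp: G_def)
    have "norm (l2_class (G (Suc n))) \<le> norm (l2_class (G n)) + norm (l2_class (d n))"
      unfolding eq using Suc d by (simp add: l2_class_add[symmetric] norm_triangle_ineq)
    then show ?case using Suc d(2)[of n] d(1)[of n] unfolding eq by (auto intro: square_integrable_add)
  qed
  have G2: "(\<integral>\<^sup>+r. ennreal ((cmod (G n r))\<^sup>2) \<partial>half_line) \<le> 4" for n
  proof -
    have "(\<Sum>k<n. (1 / 2 :: real) ^ k) \<le> 2"
      by (subst geometric_sum) auto
    then have "norm (l2_class (G n)) \<le> 2" using G[of n] by linarith
    then have "(norm (l2_class (G n)))\<^sup>2 \<le> 2\<^sup>2" by (intro power_mono) auto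
    then have "ennreal ((norm (l2_class (G n)))\<^sup>2) \<le> ennreal 4" by (intro ennreal_leI) simp
    then show ?thesis using nn_integral_l2_class[of "G n"] G[of n] by simp
  qed
  have G_nonneg: "cmod (G n r) = (\<Sum>k<n. cmod (f (Suc k) r - f k r))" for n r
  proof -
    have "G n r = complex_of_real (\<Sum>k<n. cmod (f (Suc k) r - f k r))" by (simp add: G_def d_def)
    then show ?thesis by (simp only: norm_of_real) (simp add: sum_nonneg)
  qed
  have G_meas: "(\<lambda>r. ennreal ((cmod (G n r))\<^sup>2)) \<in> borel_measurable half_line" for n
    using G[of n] by (auto simp: square_integrable_def)
  have "(\<integral>\<^sup>+r. (SUP n. ennreal ((cmod (G n r))\<^sup>2)) \<partial>half_line) = (SUP n. \<integral>\<^sup>+r. ennreal ((cmod (G n r))\<^sup>2) \<partial>half_line)"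
  proof (rule nn_integral_monotone_convergence_SUP)
    show "incseq (\<lambda>n r. ennreal ((cmod (G n r))\<^sup>2))"
      unfolding G_nonneg by (intro incseq_SucI le_funI ennreal_leI power_mono) (auto intro: sum_nonneg)
  qed (rule G_meas)
  also have "\<dots> \<le> 4" using G2 by (intro SUP_least) auto
  finally have "(\<integral>\<^sup>+r. (SUP n. ennreal ((cmod (G n r))\<^sup>2)) \<partial>half_line) \<noteq> \<infinity>"
    by (auto simp: top_unique)
  then have "AE r in half_line. (SUP n. ennreal ((cmod (G n r))\<^sup>2)) \<noteq> \<infinity>"
    using G_meas by (intro nn_integral_PInf_AE) auto
  then have conv: "AE r in half_line. convergent (\<lambda>n. f n r)"
  proof eventually_elim
    case (elim r)
    then obtain B where B: "(SUP n. ennreal ((cmod (G n r))\<^sup>2)) = ennreal B" "B \<ge> 0"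
      by (cases "SUP n. ennreal ((cmod (G n r))\<^sup>2)") auto
    have "(\<Sum>k<n. cmod (f (Suc k) r - f k r)) \<le> sqrt B" for n
    proof -
      have "ennreal ((cmod (G n r))\<^sup>2) \<le> ennreal B" unfolding B(1)[symmetric] by (rule SUP_upper) auto
      then have "(cmod (G n r))\<^sup>2 \<le> B" using B(2) by simp
      then show ?thesis unfolding G_nonneg by (rule real_le_rsqrt)
    qed
    then have "summable (\<lambda>k. cmod (f (Suc k) r - f k r))"
      by (intro summableI_nonneg_bounded) auto
    then have "summable (\<lambda>k. f (Suc k) r - f k r)" by (rule summable_norm_cancel)
    then have "convergent (\<lambda>n. \<Sum>k<n. f (Suc k) r - f k r)" by (simp add: summable_iff_convergent)
    then have "convergent (\<lambda>n. (f n r - f 0 r) + f 0 r)"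
      by (subst (asm) sum_lessThan_telescope) (intro convergent_add convergent_const)
    then show ?case by simp
  qed
  \<comment> \<open>Where the sequence diverges the value of \<open>lim\<close> is arbitrary; this
    happens only on a null set.\<close>
  define F where "F r = lim (\<lambda>n. f n r)" for r
  have [measurable]: "F \<in> borel_measurable half_line"
    unfolding F_def[abs_def] by (intro borel_measurable_lim_metric f_meas)
  have tail: "(\<integral>\<^sup>+r. ennreal ((cmod (F r - f n r))\<^sup>2) \<partial>half_line) \<le> ennreal (((1 / 2) ^ n)\<^sup>2)" for n
  proof -
    have "(\<integral>\<^sup>+r. ennreal ((cmod (F r - f n r))\<^sup>2) \<partial>half_line) =
        (\<integral>\<^sup>+r. liminf (\<lambda>m. ennreal ((cmod (f m r - f n r))\<^sup>2)) \<partial>half_line)"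
    proof (rule nn_integral_cong_AE, use conv in eventually_elim)
      case (elim r)
      then have "(\<lambda>m. f m r) \<longlonglongrightarrow> F r" by (simp add: F_def convergent_LIMSEQ_iff)
      then have "(\<lambda>m. ennreal ((cmod (f m r - f n r))\<^sup>2)) \<longlonglongrightarrow> ennreal ((cmod (F r - f n r))\<^sup>2)"
        by (intro tendsto_intros)
      then show ?case by (intro lim_imp_Liminf[symmetric]) auto
    qed
    also have "\<dots> \<le> liminf (\<lambda>m. \<integral>\<^sup>+r. ennreal ((cmod (f m r - f n r))\<^sup>2) \<partial>half_line)"
      by (intro nn_integral_liminf) measurable
    also have "\<dots> \<le> ennreal (((1 / 2) ^ n)\<^sup>2)"
    proof (rule Liminf_le)
      show "\<forall>\<^sub>F m in sequentially. (\<integral>\<^sup>+r. ennreal ((cmod (f m r - f n r))\<^sup>2) \<partial>half_line) \<le> ennreal (((1 / 2) ^ n)\<^sup>2)"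
        using eventually_ge_at_top[of n]
      proof eventually_elim
        case (elim m)
        have "(\<integral>\<^sup>+r. ennreal ((cmod (f m r - f n r))\<^sup>2) \<partial>half_line) = ennreal ((norm (X m - X n))\<^sup>2)"
          using f by (subst nn_integral_l2_class) (auto simp: Xf l2_class_diff intro: square_integrable_diff)
        also have "\<dots> \<le> ennreal (((1 / 2) ^ n)\<^sup>2)"
          using X[OF elim] by (intro ennreal_leI power_mono) auto
        finally show ?case .
      qed
    qed simp
    finally show ?thesis .
  qed
  have diff: "square_integrable (\<lambda>r. F r - f n r)" "norm (l2_class (\<lambda>r. F r - f n r)) \<le> (1 / 2) ^ n" for n
    using square_integrable_nn[OF _ tail[of n]] by (auto simp: real_sqrt_abs)
  have F: "square_integrable F"
    using square_integrable_add[OF diff(1)[of 0] f[of 0]] by simp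
  have "X \<longlonglongrightarrow> l2_class F"
  proof (rule LIMSEQ_I)
    fix e :: real assume "e > 0"
    then obtain N where N: "(1 / 2 :: real) ^ N < e" using real_arch_pow_inv[of e "1 / 2"] by auto
    show "\<exists>N. \<forall>n\<ge>N. norm (X n - l2_class F) < e"
    proof (intro exI allI impI)
      fix n assume "n \<ge> N"
      have "norm (X n - l2_class F) = norm (l2_class F - X n)" by (rule norm_minus_commute)
      also have "\<dots> \<le> (1 / 2) ^ n" using diff(2)[of n] F f by (simp add: Xf l2_class_diff)
      also have "\<dots> \<le> (1 / 2) ^ N" using \<open>n \<ge> N\<close> by (intro power_decreasing) auto
      finally show "norm (X n - l2_class F) < e" using N by simp
    qed
  qed
  then show ?thesis by (auto simp: convergent_def)
qed

text \<open>A Cauchy sequence has a subsequence with the geometric rate, and convergence of a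
  subsequence suffices.\<close>

instance l2 :: complete_space
proof
  fix X :: "nat \<Rightarrow> l2" assume X: "Cauchy X"
  have "\<exists>r :: nat \<Rightarrow> nat. \<forall>n. (\<forall>p\<ge>r n. \<forall>q\<ge>r n. norm (X p - X q) \<le> (1 / 2) ^ n) \<and> r n < r (Suc n)"
  proof (rule dependent_nat_choice)
    have *: "\<exists>N. \<forall>p\<ge>N. \<forall>q\<ge>N. norm (X p - X q) \<le> (1 / 2) ^ n" for n
      using CauchyD[OF X, of "(1 / 2) ^ n"] by (auto intro: less_imp_le)
    show "\<exists>x. \<forall>p\<ge>x. \<forall>q\<ge>x. norm (X p - X q) \<le> (1 / 2) ^ 0" by (rule *)
    fix x n :: nat
    obtain N where "\<forall>p\<ge>N. \<forall>q\<ge>N. norm (X p - X q) \<le> (1 / 2) ^ Suc n" using * by blast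
    then show "\<exists>y. (\<forall>p\<ge>y. \<forall>q\<ge>y. norm (X p - X q) \<le> (1 / 2) ^ Suc n) \<and> x < y"
      by (intro exI[of _ "max N (Suc x)"]) auto
  qed
  then obtain r :: "nat \<Rightarrow> nat" where r: "\<And>n p q. p \<ge> r n \<Longrightarrow> q \<ge> r n \<Longrightarrow> norm (X p - X q) \<le> (1 / 2) ^ n"
    and r_mono: "strict_mono r" by (auto simp: strict_mono_Suc_iff)
  have "convergent (X \<circ> r)"
  proof (rule rapidly_cauchy_l2_convergent)
    fix n m :: nat assume "n \<le> m"
    then have "r n \<le> r m" using r_mono by (simp add: strict_mono_less_eq)
    then show "norm ((X \<circ> r) m - (X \<circ> r) n) \<le> (1 / 2) ^ n" using r[of n "r m" "r n"] by simp
  qed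
  then obtain l where "(X \<circ> r) \<longlonglongrightarrow> l" by (auto simp: convergent_def)
  then have "X \<longlonglongrightarrow> l" using Cauchy_converges_subseq[OF X r_mono] by simp
  then show "convergent X" by (auto simp: convergent_def)
qed

text \<open>The midpoint of two near-minimizers lies in \<open>S\<close> and so has distance at
  least \<delta> from \<open>x\<close>; by the parallelogram law this leaves little for their
  difference.\<close>

lemma minimizing_sequence_Cauchy:
  fixes s :: "nat \<Rightarrow> 'a::real_inner"
  assumes S: "subspace S" and s: "\<And>n. s n \<in> S" and lim: "(\<lambda>n. norm (x - s n)) \<longlonglongrightarrow> \<delta>"
    and min: "\<And>y. y \<in> S \<Longrightarrow> \<delta> \<le> norm (x - y)" and "\<delta> \<ge> 0"
  shows "Cauchy s"
proof (rule metric_CauchyI)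
  fix e :: real assume "e > 0"
  have "(\<lambda>n. (norm (x - s n))\<^sup>2) \<longlonglongrightarrow> \<delta>\<^sup>2" by (intro tendsto_intros lim)
  \<comment> \<open>With excess e^2 / 4 for both points the parallelogram law gives exactly
    e^2.\<close>
  then have "eventually (\<lambda>n. (norm (x - s n))\<^sup>2 < \<delta>\<^sup>2 + e\<^sup>2 / 4) sequentially"
    using \<open>e > 0\<close> by (intro order_tendstoD) auto
  then obtain N where N: "\<And>n. n \<ge> N \<Longrightarrow> (norm (x - s n))\<^sup>2 < \<delta>\<^sup>2 + e\<^sup>2 / 4"
    by (auto simp: eventually_sequentially)
  show "\<exists>M. \<forall>m\<ge>M. \<forall>n\<ge>M. dist (s m) (s n) < e"
  proof (intro exI allI impI)
    fix m n assume mn: "m \<ge> N" "n \<ge> N"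
    define u where "u = x - s m"
    define v where "v = x - s n"
    have "(1 / 2) *\<^sub>R (s m + s n) \<in> S" using S s by (simp add: subspace_add subspace_scale)
    then have "\<delta> \<le> norm (x - (1 / 2) *\<^sub>R (s m + s n))" by (rule min)
    also have "x - (1 / 2) *\<^sub>R (s m + s n) = (1 / 2) *\<^sub>R (u + v)"
      by (simp add: u_def v_def algebra_simps) (simp flip: scaleR_add_left)
    finally have "2 * \<delta> \<le> norm (u + v)" by simp
    then have "(2 * \<delta>)\<^sup>2 \<le> (norm (u + v))\<^sup>2" using \<open>\<delta> \<ge> 0\<close> by (intro power_mono) auto
    moreover have "(norm (u + v))\<^sup>2 + (norm (u - v))\<^sup>2 = 2 * (norm u)\<^sup>2 + 2 * (norm v)\<^sup>2"
      by (simp add: power2_norm_eq_inner inner_add inner_diff inner_commute)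
    moreover have "(norm u)\<^sup>2 < \<delta>\<^sup>2 + e\<^sup>2 / 4" "(norm v)\<^sup>2 < \<delta>\<^sup>2 + e\<^sup>2 / 4"
      using N mn by (auto simp: u_def v_def)
    ultimately have "(norm (u - v))\<^sup>2 < e\<^sup>2" by (simp add: power_mult_distrib)
    then have "norm (u - v) < e" using \<open>e > 0\<close> by (simp add: power_less_imp_less_base)
    then show "dist (s m) (s n) < e" by (simp add: u_def v_def dist_norm norm_minus_commute)
  qed
qed

text \<open>The vector is the difference of \<open>x\<close> and its nearest point in
  \<open>S\<close>. The real inner product is used so that the result applies to pairs in
  \<open>l2 \<times> l2\<close> as well; complex orthogonality is recovered later by multiplying
  with the imaginary unit.\<close>

lemma orthogonal_vector_exists:
  fixes S :: "'a::{real_inner, complete_space} set"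
  assumes S: "subspace S" "closed S" and x: "x \<notin> S"
  obtains w where "\<And>y. y \<in> S \<Longrightarrow> inner y w = 0" "inner x w \<noteq> 0"
proof -
  define \<delta> where "\<delta> = (INF y\<in>S. norm (x - y))"
  have ne: "S \<noteq> {}" using S(1) subspace_0 by blast
  have bdd: "bdd_below ((\<lambda>y. norm (x - y)) ` S)" by (auto intro: bdd_belowI[of _ 0])
  have min: "\<delta> \<le> norm (x - y)" if "y \<in> S" for y
    unfolding \<delta>_def using bdd that by (intro cINF_lower) auto
  have "\<delta> \<ge> 0" unfolding \<delta>_def using ne by (intro cINF_greatest) auto
  have "\<exists>y\<in>S. norm (x - y) < \<delta> + inverse (real (Suc n))" for n
  proof -
    have "(INF y\<in>S. norm (x - y)) < \<delta> + inverse (real (Suc n))" unfolding \<delta>_def[symmetric] by simp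
    then show ?thesis using cINF_less_iff[OF ne bdd] by blast
  qed
  then obtain s where s: "\<And>n. s n \<in> S" "\<And>n. norm (x - s n) < \<delta> + inverse (real (Suc n))" by metis
  have lim: "(\<lambda>n. norm (x - s n)) \<longlonglongrightarrow> \<delta>"
  proof (rule tendsto_sandwich[OF _ _ tendsto_const])
    show "(\<lambda>n. \<delta> + inverse (real (Suc n))) \<longlonglongrightarrow> \<delta>"
      using tendsto_add[OF tendsto_const LIMSEQ_inverse_real_of_nat, of \<delta>] by simp
  qed (use s min in \<open>auto intro!: always_eventually less_imp_le\<close>)
  have "Cauchy s" using minimizing_sequence_Cauchy[OF S(1) s(1) lim min \<open>\<delta> \<ge> 0\<close>] .
  then obtain p where p: "s \<longlonglongrightarrow> p" using Cauchy_convergent convergent_def by blast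
  have pS: "p \<in> S" using S(2) s(1) p closed_sequentially by blast
  have np: "norm (x - p) = \<delta>"
    using LIMSEQ_unique[OF lim tendsto_norm[OF tendsto_diff[OF tendsto_const p]]] by simp
  define w where "w = x - p"
  have "w \<noteq> 0" using x pS by (auto simp: w_def)
  have orth: "inner y w = 0" if y: "y \<in> S" for y
  proof (cases "y = 0")
    case False
    \<comment> \<open>The coefficient for which \<open>w - c *\<^sub>R y\<close> is
      shortest.\<close>
    define c where "c = inner y w / inner y y"
    have yy: "inner y y > 0" using False by simp
    have "p + c *\<^sub>R y \<in> S" using S(1) pS y by (simp add: subspace_add subspace_scale)
    then have "norm w \<le> norm (x - (p + c *\<^sub>R y))" using min np by (simp add: w_def)
    also have "x - (p + c *\<^sub>R y) = w - c *\<^sub>R y" by (simp add: w_def)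
    finally have "inner w w \<le> inner (w - c *\<^sub>R y) (w - c *\<^sub>R y)"
      by (simp add: norm_eq_sqrt_inner)
    also have "\<dots> = inner w w - 2 * c * inner y w + c * c * inner y y"
      by (simp add: inner_diff inner_commute algebra_simps)
    also have "\<dots> = inner w w - (inner y w)\<^sup>2 / inner y y"
      using yy by (simp add: c_def field_simps power2_eq_square)
    finally have "(inner y w)\<^sup>2 / inner y y \<le> 0" by simp
    then have "(inner y w)\<^sup>2 \<le> 0" using yy by (simp add: divide_le_0_iff)
    then show ?thesis by simp
  qed simp
  moreover have "inner x w \<noteq> 0"
  proof -
    have "inner x w = inner w w + inner p w" by (simp add: w_def inner_diff_left)
    then show ?thesis using orth[OF pS] \<open>w \<noteq> 0\<close> by simp
  qed
  ultimately show ?thesis using that by blast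
qed

section \<open>Test functions\<close>

text \<open>The flat function \<open>exp (- 1 / x)\<close> times powers of 1 / x, continued by 0.
  The powers are included so that derivatives are linear combinations of members of the family; see
  \<open>flat_exp_derivative\<close>.\<close>

definition flat_exp :: "nat \<Rightarrow> real \<Rightarrow> real" where
  "flat_exp k x = (if x \<le> 0 then 0 else (1 / x) ^ k * exp (- (1 / x)))"

lemma flat_exp_tendsto_0: "(flat_exp k \<longlongrightarrow> 0) (at_right 0)"
proof -
  have "((\<lambda>x. inverse x ^ k / exp (inverse x)) \<longlongrightarrow> (0::real)) (at_right 0)"
    using filterlim_compose[OF tendsto_power_div_exp_0 filterlim_inverse_at_top_right] .
  moreover have "eventually (\<lambda>x. inverse x ^ k / exp (inverse x) = flat_exp k x) (at_right (0::real))"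
    using eventually_at_right_less[of 0]
    by eventually_elim (auto simp: flat_exp_def exp_minus inverse_eq_divide field_simps)
  ultimately show ?thesis by (rule Lim_transform_eventually)
qed

lemma flat_exp_derivative:
  "(flat_exp k has_real_derivative flat_exp (k + 2) x - real k * flat_exp (k + 1) x) (at x)"
proof -
  consider "x < 0" | "x > 0" | "x = 0" by linarith
  then show ?thesis
  proof cases
    case 1
    have "((\<lambda>_. 0) has_real_derivative 0) (at x)" by simp
    then have "(flat_exp k has_real_derivative 0) (at x)"
      by (rule has_field_derivative_transform_within_open[of _ _ _ "{..<0}"]) (use 1 in \<open>auto simp: flat_exp_def\<close>)
    then show ?thesis using 1 by (simp add: flat_exp_def)
  next
    case 2
    have "((\<lambda>x. (1 / x) ^ k * exp (- (1 / x))) has_real_derivative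
        real k * (1 / x) ^ (k - 1) * (- 1 / x ^ 2) * exp (- (1 / x)) + (1 / x) ^ k * (exp (- (1 / x)) * (1 / x ^ 2))) (at x)"
      using 2 by (auto intro!: derivative_eq_intros simp: power2_eq_square)
    also have "real k * (1 / x) ^ (k - 1) * (- 1 / x ^ 2) * exp (- (1 / x)) + (1 / x) ^ k * (exp (- (1 / x)) * (1 / x ^ 2))
        = flat_exp (k + 2) x - real k * flat_exp (k + 1) x"
      using 2 by (cases k) (auto simp: flat_exp_def power2_eq_square field_simps)
    finally have "((\<lambda>x. (1 / x) ^ k * exp (- (1 / x))) has_real_derivative
      flat_exp (k + 2) x - real k * flat_exp (k + 1) x) (at x)" .
    then show ?thesis
      by (rule has_field_derivative_transform_within_open[of _ _ _ "{0<..}"]) (use 2 in \<open>auto simp: flat_exp_def\<close>)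
  next
    case 3
    \<comment> \<open>At 0 the right difference quotient of \<open>flat_exp k\<close> is
      \<open>flat_exp (Suc k)\<close>, which tends to 0.\<close>
    have "((\<lambda>y. (flat_exp k y - flat_exp k 0) / (y - 0)) \<longlongrightarrow> 0) (at 0)"
    proof (rule filterlim_split_at)
      have "eventually (\<lambda>y. 0 = (flat_exp k y - flat_exp k 0) / (y - 0)) (at_left 0)"
        using eventually_at_left_real[of "-1" 0] by (simp add: eventually_mono flat_exp_def)
      then show "((\<lambda>y. (flat_exp k y - flat_exp k 0) / (y - 0)) \<longlongrightarrow> 0) (at_left 0)"
        by (rule Lim_transform_eventually[OF tendsto_const])
      have "eventually (\<lambda>y. flat_exp (Suc k) y = (flat_exp k y - flat_exp k 0) / (y - 0)) (at_right 0)"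
        using eventually_at_right_less[of 0] by eventually_elim (auto simp: flat_exp_def)
      then show "((\<lambda>y. (flat_exp k y - flat_exp k 0) / (y - 0)) \<longlongrightarrow> 0) (at_right 0)"
        by (rule Lim_transform_eventually[OF flat_exp_tendsto_0])
    qed
    then have "(flat_exp k has_real_derivative 0) (at 0)" by (simp add: has_field_derivative_iff)
    then show ?thesis using 3 by (simp add: flat_exp_def)
  qed
qed

text \<open>An algebra closed under differentiation, so that smoothness of its members needs no
  formula for higher derivatives. Affine arguments allow flat ends on the left and on the
  right.\<close>

inductive_set smooth_algebra :: "(real \<Rightarrow> complex) set" where
  base: "(\<lambda>x. of_real (flat_exp k (p * x + q))) \<in> smooth_algebra"
| const: "(\<lambda>_. c) \<in> smooth_algebra"
| add: "f \<in> smooth_algebra \<Longrightarrow> g \<in> smooth_algebra \<Longrightarrow> (\<lambda>x. f x + g x) \<in> smooth_algebra"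
| mult: "f \<in> smooth_algebra \<Longrightarrow> g \<in> smooth_algebra \<Longrightarrow> (\<lambda>x. f x * g x) \<in> smooth_algebra"

lemma smooth_algebra_derivative:
  assumes "f \<in> smooth_algebra"
  shows "\<exists>g\<in>smooth_algebra. \<forall>x. (f has_vector_derivative g x) (at x)"
  using assms
proof induction
  case (base k p q)
  define g where "g x = complex_of_real p * (complex_of_real (flat_exp (k + 2) (p * x + q)) +
      (- of_nat k) * complex_of_real (flat_exp (k + 1) (p * x + q)))" for x
  have "g \<in> smooth_algebra" unfolding g_def[abs_def]
    by (intro smooth_algebra.intros)
  moreover have "((\<lambda>x. complex_of_real (flat_exp k (p * x + q))) has_vector_derivative g x) (at x)" for x
  proof -
    have "((\<lambda>x. flat_exp k (p * x + q)) has_real_derivative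
        (flat_exp (k + 2) (p * x + q) - real k * flat_exp (k + 1) (p * x + q)) * p) (at x)"
      by (rule DERIV_chain2[OF flat_exp_derivative]) (auto intro!: derivative_eq_intros)
    have "((\<lambda>x. complex_of_real (flat_exp k (p * x + q))) has_vector_derivative
        of_real ((flat_exp (k + 2) (p * x + q) - real k * flat_exp (k + 1) (p * x + q)) * p)) (at x)"
      by (rule has_vector_derivative_of_real) fact
    then show ?thesis
      by (rule has_vector_derivative_eq_rhs) (simp add: g_def algebra_simps)
  qed
  ultimately show ?case by blast
next
  case (const c)
  show ?case by (rule bexI[of _ "\<lambda>_. 0"]) (auto intro: smooth_algebra.const)
next
  case (add f g)
  then obtain f' g' where "f' \<in> smooth_algebra" "g' \<in> smooth_algebra"
    "\<And>x. (f has_vector_derivative f' x) (at x)" "\<And>x. (g has_vector_derivative g' x) (at x)" by blast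
  then show ?case
    by (intro bexI[of _ "\<lambda>x. f' x + g' x"] allI has_vector_derivative_add smooth_algebra.add) auto
next
  case (mult f g)
  then obtain f' g' where "f' \<in> smooth_algebra" "g' \<in> smooth_algebra"
    "\<And>x. (f has_vector_derivative f' x) (at x)" "\<And>x. (g has_vector_derivative g' x) (at x)" by blast
  with mult show ?case
    by (intro bexI[of _ "\<lambda>x. f x * g' x + f' x * g x"] allI has_vector_derivative_mult smooth_algebra.intros) auto
qed

section \<open>Smoothness and compact support on the half-line\<close>

definition smooth_half_line :: "(real \<Rightarrow> complex) \<Rightarrow> bool" where
  "smooth_half_line f \<longleftrightarrow> (\<forall>n. \<forall>r>0. (D1 ^^ n) f differentiable (at r))"

lemma has_vector_derivative_D1: "f differentiable (at x) \<Longrightarrow> (f has_vector_derivative D1 f x) (at x)"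
  unfolding D1_def by (simp add: vector_derivative_works)

text \<open>A class closed under differentiation consists of smooth functions. Iterates of
  \<open>D1\<close> agree with members of \<open>F\<close> only at positive arguments, which is
  enough because a derivative there is determined locally.\<close>

lemma smooth_half_lineI:
  assumes "f \<in> F" and F: "\<And>f. f \<in> F \<Longrightarrow> \<exists>g\<in>F. \<forall>x>0. (f has_vector_derivative g x) (at x)"
  shows "smooth_half_line f"
proof -
  have "\<exists>g\<in>F. \<forall>x>0. (D1 ^^ n) f x = g x" for n
  proof (induction n)
    case (Suc n)
    then obtain g where g: "g \<in> F" "\<And>x. x > 0 \<Longrightarrow> (D1 ^^ n) f x = g x" by blast
    obtain g' where g': "g' \<in> F" "\<And>x. x > 0 \<Longrightarrow> (g has_vector_derivative g' x) (at x)" using F[OF g(1)] by blast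
    have "(D1 ^^ Suc n) f x = g' x" if "x > 0" for x
      using D1_cong_half_line[OF g(2) that] D1_eqI[OF g'(2)[OF that]] by simp
    then show ?case using g'(1) by blast
  qed (use assms(1) in auto)
  then show ?thesis unfolding smooth_half_line_def
  proof (intro allI impI)
    fix n and r :: real assume "r > 0"
    obtain g where g: "g \<in> F" "\<And>x. x > 0 \<Longrightarrow> (D1 ^^ n) f x = g x"
      using \<open>\<And>n. \<exists>g\<in>F. \<forall>x>0. (D1 ^^ n) f x = g x\<close> by blast
    obtain g' where "(g has_vector_derivative g' r) (at r)" using F[OF g(1)] \<open>r > 0\<close> by blast
    then have "((D1 ^^ n) f has_vector_derivative g' r) (at r)"
      using has_vector_derivative_cong_half_line[OF g(2) \<open>r > 0\<close>] by simp
    then show "(D1 ^^ n) f differentiable (at r)" by (rule differentiableI_vector)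
  qed
qed

lemma smooth_half_line_deriv:
  assumes "smooth_half_line f"
  shows "\<And>x. x > 0 \<Longrightarrow> (f has_vector_derivative D1 f x) (at x)" "smooth_half_line (D1 f)"
proof -
  show "(f has_vector_derivative D1 f x) (at x)" if "x > 0" for x
    using assms that has_vector_derivative_D1[of "(D1 ^^ 0) f" x] unfolding smooth_half_line_def by fastforce
  show "smooth_half_line (D1 f)"
    unfolding smooth_half_line_def
  proof
    fix n
    show "\<forall>r>0. (D1 ^^ n) (D1 f) differentiable at r"
      using assms[unfolded smooth_half_line_def, rule_format, of _ "Suc n"] by (simp add: funpow_swap1)
  qed
qed

lemma smooth_half_line_antiderivative:
  assumes "\<And>x. x > 0 \<Longrightarrow> (f has_vector_derivative g x) (at x)" "smooth_half_line g"
  shows "smooth_half_line f"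
proof (rule smooth_half_lineI[of _ "insert f (Collect smooth_half_line)"])
  fix h assume "h \<in> insert f (Collect smooth_half_line)"
  then show "\<exists>g\<in>insert f (Collect smooth_half_line). \<forall>x>0. (h has_vector_derivative g x) (at x)"
    using assms smooth_half_line_deriv by blast
qed simp

lemma smooth_half_line_lincomb:
  assumes "smooth_half_line f" "smooth_half_line g"
  shows "smooth_half_line (\<lambda>x. f x + c * g x)"
proof (rule smooth_half_lineI[of _ "{\<lambda>x. f x + c * g x | f g. smooth_half_line f \<and> smooth_half_line g}"])
  fix h assume "h \<in> {\<lambda>x. f x + c * g x | f g. smooth_half_line f \<and> smooth_half_line g}"
  then obtain f g where fg: "smooth_half_line f" "smooth_half_line g" and h: "h = (\<lambda>x. f x + c * g x)" by blast
  have "(h has_vector_derivative D1 f x + c * D1 g x) (at x)" if "x > 0" for x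
    unfolding h using smooth_half_line_deriv(1)[OF fg(1) that] smooth_half_line_deriv(1)[OF fg(2) that]
    by (intro has_vector_derivative_add has_vector_derivative_mult_right)
  then show "\<exists>k\<in>{\<lambda>x. f x + c * g x | f g. smooth_half_line f \<and> smooth_half_line g}.
      \<forall>x>0. (h has_vector_derivative k x) (at x)"
    using smooth_half_line_deriv(2)[OF fg(1)] smooth_half_line_deriv(2)[OF fg(2)]
    by (intro bexI[of _ "\<lambda>x. D1 f x + c * D1 g x"]) auto
qed (use assms in blast)

lemma smooth_algebra_smooth: "f \<in> smooth_algebra \<Longrightarrow> smooth_half_line f"
  using smooth_half_lineI[of f smooth_algebra] smooth_algebra_derivative by blast

lemma C0_inftyI:
  assumes "smooth_half_line f" "0 < a" "\<And>r. r > 0 \<Longrightarrow> r < a \<or> b < r \<Longrightarrow> f r = 0"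
  shows "f \<in> C0_infty"
  using assms unfolding C0_infty_def smooth_half_line_def
  by (auto intro!: exI[of _ "{a..b}"] simp: not_le)

lemma C0_inftyD:
  assumes "f \<in> C0_infty"
  obtains a b where "0 < a" "a < b" "\<And>r. r > 0 \<Longrightarrow> r \<le> a \<or> b \<le> r \<Longrightarrow> f r = 0"
proof -
  obtain K where K: "compact K" "K \<subseteq> {0<..}" "\<forall>r>0. r \<notin> K \<longrightarrow> f r = 0"
    using assms by (auto simp: C0_infty_def)
  show thesis
  proof (cases "K = {}")
    case True
    then show thesis using K that[of 1 2] by auto
  next
    case False
    obtain m where m: "m \<in> K" "\<And>t. t \<in> K \<Longrightarrow> m \<le> t" using compact_attains_inf[OF K(1) False] by blast
    obtain M where M: "M \<in> K" "\<And>t. t \<in> K \<Longrightarrow> t \<le> M" using compact_attains_sup[OF K(1) False] by blast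
    have "m > 0" using m(1) K(2) by auto
    show thesis
    \<comment> \<open>The support lies between m and M; the margins on both sides make the function
      vanish at the endpoints of the new interval too.\<close>
    proof (rule that[of "m / 2" "M + 1"])
      show "m / 2 < M + 1" using \<open>m > 0\<close> m(2)[OF M(1)] by linarith
      fix r :: real assume r: "r > 0" "r \<le> m / 2 \<or> M + 1 \<le> r"
      then have "r \<notin> K" using m(2)[of r] M(2)[of r] \<open>m > 0\<close> by force
      then show "f r = 0" using K(3) r(1) by blast
    qed (use \<open>m > 0\<close> in simp)
  qed
qed

lemma C0_infty_smooth: "f \<in> C0_infty \<Longrightarrow> smooth_half_line f"
  by (simp add: C0_infty_def smooth_half_line_def)

lemma C0_infty_derivative:
  assumes "f \<in> C0_infty"
  shows "D1 f \<in> C0_infty" "\<And>x. x > 0 \<Longrightarrow> (f has_vector_derivative D1 f x) (at x)"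
    "continuous_on {0<..} f" "antiderivative f (D1 f)"
proof -
  have deriv: "(g has_vector_derivative D1 g x) (at x)" if "g \<in> C0_infty" "x > 0" for g x
    using smooth_half_line_deriv(1)[OF C0_infty_smooth] that by blast
  have cont: "continuous_on {0<..} g" if "g \<in> C0_infty" for g
    using deriv[OF that] by (intro continuous_at_imp_continuous_on) (auto intro: has_vector_derivative_continuous)
  show "(f has_vector_derivative D1 f x) (at x)" if "x > 0" for x using deriv[OF assms that] .
  show "continuous_on {0<..} f" using cont[OF assms] .
  show D: "D1 f \<in> C0_infty"
  proof -
    obtain a b where ab: "0 < a" "a < b" "\<And>r. r > 0 \<Longrightarrow> r \<le> a \<or> b \<le> r \<Longrightarrow> f r = 0"
      using C0_inftyD[OF assms] by blast
    show ?thesis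
    proof (rule C0_inftyI[OF smooth_half_line_deriv(2)[OF C0_infty_smooth[OF assms]] ab(1)])
      fix r :: real assume r: "r > 0" "r < a \<or> b < r"
      define S where "S = (if r < a then {0<..<a} else {b<..})"
      have "((\<lambda>_. 0::complex) has_vector_derivative 0) (at r)" by simp
      then have "(f has_vector_derivative 0) (at r)"
        by (rule has_vector_derivative_transform_within_open[of _ _ _ S])
           (use r ab in \<open>auto simp: S_def split: if_splits\<close>)
      then show "D1 f r = 0" by (rule D1_eqI)
    qed
  qed
  show "antiderivative f (D1 f)"
    by (rule antiderivative_if_C1[OF deriv[OF assms] cont[OF D]])
qed

text \<open>The factors \<open>exp (-1 / (n (x - a)))\<close> and \<open>exp (-1 / (n (b - x)))\<close> are at most 1 and tend to 1
  as \<open>n\<close> grows.\<close>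

definition bump :: "real \<Rightarrow> real \<Rightarrow> nat \<Rightarrow> real \<Rightarrow> complex" where
  "bump a b n x = of_real (flat_exp 0 (real n * x + (- real n * a))) * of_real (flat_exp 0 ((- real n) * x + real n * b))"

lemma bump_C0_infty:
  assumes "0 < a"
  shows "bump a b n \<in> C0_infty"
proof (rule C0_inftyI[OF _ assms])
  have "bump a b n \<in> smooth_algebra"
    unfolding bump_def[abs_def] by (intro smooth_algebra.mult smooth_algebra.base)
  then show "smooth_half_line (bump a b n)" by (rule smooth_algebra_smooth)
  fix r assume "r < a \<or> b < r"
  then have "real n * r \<le> real n * a \<or> real n * b \<le> real n * r" by (auto intro: mult_left_mono)
  then show "bump a b n r = 0" by (auto simp: bump_def flat_exp_def)
qed

lemma flat_exp_0_bounds: "0 \<le> flat_exp 0 x" "flat_exp 0 x \<le> 1"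
  by (auto simp: flat_exp_def)

lemma cmod_bump_le: "cmod (bump a b n x) \<le> indicator {a..b} x"
proof (cases "x \<in> {a..b}")
  case True
  then show ?thesis using flat_exp_0_bounds by (auto simp: bump_def norm_mult abs_of_nonneg intro!: mult_le_one)
next
  case False
  then have "real n * x \<le> real n * a \<or> real n * b \<le> real n * x" by (auto intro: mult_left_mono)
  then show ?thesis using False by (auto simp: bump_def flat_exp_def)
qed

lemma flat_exp_0_tendsto: "s > 0 \<Longrightarrow> (\<lambda>n. flat_exp 0 (real n * s)) \<longlonglongrightarrow> 1"
proof -
  assume s: "s > 0"
  have "(\<lambda>n. exp (- (1 / s) * inverse (real n))) \<longlonglongrightarrow> exp (- (1 / s) * 0)"
    by (intro tendsto_intros lim_inverse_n)
  moreover have "eventually (\<lambda>n. exp (- (1 / s) * inverse (real n)) = flat_exp 0 (real n * s)) sequentially"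
    using eventually_gt_at_top[of "0::nat"] 
    by eventually_elim (use s in \<open>auto simp: flat_exp_def field_simps mult_le_0_iff\<close>)
  ultimately show ?thesis using Lim_transform_eventually by fastforce
qed

lemma bump_tendsto: "(\<lambda>n. bump a b n x) \<longlonglongrightarrow> indicator {a<..<b} x"
proof (cases "x \<in> {a<..<b}")
  case True
  have "(\<lambda>n. of_real (flat_exp 0 (real n * (x - a))) * of_real (flat_exp 0 (real n * (b - x)))) \<longlonglongrightarrow> complex_of_real 1 * of_real 1"
    using True by (intro tendsto_intros flat_exp_0_tendsto) auto
  then show ?thesis using True by (simp add: bump_def algebra_simps)
next
  case False
  then have "x \<le> a \<or> b \<le> x" by auto
  then have "real n * x \<le> real n * a \<or> real n * b \<le> real n * x" for n by (auto intro: mult_left_mono)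
  then have "bump a b n x = 0" for n by (auto simp: bump_def flat_exp_def)
  then show ?thesis using False by simp
qed

section \<open>Weak derivatives\<close>

definition locally_integrable :: "(real \<Rightarrow> complex) \<Rightarrow> bool" where
  "locally_integrable w \<longleftrightarrow> (\<forall>a b. 0 < a \<longrightarrow> a \<le> b \<longrightarrow> w absolutely_integrable_on {a..b})"

lemma borel_measurable_half_line_cong_AE:
  fixes f g :: "real \<Rightarrow> complex"
  assumes "f \<in> borel_measurable half_line" "AE x in half_line. f x = g x"
  shows "g \<in> borel_measurable half_line"
proof -
  have S: "{0<..} \<in> sets (lebesgue :: real measure)" by simp
  have N: "negligible {x. 0 < x \<and> f x \<noteq> g x}" using assms(2) by (simp add: AE_half_line_iff)
  have "f measurable_on {0<..}" using assms(1) by (simp add: measurable_on_iff_borel_measurable)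
  then have "g measurable_on {0<..}"
    by (rule measurable_on_spike[OF _ N]) auto
  then show ?thesis by (simp add: measurable_on_iff_borel_measurable)
qed

lemma square_integrable_cong_AE:
  assumes "square_integrable f" "AE x in half_line. f x = g x"
  shows "square_integrable g"
proof -
  have [measurable]: "f \<in> borel_measurable half_line" using assms(1) by (simp add: square_integrable_def)
  have [measurable]: "g \<in> borel_measurable half_line" by (rule borel_measurable_half_line_cong_AE[OF _ assms(2)]) fact
  have "integrable half_line (\<lambda>r. (cmod (g r))\<^sup>2)"
  proof (rule integrable_cong_AE_imp)
    show "integrable half_line (\<lambda>r. (cmod (f r))\<^sup>2)" using assms(1) by (simp add: square_integrable_def)
    show "AE r in half_line. (cmod (f r))\<^sup>2 = (cmod (g r))\<^sup>2" using assms(2) by eventually_elim simp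
  qed measurable
  then show ?thesis by (simp add: square_integrable_def)
qed

lemma integrable_half_line_compact_support:
  fixes k :: "real \<Rightarrow> complex"
  assumes "0 < a" "k absolutely_integrable_on {a..b}" "\<And>r. r > 0 \<Longrightarrow> r < a \<or> b < r \<Longrightarrow> k r = 0"
  shows "integrable half_line k" "integral\<^sup>L half_line k = (LINT x:{a..b}|lebesgue. k x)"
proof -
  have eq: "(\<lambda>x. indicator {0<..} x *\<^sub>R k x) = (\<lambda>x. indicator {a..b} x *\<^sub>R k x)"
  proof
    fix x show "indicator {0<..} x *\<^sub>R k x = indicator {a..b} x *\<^sub>R k x"
      using assms(1) assms(3)[of x] by (cases "x \<in> {a..b}"; cases "x > 0") auto
  qed
  show "integrable half_line k"
    using assms(2) by (simp add: integrable_half_line_iff set_integrable_def eq)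
  show "integral\<^sup>L half_line k = (LINT x:{a..b}|lebesgue. k x)"
    by (simp only: integral_half_line set_lebesgue_integral_def eq)
qed

lemma absolutely_integrable_continuous_mult:
  fixes f w :: "real \<Rightarrow> complex"
  assumes "continuous_on {a..b} f" "w absolutely_integrable_on {a..b}"
  shows "(\<lambda>x. f x * w x) absolutely_integrable_on {a..b}"
proof (rule absolutely_integrable_bounded_measurable_product[OF bilinear_times _ _ _ assms(2)])
  show "f \<in> borel_measurable (lebesgue_on {a..b})"
    using assms(1) by (rule continuous_imp_measurable_on_sets_lebesgue) auto
  show "bounded (f ` {a..b})"
    using assms(1) by (intro compact_imp_bounded compact_continuous_image) auto
qed auto

lemma locally_integrable_continuous_mult:
  assumes "continuous_on {0<..} f" "locally_integrable w"
  shows "locally_integrable (\<lambda>x. f x * w x)"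
  unfolding locally_integrable_def
proof (intro allI impI)
  fix a b :: real assume "0 < a" "a \<le> b"
  then show "(\<lambda>x. f x * w x) absolutely_integrable_on {a..b}"
    using assms by (intro absolutely_integrable_continuous_mult continuous_on_subset[OF assms(1)])
      (auto simp: locally_integrable_def)
qed

lemma locally_integrable_add:
  "locally_integrable f \<Longrightarrow> locally_integrable g \<Longrightarrow> locally_integrable (\<lambda>x. f x + g x)"
  unfolding locally_integrable_def by (auto intro: set_integral_add(1))

lemma locally_integrable_diff:
  "locally_integrable f \<Longrightarrow> locally_integrable g \<Longrightarrow> locally_integrable (\<lambda>x. f x - g x)"
  unfolding locally_integrable_def by (auto intro: set_integral_diff(1))

lemma locally_integrable_cnj: "locally_integrable f \<Longrightarrow> locally_integrable (\<lambda>x. cnj (f x))"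
  unfolding locally_integrable_def
  using absolutely_integrable_linear[OF _ bounded_linear_cnj] by (auto simp: o_def)

lemma continuous_imp_locally_integrable: "continuous_on {0<..} f \<Longrightarrow> locally_integrable f"
  unfolding locally_integrable_def
  by (auto intro!: absolutely_integrable_continuous_real intro: continuous_on_subset)

lemma antiderivative_locally_integrable: "antiderivative g h \<Longrightarrow> locally_integrable h"
  by (auto simp: antiderivative_def locally_integrable_def)

lemma square_integrable_imp_locally_integrable:
  assumes "square_integrable u"
  shows "locally_integrable u"
  unfolding locally_integrable_def
proof (intro allI impI)
  fix a b :: real assume ab: "0 < a" "a \<le> b"
  have u2: "(\<lambda>r. (cmod (u r))\<^sup>2) absolutely_integrable_on {a..b}"
  proof (rule set_integrable_subset)
    show "(\<lambda>r. (cmod (u r))\<^sup>2) absolutely_integrable_on {0<..}"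
      using assms by (simp add: square_integrable_def integrable_restrict_space set_integrable_def)
  qed (use ab in auto)
  have m: "u \<in> borel_measurable (lebesgue_on {a..b})"
  proof (rule measurable_restrict_mono)
    show "u \<in> borel_measurable half_line" using assms by (simp add: square_integrable_def)
  qed (use ab in auto)
  show "u absolutely_integrable_on {a..b}"
  proof (rule measurable_bounded_by_integrable_imp_absolutely_integrable[OF m])
    show "(\<lambda>r. 1 + (cmod (u r))\<^sup>2) integrable_on {a..b}"
      using u2 by (intro integrable_add) (auto simp: absolutely_integrable_on_def)
    fix x
    \<comment> \<open>Gives that \<open>cmod (u x)\<close> is at most its square plus 1 / 4, so on a
      bounded interval a square-integrable function is dominated by an integrable one.\<close>
    have "0 \<le> (cmod (u x) - 1 / 2)\<^sup>2" by simp
    then show "norm (u x) \<le> 1 + (cmod (u x))\<^sup>2" by (simp add: power2_eq_square algebra_simps)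
  qed auto
qed

lemma C0_infty_mult_integrable:
  assumes "\<phi> \<in> C0_infty" "locally_integrable w"
  shows "integrable half_line (\<lambda>x. \<phi> x * w x)"
proof -
  obtain a b where ab: "0 < a" "a < b" "\<And>r. r > 0 \<Longrightarrow> r \<le> a \<or> b \<le> r \<Longrightarrow> \<phi> r = 0"
    using C0_inftyD[OF assms(1)] by blast
  have "locally_integrable (\<lambda>x. \<phi> x * w x)"
    using assms C0_infty_derivative(3) by (intro locally_integrable_continuous_mult)
  then show ?thesis
    using ab by (intro integrable_half_line_compact_support(1)[where a = a and b = b]) (auto simp: locally_integrable_def)
qed

text \<open>The product of test function and antiderivative vanishes near both ends, so the integral
  of its derivative is 0.\<close>

lemma C0_infty_by_parts:
  assumes phi: "\<phi> \<in> C0_infty" and G: "antiderivative G h"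
  shows "integral\<^sup>L half_line (\<lambda>x. D1 \<phi> x * G x) = - integral\<^sup>L half_line (\<lambda>x. \<phi> x * h x)"
proof -
  define W where "W x = \<phi> x * G x" for x
  have W: "antiderivative W (\<lambda>x. \<phi> x * h x + D1 \<phi> x * G x)"
    unfolding W_def[abs_def] by (rule antiderivative_mult[OF C0_infty_derivative(4)[OF phi] G])
  have i1: "integrable half_line (\<lambda>x. \<phi> x * h x)"
    using phi antiderivative_locally_integrable[OF G] by (rule C0_infty_mult_integrable)
  have i2: "integrable half_line (\<lambda>x. D1 \<phi> x * G x)"
    using C0_infty_derivative(1)[OF phi] continuous_imp_locally_integrable[OF antiderivative_continuous_on[OF G]]
    by (rule C0_infty_mult_integrable)
  obtain l where l: "(W \<longlongrightarrow> l) (at_right 0)"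
    "(W \<longlongrightarrow> l + integral\<^sup>L half_line (\<lambda>x. \<phi> x * h x + D1 \<phi> x * G x)) at_top"
    using antiderivative_integral_half_line[OF W Bochner_Integration.integrable_add[OF i1 i2]] by blast
  obtain a b where ab: "0 < a" "a < b" "\<And>r. r > 0 \<Longrightarrow> r \<le> a \<or> b \<le> r \<Longrightarrow> \<phi> r = 0"
    using C0_inftyD[OF phi] by blast
  have "eventually (\<lambda>r. 0 = W r) (at_right 0)"
    using eventually_at_right_real[OF ab(1)] by eventually_elim (use ab in \<open>auto simp: W_def\<close>)
  then have "(W \<longlongrightarrow> 0) (at_right 0)" by (rule Lim_transform_eventually[OF tendsto_const])
  then have "l = 0" using tendsto_unique[OF _ l(1)] by simp
  have "eventually (\<lambda>r. 0 = W r) at_top"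
    using eventually_ge_at_top[of b] by eventually_elim (use ab in \<open>auto simp: W_def\<close>)
  then have "(W \<longlongrightarrow> 0) at_top" by (rule Lim_transform_eventually[OF tendsto_const])
  then have "integral\<^sup>L half_line (\<lambda>x. \<phi> x * h x + D1 \<phi> x * G x) = 0"
    using tendsto_unique[OF _ l(2)] \<open>l = 0\<close> by simp
  then show ?thesis using i1 i2 by (simp add: eq_neg_iff_add_eq_0 add.commute)
qed

text \<open>The bumps tend boundedly to the indicator of an interval, so \<open>w\<close> integrates
  to 0 over every compact interval. Then the zero function is an antiderivative of \<open>w\<close>,
  and antiderivatives have their density as derivative almost everywhere.\<close>

lemma fundamental_lemma_variations:
  assumes w: "locally_integrable w" and zero: "\<And>\<phi>. \<phi> \<in> C0_infty \<Longrightarrow> integral\<^sup>L half_line (\<lambda>x. \<phi> x * w x) = 0"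
  shows "AE x in half_line. w x = 0"
proof -
  have "antiderivative (\<lambda>_. 0) w"
    unfolding antiderivative_def
  proof (intro allI impI conjI)
    fix a b :: real assume ab: "0 < a" "a \<le> b"
    show wi: "w absolutely_integrable_on {a..b}" using w ab by (simp add: locally_integrable_def)
    then have wi': "integrable lebesgue (\<lambda>x. indicator {a..b} x *\<^sub>R w x)" by (simp add: set_integrable_def)
    then have m: "(\<lambda>x. indicator {a..b} x *\<^sub>R w x) \<in> borel_measurable lebesgue" by simp
    have eq: "indicator {a..b} x *\<^sub>R (bump a b n x * w x) = bump a b n x * (indicator {a..b} x *\<^sub>R w x)" for n x
      by (simp add: scaleR_conv_of_real)
    have bm: "bump a b n \<in> borel_measurable lebesgue" for n
    proof -
      have "continuous_on UNIV (flat_exp 0)"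
        using DERIV_isCont[OF flat_exp_derivative] by (intro continuous_at_imp_continuous_on) simp
      then have "continuous_on UNIV (bump a b n)" unfolding bump_def[abs_def]
        by (intro continuous_on_mult continuous_on_of_real
            continuous_on_compose2[OF \<open>continuous_on UNIV (flat_exp 0)\<close>] continuous_on_add continuous_on_const continuous_on_id)
          auto
      then show ?thesis
        using continuous_imp_measurable_on_sets_lebesgue[of UNIV "bump a b n"] by simp
    qed
    have "(\<lambda>n. LINT x|lebesgue. bump a b n x * (indicator {a..b} x *\<^sub>R w x)) \<longlonglongrightarrow>
        (LINT x|lebesgue. indicator {a<..<b} x * (indicator {a..b} x *\<^sub>R w x))"
    proof (rule integral_dominated_convergence[where w = "\<lambda>x. norm (indicator {a..b} x *\<^sub>R w x)"])
      show "integrable lebesgue (\<lambda>x. norm (indicator {a..b} x *\<^sub>R w x))" using wi' by (rule integrable_norm)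
      show "AE x in lebesgue. (\<lambda>n. bump a b n x * (indicator {a..b} x *\<^sub>R w x)) \<longlonglongrightarrow>
          indicator {a<..<b} x * (indicator {a..b} x *\<^sub>R w x)"
        by (intro AE_I2 tendsto_intros bump_tendsto)
      show "AE x in lebesgue. norm (bump a b n x * (indicator {a..b} x *\<^sub>R w x)) \<le> norm (indicator {a..b} x *\<^sub>R w x)" for n
      proof (rule AE_I2)
        fix x
        have "cmod (bump a b n x) \<le> 1" using order.trans[OF cmod_bump_le indicator_le_1] .
        then show "norm (bump a b n x * (indicator {a..b} x *\<^sub>R w x)) \<le> norm (indicator {a..b} x *\<^sub>R w x)"
          unfolding norm_mult by (rule mult_left_le_one_le[OF norm_ge_zero norm_ge_zero])
      qed
      show "(\<lambda>x. bump a b n x * (indicator {a..b} x *\<^sub>R w x)) \<in> borel_measurable lebesgue" for n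
        by (rule borel_measurable_times[OF bm m])
      have "(indicator {a<..<b} :: real \<Rightarrow> complex) \<in> borel_measurable lebesgue"
        by (rule borel_measurable_indicator) simp
      then show "(\<lambda>x. indicator {a<..<b} x * (indicator {a..b} x *\<^sub>R w x)) \<in> borel_measurable lebesgue"
        using m by (rule borel_measurable_times)
    qed
    moreover have "(LINT x|lebesgue. bump a b n x * (indicator {a..b} x *\<^sub>R w x)) = 0" for n
    proof -
      have "integral\<^sup>L half_line (\<lambda>x. bump a b n x * w x) = (LINT x:{a..b}|lebesgue. bump a b n x * w x)"
      proof (rule integrable_half_line_compact_support(2)[OF ab(1)])
        show "(\<lambda>x. bump a b n x * w x) absolutely_integrable_on {a..b}"
          using locally_integrable_continuous_mult[OF C0_infty_derivative(3)[OF bump_C0_infty[OF ab(1), of b n]] w] ab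
          by (simp add: locally_integrable_def)
        fix r :: real assume "r < a \<or> b < r"
        then have "indicator {a..b} r = (0::real)" by (auto simp: indicator_def)
        then show "bump a b n r * w r = 0" using cmod_bump_le[of a b n r] by simp
      qed
      then have "(LINT x:{a..b}|lebesgue. bump a b n x * w x) = 0"
        using zero[OF bump_C0_infty[OF ab(1), of b n]] by (simp only:)
      then show ?thesis by (simp only: set_lebesgue_integral_def eq)
    qed
    ultimately have "(\<lambda>n::nat. 0) \<longlonglongrightarrow> (LINT x|lebesgue. indicator {a<..<b} x * (indicator {a..b} x *\<^sub>R w x))"
      by (simp only:)
    from LIMSEQ_unique[OF tendsto_const this]
    have "(LINT x|lebesgue. indicator {a<..<b} x * (indicator {a..b} x *\<^sub>R w x)) = 0" by (rule sym)
    moreover have "(\<lambda>x. indicator {a<..<b} x * (indicator {a..b} x *\<^sub>R w x)) = (\<lambda>x. indicator {a<..<b} x *\<^sub>R w x)"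
      by (rule ext) (simp add: indicator_def)
    ultimately have "(LINT x:{a<..<b}|lebesgue. w x) = 0" by (simp only: set_lebesgue_integral_def)
    moreover have "w absolutely_integrable_on {a<..<b}" using wi by (rule set_integrable_subset) auto
    ultimately have "(w has_integral 0) {a<..<b}" using has_integral_set_lebesgue[of "{a<..<b}" w] by simp
    then show "(w has_integral 0 - 0) {a..b}" by (simp add: has_integral_Icc_iff_Ioo)
  qed
  from antiderivative_deriv[OF this] show ?thesis
  proof eventually_elim
    case (elim x)
    then show "w x = 0" using vector_derivative_unique_at[OF elim has_vector_derivative_const] by simp
  qed
qed

lemma C0_infty_lincomb:
  assumes "f \<in> C0_infty" "g \<in> C0_infty"
  shows "(\<lambda>x. f x + c * g x) \<in> C0_infty"
proof -
  obtain a b where ab: "0 < a" "a < b" "\<And>r. r > 0 \<Longrightarrow> r \<le> a \<or> b \<le> r \<Longrightarrow> f r = 0"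
    using C0_inftyD[OF assms(1)] by blast
  obtain a' b' where ab': "0 < a'" "a' < b'" "\<And>r. r > 0 \<Longrightarrow> r \<le> a' \<or> b' \<le> r \<Longrightarrow> g r = 0"
    using C0_inftyD[OF assms(2)] by blast
  show ?thesis
  proof (rule C0_inftyI[where a = "min a a'" and b = "max b b'"])
    show "smooth_half_line (\<lambda>x. f x + c * g x)"
      using assms by (intro smooth_half_line_lincomb C0_infty_smooth)
  qed (use ab ab' in auto)
qed

text \<open>The antiderivative that is 0 left of the support is constant right of it, with the total
  integral as value.\<close>

lemma C0_infty_integral_zero_antiderivative:
  assumes psi: "\<psi> \<in> C0_infty" and zero: "integral\<^sup>L half_line \<psi> = 0"
  obtains \<Psi> where "\<Psi> \<in> C0_infty" "\<And>x. x > 0 \<Longrightarrow> D1 \<Psi> x = \<psi> x"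
proof -
  obtain a b where ab: "0 < a" "a < b" "\<And>r. r > 0 \<Longrightarrow> r \<le> a \<or> b \<le> r \<Longrightarrow> \<psi> r = 0"
    using C0_inftyD[OF psi] by blast
  have cont: "continuous_on {0<..} \<psi>" by (rule C0_infty_derivative(3)[OF psi])
  have loc: "locally_integrable \<psi>" using cont by (rule continuous_imp_locally_integrable)
  then obtain g where g: "antiderivative g \<psi>"
    using antiderivative_exists[of \<psi>] by (auto simp: locally_integrable_def)
  define \<Psi> where "\<Psi> x = g x - g a" for x
  have d: "(\<Psi> has_vector_derivative \<psi> x) (at x)" if "x > 0" for x
    unfolding \<Psi>_def[abs_def]
    using has_vector_derivative_diff[OF antiderivative_has_vector_derivative[OF g cont that] has_vector_derivative_const, of "g a"] by simp
  have "integral\<^sup>L half_line \<psi> = (LINT x:{a..b}|lebesgue. \<psi> x)"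
    using ab loc by (intro integrable_half_line_compact_support(2)) (auto simp: locally_integrable_def)
  then have gab: "g b = g a" using antiderivativeD(3)[OF g, of a b] ab zero by simp
  have const: "g y = g x" if "0 < x" "x \<le> y" "\<And>r. x \<le> r \<Longrightarrow> r \<le> y \<Longrightarrow> \<psi> r = 0" for x y
  proof -
    have "(\<psi> has_integral 0) {x..y}"
      by (rule has_integral_is_0) (use that in auto)
    from has_integral_unique[OF antiderivativeD(2)[OF g that(1,2)] this] show ?thesis by simp
  qed
  have "\<Psi> \<in> C0_infty"
  proof (rule C0_inftyI[OF _ ab(1)])
    show "smooth_half_line \<Psi>" using d C0_infty_smooth[OF psi] by (rule smooth_half_line_antiderivative)
    fix r :: real assume r: "r > 0" "r < a \<or> b < r"
    show "\<Psi> r = 0"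
    proof (cases "r < a")
      case True
      then show ?thesis using const[of r a] r ab by (auto simp: \<Psi>_def)
    next
      case False
      then show ?thesis using const[of b r] r ab gab by (auto simp: \<Psi>_def)
    qed
  qed
  then show ?thesis using that D1_eqI[OF d] by blast
qed

text \<open>If all test functions had integral 0, the fundamental lemma for the constant 1 would
  give 1 = 0 almost everywhere.\<close>

lemma normalized_test_function:
  obtains \<rho> where "\<rho> \<in> C0_infty" "integral\<^sup>L half_line \<rho> = 1"
proof -
  have "\<exists>\<phi>\<in>C0_infty. integral\<^sup>L half_line \<phi> \<noteq> 0"
  proof (rule ccontr)
    assume *: "\<not> (\<exists>\<phi>\<in>C0_infty. integral\<^sup>L half_line \<phi> \<noteq> 0)"
    have "AE x in half_line. (1::complex) = 0"
      using fundamental_lemma_variations[of "\<lambda>_. 1"] * continuous_imp_locally_integrable[of "\<lambda>_. 1"] by auto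
    then have "negligible {0::real<..}" by (simp add: AE_half_line_iff greaterThan_def)
    then have "negligible {1<..<2::real}" by (rule negligible_subset) auto
    then show False using negligible_interval(2)[of 1 "2::real"] by (auto simp: box_real)
  qed
  then obtain \<phi> where phi: "\<phi> \<in> C0_infty" "integral\<^sup>L half_line \<phi> \<noteq> 0" by blast
  \<comment> \<open>Rescaling is written as f + (t - 1) f to fit the closure property of test
    functions.\<close>
  have "(\<lambda>x. \<phi> x + (1 / integral\<^sup>L half_line \<phi> - 1) * \<phi> x) \<in> C0_infty" using phi(1) by (intro C0_infty_lincomb)
  moreover have "(\<lambda>x. \<phi> x + (1 / integral\<^sup>L half_line \<phi> - 1) * \<phi> x) = (\<lambda>x. (1 / integral\<^sup>L half_line \<phi>) * \<phi> x)"
    by (auto simp: algebra_simps)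
  moreover have "integral\<^sup>L half_line (\<lambda>x. (1 / integral\<^sup>L half_line \<phi>) * \<phi> x) = 1"
    using phi(2) by simp
  ultimately show ?thesis using that by metis
qed

text \<open>Subtracting the right multiple of a normalized \<rho> from \<phi> leaves a test function
  of integral 0, hence the derivative of a test function. So \<open>w\<close> acts on \<phi> like
  the constant c that it yields on \<rho>.\<close>

lemma du_bois_reymond:
  assumes w: "locally_integrable w"
    and zero: "\<And>\<phi>. \<phi> \<in> C0_infty \<Longrightarrow> integral\<^sup>L half_line (\<lambda>x. D1 \<phi> x * w x) = 0"
  shows "\<exists>c. AE x in half_line. w x = c"
proof -
  obtain \<rho> where rho: "\<rho> \<in> C0_infty" "integral\<^sup>L half_line \<rho> = 1" by (rule normalized_test_function)
  define c where "c = integral\<^sup>L half_line (\<lambda>x. \<rho> x * w x)"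
  have one: "locally_integrable (\<lambda>_. 1)" by (intro continuous_imp_locally_integrable continuous_intros)
  have int: "integrable half_line \<phi>" if "\<phi> \<in> C0_infty" for \<phi>
    using C0_infty_mult_integrable[OF that one] by simp
  have cl: "locally_integrable (\<lambda>_. c)" by (intro continuous_imp_locally_integrable continuous_intros)
  have "AE x in half_line. w x - c = 0"
  proof (rule fundamental_lemma_variations)
    show "locally_integrable (\<lambda>x. w x - c)"
      by (intro locally_integrable_diff w cl)
    fix \<phi> assume phi: "\<phi> \<in> C0_infty"
    define m where "m = integral\<^sup>L half_line \<phi>"
    define \<psi> where "\<psi> x = \<phi> x + (- m) * \<rho> x" for x
    have psi: "\<psi> \<in> C0_infty" unfolding \<psi>_def[abs_def] using phi rho(1) by (rule C0_infty_lincomb)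
    have "integral\<^sup>L half_line \<psi> = integral\<^sup>L half_line \<phi> + (- m) * integral\<^sup>L half_line \<rho>"
      unfolding \<psi>_def[abs_def] using int[OF phi] int[OF rho(1)]
      by (subst Bochner_Integration.integral_add) auto
    then have "integral\<^sup>L half_line \<psi> = 0" using rho(2) by (simp add: m_def)
    then obtain \<Psi> where Psi: "\<Psi> \<in> C0_infty" "\<And>x. x > 0 \<Longrightarrow> D1 \<Psi> x = \<psi> x"
      using C0_infty_integral_zero_antiderivative[OF psi] by blast
    have "integral\<^sup>L half_line (\<lambda>x. \<psi> x * w x) = integral\<^sup>L half_line (\<lambda>x. D1 \<Psi> x * w x)"
      using Psi(2) by (intro Bochner_Integration.integral_cong) auto
    then have "integral\<^sup>L half_line (\<lambda>x. \<psi> x * w x) = 0" using zero[OF Psi(1)] by simp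
    moreover have "integral\<^sup>L half_line (\<lambda>x. \<psi> x * w x) = integral\<^sup>L half_line (\<lambda>x. \<phi> x * w x) - m * c"
    proof -
      have "(\<lambda>x. \<psi> x * w x) = (\<lambda>x. \<phi> x * w x - m * (\<rho> x * w x))" by (auto simp: \<psi>_def algebra_simps)
      then show ?thesis
        using C0_infty_mult_integrable[OF phi w] C0_infty_mult_integrable[OF rho(1) w] by (simp add: c_def)
    qed
    moreover have "integral\<^sup>L half_line (\<lambda>x. \<phi> x * (w x - c)) = integral\<^sup>L half_line (\<lambda>x. \<phi> x * w x) - m * c"
      using C0_infty_mult_integrable[OF phi w] int[OF phi] by (simp add: algebra_simps m_def)
    ultimately show "integral\<^sup>L half_line (\<lambda>x. \<phi> x * (w x - c)) = 0" by simp
  qed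
  then have "AE x in half_line. w x = c" by eventually_elim simp
  then show ?thesis by blast
qed

text \<open>The same correction, with \<open>k\<close> now defined by pairing \<open>w\<close> with
  the derivative of \<rho>. Since the derivative of \<phi> paired with x gives minus the integral of
  \<phi>, it is \<open>w + k * x\<close>, with a plus sign, that falls under
  \<open>du_bois_reymond\<close>.\<close>

lemma du_bois_reymond_2:
  assumes w: "locally_integrable w"
    and zero: "\<And>\<phi>. \<phi> \<in> C0_infty \<Longrightarrow> integral\<^sup>L half_line (\<lambda>x. D1 (D1 \<phi>) x * w x) = 0"
  shows "\<exists>c k. AE x in half_line. w x = c + k * of_real x"
proof -
  obtain \<rho> where rho: "\<rho> \<in> C0_infty" "integral\<^sup>L half_line \<rho> = 1" by (rule normalized_test_function)
  define k where "k = integral\<^sup>L half_line (\<lambda>x. D1 \<rho> x * w x)"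
  have one: "locally_integrable (\<lambda>_. 1)" by (intro continuous_imp_locally_integrable continuous_intros)
  have idl: "locally_integrable of_real" by (intro continuous_imp_locally_integrable continuous_intros)
  have int: "integrable half_line \<phi>" if "\<phi> \<in> C0_infty" for \<phi>
    using C0_infty_mult_integrable[OF that one] by simp
  have "\<exists>c. AE x in half_line. w x + k * of_real x = c"
  proof (rule du_bois_reymond)
    show "locally_integrable (\<lambda>x. w x + k * of_real x)"
      by (intro locally_integrable_add w continuous_imp_locally_integrable continuous_intros)
    fix \<phi> assume phi: "\<phi> \<in> C0_infty"
    note dphi = C0_infty_derivative(1)[OF phi] and drho = C0_infty_derivative(1)[OF rho(1)]
    define m where "m = integral\<^sup>L half_line \<phi>"
    define \<psi> where "\<psi> x = \<phi> x + (- m) * \<rho> x" for x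
    have psi: "\<psi> \<in> C0_infty" unfolding \<psi>_def[abs_def] using phi rho(1) by (rule C0_infty_lincomb)
    have "integral\<^sup>L half_line \<psi> = integral\<^sup>L half_line \<phi> + (- m) * integral\<^sup>L half_line \<rho>"
      unfolding \<psi>_def[abs_def] using int[OF phi] int[OF rho(1)]
      by (subst Bochner_Integration.integral_add) auto
    then have "integral\<^sup>L half_line \<psi> = 0" using rho(2) by (simp add: m_def)
    then obtain \<Psi> where Psi: "\<Psi> \<in> C0_infty" "\<And>x. x > 0 \<Longrightarrow> D1 \<Psi> x = \<psi> x"
      using C0_infty_integral_zero_antiderivative[OF psi] by blast
    have D: "D1 (D1 \<Psi>) x = D1 \<phi> x - m * D1 \<rho> x" if "x > 0" for x
    proof -
      have "(\<psi> has_vector_derivative D1 \<phi> x + (- m) * D1 \<rho> x) (at x)" unfolding \<psi>_def[abs_def]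
        by (intro has_vector_derivative_add has_vector_derivative_mult_right C0_infty_derivative(2) phi rho(1) that)
      from D1_eqI[OF this] D1_cong_half_line[OF Psi(2) that] show ?thesis by simp
    qed
    have "0 = integral\<^sup>L half_line (\<lambda>x. D1 (D1 \<Psi>) x * w x)" using zero[OF Psi(1)] by simp
    also have "\<dots> = integral\<^sup>L half_line (\<lambda>x. D1 \<phi> x * w x - m * (D1 \<rho> x * w x))"
      by (intro Bochner_Integration.integral_cong) (auto simp: D left_diff_distrib mult.assoc)
    also have "\<dots> = integral\<^sup>L half_line (\<lambda>x. D1 \<phi> x * w x) - m * k"
      using C0_infty_mult_integrable[OF dphi w] C0_infty_mult_integrable[OF drho w] by (simp add: k_def)
    finally have "integral\<^sup>L half_line (\<lambda>x. D1 \<phi> x * w x) = m * k" by simp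
    moreover have "integral\<^sup>L half_line (\<lambda>x. D1 \<phi> x * of_real x) = - m"
    proof -
      have "antiderivative of_real (\<lambda>_. 1)"
        by (rule antiderivative_if_C1) (auto intro!: derivative_eq_intros has_vector_derivative_of_real DERIV_ident)
      from C0_infty_by_parts[OF phi this] show ?thesis by (simp add: m_def)
    qed
    moreover have "integral\<^sup>L half_line (\<lambda>x. D1 \<phi> x * (w x + k * of_real x)) =
        integral\<^sup>L half_line (\<lambda>x. D1 \<phi> x * w x) + k * integral\<^sup>L half_line (\<lambda>x. D1 \<phi> x * of_real x)"
    proof -
      have "(\<lambda>x. D1 \<phi> x * (w x + k * of_real x)) = (\<lambda>x. D1 \<phi> x * w x + k * (D1 \<phi> x * of_real x))"
        by (auto simp: algebra_simps)
      then show ?thesis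
        using C0_infty_mult_integrable[OF dphi w] C0_infty_mult_integrable[OF dphi idl] by simp
    qed
    ultimately show "integral\<^sup>L half_line (\<lambda>x. D1 \<phi> x * (w x + k * of_real x)) = 0" by simp
  qed
  then obtain c where c: "AE x in half_line. w x + k * of_real x = c" by blast
  then have "AE x in half_line. w x = c + (- k) * of_real x"
    by eventually_elim (simp add: algebra_simps)
  then show ?thesis by blast
qed

section \<open>The maximal operator\<close>

lemma continuous_compact_support_square_integrable:
  assumes "continuous_on {0<..} k" "0 < a" "\<And>r. r > 0 \<Longrightarrow> r < a \<or> b < r \<Longrightarrow> k r = 0"
  shows "square_integrable k"
proof -
  have m: "k \<in> borel_measurable half_line"
    using assms(1) by (rule continuous_imp_measurable_on_sets_lebesgue) simp
  have "(\<lambda>r. complex_of_real ((cmod (k r))\<^sup>2)) absolutely_integrable_on {a..b}"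
    using assms(2) by (intro absolutely_integrable_continuous_real continuous_intros continuous_on_subset[OF assms(1)]) auto
  then have "integrable half_line (\<lambda>r. complex_of_real ((cmod (k r))\<^sup>2))"
    using assms by (intro integrable_half_line_compact_support(1)[where a = a and b = b]) auto
  then have "integrable half_line (\<lambda>r. Re (complex_of_real ((cmod (k r))\<^sup>2)))" by (rule integrable_Re)
  then show ?thesis using m by (simp add: square_integrable_def)
qed

context
  fixes \<alpha> :: real
begin

lemma DeltaD:
  assumes "f \<in> Delta \<alpha>"
  shows "f \<in> D_space" "square_integrable f" "square_integrable (L_expr \<alpha> f)"
  using assms by (auto simp: Delta_def)

lemma D1_D1_eq: "D1 (D1 f) r = of_real ((\<alpha> - 1 / 4) / r\<^sup>2) * f r - L_expr \<alpha> f r"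
  by (simp add: L_expr_def)

lemma C0_infty_D_space: "\<phi> \<in> C0_infty \<Longrightarrow> \<phi> \<in> D_space"
  using D_spaceI(1)[of \<phi> "D1 \<phi>"] C0_infty_derivative by blast

lemma C0_infty_subset_Delta: "C0_infty \<subseteq> Delta \<alpha>"
proof
  fix \<phi> :: "real \<Rightarrow> complex" assume phi: "\<phi> \<in> C0_infty"
  note d1 = C0_infty_derivative(1)[OF phi]
  note d2 = C0_infty_derivative(1)[OF d1]
  obtain a b where ab: "0 < a" "a < b" "\<And>r. r > 0 \<Longrightarrow> r \<le> a \<or> b \<le> r \<Longrightarrow> \<phi> r = 0"
    using C0_inftyD[OF phi] by blast
  obtain a' b' where ab': "0 < a'" "a' < b'" "\<And>r. r > 0 \<Longrightarrow> r \<le> a' \<or> b' \<le> r \<Longrightarrow> D1 (D1 \<phi>) r = 0"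
    using C0_inftyD[OF d2] by blast
  have "square_integrable \<phi>"
    using C0_infty_derivative(3)[OF phi] ab(1)
    by (rule continuous_compact_support_square_integrable[where b = b]) (use ab in auto)
  moreover have "square_integrable (L_expr \<alpha> \<phi>)"
  proof (rule continuous_compact_support_square_integrable)
    show "continuous_on {0<..} (L_expr \<alpha> \<phi>)" unfolding L_expr_def[abs_def]
      by (intro continuous_intros C0_infty_derivative(3)[OF d2] C0_infty_derivative(3)[OF phi]) auto
    show "0 < min a a'" using ab ab' by simp
    fix r :: real assume "r > 0" "r < min a a' \<or> max b b' < r"
    then show "L_expr \<alpha> \<phi> r = 0" using ab(3)[of r] ab'(3)[of r] by (auto simp: L_expr_def)
  qed
  ultimately show "\<phi> \<in> Delta \<alpha>" using C0_infty_D_space[OF phi] by (simp add: Delta_def)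
qed

lemma weak_solution:
  assumes u: "square_integrable u" and v: "square_integrable v"
    and weak: "\<And>\<phi>. \<phi> \<in> C0_infty \<Longrightarrow>
      integral\<^sup>L half_line (\<lambda>r. L_expr \<alpha> \<phi> r * cnj (u r)) = integral\<^sup>L half_line (\<lambda>r. \<phi> r * cnj (v r))"
  obtains g where "g \<in> Delta \<alpha>" "AE r in half_line. u r = g r" "AE r in half_line. v r = L_expr \<alpha> g r"
proof -
  define q where "q r = complex_of_real ((\<alpha> - 1 / 4) / r\<^sup>2)" for r
  define h where "h r = q r * u r - v r" for r
  have q_cont: "continuous_on {0<..} q" unfolding q_def[abs_def] by (intro continuous_intros) auto
  have q_real: "cnj (q r) = q r" for r by (simp add: q_def)
  have ul: "locally_integrable u" and vl: "locally_integrable v"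
    using u v by (auto intro: square_integrable_imp_locally_integrable)
  have qul: "locally_integrable (\<lambda>r. q r * u r)" using q_cont ul by (rule locally_integrable_continuous_mult)
  have hl: "locally_integrable h" unfolding h_def[abs_def] using qul vl by (rule locally_integrable_diff)
  obtain G1 where G1: "antiderivative G1 h"
    using antiderivative_exists[of h] hl by (auto simp: locally_integrable_def)
  have G1_cont: "continuous_on {0<..} G1" using G1 by (rule antiderivative_continuous_on)
  obtain G2 where G2: "antiderivative G2 G1"
    using antiderivative_exists[of G1] continuous_imp_locally_integrable[OF G1_cont] by (auto simp: locally_integrable_def)
  have G2_cont: "continuous_on {0<..} G2" using G2 by (rule antiderivative_continuous_on)
  \<comment> \<open>Conjugated because the weak equation involves \<open>cnj (u r)\<close>; the
    potential is real, so \<open>cnj (h r)\<close> is the right-hand side for the conjugated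
    equation.\<close>
  define w where "w r = cnj (u r) - cnj (G2 r)" for r
  have G2l: "locally_integrable (\<lambda>r. cnj (G2 r))"
    by (intro locally_integrable_cnj continuous_imp_locally_integrable G2_cont)
  have wl: "locally_integrable w" unfolding w_def[abs_def]
    by (intro locally_integrable_diff locally_integrable_cnj[OF ul] G2l)
  have "\<exists>c k. AE x in half_line. w x = c + k * of_real x"
  proof (rule du_bois_reymond_2[OF wl])
    fix \<phi> assume phi: "\<phi> \<in> C0_infty"
    note d1 = C0_infty_derivative(1)[OF phi]
    note d2 = C0_infty_derivative(1)[OF d1]
    have ucl: "locally_integrable (\<lambda>r. cnj (u r))" using ul by (rule locally_integrable_cnj)
    have vcl: "locally_integrable (\<lambda>r. cnj (v r))" using vl by (rule locally_integrable_cnj)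
    have qucl: "locally_integrable (\<lambda>r. q r * cnj (u r))" using q_cont ucl by (rule locally_integrable_continuous_mult)
    note i_u2 = C0_infty_mult_integrable[OF d2 ucl]
    note i_qu = C0_infty_mult_integrable[OF phi qucl]
    note i_v = C0_infty_mult_integrable[OF phi vcl]
    note i_G = C0_infty_mult_integrable[OF d2 G2l]
    have "integral\<^sup>L half_line (\<lambda>r. L_expr \<alpha> \<phi> r * cnj (u r)) =
        integral\<^sup>L half_line (\<lambda>r. \<phi> r * (q r * cnj (u r)) - D1 (D1 \<phi>) r * cnj (u r))"
      by (simp add: L_expr_def q_def algebra_simps)
    also have "\<dots> = integral\<^sup>L half_line (\<lambda>r. \<phi> r * (q r * cnj (u r))) - integral\<^sup>L half_line (\<lambda>r. D1 (D1 \<phi>) r * cnj (u r))"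
      using i_qu i_u2 by (rule Bochner_Integration.integral_diff)
    finally have e1: "integral\<^sup>L half_line (\<lambda>r. D1 (D1 \<phi>) r * cnj (u r)) =
        integral\<^sup>L half_line (\<lambda>r. \<phi> r * (q r * cnj (u r))) - integral\<^sup>L half_line (\<lambda>r. \<phi> r * cnj (v r))"
      using weak[OF phi] by (simp add: algebra_simps)
    have "integral\<^sup>L half_line (\<lambda>r. D1 (D1 \<phi>) r * cnj (G2 r)) = integral\<^sup>L half_line (\<lambda>r. \<phi> r * cnj (h r))"
      using C0_infty_by_parts[OF d1 antiderivative_cnj[OF G2]] C0_infty_by_parts[OF phi antiderivative_cnj[OF G1]]
      by simp
    also have "\<dots> = integral\<^sup>L half_line (\<lambda>r. \<phi> r * (q r * cnj (u r)) - \<phi> r * cnj (v r))"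
      by (simp add: h_def q_real algebra_simps)
    also have "\<dots> = integral\<^sup>L half_line (\<lambda>r. \<phi> r * (q r * cnj (u r))) - integral\<^sup>L half_line (\<lambda>r. \<phi> r * cnj (v r))"
      using i_qu i_v by (rule Bochner_Integration.integral_diff)
    finally have e2: "integral\<^sup>L half_line (\<lambda>r. D1 (D1 \<phi>) r * cnj (G2 r)) = integral\<^sup>L half_line (\<lambda>r. D1 (D1 \<phi>) r * cnj (u r))"
      using e1 by simp
    have "integral\<^sup>L half_line (\<lambda>r. D1 (D1 \<phi>) r * w r) =
        integral\<^sup>L half_line (\<lambda>r. D1 (D1 \<phi>) r * cnj (u r) - D1 (D1 \<phi>) r * cnj (G2 r))"
      by (simp add: w_def right_diff_distrib)
    also have "\<dots> = 0" using Bochner_Integration.integral_diff[OF i_u2 i_G] e2 by simp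
    finally show "integral\<^sup>L half_line (\<lambda>r. D1 (D1 \<phi>) r * w r) = 0" .
  qed
  then obtain c k where ck: "AE x in half_line. w x = c + k * of_real x" by blast
  \<comment> \<open>The continuously differentiable representative of \<open>u\<close>; the
    constants are conjugated back.\<close>
  define g where "g r = G2 r + (cnj c + cnj k * of_real r)" for r
  have lin: "((\<lambda>r. cnj c + cnj k * complex_of_real r) has_vector_derivative cnj k) (at r)" for r
  proof -
    have "(complex_of_real has_vector_derivative of_real 1) (at r)"
      by (rule has_vector_derivative_of_real) (rule DERIV_ident)
    from has_vector_derivative_mult_right[OF this, of "cnj k"] show ?thesis
      using has_vector_derivative_add[OF has_vector_derivative_const, of "\<lambda>r. cnj k * complex_of_real r"] by simp
  qed
  have g1: "(g has_vector_derivative G1 x + cnj k) (at x)" if "x > 0" for x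
    unfolding g_def[abs_def]
    by (intro has_vector_derivative_add lin antiderivative_has_vector_derivative[OF G2 G1_cont that])
  have "antiderivative (\<lambda>x. G1 x + cnj k) (\<lambda>x. h x + 0)"
  proof (rule antiderivative_add[OF G1 antiderivative_if_C1])
    show "((\<lambda>_. cnj k) has_vector_derivative 0) (at x)" for x by simp
  qed simp
  then have g2: "antiderivative (\<lambda>x. G1 x + cnj k) h" by simp
  have g: "g \<in> D_space" "AE r in half_line. D1 (D1 g) r = h r"
    using D_spaceI(1,3)[OF _ g2, of g] g1 by auto
  have ug: "AE r in half_line. u r = g r"
    using ck
  proof eventually_elim
    case (elim r)
    then have "cnj (w r) = cnj (c + k * of_real r)" by simp
    then show ?case by (simp add: w_def g_def algebra_simps)
  qed
  have vL: "AE r in half_line. v r = L_expr \<alpha> g r"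
    using ug g(2) by eventually_elim (simp add: L_expr_def h_def q_def)
  have "g \<in> Delta \<alpha>"
    using g(1) square_integrable_cong_AE[OF u ug] square_integrable_cong_AE[OF v vL] by (simp add: Delta_def)
  then show ?thesis using that ug vL by blast
qed

section \<open>Green's formula and the behaviour at infinity\<close>

definition boundary_form :: "(real \<Rightarrow> complex) \<Rightarrow> (real \<Rightarrow> complex) \<Rightarrow> real \<Rightarrow> complex" where
  "boundary_form f g r = f r * cnj (D1 g r) - D1 f r * cnj (g r)"

text \<open>Lagrange's identity. For differentiable g the boundary form is the Wronskian of
  \<open>f\<close> and the conjugate of \<open>g\<close>; the products of first derivatives cancel,
  and so do the potential terms because the potential is real.\<close>

lemma boundary_form_antiderivative:
  assumes "f \<in> D_space" "g \<in> D_space"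
  shows "antiderivative (boundary_form f g) (\<lambda>r. L_expr \<alpha> f r * cnj (g r) - f r * cnj (L_expr \<alpha> g r))"
proof -
  have "antiderivative (\<lambda>r. f r * cnj (D1 g r) - D1 f r * cnj (g r))
    (\<lambda>r. (f r * cnj (D1 (D1 g) r) + D1 f r * cnj (D1 g r)) - (D1 f r * cnj (D1 g r) + D1 (D1 f) r * cnj (g r)))"
    using assms by (intro antiderivative_diff antiderivative_mult antiderivative_cnj D_spaceD(3,4))
  moreover have "(f r * cnj (D1 (D1 g) r) + D1 f r * cnj (D1 g r)) - (D1 f r * cnj (D1 g r) + D1 (D1 f) r * cnj (g r)) =
      L_expr \<alpha> f r * cnj (g r) - f r * cnj (L_expr \<alpha> g r)" for r
    by (simp add: L_expr_def algebra_simps)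
  ultimately show ?thesis by (simp add: boundary_form_def[abs_def])
qed

text \<open>On a window of length 1 / 3 the minimum is at most 3 times the integral over the window,
  which tends to 0 as the window moves out. The offset \<open>c\<close> allows two separated windows
  in every unit interval.\<close>

lemma exists_points_tendsto_0:
  fixes \<phi> :: "real \<Rightarrow> real"
  assumes cont: "continuous_on {0<..} \<phi>" and int: "integrable half_line \<phi>" and nonneg: "\<And>x. 0 \<le> \<phi> x" and "c \<ge> 0"
  obtains t where "\<And>n::nat. real n + 1 + c \<le> t n" "\<And>n::nat. t n \<le> real n + 1 + c + 1 / 3" "(\<lambda>n. \<phi> (t n)) \<longlonglongrightarrow> 0"
proof -
  define I where "I n = {real n + 1 + c..real n + 1 + c + 1 / 3}" for n
  have I_cont: "continuous_on (I n) \<phi>" for n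
    using \<open>c \<ge> 0\<close> by (intro continuous_on_subset[OF cont]) (auto simp: I_def)
  have "\<exists>t\<in>I n. \<forall>y\<in>I n. \<phi> t \<le> \<phi> y" for n
    by (intro continuous_attains_inf I_cont) (auto simp: I_def)
  then obtain t where t: "\<And>n. t n \<in> I n" "\<And>n y. y \<in> I n \<Longrightarrow> \<phi> (t n) \<le> \<phi> y" by metis
  have cint: "integrable half_line (\<lambda>x. complex_of_real (\<phi> x))" using int by simp
  have ccont: "continuous_on {0<..} (\<lambda>x. complex_of_real (\<phi> x))" using cont by (intro continuous_intros)
  obtain \<Phi> where Phi: "antiderivative \<Phi> (\<lambda>x. complex_of_real (\<phi> x))"
    using antiderivative_exists[of "\<lambda>x. complex_of_real (\<phi> x)"] continuous_imp_locally_integrable[OF ccont]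
    by (auto simp: locally_integrable_def)
  obtain l where "(\<Phi> \<longlongrightarrow> l) at_top" using antiderivative_integral_half_line[OF Phi cint] by blast
  then have lim: "(\<lambda>n. \<Phi> (real n + b)) \<longlonglongrightarrow> l" for b
    by (rule filterlim_compose) (auto intro!: filterlim_tendsto_add_at_top filterlim_real_sequentially
        simp: add.commute[of _ b])
  have "(\<lambda>n. 3 * Re (\<Phi> (real n + (1 + c + 1 / 3)) - \<Phi> (real n + (1 + c)))) \<longlonglongrightarrow> 3 * Re (l - l)"
    by (intro tendsto_intros lim)
  then have z: "(\<lambda>n. 3 * Re (\<Phi> (real n + (1 + c + 1 / 3)) - \<Phi> (real n + (1 + c)))) \<longlonglongrightarrow> 0" by simp
  have le: "\<phi> (t n) \<le> 3 * Re (\<Phi> (real n + (1 + c + 1 / 3)) - \<Phi> (real n + (1 + c)))" for n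
  proof -
    have "((\<lambda>x. complex_of_real (\<phi> x)) has_integral \<Phi> (real n + (1 + c + 1 / 3)) - \<Phi> (real n + (1 + c))) (I n)"
      using antiderivativeD(2)[OF Phi, of "real n + (1 + c)" "real n + (1 + c + 1 / 3)"] \<open>c \<ge> 0\<close>
      by (simp add: I_def add.assoc)
    from has_integral_linear[OF this bounded_linear_Re]
    have up: "(\<phi> has_integral Re (\<Phi> (real n + (1 + c + 1 / 3)) - \<Phi> (real n + (1 + c)))) (I n)"
      by (simp add: o_def)
    have "((\<lambda>_. \<phi> (t n)) has_integral (1 / 3) * \<phi> (t n)) (I n)"
      using has_integral_const_real[of "\<phi> (t n)" "real n + 1 + c" "real n + 1 + c + 1 / 3"] by (simp add: I_def)
    from has_integral_le[OF this up t(2)] show ?thesis by simp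
  qed
  show thesis
  proof
    show "(\<lambda>n. \<phi> (t n)) \<longlonglongrightarrow> 0"
    proof (rule tendsto_sandwich[OF _ _ tendsto_const z])
      show "\<forall>\<^sub>F n in sequentially. 0 \<le> \<phi> (t n)" using nonneg by (intro always_eventually allI)
      show "\<forall>\<^sub>F n in sequentially. \<phi> (t n) \<le> 3 * Re (\<Phi> (real n + (1 + c + 1 / 3)) - \<Phi> (real n + (1 + c)))"
        using le by (intro always_eventually allI)
    qed
  qed (use t(1) in \<open>auto simp: I_def\<close>)
qed

text \<open>The second derivative is the potential times f minus \<open>L_expr \<alpha> f\<close>.
  Right of 1 the potential is bounded, and x \<le> 1 + x^2 turns square-integrability into a bound
  for the integral over any interval of length at most 1.\<close>

lemma D1_oscillation_bounded:
  assumes f: "f \<in> Delta \<alpha>"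
  obtains M where "\<And>t y. 1 \<le> t \<Longrightarrow> t \<le> y \<Longrightarrow> y \<le> t + 1 \<Longrightarrow> cmod (D1 f y - D1 f t) \<le> M"
proof -
  define C where "C = \<bar>\<alpha> - 1 / 4\<bar>"
  define F where "F = (\<lambda>r. C * (1 + (cmod (f r))\<^sup>2) + (1 + (cmod (L_expr \<alpha> f r))\<^sup>2))"
  have sq: "(\<lambda>r. (cmod (g r))\<^sup>2) absolutely_integrable_on {0<..}" if "square_integrable g" for g
    using that by (simp add: square_integrable_def integrable_restrict_space set_integrable_def)
  define A where "A = integral {0<..} (\<lambda>r. (cmod (f r))\<^sup>2)"
  define B where "B = integral {0<..} (\<lambda>r. (cmod (L_expr \<alpha> f r))\<^sup>2)"
  have sub: "(\<lambda>r. (cmod (g r))\<^sup>2) integrable_on {t..y}"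
      "integral {t..y} (\<lambda>r. (cmod (g r))\<^sup>2) \<le> integral {0<..} (\<lambda>r. (cmod (g r))\<^sup>2)"
    if "square_integrable g" "0 < t" for g t y
  proof -
    have s: "{t..y} \<subseteq> {0<..}" using that(2) by auto
    show i: "(\<lambda>r. (cmod (g r))\<^sup>2) integrable_on {t..y}"
      using set_integrable_subset[OF sq[OF that(1)] _ s] by (auto simp: absolutely_integrable_on_def)
    show "integral {t..y} (\<lambda>r. (cmod (g r))\<^sup>2) \<le> integral {0<..} (\<lambda>r. (cmod (g r))\<^sup>2)"
      using s i sq[OF that(1)] by (intro integral_subset_le) (auto simp: absolutely_integrable_on_def)
  qed
  have pt: "x \<le> 1 + x\<^sup>2" for x :: real
  proof -
    have "0 \<le> (x - 1 / 2)\<^sup>2" by simp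
    then show ?thesis by (simp add: power2_eq_square algebra_simps)
  qed
  show thesis
  proof
    fix t y :: real assume ty: "1 \<le> t" "t \<le> y" "y \<le> t + 1"
    have hi: "(D1 (D1 f) has_integral D1 f y - D1 f t) {t..y}"
      using antiderivativeD(2)[OF D_spaceD(4)[OF DeltaD(1)[OF f]], of t y] ty by simp
    have "cmod (D1 (D1 f) r) \<le> F r" if "r \<in> {t..y}" for r
    proof -
      have "cmod (of_real ((\<alpha> - 1 / 4) / r\<^sup>2) * f r) \<le> C * (1 + (cmod (f r))\<^sup>2)"
      proof -
        have "1 \<le> r\<^sup>2" using that ty by (simp add: power2_eq_square mult_ge1_I)
        then have "\<bar>\<alpha> - 1 / 4\<bar> / r\<^sup>2 \<le> \<bar>\<alpha> - 1 / 4\<bar>" by (simp add: divide_le_eq mult_le_cancel_left1)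
        then show ?thesis using pt[of "cmod (f r)"]
          unfolding norm_mult norm_of_real C_def by (intro mult_mono) (auto simp: abs_divide)
      qed
      moreover have "cmod (D1 (D1 f) r) \<le> cmod (of_real ((\<alpha> - 1 / 4) / r\<^sup>2) * f r) + cmod (L_expr \<alpha> f r)"
        unfolding D1_D1_eq by (rule norm_triangle_ineq4)
      ultimately show ?thesis using pt[of "cmod (L_expr \<alpha> f r)"] unfolding F_def by linarith
    qed
    moreover have F_has: "(F has_integral (C * ((y - t) + integral {t..y} (\<lambda>r. (cmod (f r))\<^sup>2))
        + ((y - t) + integral {t..y} (\<lambda>r. (cmod (L_expr \<alpha> f r))\<^sup>2)))) {t..y}"
      unfolding F_def
      using has_integral_const_real[of "1::real" t y] ty sub(1)[OF DeltaD(2)[OF f]] sub(1)[OF DeltaD(3)[OF f]]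
      by (intro has_integral_add has_integral_mult_right integrable_integral) auto
    ultimately have "norm (integral {t..y} (D1 (D1 f))) \<le> integral {t..y} F"
      using hi by (intro integral_norm_bound_integral) (auto intro: has_integral_integrable)
    then have "cmod (D1 f y - D1 f t) \<le> C * ((y - t) + integral {t..y} (\<lambda>r. (cmod (f r))\<^sup>2))
        + ((y - t) + integral {t..y} (\<lambda>r. (cmod (L_expr \<alpha> f r))\<^sup>2))"
      using integral_unique[OF hi] integral_unique[OF F_has] by simp
    also have "\<dots> \<le> C * (1 + A) + (1 + B)"
      using sub(2)[OF DeltaD(2)[OF f], of t y] sub(2)[OF DeltaD(3)[OF f], of t y] ty
      by (intro add_mono mult_left_mono) (auto simp: A_def B_def C_def)
    finally show "cmod (D1 f y - D1 f t) \<le> C * (1 + A) + (1 + B)" .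
  qed
qed

text \<open>Replacing \<open>D1 f\<close> by its value at \<open>t\<close> changes the integral from
  \<open>t\<close> to \<open>s\<close> by at most \<open>M\<close>, while \<open>f s - f t\<close>
  is controlled; the factor 3 comes from \<open>s - t\<close> being at least 1 / 3.\<close>

lemma D1_bound:
  assumes f: "f \<in> D_space" and M: "\<And>t y. 1 \<le> t \<Longrightarrow> t \<le> y \<Longrightarrow> y \<le> t + 1 \<Longrightarrow> cmod (D1 f y - D1 f t) \<le> M"
    and ts: "1 \<le> t" "t + 1 / 3 \<le> s" "s \<le> t + 1"
  shows "cmod (D1 f t) \<le> 3 * (cmod (f s) + cmod (f t) + M)"
proof -
  have "(D1 f has_integral f s - f t) {t..s}"
    using antiderivativeD(2)[OF D_spaceD(3)[OF f], of t s] ts by simp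
  moreover have "((\<lambda>_. D1 f t) has_integral (s - t) *\<^sub>R D1 f t) {t..s}"
    using has_integral_const_real[of "D1 f t" t s] ts by simp
  ultimately have hi: "((\<lambda>y. D1 f y - D1 f t) has_integral (f s - f t) - (s - t) *\<^sub>R D1 f t) {t..s}"
    by (rule has_integral_diff)
  have M0: "0 \<le> M" using M[of t t] ts by simp
  have "norm ((f s - f t) - (s - t) *\<^sub>R D1 f t) \<le> M * (s - t)"
    using has_integral_bound[OF M0, of "\<lambda>y. D1 f y - D1 f t" _ t s] hi M ts by (simp add: content_real)
  also have "\<dots> \<le> M * 1" using M0 ts by (intro mult_left_mono) auto
  finally have "norm ((f s - f t) - (s - t) *\<^sub>R D1 f t) \<le> M" by simp
  moreover have "norm ((s - t) *\<^sub>R D1 f t) \<le> norm (f s - f t) + norm ((f s - f t) - (s - t) *\<^sub>R D1 f t)"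
    using norm_triangle_ineq4[of "f s - f t" "(f s - f t) - (s - t) *\<^sub>R D1 f t"] by simp
  moreover have "norm (f s - f t) \<le> cmod (f s) + cmod (f t)" by (rule norm_triangle_ineq4)
  moreover have "cmod (D1 f t) \<le> 3 * norm ((s - t) *\<^sub>R D1 f t)"
  proof -
    have "1 * cmod (D1 f t) \<le> (3 * (s - t)) * cmod (D1 f t)"
      using ts by (intro mult_right_mono) auto
    moreover have "norm ((s - t) *\<^sub>R D1 f t) = (s - t) * cmod (D1 f t)" using ts by simp
    ultimately show ?thesis by (simp only: mult.assoc mult_1)
  qed
  ultimately show ?thesis by argo
qed

text \<open>Windows with offsets 0 and 2 / 3 give points \<open>t n\<close> and \<open>s n\<close>
  at distance between 1 / 3 and 1 where f and g are small. So the derivatives at \<open>t n\<close>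
  stay bounded, and every product in the boundary form has a factor tending to 0.\<close>

lemma boundary_form_at_top:
  assumes f: "f \<in> Delta \<alpha>" and g: "g \<in> Delta \<alpha>"
  obtains t where "filterlim t at_top sequentially" "(\<lambda>n. boundary_form f g (t n)) \<longlonglongrightarrow> 0"
proof -
  define \<phi> where "\<phi> r = (cmod (f r))\<^sup>2 + (cmod (g r))\<^sup>2" for r
  have cont: "continuous_on {0<..} h" if "h \<in> Delta \<alpha>" for h
    using antiderivative_continuous_on[OF D_spaceD(3)[OF DeltaD(1)[OF that]]] .
  have phi: "continuous_on {0<..} \<phi>" "integrable half_line \<phi>" "\<And>x. 0 \<le> \<phi> x"
    unfolding \<phi>_def[abs_def] using DeltaD(2)[OF f] DeltaD(2)[OF g]
    by (auto intro!: continuous_intros cont f g simp: square_integrable_def)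
  obtain t where t: "\<And>n::nat. real n + 1 + 0 \<le> t n" "\<And>n::nat. t n \<le> real n + 1 + 0 + 1 / 3" "(\<lambda>n. \<phi> (t n)) \<longlonglongrightarrow> 0"
    by (rule exists_points_tendsto_0[OF phi, of 0]) auto
  obtain s where s: "\<And>n::nat. real n + 1 + 2 / 3 \<le> s n" "\<And>n::nat. s n \<le> real n + 1 + 2 / 3 + 1 / 3" "(\<lambda>n. \<phi> (s n)) \<longlonglongrightarrow> 0"
    by (rule exists_points_tendsto_0[OF phi, of "2 / 3"]) auto
  have sqrt_lim: "(\<lambda>n. sqrt (\<phi> (x n))) \<longlonglongrightarrow> 0" if "(\<lambda>n. \<phi> (x n)) \<longlonglongrightarrow> 0" for x :: "nat \<Rightarrow> real"
    using tendsto_real_sqrt[OF that] by simp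
  have le: "cmod (f r) \<le> sqrt (\<phi> r)" "cmod (g r) \<le> sqrt (\<phi> r)" for r
    by (auto intro!: real_le_rsqrt simp: \<phi>_def)
  obtain M where M: "\<And>t y. 1 \<le> t \<Longrightarrow> t \<le> y \<Longrightarrow> y \<le> t + 1 \<Longrightarrow> cmod (D1 f y - D1 f t) \<le> M"
    using D1_oscillation_bounded[OF f] by blast
  obtain N where N: "\<And>t y. 1 \<le> t \<Longrightarrow> t \<le> y \<Longrightarrow> y \<le> t + 1 \<Longrightarrow> cmod (D1 g y - D1 g t) \<le> N"
    using D1_oscillation_bounded[OF g] by blast
  have ts: "1 \<le> t n" "t n + 1 / 3 \<le> s n" "s n \<le> t n + 1" for n
    using t(1)[of n] t(2)[of n] s(1)[of n] s(2)[of n] by auto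
  show thesis
  proof
    show "filterlim t at_top sequentially"
    proof (rule filterlim_at_top_mono[OF filterlim_real_sequentially])
      show "\<forall>\<^sub>F n in sequentially. real n \<le> t n" using t(1) by (intro always_eventually) (smt (verit))
    qed
    define b where "b n = sqrt (\<phi> (t n)) * (3 * (sqrt (\<phi> (s n)) + sqrt (\<phi> (t n)) + N))
      + (3 * (sqrt (\<phi> (s n)) + sqrt (\<phi> (t n)) + M)) * sqrt (\<phi> (t n))" for n
    have "b \<longlonglongrightarrow> 0 * (3 * (0 + 0 + N)) + (3 * (0 + 0 + M)) * 0"
      unfolding b_def[abs_def] by (intro tendsto_intros sqrt_lim t(3) s(3))
    then have b0: "b \<longlonglongrightarrow> 0" by simp
    show "(\<lambda>n. boundary_form f g (t n)) \<longlonglongrightarrow> 0"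
    proof (rule Lim_null_comparison[OF always_eventually b0], rule allI)
      fix n
      have df: "cmod (D1 f (t n)) \<le> 3 * (sqrt (\<phi> (s n)) + sqrt (\<phi> (t n)) + M)"
        using D1_bound[OF DeltaD(1)[OF f] M ts] le(1)[of "s n"] le(1)[of "t n"] by (smt (verit))
      have dg: "cmod (D1 g (t n)) \<le> 3 * (sqrt (\<phi> (s n)) + sqrt (\<phi> (t n)) + N)"
        using D1_bound[OF DeltaD(1)[OF g] N ts] le(2)[of "s n"] le(2)[of "t n"] by (smt (verit))
      have "norm (boundary_form f g (t n)) \<le> cmod (f (t n)) * cmod (D1 g (t n)) + cmod (D1 f (t n)) * cmod (g (t n))"
        unfolding boundary_form_def by (rule order.trans[OF norm_triangle_ineq4]) (simp add: norm_mult)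
      also have "\<dots> \<le> b n"
        unfolding b_def
        by (intro add_mono mult_mono le df dg norm_ge_zero real_sqrt_ge_zero phi(3) order.trans[OF norm_ge_zero df])
      finally show "norm (boundary_form f g (t n)) \<le> b n" .
    qed
  qed
qed

text \<open>The limit at infinity is known to exist, so the single sequence of
  \<open>boundary_form_at_top\<close> identifies it as 0 and the limit at the origin carries the
  whole integral.\<close>

lemma green_formula:
  assumes f: "f \<in> Delta \<alpha>" and g: "g \<in> Delta \<alpha>"
  shows "(boundary_form f g \<longlongrightarrow>
    cinner_l2 (l2_class f) (l2_class (L_expr \<alpha> g)) - cinner_l2 (l2_class (L_expr \<alpha> f)) (l2_class g)) (at_right 0)"
proof -
  note fD = DeltaD[OF f] and gD = DeltaD[OF g]
  let ?k = "\<lambda>r. L_expr \<alpha> f r * cnj (g r) - f r * cnj (L_expr \<alpha> g r)"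
  have i: "integrable half_line (\<lambda>r. L_expr \<alpha> f r * cnj (g r))" "integrable half_line (\<lambda>r. f r * cnj (L_expr \<alpha> g r))"
    using fD gD by (auto intro: integrable_mult_cnj)
  obtain l where l: "(boundary_form f g \<longlongrightarrow> l) (at_right 0)"
    "(boundary_form f g \<longlongrightarrow> l + integral\<^sup>L half_line ?k) at_top"
    using antiderivative_integral_half_line[OF boundary_form_antiderivative[OF fD(1) gD(1)]
        Bochner_Integration.integrable_diff[OF i]] by blast
  obtain t where t: "filterlim t at_top sequentially" "(\<lambda>n. boundary_form f g (t n)) \<longlonglongrightarrow> 0"
    using boundary_form_at_top[OF f g] by blast
  have "l + integral\<^sup>L half_line ?k = 0"
    using LIMSEQ_unique[OF filterlim_compose[OF l(2) t(1)] t(2)] .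
  moreover have "integral\<^sup>L half_line ?k =
      cinner_l2 (l2_class (L_expr \<alpha> f)) (l2_class g) - cinner_l2 (l2_class f) (l2_class (L_expr \<alpha> g))"
    using Bochner_Integration.integral_diff[OF i] fD gD by (simp add: cinner_l2_class)
  ultimately have "l = - (cinner_l2 (l2_class (L_expr \<alpha> f)) (l2_class g) - cinner_l2 (l2_class f) (l2_class (L_expr \<alpha> g)))"
    by (simp only: eq_neg_iff_add_eq_0)
  then have "l = cinner_l2 (l2_class f) (l2_class (L_expr \<alpha> g)) - cinner_l2 (l2_class (L_expr \<alpha> f)) (l2_class g)"
    by simp
  then show ?thesis using l(1) by simp
qed

end

section \<open>Adjoints and closures\<close>

lemma cinner_commute: "cinner_l2 x y = cnj (cinner_l2 y x)"
  by transfer (subst Bochner_Integration.integral_cnj[symmetric], simp add: mult.commute)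

lemma cinner_scaleC_left: "cinner_l2 (scaleC_l2 c x) y = c * cinner_l2 x y"
  by transfer (simp add: mult.assoc)

lemma cinner_scaleC_right: "cinner_l2 x (scaleC_l2 c y) = cnj c * cinner_l2 x y"
  by (subst (1 2) cinner_commute) (simp add: cinner_scaleC_left)

lemma cinner_minus_right: "cinner_l2 x (- y) = - cinner_l2 x y"
  by (simp add: uminus_l2_def cinner_scaleC_right)

text \<open>The topology of \<open>l2\<close> comes from the real inner product, so this reduces
  continuity of the complex one to that of the real one.\<close>

lemma cinner_conv_inner: "cinner_l2 x y = of_real (inner x y) + \<i> * of_real (inner (scaleC_l2 (- \<i>) x) y)"
  by (simp add: inner_l2_def cinner_scaleC_left complex_eq_iff)

lemma continuous_on_cinner_right: "continuous_on S f \<Longrightarrow> continuous_on S (\<lambda>z. cinner_l2 x (f z))"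
  unfolding cinner_conv_inner
  by (intro continuous_on_add continuous_on_mult continuous_on_of_real continuous_on_inner continuous_on_const)

lemma continuous_on_cinner_left:
  assumes "continuous_on S f"
  shows "continuous_on S (\<lambda>z. cinner_l2 (f z) x)"
  by (subst cinner_commute) (intro continuous_on_cnj continuous_on_cinner_right assms)

lemma closed_adjoint_operator: "closed (adjoint_operator T)"
proof -
  have "adjoint_operator T = (\<Inter>(x, y)\<in>T. {p. cinner_l2 y (fst p) = cinner_l2 x (snd p)})"
    by (auto simp: adjoint_operator_def)
  also have "closed \<dots>"
    by (intro closed_INT ballI)
      (auto simp: case_prod_unfold intro!: closed_Collect_eq continuous_on_cinner_right continuous_intros)
  finally show ?thesis .
qed

lemma adjoint_operator_antimono: "S \<subseteq> T \<Longrightarrow> adjoint_operator T \<subseteq> adjoint_operator S"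
  by (auto simp: adjoint_operator_def)

lemma adjoint_operator_closure: "adjoint_operator (closure T) = adjoint_operator T"
proof
  show "adjoint_operator (closure T) \<subseteq> adjoint_operator T"
    by (intro adjoint_operator_antimono closure_subset)
  show "adjoint_operator T \<subseteq> adjoint_operator (closure T)"
  proof
    fix p assume p: "p \<in> adjoint_operator T"
    have "closure T \<subseteq> {q. cinner_l2 (snd q) (fst p) = cinner_l2 (fst q) (snd p)}"
    proof (rule closure_minimal)
      show "T \<subseteq> {q. cinner_l2 (snd q) (fst p) = cinner_l2 (fst q) (snd p)}"
        using p by (auto simp: adjoint_operator_def)
    qed (intro closed_Collect_eq continuous_on_cinner_left continuous_intros)
    then show "p \<in> adjoint_operator (closure T)"
      by (auto simp: adjoint_operator_def)
  qed
qed

lemma scaleR_l2_eq: "a *\<^sub>R x = scaleC_l2 (complex_of_real a) x"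
  by (rule scaleR_l2_def)

lemma subspace_closure:
  fixes S :: "'a::real_normed_vector set"
  assumes "subspace S"
  shows "subspace (closure S)"
  unfolding subspace_def
proof (intro conjI ballI allI)
  show "0 \<in> closure S" using assms closure_subset subspace_0 by blast
  fix x y assume "x \<in> closure S" "y \<in> closure S"
  then obtain f g where "\<And>n. f n \<in> S" "f \<longlonglongrightarrow> x" "\<And>n. g n \<in> S" "g \<longlonglongrightarrow> y"
    unfolding closure_sequential by blast
  then have "(\<forall>n. f n + g n \<in> S) \<and> (\<lambda>n. f n + g n) \<longlonglongrightarrow> x + y"
    using assms by (auto intro: tendsto_add subspace_add)
  then show "x + y \<in> closure S" unfolding closure_sequential by (rule exI[of _ "\<lambda>n. f n + g n"])
next
  fix c :: real and x assume "x \<in> closure S"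
  then obtain f where "\<And>n. f n \<in> S" "f \<longlonglongrightarrow> x"
    unfolding closure_sequential by blast
  then have "(\<forall>n. c *\<^sub>R f n \<in> S) \<and> (\<lambda>n. c *\<^sub>R f n) \<longlonglongrightarrow> c *\<^sub>R x"
    using assms by (auto intro: tendsto_scaleR subspace_scale)
  then show "c *\<^sub>R x \<in> closure S" unfolding closure_sequential by (rule exI[of _ "\<lambda>n. c *\<^sub>R f n"])
qed

text \<open>A point outside the closed graph is separated from it by some (a, b) orthogonal to the
  graph. That orthogonality says that (b, -a) lies in the adjoint, and pairing it with an element of
  the double adjoint makes the latter orthogonal to (a, b), a contradiction.\<close>

lemma double_adjoint_subset_closure:
  assumes T: "linear_operator T"
  shows "adjoint_operator (adjoint_operator T) \<subseteq> closure T"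
proof (rule ccontr)
  assume "\<not> adjoint_operator (adjoint_operator T) \<subseteq> closure T"
  then obtain f k where fk: "(f, k) \<in> adjoint_operator (adjoint_operator T)" "(f, k) \<notin> closure T" by auto
  have sc: "(scaleC_l2 c x, scaleC_l2 c y) \<in> T" if "(x, y) \<in> T" for c x y
    using T that unfolding linear_operator_def by blast
  have ad: "(x + x', y + y') \<in> T" if "(x, y) \<in> T" "(x', y') \<in> T" for x y x' y'
    using T that unfolding linear_operator_def by blast
  have "(0, 0) \<in> T" using T by (simp add: linear_operator_def)
  then have "subspace T"
    unfolding subspace_def using sc ad by (auto simp: zero_prod_def scaleR_l2_eq)
  then have "subspace (closure T)" by (rule subspace_closure)
  from orthogonal_vector_exists[OF this closed_closure fk(2)]
  obtain w where w: "\<And>p. p \<in> closure T \<Longrightarrow> inner p w = 0" "inner (f, k) w \<noteq> 0" by blast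
  obtain a b where ab: "w = (a, b)" by (cases w)
  have re: "Re (cinner_l2 x a + cinner_l2 y b) = 0" if "(x, y) \<in> T" for x y
    using w(1)[of "(x, y)"] closure_subset that by (auto simp: ab inner_l2_def)
  \<comment> \<open>Real orthogonality becomes complex orthogonality because the graph is closed
    under multiplication by -i.\<close>
  have "cinner_l2 x a + cinner_l2 y b = 0" if "(x, y) \<in> T" for x y
    using re[OF that] re[OF sc[OF that, of "- \<i>"]] by (simp add: cinner_scaleC_left complex_eq_iff)
  then have "cinner_l2 y b = cinner_l2 x (- a)" if "(x, y) \<in> T" for x y
    using that by (simp add: cinner_minus_right eq_neg_iff_add_eq_0 add.commute)
  then have "(b, - a) \<in> adjoint_operator T" by (auto simp: adjoint_operator_def)
  then have "cinner_l2 (- a) f = cinner_l2 b k" using fk(1) by (auto simp: adjoint_operator_def)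
  then have "cinner_l2 f (- a) = cinner_l2 k b" by (subst (1 2) cinner_commute) simp
  then have "cinner_l2 f a + cinner_l2 k b = 0" by (simp add: cinner_minus_right add_eq_0_iff)
  then have "inner (f, k) w = 0" by (simp add: ab inner_l2_def) (metis plus_complex.sel(1) zero_complex.sel(1))
  then show False using w(2) by simp
qed

lemma C0_infty_zero: "(\<lambda>_. 0) \<in> C0_infty"
  by (rule C0_inftyI[of _ 1 1]) (auto intro: smooth_algebra_smooth smooth_algebra.const)

lemma C0_infty_square_integrable: "\<phi> \<in> C0_infty \<Longrightarrow> square_integrable \<phi>"
  using C0_infty_subset_Delta DeltaD(2) by blast

text \<open>A vector orthogonal to all test functions vanishes by the fundamental lemma of the
  calculus of variations.\<close>

lemma dense_C0_infty: "closure (l2_class ` C0_infty) = UNIV"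
proof (rule ccontr)
  assume "closure (l2_class ` C0_infty) \<noteq> UNIV"
  then obtain x where x: "x \<notin> closure (l2_class ` C0_infty)" by blast
  have lc: "l2_class f + scaleC_l2 c (l2_class g) \<in> l2_class ` C0_infty" if "f \<in> C0_infty" "g \<in> C0_infty" for f g c
    using C0_infty_lincomb[OF that, of c] that
    by (auto simp: l2_class_scaleC l2_class_add square_integrable_mult C0_infty_square_integrable)
  have z: "0 \<in> l2_class ` C0_infty" using C0_infty_zero by (auto simp: zero_l2_def)
  have "subspace (l2_class ` C0_infty)"
    unfolding subspace_def
  proof (intro conjI ballI allI z)
    fix x y assume "x \<in> l2_class ` C0_infty" "y \<in> l2_class ` C0_infty"
    then show "x + y \<in> l2_class ` C0_infty" using lc[of _ _ 1] scaleR_l2_eq[of 1, symmetric] by auto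
  next
    fix c :: real and x assume "x \<in> l2_class ` C0_infty"
    then show "c *\<^sub>R x \<in> l2_class ` C0_infty"
      using lc[OF C0_infty_zero, of _ "complex_of_real c"] by (auto simp: scaleR_l2_eq zero_l2_def[symmetric])
  qed
  then have "subspace (closure (l2_class ` C0_infty))" by (rule subspace_closure)
  from orthogonal_vector_exists[OF this closed_closure x]
  obtain w where w: "\<And>p. p \<in> closure (l2_class ` C0_infty) \<Longrightarrow> inner p w = 0" "inner x w \<noteq> 0" by blast
  obtain k where k: "square_integrable k" "w = l2_class k" by (rule l2_class_cases)
  have orth: "inner (l2_class \<phi>) w = 0" if "\<phi> \<in> C0_infty" for \<phi>
    using w(1) closure_subset that by blast
  have "AE r in half_line. cnj (k r) = 0"
  proof (rule fundamental_lemma_variations)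
    show "locally_integrable (\<lambda>r. cnj (k r))"
      using k(1) by (intro locally_integrable_cnj square_integrable_imp_locally_integrable)
    fix \<phi> assume phi: "\<phi> \<in> C0_infty"
    have "(\<lambda>r. 0 + (- \<i>) * \<phi> r) \<in> C0_infty" by (intro C0_infty_lincomb C0_infty_zero phi)
    then have i: "(\<lambda>r. (- \<i>) * \<phi> r) \<in> C0_infty" by simp
    have "cinner_l2 (l2_class \<phi>) w = 0"
      unfolding cinner_conv_inner using orth[OF phi] orth[OF i] phi
      by (simp only: l2_class_scaleC C0_infty_square_integrable) (simp add: complex_eq_iff)
    then show "integral\<^sup>L half_line (\<lambda>r. \<phi> r * cnj (k r)) = 0"
      using phi k by (simp add: cinner_l2_class C0_infty_square_integrable)
  qed
  then have "AE r in half_line. k r = 0" by eventually_elim simp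
  then have "w = 0" using k l2_class_eq_iff[OF k(1) square_integrable_zero] by (simp add: zero_l2_def)
  then show False using w(2) by simp
qed

lemma continuous_AE_eq_imp_eq:
  assumes "continuous_on {0<..} f" "continuous_on {0<..} g" "AE r in half_line. f r = (g r :: complex)" "x > 0"
  shows "f x = g x"
proof (rule ccontr)
  assume ne: "f x \<noteq> g x"
  have "open ({0<..} \<inter> (\<lambda>r. f r - g r) -` (- {0}))"
    using assms(1,2) by (intro continuous_open_preimage continuous_intros) auto
  moreover have "{0<..} \<inter> (\<lambda>r. f r - g r) -` (- {0}) = {r. 0 < r \<and> f r \<noteq> g r}" by auto
  ultimately have "open {r. 0 < r \<and> f r \<noteq> g r}" by simp
  moreover have "negligible {r. 0 < r \<and> f r \<noteq> g r}" using assms(3) by (simp add: AE_half_line_iff)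
  ultimately show False using ne assms(4) open_not_negligible by blast
qed

section \<open>Operators given by spaces of functions in \<open>Delta \<alpha>\<close>\<close>

context
  fixes \<alpha> :: real
begin

lemma Delta_continuous: "f \<in> Delta \<alpha> \<Longrightarrow> continuous_on {0<..} f"
  using antiderivative_continuous_on[OF D_spaceD(3)[OF DeltaD(1)]] .

lemma Delta_lincomb:
  assumes f: "f \<in> Delta \<alpha>" and g: "g \<in> Delta \<alpha>"
  shows "(\<lambda>r. f r + c * g r) \<in> Delta \<alpha>"
    "AE r in half_line. L_expr \<alpha> (\<lambda>r. f r + c * g r) r = L_expr \<alpha> f r + c * L_expr \<alpha> g r"
    "\<And>r. r > 0 \<Longrightarrow> D1 (\<lambda>r. f r + c * g r) r = D1 f r + c * D1 g r"
proof -
  note F = D_spaceD[OF DeltaD(1)[OF f]] and G = D_spaceD[OF DeltaD(1)[OF g]]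
  have d: "((\<lambda>r. f r + c * g r) has_vector_derivative D1 f x + c * D1 g x) (at x)" if "x > 0" for x
    by (intro has_vector_derivative_add has_vector_derivative_mult_right F(1) G(1) that)
  have a: "antiderivative (\<lambda>x. D1 f x + c * D1 g x) (\<lambda>x. D1 (D1 f) x + c * D1 (D1 g) x)"
    by (intro antiderivative_add antiderivative_mult_const F(4) G(4))
  show "D1 (\<lambda>r. f r + c * g r) r = D1 f r + c * D1 g r" if "r > 0" for r using D1_eqI[OF d[OF that]] .
  have D: "(\<lambda>r. f r + c * g r) \<in> D_space" using D_spaceI(1)[OF d a] .
  have "AE r in half_line. D1 (D1 (\<lambda>r. f r + c * g r)) r = D1 (D1 f) r + c * D1 (D1 g) r"
    using D_spaceI(3)[OF d a] .
  then show L: "AE r in half_line. L_expr \<alpha> (\<lambda>r. f r + c * g r) r = L_expr \<alpha> f r + c * L_expr \<alpha> g r"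
  proof eventually_elim
    case (elim r)
    have "- (a + c * b) + Q * (F + c * G) = (- a + Q * F) + c * (- b + Q * G)" for a b Q F G :: complex
      by (simp add: algebra_simps)
    then show ?case unfolding L_expr_def elim .
  qed
  have "square_integrable (\<lambda>r. L_expr \<alpha> f r + c * L_expr \<alpha> g r)"
    by (intro square_integrable_add square_integrable_mult DeltaD(3) f g)
  then have "square_integrable (L_expr \<alpha> (\<lambda>r. f r + c * g r))"
    by (rule square_integrable_cong_AE) (use L in eventually_elim, simp)
  then show "(\<lambda>r. f r + c * g r) \<in> Delta \<alpha>"
    using D by (auto simp: Delta_def intro!: square_integrable_add square_integrable_mult DeltaD(2)[OF f] DeltaD(2)[OF g])
qed

text \<open>Functions in \<open>Delta \<alpha>\<close> are continuous, so a class has at most one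
  such representative on the positive axis. This makes \<open>H_op\<close> single-valued and lets
  boundary values be read off from classes.\<close>

lemma H_op_unique:
  assumes "f \<in> Delta \<alpha>" "g \<in> Delta \<alpha>" "l2_class f = l2_class g"
  shows "\<And>r. r > 0 \<Longrightarrow> f r = g r" "\<And>r. r > 0 \<Longrightarrow> D1 f r = D1 g r" "l2_class (L_expr \<alpha> f) = l2_class (L_expr \<alpha> g)"
proof -
  have ae: "AE r in half_line. f r = g r"
    using assms l2_class_eq_iff DeltaD(2) by blast
  show eq: "f r = g r" if "r > 0" for r
    by (rule continuous_AE_eq_imp_eq[OF Delta_continuous[OF assms(1)] Delta_continuous[OF assms(2)] ae that])
  show eq1: "D1 f r = D1 g r" if "r > 0" for r by (rule D1_cong_half_line[OF eq that])
  have "L_expr \<alpha> f r = L_expr \<alpha> g r" if "r > 0" for r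
    using eq[OF that] D1_cong_half_line[OF eq1 that] by (simp add: L_expr_def)
  then have "AE r in half_line. L_expr \<alpha> f r = L_expr \<alpha> g r" by (intro AE_I2) simp
  then show "l2_class (L_expr \<alpha> f) = l2_class (L_expr \<alpha> g)"
    using l2_class_eq_iff[OF DeltaD(3)[OF assms(1)] DeltaD(3)[OF assms(2)]] by simp
qed

lemma H_op_linear:
  assumes Z: "Z \<subseteq> Delta \<alpha>" "Z \<noteq> {}" and lc: "\<And>f g c. f \<in> Z \<Longrightarrow> g \<in> Z \<Longrightarrow> (\<lambda>r. f r + c * g r) \<in> Z"
  shows "linear_operator (H_op \<alpha> Z)"
proof -
  have comb: "(l2_class f + scaleC_l2 c (l2_class g), l2_class (L_expr \<alpha> f) + scaleC_l2 c (l2_class (L_expr \<alpha> g))) \<in> H_op \<alpha> Z"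
    if fg: "f \<in> Z" "g \<in> Z" for f g c
  proof -
    have D: "f \<in> Delta \<alpha>" "g \<in> Delta \<alpha>" using Z fg by auto
    note sq = DeltaD(2,3)[OF D(1)] DeltaD(2,3)[OF D(2)]
    have "l2_class (L_expr \<alpha> (\<lambda>r. f r + c * g r)) = l2_class (\<lambda>r. L_expr \<alpha> f r + c * L_expr \<alpha> g r)"
      using DeltaD(3)[OF Delta_lincomb(1)[OF D, of c]] Delta_lincomb(2)[OF D, of c] sq
      by (subst l2_class_eq_iff) (auto intro!: square_integrable_add square_integrable_mult)
    then show ?thesis unfolding H_op_def using lc[OF fg, of c] sq
      by (auto simp: l2_class_scaleC l2_class_add square_integrable_mult intro!: exI[of _ "\<lambda>r. f r + c * g r"])
  qed
  have one: "scaleC_l2 1 x = x" for x using scaleR_l2_eq[of 1 x] by simp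
  have cancel: "x + scaleC_l2 (-1) x = 0" for x using uminus_l2_def[of x] by (metis add.right_inverse)
  \<comment> \<open>The closure assumption is about f + c g only; scaling is obtained as x + (c - 1)
    x and addition with c = 1.\<close>
  have expand: "x + scaleC_l2 (c - 1) x = scaleC_l2 c x" for x c
  proof -
    obtain f where f: "square_integrable f" "x = l2_class f" by (rule l2_class_cases)
    have "(\<lambda>r. f r + (c - 1) * f r) = (\<lambda>r. c * f r)" by (auto simp: algebra_simps)
    then show ?thesis using f by (simp add: l2_class_scaleC l2_class_add square_integrable_mult)
  qed
  show ?thesis
    unfolding linear_operator_def
  proof (intro conjI ballI allI)
    show "single_valued (H_op \<alpha> Z)"
      unfolding single_valued_def H_op_def using Z(1) H_op_unique(3) by auto
    obtain f where "f \<in> Z" using Z(2) by blast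
    from comb[OF this this, of "-1"] show "(0, 0) \<in> H_op \<alpha> Z" by (simp add: cancel)
    fix p assume "p \<in> H_op \<alpha> Z"
    then obtain f where f: "f \<in> Z" "p = (l2_class f, l2_class (L_expr \<alpha> f))" by (auto simp: H_op_def)
    show "case p of (x, y) \<Rightarrow> (scaleC_l2 c x, scaleC_l2 c y) \<in> H_op \<alpha> Z" for c
      using comb[OF f(1) f(1), of "c - 1"] by (simp add: f(2) expand)
    show "case p of (x, y) \<Rightarrow> \<forall>(x', y')\<in>H_op \<alpha> Z. (x + x', y + y') \<in> H_op \<alpha> Z"
      using comb[OF f(1), of _ 1] by (auto simp: f(2) one H_op_def[of _ Z])
  qed
qed

lemma H_op_densely_defined:
  assumes "C0_infty \<subseteq> Z"
  shows "densely_defined (H_op \<alpha> Z)"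
proof -
  have "l2_class ` C0_infty \<subseteq> Domain (H_op \<alpha> Z)" using assms by (auto simp: H_op_def)
  then show ?thesis unfolding densely_defined_def using dense_C0_infty closure_mono by blast
qed

lemma H_op_mono: "Y \<subseteq> Z \<Longrightarrow> H_op \<alpha> Y \<subseteq> H_op \<alpha> Z"
  by (auto simp: H_op_def)

lemma boundary_form_C0_infty:
  assumes "\<phi> \<in> C0_infty"
  shows "\<forall>\<^sub>F r in at_right 0. boundary_form \<phi> g r = 0"
proof -
  obtain a b where ab: "0 < a" "a < b" "\<And>r. r > 0 \<Longrightarrow> r \<le> a \<or> b \<le> r \<Longrightarrow> \<phi> r = 0"
    using C0_inftyD[OF assms] by blast
  obtain a' b' where ab': "0 < a'" "a' < b'" "\<And>r. r > 0 \<Longrightarrow> r \<le> a' \<or> b' \<le> r \<Longrightarrow> D1 \<phi> r = 0"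
    using C0_inftyD[OF C0_infty_derivative(1)[OF assms]] by blast
  show ?thesis
    using eventually_at_right_real[OF ab(1)] eventually_at_right_real[OF ab'(1)]
    by eventually_elim (use ab ab' in \<open>auto simp: boundary_form_def\<close>)
qed

text \<open>One inclusion is \<open>weak_solution\<close>; the other is Green's formula, where the
  boundary form vanishes near 0 together with the test function.\<close>

theorem adjoint_H_op_C0_infty: "adjoint_operator (H_op \<alpha> C0_infty) = H_op \<alpha> (Delta \<alpha>)"
proof
  show "adjoint_operator (H_op \<alpha> C0_infty) \<subseteq> H_op \<alpha> (Delta \<alpha>)"
  proof
    fix p assume p: "p \<in> adjoint_operator (H_op \<alpha> C0_infty)"
    obtain u where u: "square_integrable u" "fst p = l2_class u" by (rule l2_class_cases)
    obtain v where v: "square_integrable v" "snd p = l2_class v" by (rule l2_class_cases)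
    have "integral\<^sup>L half_line (\<lambda>r. L_expr \<alpha> \<phi> r * cnj (u r)) = integral\<^sup>L half_line (\<lambda>r. \<phi> r * cnj (v r))"
      if phi: "\<phi> \<in> C0_infty" for \<phi>
    proof -
      have D: "\<phi> \<in> Delta \<alpha>" using C0_infty_subset_Delta phi by blast
      have "cinner_l2 (l2_class (L_expr \<alpha> \<phi>)) (l2_class u) = cinner_l2 (l2_class \<phi>) (l2_class v)"
      proof -
        have "\<forall>(x, y)\<in>H_op \<alpha> C0_infty. cinner_l2 y (fst p) = cinner_l2 x (snd p)"
          using p by (auto simp: adjoint_operator_def)
        moreover have "(l2_class \<phi>, l2_class (L_expr \<alpha> \<phi>)) \<in> H_op \<alpha> C0_infty"
          using phi by (auto simp: H_op_def)
        ultimately show ?thesis unfolding u v by blast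
      qed
      then show ?thesis using DeltaD[OF D] u v by (simp add: cinner_l2_class)
    qed
    then obtain g where g: "g \<in> Delta \<alpha>" "AE r in half_line. u r = g r" "AE r in half_line. v r = L_expr \<alpha> g r"
      using weak_solution[OF u(1) v(1), of \<alpha>] by blast
    have "fst p = l2_class g" "snd p = l2_class (L_expr \<alpha> g)"
      using g u v DeltaD[OF g(1)] l2_class_eq_iff by auto
    then show "p \<in> H_op \<alpha> (Delta \<alpha>)" using g(1) by (cases p) (auto simp: H_op_def)
  qed
  show "H_op \<alpha> (Delta \<alpha>) \<subseteq> adjoint_operator (H_op \<alpha> C0_infty)"
  proof
    fix p assume "p \<in> H_op \<alpha> (Delta \<alpha>)"
    then obtain g where g: "g \<in> Delta \<alpha>" "p = (l2_class g, l2_class (L_expr \<alpha> g))" by (auto simp: H_op_def)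
    have "cinner_l2 (l2_class (L_expr \<alpha> \<phi>)) (l2_class g) = cinner_l2 (l2_class \<phi>) (l2_class (L_expr \<alpha> g))"
      if phi: "\<phi> \<in> C0_infty" for \<phi>
    proof -
      have D: "\<phi> \<in> Delta \<alpha>" using C0_infty_subset_Delta phi by blast
      have "(boundary_form \<phi> g \<longlongrightarrow> 0) (at_right 0)"
        using boundary_form_C0_infty[OF phi] by (rule tendsto_eventually)
      from tendsto_unique[OF _ green_formula[OF D g(1)] this] show ?thesis by simp
    qed
    then show "p \<in> adjoint_operator (H_op \<alpha> C0_infty)"
      by (auto simp: adjoint_operator_def H_op_def g(2))
  qed
qed

lemma C0_infty_linear: "linear_operator (H_op \<alpha> C0_infty)"
  using C0_infty_zero by (intro H_op_linear C0_infty_subset_Delta C0_infty_lincomb) auto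

lemma Delta_linear: "linear_operator (H_op \<alpha> (Delta \<alpha>))"
  using C0_infty_zero C0_infty_subset_Delta by (intro H_op_linear Delta_lincomb(1)) auto

text \<open>A symmetric maximal operator is contained in its own adjoint, which is the double
  adjoint of the minimal operator and so lies in the closure. The reverse inclusion holds because
  adjoints are closed.\<close>

lemma h_op_self_adjoint_if_boundary_form_vanishes:
  assumes "\<And>f g. f \<in> Delta \<alpha> \<Longrightarrow> g \<in> Delta \<alpha> \<Longrightarrow> (boundary_form f g \<longlongrightarrow> 0) (at_right 0)"
  shows "self_adjoint (h_op \<alpha>)"
proof -
  have sym: "cinner_l2 (l2_class (L_expr \<alpha> f)) (l2_class g) = cinner_l2 (l2_class f) (l2_class (L_expr \<alpha> g))"
    if "f \<in> Delta \<alpha>" "g \<in> Delta \<alpha>" for f g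
    using tendsto_unique[OF _ green_formula[OF that] assms[OF that]] by simp
  have "H_op \<alpha> (Delta \<alpha>) \<subseteq> adjoint_operator (adjoint_operator (H_op \<alpha> C0_infty))"
    unfolding adjoint_H_op_C0_infty using sym by (auto simp: adjoint_operator_def H_op_def)
  also have "\<dots> \<subseteq> h_op \<alpha>" unfolding h_op_def by (rule double_adjoint_subset_closure[OF C0_infty_linear])
  finally have 1: "H_op \<alpha> (Delta \<alpha>) \<subseteq> h_op \<alpha>" .
  have "closed (H_op \<alpha> (Delta \<alpha>))"
    unfolding adjoint_H_op_C0_infty[symmetric] by (rule closed_adjoint_operator)
  then have "h_op \<alpha> \<subseteq> H_op \<alpha> (Delta \<alpha>)"
    unfolding h_op_def by (intro closure_minimal H_op_mono C0_infty_subset_Delta)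
  with 1 have eq: "h_op \<alpha> = H_op \<alpha> (Delta \<alpha>)" by blast
  have "adjoint_operator (h_op \<alpha>) = h_op \<alpha>"
    unfolding h_op_def adjoint_operator_closure adjoint_H_op_C0_infty using eq h_op_def by simp
  then show ?thesis
    using Delta_linear H_op_densely_defined[OF C0_infty_subset_Delta] eq by (simp add: self_adjoint_def)
qed

end

section \<open>Boundary values at the origin\<close>

text \<open>The Wronskian of \<open>y\<close> and \<open>f\<close> with the derivative of
  \<open>y\<close> as a separate argument, so that explicit formulas can be inserted for it; there
  is no conjugation.\<close>

definition solution_pairing :: "(real \<Rightarrow> complex) \<Rightarrow> (real \<Rightarrow> complex) \<Rightarrow> (real \<Rightarrow> complex) \<Rightarrow> real \<Rightarrow> complex" where
  "solution_pairing y y' f r = y r * D1 f r - y' r * f r"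

definition zero_energy_solution :: "real \<Rightarrow> (real \<Rightarrow> complex) \<Rightarrow> (real \<Rightarrow> complex) \<Rightarrow> bool" where
  "zero_energy_solution \<alpha> y y' \<longleftrightarrow> (\<forall>x>0. (y has_vector_derivative y' x) (at x) \<and>
     (y' has_vector_derivative of_real ((\<alpha> - 1 / 4) / x\<^sup>2) * y x) (at x))"

lemma zero_energy_solution_continuous:
  assumes "zero_energy_solution \<alpha> y y'"
  shows "continuous_on {0<..} y" "continuous_on {0<..} y'"
  using assms unfolding zero_energy_solution_def
  by (auto intro!: continuous_at_imp_continuous_on has_vector_derivative_continuous)

text \<open>Because \<open>y\<close> solves the equation at energy zero, the potential terms cancel.
  Existence of the limit at 0 thus depends only on integrability of \<open>y\<close> times
  \<open>L_expr \<alpha> f\<close>.\<close>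

lemma solution_pairing_antiderivative:
  assumes y: "zero_energy_solution \<alpha> y y'" and f: "f \<in> D_space"
  shows "antiderivative (solution_pairing y y' f) (\<lambda>r. - (y r * L_expr \<alpha> f r))"
proof -
  have a1: "antiderivative y y'"
    using y zero_energy_solution_continuous[OF y]
    by (intro antiderivative_if_C1) (auto simp: zero_energy_solution_def)
  have a2: "antiderivative y' (\<lambda>x. of_real ((\<alpha> - 1 / 4) / x\<^sup>2) * y x)"
  proof (rule antiderivative_if_C1)
    show "continuous_on {0<..} (\<lambda>x. complex_of_real ((\<alpha> - 1 / 4) / x\<^sup>2) * y x)"
      by (intro continuous_intros zero_energy_solution_continuous[OF y]) auto
  qed (use y in \<open>auto simp: zero_energy_solution_def\<close>)
  have "antiderivative (\<lambda>r. y r * D1 f r - y' r * f r)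
     (\<lambda>r. (y r * D1 (D1 f) r + y' r * D1 f r) - (y' r * D1 f r + of_real ((\<alpha> - 1 / 4) / r\<^sup>2) * y r * f r))"
    by (intro antiderivative_diff antiderivative_mult D_spaceD(3,4) f a1 a2)
  moreover have "(y r * D1 (D1 f) r + y' r * D1 f r) - (y' r * D1 f r + of_real ((\<alpha> - 1 / 4) / r\<^sup>2) * y r * f r)
      = - (y r * L_expr \<alpha> f r)" for r
    by (simp only: L_expr_def) (simp add: algebra_simps del: of_real_diff of_real_divide)
  ultimately show ?thesis by (simp add: solution_pairing_def[abs_def])
qed

text \<open>The assumption is the indicial equation; its roots are 1/2 plus and minus the square
  root of \<alpha>.\<close>

lemma powr_zero_energy_solution:
  assumes "p * (p - 1) = \<alpha> - 1 / 4"
  shows "zero_energy_solution \<alpha> (\<lambda>r. of_real (r powr p)) (\<lambda>r. of_real (p * r powr (p - 1)))"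
  unfolding zero_energy_solution_def
proof (intro allI impI conjI)
  fix x :: real assume x: "x > 0"
  have "((\<lambda>r. r powr p) has_real_derivative p * x powr (p - 1)) (at x)"
    using x by (rule has_real_derivative_powr)
  then show "((\<lambda>r. complex_of_real (r powr p)) has_vector_derivative of_real (p * x powr (p - 1))) (at x)"
    by (rule has_vector_derivative_of_real)
  have "((\<lambda>r. p * r powr (p - 1)) has_real_derivative p * ((p - 1) * x powr (p - 1 - 1))) (at x)"
    by (intro DERIV_cmult has_real_derivative_powr x)
  moreover have "p * ((p - 1) * x powr (p - 1 - 1)) = (\<alpha> - 1 / 4) / x\<^sup>2 * x powr p"
  proof -
    have "x powr (p - 1 - 1) = x powr p / x\<^sup>2"
      using x powr_diff[of x p 2] by simp
    then show ?thesis by (simp add: assms[symmetric])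
  qed
  ultimately have "((\<lambda>r. p * r powr (p - 1)) has_real_derivative (\<alpha> - 1 / 4) / x\<^sup>2 * x powr p) (at x)" by simp
  then have "((\<lambda>r. complex_of_real (p * r powr (p - 1))) has_vector_derivative of_real ((\<alpha> - 1 / 4) / x\<^sup>2 * x powr p)) (at x)"
    by (rule has_vector_derivative_of_real)
  then show "((\<lambda>r. complex_of_real (p * r powr (p - 1))) has_vector_derivative
      of_real ((\<alpha> - 1 / 4) / x\<^sup>2) * of_real (x powr p)) (at x)"
    by (simp only: of_real_mult)
qed

lemma Ioc_lmeasurable: "{0<..1::real} \<in> lmeasurable"
  by (intro bounded_set_imp_lmeasurable bounded_subset[OF bounded_closed_interval[of 0 1]]) auto

lemma square_integrable_absolutely_integrable_near_0:
  assumes "square_integrable k"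
  shows "k absolutely_integrable_on {0<..1}" "(\<lambda>r. (cmod (k r))\<^sup>2) absolutely_integrable_on {0<..1}"
proof -
  show k2: "(\<lambda>r. (cmod (k r))\<^sup>2) absolutely_integrable_on {0<..1}"
  proof (rule set_integrable_subset)
    show "(\<lambda>r. (cmod (k r))\<^sup>2) absolutely_integrable_on {0<..}"
      using assms by (simp add: square_integrable_def integrable_restrict_space set_integrable_def)
  qed auto
  have m: "k \<in> borel_measurable (lebesgue_on {0<..1})"
  proof (rule measurable_restrict_mono)
    show "k \<in> borel_measurable half_line" using assms by (simp add: square_integrable_def)
  qed auto
  show "k absolutely_integrable_on {0<..1}"
  proof (rule measurable_bounded_by_integrable_imp_absolutely_integrable[OF m])
    show "(\<lambda>r. 1 + (cmod (k r))\<^sup>2) integrable_on {0<..1}"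
      using k2 by (intro integrable_add) (auto simp: absolutely_integrable_on_def intro!: integrable_on_const Ioc_lmeasurable)
    fix x
    have "0 \<le> (cmod (k x) - 1 / 2)\<^sup>2" by simp
    then show "norm (k x) \<le> 1 + (cmod (k x))\<^sup>2" by (simp add: power2_eq_square algebra_simps)
  qed auto
qed

lemma mult_absolutely_integrable_near_0:
  assumes y: "continuous_on {0<..} y" "(\<lambda>r. (cmod (y r))\<^sup>2) absolutely_integrable_on {0<..1}"
    and k: "square_integrable k"
  shows "(\<lambda>r. y r * k r) absolutely_integrable_on {0<..1}"
proof (rule measurable_bounded_by_integrable_imp_absolutely_integrable)
  have "k \<in> borel_measurable (lebesgue_on {0<..1})"
  proof (rule measurable_restrict_mono)
    show "k \<in> borel_measurable half_line" using k by (simp add: square_integrable_def)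
  qed auto
  moreover have "y \<in> borel_measurable (lebesgue_on {0<..1})"
    by (rule continuous_imp_measurable_on_sets_lebesgue[OF continuous_on_subset[OF y(1)]]) auto
  ultimately show "(\<lambda>r. y r * k r) \<in> borel_measurable (lebesgue_on {0<..1})" by simp
  show "(\<lambda>r. (cmod (y r))\<^sup>2 + (cmod (k r))\<^sup>2) integrable_on {0<..1}"
    using y(2) square_integrable_absolutely_integrable_near_0(2)[OF k]
    by (intro integrable_add) (auto simp: absolutely_integrable_on_def)
  fix r
  have "2 * (cmod (y r) * cmod (k r)) \<le> (cmod (y r))\<^sup>2 + (cmod (k r))\<^sup>2"
    using sum_squares_bound[of "cmod (y r)" "cmod (k r)"] by simp
  moreover have "0 \<le> cmod (y r) * cmod (k r)" by simp
  ultimately show "norm (y r * k r) \<le> (cmod (y r))\<^sup>2 + (cmod (k r))\<^sup>2" unfolding norm_mult by linarith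
qed auto

text \<open>The factor besides \<open>Y\<close> does not depend on s and r, so a bound of the
  solution on [s, r] becomes a rate for the pairing.\<close>

lemma solution_pairing_increment:
  assumes y: "zero_energy_solution \<alpha> y y'" and f: "f \<in> Delta \<alpha>" and sr: "0 < s" "s \<le> r" "r \<le> 1"
    and Y: "\<And>x. s \<le> x \<Longrightarrow> x \<le> r \<Longrightarrow> cmod (y x) \<le> Y" and "0 \<le> Y"
  shows "cmod (solution_pairing y y' f r - solution_pairing y y' f s) \<le>
    Y * integral {0<..1} (\<lambda>x. cmod (L_expr \<alpha> f x))"
proof -
  let ?k = "L_expr \<alpha> f"
  have k: "(\<lambda>x. cmod (?k x)) integrable_on {0<..1}"
    using square_integrable_absolutely_integrable_near_0(1)[OF DeltaD(3)[OF f]] by (simp add: absolutely_integrable_on_def)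
  have s: "{s..r} \<subseteq> {0<..1}" using sr by auto
  have k': "(\<lambda>x. cmod (?k x)) integrable_on {s..r}"
    using set_integrable_subset[OF square_integrable_absolutely_integrable_near_0(1)[OF DeltaD(3)[OF f]] _ s]
    by (simp add: absolutely_integrable_on_def)
  have hi: "((\<lambda>x. - (y x * ?k x)) has_integral solution_pairing y y' f r - solution_pairing y y' f s) {s..r}"
    using antiderivativeD(2)[OF solution_pairing_antiderivative[OF y DeltaD(1)[OF f]] sr(1,2)] .
  have "norm (integral {s..r} (\<lambda>x. - (y x * ?k x))) \<le> integral {s..r} (\<lambda>x. Y * cmod (?k x))"
  proof (rule integral_norm_bound_integral)
    show "(\<lambda>x. - (y x * ?k x)) integrable_on {s..r}" using hi by (rule has_integral_integrable)
    show "(\<lambda>x. Y * cmod (?k x)) integrable_on {s..r}" using k' by (rule integrable_on_mult_right)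
    fix x assume "x \<in> {s..r}"
    then show "norm (- (y x * ?k x)) \<le> Y * cmod (?k x)"
      using Y[of x] by (simp add: norm_mult mult_right_mono)
  qed
  also have "integral {s..r} (\<lambda>x. Y * cmod (?k x)) = Y * integral {s..r} (\<lambda>x. cmod (?k x))"
    by simp
  also have "\<dots> \<le> Y * integral {0<..1} (\<lambda>x. cmod (?k x))"
    using \<open>0 \<le> Y\<close> by (intro mult_left_mono integral_subset_le s k k') auto
  finally show ?thesis by (simp only: integral_unique[OF hi])
qed

section \<open>The limit-point case\<close>

lemma inverse_not_absolutely_integrable: "\<not> (\<lambda>r. complex_of_real (1 / r)) absolutely_integrable_on {0<..1}"
proof
  assume i: "(\<lambda>r. complex_of_real (1 / r)) absolutely_integrable_on {0<..1}"
  \<comment> \<open>Integrability would give the logarithm a finite limit at 0.\<close>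
  have "antiderivative (\<lambda>r. complex_of_real (ln r)) (\<lambda>r. complex_of_real (1 / r))"
  proof (rule antiderivative_if_C1)
    fix x :: real assume "x > 0"
    then have "(ln has_real_derivative 1 / x) (at x)" by (rule DERIV_ln_divide)
    then show "((\<lambda>r. complex_of_real (ln r)) has_vector_derivative complex_of_real (1 / x)) (at x)"
      by (rule has_vector_derivative_of_real)
  qed (auto intro!: continuous_intros)
  from antiderivative_tendsto_0[OF this i]
  obtain l where "((\<lambda>r. complex_of_real (ln r)) \<longlongrightarrow> l) (at_right 0)" by auto
  from tendsto_Re[OF this] have "(ln \<longlongrightarrow> Re l) (at_right (0::real))" by simp
  then show False using not_tendsto_and_filterlim_at_infinity[OF _ _ filterlim_at_bot_imp_at_infinity[OF ln_at_0]]
    by (meson trivial_limit_at_right_real)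
qed

text \<open>The Pluecker relation for the 2 by 2 minors of the matrix with columns (a, a'), (b, b'),
  (f, f') and (g, g').\<close>

lemma wronskian_identity:
  fixes a a' b b' f f' g g' :: complex
  shows "(a * b' - a' * b) * (f * g' - f' * g) =
    (a * f' - a' * f) * (b * g' - b' * g) - (b * f' - b' * f) * (a * g' - a' * g)"
  by (simp add: algebra_simps)

text \<open>For \<open>\<alpha> \<ge> 1\<close> the solution \<open>r powr (1/2 - \<kappa>)\<close> is not square-integrable at the origin, so the
  pairing with the other solution has limit zero, at the rate given by \<open>r powr (1/2 + \<kappa>)\<close>.\<close>

lemma limit_point_estimates:
  assumes \<alpha>: "\<alpha> \<ge> 1" and f: "f \<in> Delta \<alpha>"
  defines "\<kappa> \<equiv> sqrt \<alpha>"
  defines "P \<equiv> solution_pairing (\<lambda>r. of_real (r powr (1 / 2 + \<kappa>))) (\<lambda>r. of_real ((1 / 2 + \<kappa>) * r powr (1 / 2 + \<kappa> - 1))) f"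
  defines "Q \<equiv> solution_pairing (\<lambda>r. of_real (r powr (1 / 2 - \<kappa>))) (\<lambda>r. of_real ((1 / 2 - \<kappa>) * r powr (1 / 2 - \<kappa> - 1))) f"
  obtains C where "C \<ge> 0" "\<And>r. 0 < r \<Longrightarrow> r \<le> 1 \<Longrightarrow> cmod (P r) \<le> C * r powr (1 / 2 + \<kappa>)"
    "\<And>r. 0 < r \<Longrightarrow> r \<le> 1 \<Longrightarrow> cmod (Q r) \<le> C * r powr (1 / 2 - \<kappa>)"
proof -
  have \<kappa>: "\<kappa> \<ge> 1" "\<kappa> * \<kappa> = \<alpha>" using \<alpha> by (auto simp: \<kappa>_def)
  have sol: "zero_energy_solution \<alpha> (\<lambda>r. of_real (r powr (1 / 2 + \<kappa>))) (\<lambda>r. of_real ((1 / 2 + \<kappa>) * r powr (1 / 2 + \<kappa> - 1)))"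
    "zero_energy_solution \<alpha> (\<lambda>r. of_real (r powr (1 / 2 - \<kappa>))) (\<lambda>r. of_real ((1 / 2 - \<kappa>) * r powr (1 / 2 - \<kappa> - 1)))"
    by (rule powr_zero_energy_solution, use \<kappa>(2) in \<open>simp add: algebra_simps\<close>)+
  define H where "H = integral {0<..1} (\<lambda>x. cmod (L_expr \<alpha> f x))"
  have H0: "H \<ge> 0" unfolding H_def by (intro Henstock_Kurzweil_Integration.integral_nonneg)
      (use square_integrable_absolutely_integrable_near_0(1)[OF DeltaD(3)[OF f]] in \<open>auto simp: absolutely_integrable_on_def\<close>)
  \<comment> \<open>The exponent is positive, so the solution is largest at the right endpoint
    \<open>r\<close> of the interval.\<close>
  have incP: "cmod (P r - P s) \<le> r powr (1 / 2 + \<kappa>) * H" if "0 < s" "s \<le> r" "r \<le> 1" for r s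
    unfolding P_def H_def using that \<kappa>
    by (intro solution_pairing_increment[OF sol(1) f]) (auto intro!: powr_mono2)
  \<comment> \<open>Here the exponent is negative, and on [r, 1] the solution is largest at the left
    endpoint \<open>r\<close>.\<close>
  have incQ: "cmod (Q 1 - Q r) \<le> r powr (1 / 2 - \<kappa>) * H" if "0 < r" "r \<le> 1" for r
    unfolding Q_def H_def using that \<kappa>
    by (intro solution_pairing_increment[OF sol(2) f]) (auto intro!: powr_mono2')
  define K where "K = cmod (Q 1) + H"
  have K0: "K \<ge> 0" using H0 by (simp add: K_def)
  have ge1: "1 \<le> r powr (1 / 2 - \<kappa>)" if "0 < r" "r \<le> 1" for r
  proof -
    have "1 powr (1 / 2 - \<kappa>) \<le> r powr (1 / 2 - \<kappa>)" using that \<kappa> by (intro powr_mono2') auto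
    then show ?thesis by simp
  qed
  have Qb: "cmod (Q r) \<le> K * r powr (1 / 2 - \<kappa>)" if r: "0 < r" "r \<le> 1" for r
  proof -
    have "cmod (Q r) \<le> cmod (Q 1) + cmod (Q 1 - Q r)"
      using norm_triangle_ineq4[of "Q 1" "Q 1 - Q r"] by simp
    also have "\<dots> \<le> cmod (Q 1) * r powr (1 / 2 - \<kappa>) + r powr (1 / 2 - \<kappa>) * H"
      using incQ[OF r] ge1[OF r] by (intro add_mono) (auto simp: mult_le_cancel_left1)
    finally show ?thesis by (simp add: K_def algebra_simps)
  qed
  have k_int: "L_expr \<alpha> f absolutely_integrable_on {0<..1}"
    using square_integrable_absolutely_integrable_near_0(1)[OF DeltaD(3)[OF f]] .
  have "(\<lambda>r. of_real (r powr (1 / 2 + \<kappa>)) * L_expr \<alpha> f r) absolutely_integrable_on {0<..1}"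
  proof (rule absolutely_integrable_bounded_measurable_product[OF bilinear_times _ _ _ k_int])
    show "(\<lambda>r. complex_of_real (r powr (1 / 2 + \<kappa>))) \<in> borel_measurable (lebesgue_on {0<..1})"
      using zero_energy_solution_continuous(1)[OF sol(1)]
      by (intro continuous_imp_measurable_on_sets_lebesgue) (auto intro: continuous_on_subset)
    show "bounded ((\<lambda>r. complex_of_real (r powr (1 / 2 + \<kappa>))) ` {0<..1})"
      unfolding bounded_iff using \<kappa> by (intro exI[of _ 1]) (auto intro!: powr_le1)
  qed auto
  then have "(\<lambda>r. - (of_real (r powr (1 / 2 + \<kappa>)) * L_expr \<alpha> f r)) absolutely_integrable_on {0<..1}"
    by (simp add: set_integrable_def)
  from antiderivative_tendsto_0[OF solution_pairing_antiderivative[OF sol(1) DeltaD(1)[OF f]] this]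
  obtain p0 where p0: "(P \<longlongrightarrow> p0) (at_right 0)" by (auto simp: P_def)
  have Pb: "cmod (P r - p0) \<le> r powr (1 / 2 + \<kappa>) * H" if r: "0 < r" "r \<le> 1" for r
  proof (rule tendsto_upperbound)
    show "((\<lambda>s. cmod (P r - P s)) \<longlongrightarrow> cmod (P r - p0)) (at_right 0)" by (intro tendsto_intros p0)
    show "\<forall>\<^sub>F s in at_right 0. cmod (P r - P s) \<le> r powr (1 / 2 + \<kappa>) * H"
      using eventually_at_right_real[OF r(1)] by eventually_elim (use incP r in auto)
  qed simp
  have "p0 = 0"
  proof (rule ccontr)
    assume p0ne: "p0 \<noteq> 0"
    define c where "c = cmod p0"
    have c: "c > 0" using p0ne by (simp add: c_def)
    \<comment> \<open>Eliminating the derivative of f from \<open>P\<close> and \<open>Q\<close>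
      gives b P - a Q = -2 \<kappa> f, where a Q stays bounded. So a nonzero limit of
      \<open>P\<close> would force f to be at least of the order of the singular solution b.\<close>
    have bound: "c * r powr (1 / 2 - \<kappa>) \<le> 2 * \<kappa> * cmod (f r) + (H + K)" if r: "0 < r" "r \<le> 1" for r
    proof -
      define a where "a = r powr (1 / 2 + \<kappa>)"
      define b where "b = r powr (1 / 2 - \<kappa>)"
      define a' where "a' = (1 / 2 + \<kappa>) * r powr (1 / 2 + \<kappa> - 1)"
      define b' where "b' = (1 / 2 - \<kappa>) * r powr (1 / 2 - \<kappa> - 1)"
      have ab: "a * b = r" using r(1) by (simp add: a_def b_def powr_add[symmetric])
      have "r powr (1 / 2 + \<kappa>) * r powr (1 / 2 - \<kappa> - 1) = 1" "r powr (1 / 2 + \<kappa> - 1) * r powr (1 / 2 - \<kappa>) = 1"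
        using r(1) by (simp_all add: powr_add[symmetric])
      then have W: "a * b' - a' * b = - (2 * \<kappa>)" by (simp add: a_def b_def a'_def b'_def algebra_simps)
      have a0: "0 \<le> a" "0 \<le> b" by (auto simp: a_def b_def)
      have "of_real b * P r - of_real a * Q r = complex_of_real (a * b' - a' * b) * f r"
        by (simp add: P_def Q_def solution_pairing_def a_def b_def a'_def b'_def algebra_simps)
      then have "of_real b * p0 = of_real (- (2 * \<kappa>)) * f r + of_real a * Q r - of_real b * (P r - p0)"
        unfolding W by (simp add: algebra_simps)
      then have "b * c = cmod (of_real (- (2 * \<kappa>)) * f r + of_real a * Q r - of_real b * (P r - p0))"
        using a0 by (metis abs_of_nonneg c_def norm_mult norm_of_real)
      also have "\<dots> \<le> cmod (of_real (- (2 * \<kappa>)) * f r) + cmod (of_real a * Q r) + cmod (of_real b * (P r - p0))"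
        by (intro order.trans[OF norm_triangle_ineq4] add_mono norm_triangle_ineq order_refl)
      also have "\<dots> = 2 * \<kappa> * cmod (f r) + a * cmod (Q r) + b * cmod (P r - p0)"
        using a0 \<kappa> by (simp add: norm_mult)
      also have "\<dots> \<le> 2 * \<kappa> * cmod (f r) + a * (K * b) + b * (a * H)"
        using Qb[OF r] Pb[OF r] a0 \<kappa> by (intro add_mono mult_left_mono) (auto simp: a_def b_def)
      also have "a * (K * b) + b * (a * H) = r * (H + K)" using ab by (simp add: algebra_simps)
      then have "2 * \<kappa> * cmod (f r) + a * (K * b) + b * (a * H) = 2 * \<kappa> * cmod (f r) + r * (H + K)" by simp
      also have "r * (H + K) \<le> 1 * (H + K)" using r H0 K0 by (intro mult_right_mono) auto
      finally show ?thesis by (simp add: b_def mult.commute)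
    qed
    \<comment> \<open>As \<kappa> \<ge> 1, the singular solution dominates
      \<open>r powr (- (1 / 2))\<close>; squaring bounds 1 / r by an integrable function.\<close>
    have sq: "cmod (complex_of_real (1 / r)) \<le> (8 * \<kappa>\<^sup>2 / c\<^sup>2) * (cmod (f r))\<^sup>2 + 2 * (H + K)\<^sup>2 / c\<^sup>2"
      if "r \<in> {0<..1}" for r
    proof -
      have r: "0 < r" "r \<le> 1" using that by auto
      have "r powr (- (1 / 2)) \<le> r powr (1 / 2 - \<kappa>)" using r \<kappa> by (intro powr_mono') auto
      then have "c * r powr (- (1 / 2)) \<le> 2 * \<kappa> * cmod (f r) + (H + K)"
        using bound[OF r] c by (smt (verit) mult_left_mono)
      then have "(c * r powr (- (1 / 2)))\<^sup>2 \<le> (2 * \<kappa> * cmod (f r) + (H + K))\<^sup>2"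
        using c by (intro power_mono) auto
      also have "\<dots> \<le> 2 * (2 * \<kappa> * cmod (f r))\<^sup>2 + 2 * (H + K)\<^sup>2"
        using sum_squares_bound[of "2 * \<kappa> * cmod (f r)" "H + K"] by (simp add: power2_sum)
      also have "(c * r powr (- (1 / 2)))\<^sup>2 = c\<^sup>2 * (1 / r)"
      proof -
        have "(r powr (- (1 / 2)))\<^sup>2 = r powr (- 1)" using r by (simp add: power2_eq_square powr_add[symmetric])
        also have "\<dots> = 1 / r" using r by (simp add: powr_minus inverse_eq_divide)
        finally show ?thesis by (simp only: power_mult_distrib)
      qed
      finally have "1 / r \<le> (2 * (2 * \<kappa> * cmod (f r))\<^sup>2 + 2 * (H + K)\<^sup>2) / c\<^sup>2"
        using c by (simp add: pos_le_divide_eq mult.commute)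
      also have "\<dots> = (8 * \<kappa>\<^sup>2 / c\<^sup>2) * (cmod (f r))\<^sup>2 + 2 * (H + K)\<^sup>2 / c\<^sup>2"
        by (simp add: power_mult_distrib add_divide_distrib)
      finally show ?thesis using r by (simp add: norm_divide)
    qed
    have "(\<lambda>r. complex_of_real (1 / r)) absolutely_integrable_on {0<..1}"
    proof (rule measurable_bounded_by_integrable_imp_absolutely_integrable[OF _ _ _ sq])
      show "(\<lambda>r. complex_of_real (1 / r)) \<in> borel_measurable (lebesgue_on {0<..1})"
        by (intro continuous_imp_measurable_on_sets_lebesgue continuous_intros) auto
      have "(\<lambda>r. (cmod (f r))\<^sup>2) integrable_on {0<..1}"
        using square_integrable_absolutely_integrable_near_0(2)[OF DeltaD(2)[OF f]] by (simp add: absolutely_integrable_on_def)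
      then show "(\<lambda>r. (8 * \<kappa>\<^sup>2 / c\<^sup>2) * (cmod (f r))\<^sup>2 + 2 * (H + K)\<^sup>2 / c\<^sup>2) integrable_on {0<..1}"
        by (intro integrable_add integrable_on_mult_right integrable_on_const Ioc_lmeasurable)
    qed auto
    then show False using inverse_not_absolutely_integrable by blast
  qed
  show thesis
  proof (rule that[of "H + K"])
    show "0 \<le> H + K" using H0 K0 by simp
    fix r :: real assume r: "0 < r" "r \<le> 1"
    have "H * r powr (1 / 2 + \<kappa>) \<le> (H + K) * r powr (1 / 2 + \<kappa>)" using K0 by (intro mult_right_mono) auto
    then show "cmod (P r) \<le> (H + K) * r powr (1 / 2 + \<kappa>)" using Pb[OF r] by (simp add: \<open>p0 = 0\<close> mult.commute)
    have "K * r powr (1 / 2 - \<kappa>) \<le> (H + K) * r powr (1 / 2 - \<kappa>)" using H0 by (intro mult_right_mono) auto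
    then show "cmod (Q r) \<le> (H + K) * r powr (1 / 2 - \<kappa>)" using Qb[OF r] by linarith
  qed
qed

text \<open>Each term of the alternating expression pairs the rate of one solution with that of the
  other, and the product of the two rates is r.\<close>

theorem boundary_form_vanishes:
  assumes \<alpha>: "\<alpha> \<ge> 1" and f: "f \<in> Delta \<alpha>" and g: "g \<in> Delta \<alpha>"
  shows "(boundary_form f g \<longlongrightarrow> 0) (at_right 0)"
proof -
  define \<kappa> where "\<kappa> = sqrt \<alpha>"
  have \<kappa>: "\<kappa> \<ge> 1" using \<alpha> by (auto simp: \<kappa>_def)
  define a where "a r = r powr (1 / 2 + \<kappa>)" for r
  define b where "b r = r powr (1 / 2 - \<kappa>)" for r
  define a' where "a' r = (1 / 2 + \<kappa>) * r powr (1 / 2 + \<kappa> - 1)" for r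
  define b' where "b' r = (1 / 2 - \<kappa>) * r powr (1 / 2 - \<kappa> - 1)" for r
  define P where "P = solution_pairing (\<lambda>r. of_real (a r)) (\<lambda>r. of_real (a' r))"
  define Q where "Q = solution_pairing (\<lambda>r. of_real (b r)) (\<lambda>r. of_real (b' r))"
  obtain C where C: "C \<ge> 0" "\<And>r. 0 < r \<Longrightarrow> r \<le> 1 \<Longrightarrow> cmod (P f r) \<le> C * a r"
    "\<And>r. 0 < r \<Longrightarrow> r \<le> 1 \<Longrightarrow> cmod (Q f r) \<le> C * b r"
    using limit_point_estimates[OF \<alpha> f] unfolding P_def Q_def a_def b_def a'_def b'_def \<kappa>_def by blast
  obtain D where D: "D \<ge> 0" "\<And>r. 0 < r \<Longrightarrow> r \<le> 1 \<Longrightarrow> cmod (P g r) \<le> D * a r"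
    "\<And>r. 0 < r \<Longrightarrow> r \<le> 1 \<Longrightarrow> cmod (Q g r) \<le> D * b r"
    using limit_point_estimates[OF \<alpha> g] unfolding P_def Q_def a_def b_def a'_def b'_def \<kappa>_def by blast
  have bound: "cmod (boundary_form f g r) \<le> (C * D / \<kappa>) * r" if r: "0 < r" "r \<le> 1" for r
  proof -
    have ab: "a r * b r = r" using r(1) by (simp add: a_def b_def powr_add[symmetric])
    have "r powr (1 / 2 + \<kappa>) * r powr (1 / 2 - \<kappa> - 1) = 1" "r powr (1 / 2 + \<kappa> - 1) * r powr (1 / 2 - \<kappa>) = 1"
      using r(1) by (simp_all add: powr_add[symmetric])
    then have W: "a r * b' r - a' r * b r = - (2 * \<kappa>)" by (simp add: a_def b_def a'_def b'_def algebra_simps)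
    have a0: "0 \<le> a r" "0 \<le> b r" by (auto simp: a_def b_def)
    have "complex_of_real (a r * b' r - a' r * b r) * boundary_form f g r = P f r * cnj (Q g r) - Q f r * cnj (P g r)"
      using wronskian_identity[of "of_real (a r)" "of_real (b' r)" "of_real (a' r)" "of_real (b r)" "f r" "cnj (D1 g r)" "D1 f r" "cnj (g r)"]
      by (simp add: P_def Q_def solution_pairing_def boundary_form_def)
    then have "cmod (complex_of_real (- (2 * \<kappa>)) * boundary_form f g r) = cmod (P f r * cnj (Q g r) - Q f r * cnj (P g r))"
      unfolding W by (rule arg_cong)
    also have "\<dots> \<le> cmod (P f r) * cmod (Q g r) + cmod (Q f r) * cmod (P g r)"
      by (rule order.trans[OF norm_triangle_ineq4]) (simp add: norm_mult)
    also have "\<dots> \<le> (C * a r) * (D * b r) + (C * b r) * (D * a r)"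
      using C D r a0 by (intro add_mono mult_mono) auto
    also have "\<dots> = 2 * (C * D) * (a r * b r)" by (simp add: algebra_simps)
    finally have "(2 * \<kappa>) * cmod (boundary_form f g r) \<le> 2 * (C * D) * r"
      using \<kappa> unfolding ab norm_mult norm_of_real by simp
    then have "\<kappa> * cmod (boundary_form f g r) \<le> C * D * r" by simp
    then show ?thesis using \<kappa> by (simp add: field_simps)
  qed
  have "((\<lambda>r. (C * D / \<kappa>) * r) \<longlongrightarrow> (C * D / \<kappa>) * 0) (at_right 0)" by (intro tendsto_intros)
  then have lim: "((\<lambda>r. (C * D / \<kappa>) * r) \<longlongrightarrow> 0) (at_right 0)" by simp
  have "\<forall>\<^sub>F r in at_right 0. cmod (boundary_form f g r) \<le> (C * D / \<kappa>) * r"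
    using eventually_at_right_real[OF zero_less_one] by eventually_elim (use bound in auto)
  then show ?thesis using lim by (rule Lim_null_comparison)
qed

theorem h_op_self_adjoint: "\<alpha> \<ge> 1 \<Longrightarrow> self_adjoint (h_op \<alpha>)"
  by (intro h_op_self_adjoint_if_boundary_form_vanishes boundary_form_vanishes)

section \<open>Boundary conditions in the limit-circle case\<close>

lemma square_integrable_of_near_0:
  assumes f: "continuous_on {0<..} f" and a: "0 < a" and near: "(\<lambda>r. (cmod (f r))\<^sup>2) absolutely_integrable_on {0<..a}"
    and zero: "\<And>r. r > b \<Longrightarrow> f r = 0"
  shows "square_integrable f"
proof -
  have m: "f \<in> borel_measurable half_line"
    using f by (rule continuous_imp_measurable_on_sets_lebesgue) simp
  define c where "c = max a b"
  have "(\<lambda>r. (cmod (f r))\<^sup>2) absolutely_integrable_on {a..c}"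
    using a by (intro absolutely_integrable_continuous_real continuous_intros continuous_on_subset[OF f]) auto
  then have i: "(\<lambda>r. (cmod (f r))\<^sup>2) absolutely_integrable_on {0<..a} \<union> {a..c}"
    using near by (intro set_integrable_Un) auto
  have "(\<lambda>x. indicator ({0<..a} \<union> {a..c}) x *\<^sub>R (cmod (f x))\<^sup>2) = (\<lambda>x. indicator {0<..} x *\<^sub>R (cmod (f x))\<^sup>2)"
  proof
    fix x
    show "indicator ({0<..a} \<union> {a..c}) x *\<^sub>R (cmod (f x))\<^sup>2 = indicator {0<..} x *\<^sub>R (cmod (f x))\<^sup>2"
    proof (cases "0 < x \<and> x \<le> c")
      case True
      then have "x \<in> {0<..a} \<union> {a..c}" "x \<in> {0<..}" by auto
      then show ?thesis by simp
    next
      case False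
      then show ?thesis using zero[of x] a by (cases "0 < x") (auto simp: c_def)
    qed
  qed
  then show ?thesis using i m by (simp add: square_integrable_def integrable_restrict_space set_integrable_def)
qed

lemma zero_energy_solution_lincomb:
  assumes "zero_energy_solution \<alpha> y y'" "zero_energy_solution \<alpha> z z'"
  shows "zero_energy_solution \<alpha> (\<lambda>r. c * y r + d * z r) (\<lambda>r. c * y' r + d * z' r)"
  unfolding zero_energy_solution_def
proof (intro allI impI conjI)
  fix x :: real assume x: "x > 0"
  show "((\<lambda>r. c * y r + d * z r) has_vector_derivative c * y' x + d * z' x) (at x)"
    using assms x unfolding zero_energy_solution_def
    by (intro has_vector_derivative_add has_vector_derivative_mult_right) auto
  have "((\<lambda>r. c * y' r + d * z' r) has_vector_derivative
     c * (of_real ((\<alpha> - 1 / 4) / x\<^sup>2) * y x) + d * (of_real ((\<alpha> - 1 / 4) / x\<^sup>2) * z x)) (at x)"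
    using assms x unfolding zero_energy_solution_def
    by (intro has_vector_derivative_add has_vector_derivative_mult_right) auto
  then show "((\<lambda>r. c * y' r + d * z' r) has_vector_derivative of_real ((\<alpha> - 1 / 4) / x\<^sup>2) * (c * y x + d * z x)) (at x)"
  proof (rule has_vector_derivative_eq_rhs)
    show "c * (Q * a) + d * (Q * b) = Q * (c * a + d * b)" for Q a b :: complex
      by (simp add: algebra_simps)
  qed
qed

lemma square_absolutely_integrable_lincomb:
  fixes y z :: "real \<Rightarrow> complex"
  assumes "continuous_on {0<..} y" "(\<lambda>r. (cmod (y r))\<^sup>2) absolutely_integrable_on {0<..1}"
    and "continuous_on {0<..} z" "(\<lambda>r. (cmod (z r))\<^sup>2) absolutely_integrable_on {0<..1}"
  shows "(\<lambda>r. (cmod (c * y r + d * z r))\<^sup>2) absolutely_integrable_on {0<..1}"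
proof (rule measurable_bounded_by_integrable_imp_absolutely_integrable)
  have "continuous_on {0<..} (\<lambda>r. (cmod (c * y r + d * z r))\<^sup>2)"
    by (intro continuous_intros assms)
  then show "(\<lambda>r. (cmod (c * y r + d * z r))\<^sup>2) \<in> borel_measurable (lebesgue_on {0<..1})"
    by (rule continuous_imp_measurable_on_sets_lebesgue[OF continuous_on_subset]) auto
  show "(\<lambda>r. (2 * (cmod c)\<^sup>2) * (cmod (y r))\<^sup>2 + (2 * (cmod d)\<^sup>2) * (cmod (z r))\<^sup>2) integrable_on {0<..1}"
    using assms(2,4) by (intro integrable_add integrable_on_mult_right) (auto simp: absolutely_integrable_on_def)
  fix r
  have "(cmod (c * y r + d * z r))\<^sup>2 \<le> (cmod (c * y r) + cmod (d * z r))\<^sup>2"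
    by (intro power_mono norm_triangle_ineq) auto
  also have "\<dots> \<le> 2 * (cmod (c * y r))\<^sup>2 + 2 * (cmod (d * z r))\<^sup>2"
    using sum_squares_bound[of "cmod (c * y r)" "cmod (d * z r)"] by (simp add: power2_sum)
  finally show "norm ((cmod (c * y r + d * z r))\<^sup>2) \<le> (2 * (cmod c)\<^sup>2) * (cmod (y r))\<^sup>2 + (2 * (cmod d)\<^sup>2) * (cmod (z r))\<^sup>2"
    by (simp add: norm_mult power_mult_distrib mult.assoc)
qed auto

text \<open>One minus the integral of a normalized test function. Its derivative is again a test
  function, so a product with the cutoff changes the differential expression only on a compact
  set.\<close>

lemma smooth_cutoff:
  "\<exists>(\<eta> :: real \<Rightarrow> complex) \<rho> a b. \<rho> \<in> C0_infty \<and> 0 < a \<and> a < b \<and>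
    (\<forall>x>0. (\<eta> has_vector_derivative (- \<rho> x)) (at x)) \<and>
    (\<forall>r>0. r \<le> a \<longrightarrow> \<eta> r = 1 \<and> \<rho> r = 0) \<and> (\<forall>r\<ge>b. \<eta> r = 0 \<and> \<rho> r = 0)"
proof -
  obtain \<rho> where rho: "\<rho> \<in> C0_infty" "integral\<^sup>L half_line \<rho> = 1" by (rule normalized_test_function)
  obtain a b where ab: "0 < a" "a < b" "\<And>r. r > 0 \<Longrightarrow> r \<le> a \<or> b \<le> r \<Longrightarrow> \<rho> r = 0"
    using C0_inftyD[OF rho(1)] by blast
  have cont: "continuous_on {0<..} \<rho>" by (rule C0_infty_derivative(3)[OF rho(1)])
  have loc: "locally_integrable \<rho>" using cont by (rule continuous_imp_locally_integrable)
  then obtain R where R: "antiderivative R \<rho>"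
    using antiderivative_exists[of \<rho>] by (auto simp: locally_integrable_def)
  define \<eta> where "\<eta> x = 1 - (R x - R a)" for x
  have const: "R y = R x" if "0 < x" "x \<le> y" "\<And>r. x \<le> r \<Longrightarrow> r \<le> y \<Longrightarrow> \<rho> r = 0" for x y
  proof -
    have "(\<rho> has_integral 0) {x..y}"
      by (rule has_integral_is_0) (use that in auto)
    from has_integral_unique[OF antiderivativeD(2)[OF R that(1,2)] this] show ?thesis by simp
  qed
  have "integral\<^sup>L half_line \<rho> = (LINT x:{a..b}|lebesgue. \<rho> x)"
    using ab loc by (intro integrable_half_line_compact_support(2)) (auto simp: locally_integrable_def)
  then have Rab: "R b - R a = 1" using antiderivativeD(3)[OF R, of a b] ab rho(2) by simp
  show ?thesis
  proof (intro exI conjI allI impI)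
    show "\<rho> \<in> C0_infty" "0 < a" "a < b" by (fact rho(1) ab(1) ab(2))+
    show "(\<eta> has_vector_derivative (- \<rho> x)) (at x)" if "x > 0" for x
    proof -
      have "(\<eta> has_vector_derivative 0 - (\<rho> x - 0)) (at x)" unfolding \<eta>_def[abs_def]
        by (intro has_vector_derivative_diff has_vector_derivative_const antiderivative_has_vector_derivative[OF R cont that])
      then show ?thesis by simp
    qed
    show "\<eta> r = 1" "\<rho> r = 0" if "0 < r" "r \<le> a" for r
      using const[of r a] ab that by (auto simp: \<eta>_def)
    show "\<eta> r = 0" "\<rho> r = 0" if "b \<le> r" for r
      using const[of b r] ab that Rab by (auto simp: \<eta>_def algebra_simps)
  qed
qed

text \<open>Collects what is used about the two solutions at energy zero, so that the explicit
  formulas, which differ for \<alpha> = 0 and \<alpha> \<noteq> 0, enter only when the locale is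
  instantiated.\<close>

locale limit_circle =
  fixes \<alpha> :: real and A A' B B' :: "real \<Rightarrow> complex" and w :: complex
  assumes solA: "zero_energy_solution \<alpha> A A'" and solB: "zero_energy_solution \<alpha> B B'"
    and realA: "\<And>r. r > 0 \<Longrightarrow> cnj (A r) = A r" and realB: "\<And>r. r > 0 \<Longrightarrow> cnj (B r) = B r"
    and sqA: "(\<lambda>r. (cmod (A r))\<^sup>2) absolutely_integrable_on {0<..1}"
    and sqB: "(\<lambda>r. (cmod (B r))\<^sup>2) absolutely_integrable_on {0<..1}"
    and wronskian_AB: "\<And>r. r > 0 \<Longrightarrow> A r * B' r - A' r * B r = w" and w_nonzero: "w \<noteq> 0"
begin

lemma real_derivative:
  assumes "\<And>r. r > 0 \<Longrightarrow> cnj (y r) = y r" "zero_energy_solution \<alpha> y y'" "r > 0"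
  shows "cnj (y' r) = y' r"
proof -
  have d: "(y has_vector_derivative y' r) (at r)" using assms(2,3) by (simp add: zero_energy_solution_def)
  have "((\<lambda>x. cnj (y x)) has_vector_derivative cnj (y' r)) (at r)"
    by (rule bounded_linear.has_vector_derivative[OF bounded_linear_cnj d])
  then have "(y has_vector_derivative cnj (y' r)) (at r)"
    using has_vector_derivative_cong_half_line[of "\<lambda>x. cnj (y x)" y r] assms(1,3) by simp
  then show ?thesis using vector_derivative_unique_at d by blast
qed

text \<open>\<open>Lim\<close> has a meaning only when the limit exists, which is ensured for
  functions in \<open>Delta \<alpha>\<close> by \<open>solution_pairing_converges\<close>.\<close>

definition bvA :: "(real \<Rightarrow> complex) \<Rightarrow> complex" where
  "bvA f = Lim (at_right 0) (solution_pairing A A' f)"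

definition bvB :: "(real \<Rightarrow> complex) \<Rightarrow> complex" where
  "bvB f = Lim (at_right 0) (solution_pairing B B' f)"

text \<open>Both \<open>y\<close> and \<open>L_expr \<alpha> f\<close> are square-integrable near 0,
  so their product, which is minus the derivative of the pairing, is integrable there.\<close>

lemma solution_pairing_converges:
  assumes y: "zero_energy_solution \<alpha> y y'" "(\<lambda>r. (cmod (y r))\<^sup>2) absolutely_integrable_on {0<..1}"
    and f: "f \<in> Delta \<alpha>"
  shows "(solution_pairing y y' f \<longlongrightarrow> Lim (at_right 0) (solution_pairing y y' f)) (at_right 0)"
proof -
  have "(\<lambda>r. y r * L_expr \<alpha> f r) absolutely_integrable_on {0<..1}"
    by (rule mult_absolutely_integrable_near_0[OF zero_energy_solution_continuous(1)[OF y(1)] y(2) DeltaD(3)[OF f]])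
  then have "(\<lambda>r. - (y r * L_expr \<alpha> f r)) absolutely_integrable_on {0<..1}"
    by (simp add: set_integrable_def)
  from antiderivative_tendsto_0[OF solution_pairing_antiderivative[OF y(1) DeltaD(1)[OF f]] this]
  obtain l where "(solution_pairing y y' f \<longlongrightarrow> l) (at_right 0)" by auto
  then show ?thesis using tendsto_Lim[of "at_right (0::real)"] by auto
qed

lemma bvA: "f \<in> Delta \<alpha> \<Longrightarrow> (solution_pairing A A' f \<longlongrightarrow> bvA f) (at_right 0)"
  unfolding bvA_def by (rule solution_pairing_converges[OF solA sqA])

lemma bvB: "f \<in> Delta \<alpha> \<Longrightarrow> (solution_pairing B B' f \<longlongrightarrow> bvB f) (at_right 0)"
  unfolding bvB_def by (rule solution_pairing_converges[OF solB sqB])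

lemma bv_eqI:
  assumes "f \<in> Delta \<alpha>" "0 < a" "\<And>r. 0 < r \<Longrightarrow> r < a \<Longrightarrow> solution_pairing A A' f r = k"
    "\<And>r. 0 < r \<Longrightarrow> r < a \<Longrightarrow> solution_pairing B B' f r = l"
  shows "bvA f = k" "bvB f = l"
proof -
  have "\<forall>\<^sub>F r in at_right 0. solution_pairing A A' f r = k"
    using eventually_at_right_real[OF assms(2)] by eventually_elim (use assms(3) in auto)
  from tendsto_unique[OF _ bvA[OF assms(1)] tendsto_eventually[OF this]] show "bvA f = k" by simp
  have "\<forall>\<^sub>F r in at_right 0. solution_pairing B B' f r = l"
    using eventually_at_right_real[OF assms(2)] by eventually_elim (use assms(4) in auto)
  from tendsto_unique[OF _ bvB[OF assms(1)] tendsto_eventually[OF this]] show "bvB f = l" by simp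
qed

lemma bv_cong:
  assumes "f \<in> Delta \<alpha>" "g \<in> Delta \<alpha>" "l2_class f = l2_class g"
  shows "bvA f = bvA g" "bvB f = bvB g"
proof -
  have eq: "solution_pairing y y' f r = solution_pairing y y' g r" if "r > 0" for y y' r
    using H_op_unique(1,2)[OF assms that] by (simp add: solution_pairing_def)
  have "\<forall>\<^sub>F r in at_right 0. solution_pairing A A' f r = solution_pairing A A' g r"
    "\<forall>\<^sub>F r in at_right 0. solution_pairing B B' f r = solution_pairing B B' g r"
    using eventually_at_right_less[of 0] by (eventually_elim, simp add: eq)+
  then show "bvA f = bvA g" "bvB f = bvB g"
    using tendsto_unique[OF _ Lim_transform_eventually[OF bvA[OF assms(1)]] bvA[OF assms(2)]]
      tendsto_unique[OF _ Lim_transform_eventually[OF bvB[OF assms(1)]] bvB[OF assms(2)]] by simp_all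
qed

lemma bv_lincomb:
  assumes "f \<in> Delta \<alpha>" "g \<in> Delta \<alpha>"
  shows "bvA (\<lambda>r. f r + c * g r) = bvA f + c * bvA g" "bvB (\<lambda>r. f r + c * g r) = bvB f + c * bvB g"
proof -
  note D = Delta_lincomb[OF assms, where c = c]
  have eq: "solution_pairing y y' (\<lambda>r. f r + c * g r) r = solution_pairing y y' f r + c * solution_pairing y y' g r"
    if "r > 0" for y y' r
    using D(3)[OF that] by (simp add: solution_pairing_def algebra_simps)
  have e: "\<forall>\<^sub>F r in at_right 0. solution_pairing A A' f r + c * solution_pairing A A' g r = solution_pairing A A' (\<lambda>r. f r + c * g r) r"
    "\<forall>\<^sub>F r in at_right 0. solution_pairing B B' f r + c * solution_pairing B B' g r = solution_pairing B B' (\<lambda>r. f r + c * g r) r"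
    using eventually_at_right_less[of 0] by (eventually_elim, simp add: eq)+
  have "((\<lambda>r. solution_pairing A A' f r + c * solution_pairing A A' g r) \<longlongrightarrow> bvA f + c * bvA g) (at_right 0)"
    "((\<lambda>r. solution_pairing B B' f r + c * solution_pairing B B' g r) \<longlongrightarrow> bvB f + c * bvB g) (at_right 0)"
    by (intro tendsto_intros bvA bvB assms)+
  then show "bvA (\<lambda>r. f r + c * g r) = bvA f + c * bvA g" "bvB (\<lambda>r. f r + c * g r) = bvB f + c * bvB g"
    using tendsto_unique[OF _ bvA[OF D(1)] Lim_transform_eventually[OF _ e(1)]]
      tendsto_unique[OF _ bvB[OF D(1)] Lim_transform_eventually[OF _ e(2)]] by simp_all
qed

lemma bv_C0_infty:
  assumes "\<phi> \<in> C0_infty"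
  shows "bvA \<phi> = 0" "bvB \<phi> = 0"
proof -
  obtain a b where ab: "0 < a" "a < b" "\<And>r. r > 0 \<Longrightarrow> r \<le> a \<or> b \<le> r \<Longrightarrow> \<phi> r = 0"
    using C0_inftyD[OF assms] by blast
  obtain a' b' where ab': "0 < a'" "a' < b'" "\<And>r. r > 0 \<Longrightarrow> r \<le> a' \<or> b' \<le> r \<Longrightarrow> D1 \<phi> r = 0"
    using C0_inftyD[OF C0_infty_derivative(1)[OF assms]] by blast
  have D: "\<phi> \<in> Delta \<alpha>" using assms C0_infty_subset_Delta by blast
  show "bvA \<phi> = 0" "bvB \<phi> = 0"
    using ab ab' by (auto intro!: bv_eqI[OF D, of "min a a'"] simp: solution_pairing_def)
qed

text \<open>A solution c A + s B multiplied by a cutoff: near 0 it is the solution itself, and its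
  pairings with A and B are constant multiples of the Wronskian \<open>w\<close>. As
  \<open>w\<close> is nonzero, all pairs of boundary values occur.\<close>

lemma exists_boundary_values:
  fixes c s :: complex
  obtains f where "f \<in> Delta \<alpha>" "bvA f = s * w" "bvB f = - (c * w)"
proof -
  define U where "U r = c * A r + s * B r" for r
  define U' where "U' r = c * A' r + s * B' r" for r
  define q where "q r = complex_of_real ((\<alpha> - 1 / 4) / r\<^sup>2)" for r
  have sol: "zero_energy_solution \<alpha> U U'"
    unfolding U_def[abs_def] U'_def[abs_def] by (rule zero_energy_solution_lincomb[OF solA solB])
  note U_cont = zero_energy_solution_continuous[OF sol]
  have sqU: "(\<lambda>r. (cmod (U r))\<^sup>2) absolutely_integrable_on {0<..1}"
    unfolding U_def by (intro square_absolutely_integrable_lincomb sqA sqB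
        zero_energy_solution_continuous(1)[OF solA] zero_energy_solution_continuous(1)[OF solB])
  obtain \<eta> \<rho> :: "real \<Rightarrow> complex" and a b :: real where cut': "\<rho> \<in> C0_infty \<and> 0 < a \<and> a < b \<and>
    (\<forall>x>0. (\<eta> has_vector_derivative (- \<rho> x)) (at x)) \<and>
    (\<forall>r>0. r \<le> a \<longrightarrow> \<eta> r = 1 \<and> \<rho> r = 0) \<and> (\<forall>r\<ge>b. \<eta> r = 0 \<and> \<rho> r = 0)"
    using smooth_cutoff by (elim exE)
  have cut: "\<rho> \<in> C0_infty" "0 < a" "a < b"
    "\<And>x. x > 0 \<Longrightarrow> (\<eta> has_vector_derivative (- \<rho> x)) (at x)"
    "\<And>r. 0 < r \<Longrightarrow> r \<le> a \<Longrightarrow> \<eta> r = 1 \<and> \<rho> r = 0" "\<And>r. b \<le> r \<Longrightarrow> \<eta> r = 0 \<and> \<rho> r = 0"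
    using cut' by simp_all
  have rho_cont: "continuous_on {0<..} \<rho>" "continuous_on {0<..} (D1 \<rho>)"
    using C0_infty_derivative(3) C0_infty_derivative(1) cut(1) by blast+
  have chi_cont: "continuous_on {0<..} \<eta>"
    using cut(4) by (intro continuous_at_imp_continuous_on) (auto intro: has_vector_derivative_continuous)
  have q_cont: "continuous_on {0<..} q" unfolding q_def[abs_def] by (intro continuous_intros) auto
  have dU: "(U has_vector_derivative U' x) (at x)" "(U' has_vector_derivative q x * U x) (at x)" if "x > 0" for x
    using sol that by (auto simp: zero_energy_solution_def q_def)
  define f where "f r = \<eta> r * U r" for r
  define f' where "f' r = \<eta> r * U' r + - \<rho> r * U r" for r
  \<comment> \<open>The image of f under the differential expression: terms without a derivative of
    the cutoff cancel, and the rest is written with \<rho>, minus the derivative of \<eta>.\<close>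
  define k where "k r = 2 * \<rho> r * U' r + D1 \<rho> r * U r" for r
  have d1: "(f has_vector_derivative f' x) (at x)" if "x > 0" for x
    unfolding f_def[abs_def] f'_def by (intro has_vector_derivative_mult cut(4) dU that)
  have d2: "(f' has_vector_derivative q x * f x - k x) (at x)" if "x > 0" for x
  proof -
    have "(f' has_vector_derivative (\<eta> x * (q x * U x) + - \<rho> x * U' x) + (- \<rho> x * U' x + - D1 \<rho> x * U x)) (at x)"
      unfolding f'_def[abs_def]
      by (intro has_vector_derivative_add has_vector_derivative_mult has_vector_derivative_minus cut(4) dU that
          C0_infty_derivative(2)[OF cut(1)])
    then show ?thesis by (rule has_vector_derivative_eq_rhs) (simp add: f_def k_def algebra_simps)
  qed
  have f_cont: "continuous_on {0<..} f" unfolding f_def[abs_def] by (intro continuous_intros chi_cont U_cont)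
  have k_cont: "continuous_on {0<..} k" unfolding k_def[abs_def] by (intro continuous_intros rho_cont U_cont)
  have "antiderivative f' (\<lambda>x. q x * f x - k x)"
    by (rule antiderivative_if_C1[OF d2]) (auto intro!: continuous_intros q_cont f_cont k_cont)
  then have f: "f \<in> D_space" "AE r in half_line. D1 (D1 f) r = q r * f r - k r"
    using D_spaceI(1,3)[of f f'] d1 by auto
  have D1f: "D1 f r = f' r" if "r > 0" for r using D1_eqI[OF d1[OF that]] .
  obtain a' b' where ab': "0 < a'" "a' < b'" "\<And>r. r > 0 \<Longrightarrow> r \<le> a' \<or> b' \<le> r \<Longrightarrow> D1 \<rho> r = 0"
    using C0_inftyD[OF C0_infty_derivative(1)[OF cut(1)]] by blast
  have k: "square_integrable k"
  proof (rule continuous_compact_support_square_integrable[OF k_cont])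
    show "0 < min a a'" using cut(2) ab'(1) by simp
    fix r assume "r > 0" "r < min a a' \<or> max b b' < r"
    then show "k r = 0" using ab'(3)[of r] cut(5)[of r] cut(6)[of r] by (auto simp: k_def)
  qed
  have L: "AE r in half_line. k r = L_expr \<alpha> f r"
    using f(2) by eventually_elim (simp add: L_expr_def q_def)
  have "square_integrable f"
  proof (rule square_integrable_of_near_0[OF f_cont])
    show "0 < min a 1" using cut(2) by simp
    have "(\<lambda>r. (cmod (U r))\<^sup>2) absolutely_integrable_on {0<..min a 1}"
      using sqU by (rule set_integrable_subset) auto
    then show "(\<lambda>r. (cmod (f r))\<^sup>2) absolutely_integrable_on {0<..min a 1}"
      by (rule absolutely_integrable_spike[OF _ negligible_empty]) (use cut(5) in \<open>auto simp: f_def\<close>)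
    show "f r = 0" if "b < r" for r using cut(6)[of r] that by (simp add: f_def)
  qed
  then have D: "f \<in> Delta \<alpha>" using f(1) square_integrable_cong_AE[OF k L] by (simp add: Delta_def)
  have near: "f r = U r" "D1 f r = U' r" if "0 < r" "r < a" for r
    using cut(5)[of r] that D1f[of r] by (auto simp: f_def f'_def)
  have pA: "solution_pairing A A' f r = s * w" if r: "0 < r" "r < a" for r
  proof -
    have "solution_pairing A A' f r = s * (A r * B' r - A' r * B r)"
      using near[OF r] by (simp add: solution_pairing_def U_def U'_def algebra_simps)
    then show ?thesis using wronskian_AB[OF r(1)] by simp
  qed
  have pB: "solution_pairing B B' f r = - (c * w)" if r: "0 < r" "r < a" for r
  proof -
    have "solution_pairing B B' f r = - (c * (A r * B' r - A' r * B r))"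
      using near[OF r] by (simp add: solution_pairing_def U_def U'_def algebra_simps)
    then show ?thesis using wronskian_AB[OF r(1)] by simp
  qed
  have "bvA f = s * w" "bvB f = - (c * w)"
    using bv_eqI[of f a "s * w" "- (c * w)", OF D cut(2) pA pB] by simp_all
  then show thesis using that D by blast
qed

text \<open>\<open>wronskian_identity\<close> with the conjugate of g as fourth function. Since A
  and B are real, pairing them with the conjugate of g gives the conjugate of their pairing with
  g.\<close>

lemma boundary_form_limit:
  assumes f: "f \<in> Delta \<alpha>" and g: "g \<in> Delta \<alpha>"
  shows "w * (cinner_l2 (l2_class f) (l2_class (L_expr \<alpha> g)) - cinner_l2 (l2_class (L_expr \<alpha> f)) (l2_class g)) =
    bvA f * cnj (bvB g) - bvB f * cnj (bvA g)"
proof -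
  have "((\<lambda>r. w * boundary_form f g r) \<longlongrightarrow>
      w * (cinner_l2 (l2_class f) (l2_class (L_expr \<alpha> g)) - cinner_l2 (l2_class (L_expr \<alpha> f)) (l2_class g))) (at_right 0)"
    by (intro tendsto_intros green_formula f g)
  moreover have "((\<lambda>r. w * boundary_form f g r) \<longlongrightarrow> bvA f * cnj (bvB g) - bvB f * cnj (bvA g)) (at_right 0)"
  proof (rule Lim_transform_eventually)
    show "((\<lambda>r. solution_pairing A A' f r * cnj (solution_pairing B B' g r)
        - solution_pairing B B' f r * cnj (solution_pairing A A' g r)) \<longlongrightarrow>
        bvA f * cnj (bvB g) - bvB f * cnj (bvA g)) (at_right 0)"
      by (intro tendsto_intros bvA bvB f g)
    show "\<forall>\<^sub>F r in at_right 0. solution_pairing A A' f r * cnj (solution_pairing B B' g r)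
        - solution_pairing B B' f r * cnj (solution_pairing A A' g r) = w * boundary_form f g r"
      using eventually_at_right_less[of 0]
    proof eventually_elim
      case (elim r)
      show ?case
        using wronskian_identity[of "A r" "B' r" "A' r" "B r" "f r" "cnj (D1 g r)" "D1 f r" "cnj (g r)"]
          wronskian_AB[OF elim] realA[OF elim] realB[OF elim] real_derivative[OF realA solA elim]
          real_derivative[OF realB solB elim]
        by (simp add: solution_pairing_def boundary_form_def)
    qed
  qed
  ultimately show ?thesis by (rule tendsto_unique[rotated]) simp
qed

section \<open>Self-adjoint operators given by a boundary condition\<close>

definition bc_space :: "real \<Rightarrow> real \<Rightarrow> (real \<Rightarrow> complex) set" where
  "bc_space c s = {f \<in> Delta \<alpha>. bvA f * of_real c + bvB f * of_real s = 0}"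

lemma C0_infty_subset_bc_space: "C0_infty \<subseteq> bc_space c s"
  using C0_infty_subset_Delta[of \<alpha>] bv_C0_infty by (auto simp: bc_space_def)

text \<open>The vector (c, s) is real, so it annihilates the boundary values of f and the conjugated
  boundary values of g. Two vectors annihilated by the same nonzero vector have zero determinant,
  and this determinant is the boundary form up to the factor \<open>w\<close>.\<close>

lemma symmetric_if_bc:
  assumes f: "f \<in> bc_space c s" and g: "g \<in> bc_space c s" and cs: "c \<noteq> 0 \<or> s \<noteq> 0"
  shows "cinner_l2 (l2_class (L_expr \<alpha> f)) (l2_class g) = cinner_l2 (l2_class f) (l2_class (L_expr \<alpha> g))"
proof -
  define a where "a = bvA f"
  define b where "b = bvB f"
  define a' where "a' = cnj (bvA g)"
  define b' where "b' = cnj (bvB g)"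
  have 1: "a * of_real c = - (b * of_real s)" using f by (simp add: bc_space_def a_def b_def eq_neg_iff_add_eq_0)
  have "cnj (bvA g * of_real c + bvB g * of_real s) = 0" using g by (simp add: bc_space_def)
  then have 2: "a' * of_real c = - (b' * of_real s)" by (simp add: a'_def b'_def eq_neg_iff_add_eq_0)
  have "of_real c * (a * b' - b * a') = (a * of_real c) * b' - b * (a' * of_real c)" by (simp add: algebra_simps)
  also have "\<dots> = 0" unfolding 1 2 by (simp add: algebra_simps)
  finally have 3: "of_real c * (a * b' - b * a') = 0" .
  have "of_real s * (a * b' - b * a') = a * (b' * of_real s) - (b * of_real s) * a'" by (simp add: algebra_simps)
  also have "\<dots> = a * (- (a' * of_real c)) - (- (a * of_real c)) * a'" using 1 2 by simp
  also have "\<dots> = 0" by (simp add: algebra_simps)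
  finally have "a * b' - b * a' = 0" using 3 cs by auto
  then have "w * (cinner_l2 (l2_class f) (l2_class (L_expr \<alpha> g)) - cinner_l2 (l2_class (L_expr \<alpha> f)) (l2_class g)) = 0"
    using boundary_form_limit[of f g] f g by (simp add: bc_space_def a_def b_def a'_def b'_def)
  then show ?thesis using w_nonzero by simp
qed

text \<open>An element of the adjoint lies in the maximal operator. Testing it with one f whose
  boundary values are proportional to (s, -c), a nonzero vector satisfying the condition, gives the
  condition for it as well.\<close>

lemma adjoint_bc:
  assumes cs: "c \<noteq> 0 \<or> s \<noteq> 0"
  shows "adjoint_operator (H_op \<alpha> (bc_space c s)) = H_op \<alpha> (bc_space c s)"
proof
  show "H_op \<alpha> (bc_space c s) \<subseteq> adjoint_operator (H_op \<alpha> (bc_space c s))"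
    using symmetric_if_bc[OF _ _ cs] by (auto simp: adjoint_operator_def H_op_def)
  show "adjoint_operator (H_op \<alpha> (bc_space c s)) \<subseteq> H_op \<alpha> (bc_space c s)"
  proof
    fix p assume p: "p \<in> adjoint_operator (H_op \<alpha> (bc_space c s))"
    have "p \<in> H_op \<alpha> (Delta \<alpha>)"
      using p adjoint_operator_antimono[OF H_op_mono[OF C0_infty_subset_bc_space]] adjoint_H_op_C0_infty by blast
    then obtain g where g: "g \<in> Delta \<alpha>" "p = (l2_class g, l2_class (L_expr \<alpha> g))" by (auto simp: H_op_def)
    obtain f where f: "f \<in> Delta \<alpha>" "bvA f = of_real s * w" "bvB f = - (of_real c * w)"
      by (rule exists_boundary_values)
    have "f \<in> bc_space c s" using f by (simp add: bc_space_def algebra_simps)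
    then have "(l2_class f, l2_class (L_expr \<alpha> f)) \<in> H_op \<alpha> (bc_space c s)" by (auto simp: H_op_def)
    then have "cinner_l2 (l2_class (L_expr \<alpha> f)) (l2_class g) = cinner_l2 (l2_class f) (l2_class (L_expr \<alpha> g))"
      using p g(2) by (auto simp: adjoint_operator_def)
    then have "bvA f * cnj (bvB g) - bvB f * cnj (bvA g) = 0"
      using boundary_form_limit[OF f(1) g(1)] by simp
    then have "w * (of_real s * cnj (bvB g) + of_real c * cnj (bvA g)) = 0"
      by (simp add: f(2,3) algebra_simps)
    then have "of_real s * cnj (bvB g) + of_real c * cnj (bvA g) = 0" using w_nonzero by simp
    then have "cnj (of_real s * cnj (bvB g) + of_real c * cnj (bvA g)) = 0" by (simp only: complex_cnj_zero)
    then have "g \<in> bc_space c s" using g(1) by (simp add: bc_space_def algebra_simps)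
    then show "p \<in> H_op \<alpha> (bc_space c s)" using g(2) by (auto simp: H_op_def)
  qed
qed

lemma self_adjoint_bc:
  assumes cs: "c \<noteq> 0 \<or> s \<noteq> 0"
  shows "self_adjoint (H_op \<alpha> (bc_space c s))"
  unfolding self_adjoint_def
proof (intro conjI adjoint_bc[OF cs])
  show "densely_defined (H_op \<alpha> (bc_space c s))" by (rule H_op_densely_defined[OF C0_infty_subset_bc_space])
  show "linear_operator (H_op \<alpha> (bc_space c s))"
  proof (rule H_op_linear)
    show "bc_space c s \<subseteq> Delta \<alpha>" by (auto simp: bc_space_def)
    show "bc_space c s \<noteq> {}" using C0_infty_zero C0_infty_subset_bc_space by blast
    fix f g d assume fg: "f \<in> bc_space c s" "g \<in> bc_space c s"
    then have D: "f \<in> Delta \<alpha>" "g \<in> Delta \<alpha>" by (auto simp: bc_space_def)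
    have "bvA (\<lambda>r. f r + d * g r) * of_real c + bvB (\<lambda>r. f r + d * g r) * of_real s =
        (bvA f * of_real c + bvB f * of_real s) + d * (bvA g * of_real c + bvB g * of_real s)"
      by (simp add: bv_lincomb[OF D] algebra_simps)
    then show "(\<lambda>r. f r + d * g r) \<in> bc_space c s"
      using fg Delta_lincomb(1)[OF D] by (simp add: bc_space_def)
  qed
qed

text \<open>The operator is its own adjoint and hence closed, so it contains the closure of its
  restriction to test functions.\<close>

lemma bc_extends: "c \<noteq> 0 \<or> s \<noteq> 0 \<Longrightarrow> h_op \<alpha> \<subseteq> H_op \<alpha> (bc_space c s)"
  unfolding h_op_def
  by (intro closure_minimal H_op_mono C0_infty_subset_bc_space) (metis adjoint_bc closed_adjoint_operator)

lemma self_adjoint_extension_is_bc: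
  assumes T: "self_adjoint T" and ext: "h_op \<alpha> \<subseteq> T"
  shows "\<exists>\<theta>. T = H_op \<alpha> (bc_space (cos \<theta>) (sin \<theta>))"
proof -
  have adj: "adjoint_operator T = T" using T by (simp add: self_adjoint_def)
  have "T \<subseteq> adjoint_operator (h_op \<alpha>)" using adjoint_operator_antimono[OF ext] adj by simp
  then have TD: "T \<subseteq> H_op \<alpha> (Delta \<alpha>)" by (simp add: h_op_def adjoint_operator_closure adjoint_H_op_C0_infty)
  define D where "D = {f \<in> Delta \<alpha>. (l2_class f, l2_class (L_expr \<alpha> f)) \<in> T}"
  have T_eq: "T = H_op \<alpha> D" using TD by (auto simp: H_op_def D_def)
  have sym: "bvA f * cnj (bvB g) = bvB f * cnj (bvA g)" if "f \<in> D" "g \<in> D" for f g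
  proof -
    have "(l2_class g, l2_class (L_expr \<alpha> g)) \<in> adjoint_operator T" using that adj by (simp add: D_def)
    then have "cinner_l2 (l2_class (L_expr \<alpha> f)) (l2_class g) = cinner_l2 (l2_class f) (l2_class (L_expr \<alpha> g))"
      using that(1) by (auto simp: adjoint_operator_def D_def)
    then show ?thesis using boundary_form_limit[of f g] that by (simp add: D_def)
  qed
  have "\<exists>\<theta>. D \<subseteq> bc_space (cos \<theta>) (sin \<theta>)"
  proof (cases "\<forall>f\<in>D. bvA f = 0 \<and> bvB f = 0")
    \<comment> \<open>If all boundary values are zero, every angle will do.\<close>
    case True
    then show ?thesis by (auto simp: bc_space_def D_def)
  next
    case False
    then obtain g where g: "g \<in> D" "bvA g \<noteq> 0 \<or> bvB g \<noteq> 0" by blast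
    have "\<exists>\<theta>. bvA g * of_real (cos \<theta>) + bvB g * of_real (sin \<theta>) = 0"
    proof (cases "bvB g = 0")
      case True
      then show ?thesis by (intro exI[of _ "pi / 2"]) simp
    next
      case B: False
      define \<rho> where "\<rho> = bvA g / bvB g"
      \<comment> \<open>The symmetry relation for g paired with itself says that the ratio of its
        boundary values is real.\<close>
      have "cnj \<rho> = \<rho>" using sym[OF g(1) g(1)] B by (simp add: \<rho>_def field_simps)
      then have rho: "\<rho> = of_real (Re \<rho>)" by (simp add: complex_eq_iff)
      define \<theta> where "\<theta> = - arctan (Re \<rho>)"
      have "cos \<theta> \<noteq> 0" by (simp add: \<theta>_def cos_arctan_not_zero del: cos_arctan)
      moreover have "tan \<theta> = - Re \<rho>" by (simp add: \<theta>_def tan_arctan)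
      ultimately have "Re \<rho> * cos \<theta> + sin \<theta> = 0" by (simp add: tan_def field_simps)
      then have "\<rho> * of_real (cos \<theta>) + of_real (sin \<theta>) = 0"
        by (subst rho) (simp only: of_real_mult[symmetric] of_real_add[symmetric] of_real_0)
      then have "bvB g * (\<rho> * of_real (cos \<theta>) + of_real (sin \<theta>)) = 0" by simp
      moreover have "bvB g * \<rho> = bvA g" using B by (simp add: \<rho>_def)
      ultimately have "bvA g * of_real (cos \<theta>) + bvB g * of_real (sin \<theta>) = 0"
        by (simp only: distrib_left mult.assoc[symmetric])
      then show ?thesis by blast
    qed
    then obtain \<theta> where th: "bvA g * of_real (cos \<theta>) + bvB g * of_real (sin \<theta>) = 0" by blast
    define a' where "a' = cnj (bvA g)"
    define b' where "b' = cnj (bvB g)"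
    have "cnj (bvA g * of_real (cos \<theta>) + bvB g * of_real (sin \<theta>)) = 0" using th by (simp only: complex_cnj_zero)
    then have th': "a' * of_real (cos \<theta>) = - (b' * of_real (sin \<theta>))"
      by (simp add: a'_def b'_def eq_neg_iff_add_eq_0)
    have "bvA f * of_real (cos \<theta>) + bvB f * of_real (sin \<theta>) = 0" if f: "f \<in> D" for f
    proof -
      \<comment> \<open>Symmetry of f against the fixed g lets the condition for f, multiplied by
        \<open>a'\<close> or by \<open>b'\<close>, be reduced to the conjugated condition for g; one
        of these two multipliers is nonzero.\<close>
      have s: "bvA f * b' = bvB f * a'" using sym[OF f g(1)] by (simp add: a'_def b'_def)
      have "a' * (bvA f * of_real (cos \<theta>) + bvB f * of_real (sin \<theta>)) =
          bvA f * (a' * of_real (cos \<theta>)) + (bvB f * a') * of_real (sin \<theta>)" by (simp add: algebra_simps)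
      also have "\<dots> = 0" unfolding th' s[symmetric] by (simp add: algebra_simps)
      finally have 1: "a' * (bvA f * of_real (cos \<theta>) + bvB f * of_real (sin \<theta>)) = 0" .
      have "b' * (bvA f * of_real (cos \<theta>) + bvB f * of_real (sin \<theta>)) =
          (bvA f * b') * of_real (cos \<theta>) + bvB f * (b' * of_real (sin \<theta>))" by (simp add: algebra_simps)
      also have "\<dots> = bvB f * (a' * of_real (cos \<theta>) + b' * of_real (sin \<theta>))" unfolding s by (simp add: algebra_simps)
      also have "\<dots> = 0" unfolding th' by simp
      finally have 2: "b' * (bvA f * of_real (cos \<theta>) + bvB f * of_real (sin \<theta>)) = 0" .
      have "a' \<noteq> 0 \<or> b' \<noteq> 0" using g(2) by (simp add: a'_def b'_def)
      then show ?thesis using 1 2 by (metis mult_eq_0_iff)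
    qed
    then show ?thesis by (auto simp: bc_space_def D_def)
  qed
  then obtain \<theta> where th: "D \<subseteq> bc_space (cos \<theta>) (sin \<theta>)" by blast
  have cs: "cos \<theta> \<noteq> 0 \<or> sin \<theta> \<noteq> 0" using sin_zero_abs_cos_one[of \<theta>] by auto
  have "T \<subseteq> H_op \<alpha> (bc_space (cos \<theta>) (sin \<theta>))" unfolding T_eq by (rule H_op_mono[OF th])
  \<comment> \<open>Adjoints reverse the inclusion, and both operators are their own
    adjoints.\<close>
  moreover from adjoint_operator_antimono[OF this]
  have "H_op \<alpha> (bc_space (cos \<theta>) (sin \<theta>)) \<subseteq> T" using adj adjoint_bc[OF cs] by simp
  ultimately show ?thesis by blast
qed

text \<open>A function with boundary values on the line of \<theta> satisfies the condition for
  \<theta>' only if sin (\<theta> - \<theta>') = 0. Conversely the two coefficient vectors then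
  differ by the factor cos (\<theta> - \<theta>'), which is 1 or -1.\<close>

lemma bc_eq_iff:
  "H_op \<alpha> (bc_space (cos \<theta>) (sin \<theta>)) = H_op \<alpha> (bc_space (cos \<theta>') (sin \<theta>')) \<longleftrightarrow>
    (\<exists>k::int. \<theta> - \<theta>' = pi * of_int k)"
proof -
  have iff: "sin (\<theta> - \<theta>') = 0 \<longleftrightarrow> (\<exists>k::int. \<theta> - \<theta>' = pi * of_int k)"
    by (simp add: sin_zero_iff_int2 mult.commute)
  show ?thesis
    unfolding iff[symmetric]
  proof
    assume eq: "H_op \<alpha> (bc_space (cos \<theta>) (sin \<theta>)) = H_op \<alpha> (bc_space (cos \<theta>') (sin \<theta>'))"
    obtain f where f: "f \<in> Delta \<alpha>" "bvA f = of_real (sin \<theta>) * w" "bvB f = - (of_real (cos \<theta>) * w)"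
      by (rule exists_boundary_values)
    have "f \<in> bc_space (cos \<theta>) (sin \<theta>)" using f by (simp add: bc_space_def algebra_simps)
    then have "(l2_class f, l2_class (L_expr \<alpha> f)) \<in> H_op \<alpha> (bc_space (cos \<theta>') (sin \<theta>'))"
      unfolding eq[symmetric] by (auto simp: H_op_def)
    then obtain g where g: "g \<in> bc_space (cos \<theta>') (sin \<theta>')" "l2_class f = l2_class g" by (auto simp: H_op_def)
    have gD: "g \<in> Delta \<alpha>" using g(1) by (simp add: bc_space_def)
    have "bvA f * of_real (cos \<theta>') + bvB f * of_real (sin \<theta>') = 0"
      using g(1) bv_cong[OF f(1) gD g(2)] by (simp add: bc_space_def)
    then have "w * of_real (sin \<theta> * cos \<theta>' - cos \<theta> * sin \<theta>') = 0"
      unfolding f by (simp add: algebra_simps)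
    then have "complex_of_real (sin (\<theta> - \<theta>')) = 0" using w_nonzero by (simp add: sin_diff)
    then show "sin (\<theta> - \<theta>') = 0" by (simp only: of_real_eq_0_iff)
  next
    assume s0: "sin (\<theta> - \<theta>') = 0"
    define e where "e = cos (\<theta> - \<theta>')"
    have "e \<noteq> 0" using sin_zero_abs_cos_one[OF s0] by (auto simp: e_def)
    have "cos \<theta> = cos \<theta>' * e" "sin \<theta> = sin \<theta>' * e"
      using s0 cos_add[of \<theta>' "\<theta> - \<theta>'"] sin_add[of \<theta>' "\<theta> - \<theta>'"] by (simp_all add: e_def)
    then have "bvA f * of_real (cos \<theta>) + bvB f * of_real (sin \<theta>) =
        of_real e * (bvA f * of_real (cos \<theta>') + bvB f * of_real (sin \<theta>'))" for f
      by (simp add: algebra_simps)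
    then have "bc_space (cos \<theta>) (sin \<theta>) = bc_space (cos \<theta>') (sin \<theta>')"
      using \<open>e \<noteq> 0\<close> by (auto simp: bc_space_def)
    then show "H_op \<alpha> (bc_space (cos \<theta>) (sin \<theta>)) = H_op \<alpha> (bc_space (cos \<theta>') (sin \<theta>'))" by simp
  qed
qed

text \<open>The Wronskian with \<open>U_fun\<close> is the combination of the two pairings with
  coefficients cos and sin, so the limit condition is a linear condition on the boundary
  values.\<close>

lemma h_bc_eq:
  assumes "A = A_fun (of_real \<alpha>) 0" "B = B_fun (of_real \<alpha>) 0"
  shows "h_bc \<alpha> \<theta> = H_op \<alpha> (bc_space (cos \<theta>) (sin \<theta>))"
proof -
  define U where "U = U_fun (of_real \<alpha>) (of_real \<theta>) 0"
  have U: "U r = A r * of_real (cos \<theta>) + B r * of_real (sin \<theta>)" for r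
    by (simp add: U_def U_fun_def assms sin_of_real cos_of_real)
  have D1U: "D1 U r = A' r * of_real (cos \<theta>) + B' r * of_real (sin \<theta>)" if "r > 0" for r
  proof (rule D1_eqI)
    show "(U has_vector_derivative A' r * of_real (cos \<theta>) + B' r * of_real (sin \<theta>)) (at r)"
      unfolding U[abs_def] using solA solB that
      by (intro has_vector_derivative_add has_vector_derivative_mult_left) (auto simp: zero_energy_solution_def)
  qed
  have "wronskian U f r = solution_pairing A A' f r * of_real (cos \<theta>) + solution_pairing B B' f r * of_real (sin \<theta>)"
    if "r > 0" for f r
    by (simp add: wronskian_def solution_pairing_def U D1U[OF that] algebra_simps)
  then have e: "\<forall>\<^sub>F r in at_right 0. solution_pairing A A' f r * of_real (cos \<theta>) + solution_pairing B B' f r * of_real (sin \<theta>)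
      = wronskian U f r" for f
    using eventually_at_right_less[of 0] by (auto elim: eventually_mono)
  have lim: "(wronskian U f \<longlongrightarrow> bvA f * of_real (cos \<theta>) + bvB f * of_real (sin \<theta>)) (at_right 0)" if "f \<in> Delta \<alpha>" for f
    by (rule Lim_transform_eventually[OF _ e]) (intro tendsto_intros bvA bvB that)
  have "Z_space \<alpha> \<theta> = bc_space (cos \<theta>) (sin \<theta>)"
  proof (intro set_eqI iffI)
    fix f assume "f \<in> Z_space \<alpha> \<theta>"
    then have f: "f \<in> Delta \<alpha>" "(wronskian U f \<longlongrightarrow> 0) (at_right 0)" by (auto simp: Z_space_def U_def)
    then show "f \<in> bc_space (cos \<theta>) (sin \<theta>)"
      using tendsto_unique[OF _ lim[OF f(1)] f(2)] by (simp add: bc_space_def)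
  next
    fix f assume "f \<in> bc_space (cos \<theta>) (sin \<theta>)"
    then show "f \<in> Z_space \<alpha> \<theta>" using lim[of f] by (simp add: bc_space_def Z_space_def U_def)
  qed
  then show ?thesis by (simp add: h_bc_def)
qed

end

section \<open>The zero-energy solutions\<close>

lemma complex_powr_has_vector_derivative:
  assumes "x > 0"
  shows "((\<lambda>r. complex_of_real r powr p) has_vector_derivative p * of_real x powr (p - 1)) (at x)"
  using assms by (intro has_vector_derivative_real_field has_field_derivative_powr) auto

lemma complex_powr_zero_energy_solution:
  assumes "p * (p - 1) = of_real (\<alpha> - 1 / 4)"
  shows "zero_energy_solution \<alpha> (\<lambda>r. complex_of_real r powr p) (\<lambda>r. p * of_real r powr (p - 1))"
  unfolding zero_energy_solution_def
proof (intro allI impI conjI)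
  fix x :: real assume x: "x > 0"
  show "((\<lambda>r. complex_of_real r powr p) has_vector_derivative p * of_real x powr (p - 1)) (at x)"
    using x by (rule complex_powr_has_vector_derivative)
  have "((\<lambda>r. p * complex_of_real r powr (p - 1)) has_vector_derivative p * ((p - 1) * of_real x powr (p - 1 - 1))) (at x)"
    using x by (intro has_vector_derivative_mult_right complex_powr_has_vector_derivative)
  then show "((\<lambda>r. p * complex_of_real r powr (p - 1)) has_vector_derivative of_real ((\<alpha> - 1 / 4) / x\<^sup>2) * of_real x powr p) (at x)"
  proof (rule has_vector_derivative_eq_rhs)
    have "complex_of_real x powr (p - 1 - 1) = of_real x powr (p - 2)" by (simp add: algebra_simps)
    also have "\<dots> = of_real x powr p / of_real x powr 2" using x by (simp add: powr_diff)
    also have "complex_of_real x powr 2 = (of_real x)\<^sup>2" using x powr_complexpow[of "of_real x" 2] by simp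
    finally have e: "complex_of_real x powr (p - 1 - 1) = of_real x powr p / (of_real x)\<^sup>2" .
    have "p * ((p - 1) * complex_of_real x powr (p - 1 - 1)) = (p * (p - 1)) * (of_real x powr p / (of_real x)\<^sup>2)"
      unfolding e by (simp only: mult.assoc)
    also have "\<dots> = of_real ((\<alpha> - 1 / 4) / x\<^sup>2) * of_real x powr p"
      unfolding assms by simp
    finally show "p * ((p - 1) * complex_of_real x powr (p - 1 - 1)) = of_real ((\<alpha> - 1 / 4) / x\<^sup>2) * of_real x powr p" .
  qed
qed

lemma complex_powr_square_integrable_near_0:
  assumes "Re p > - 1 / 2"
  shows "(\<lambda>r. (cmod (complex_of_real r powr p))\<^sup>2) absolutely_integrable_on {0<..1}"
proof -
  have "((\<lambda>x. x powr (2 * Re p)) has_integral (1 powr (2 * Re p + 1) / (2 * Re p + 1))) {0..1}"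
    using assms by (intro has_integral_powr_from_0) auto
  then have "(\<lambda>x. x powr (2 * Re p)) absolutely_integrable_on {0..1}"
    by (intro nonnegative_absolutely_integrable_1) (auto intro: has_integral_integrable)
  then have "(\<lambda>x. x powr (2 * Re p)) absolutely_integrable_on {0<..1}"
    by (rule set_integrable_subset) auto
  then show ?thesis
  proof (rule absolutely_integrable_spike[OF _ negligible_empty])
    fix x :: real assume "x \<in> {0<..1} - {}"
    then show "(cmod (complex_of_real x powr p))\<^sup>2 = x powr (2 * Re p)"
      by (simp add: norm_powr_real_powr power2_eq_square powr_add[symmetric])
  qed
qed

text \<open>An invertible change of basis multiplies the Wronskian by the determinant, so only
  reality of the new solutions has to be checked separately.\<close>

lemma limit_circle_lincomb:
  assumes y: "zero_energy_solution \<alpha> y y'" "(\<lambda>r. (cmod (y r))\<^sup>2) absolutely_integrable_on {0<..1}"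
    and z: "zero_energy_solution \<alpha> z z'" "(\<lambda>r. (cmod (z r))\<^sup>2) absolutely_integrable_on {0<..1}"
    and w: "\<And>r. r > 0 \<Longrightarrow> y r * z' r - y' r * z r = w" "w \<noteq> 0"
    and A: "\<And>r. r > 0 \<Longrightarrow> A r = a * y r + b * z r" "\<And>r. r > 0 \<Longrightarrow> cnj (A r) = A r"
    and B: "\<And>r. r > 0 \<Longrightarrow> B r = c * y r + d * z r" "\<And>r. r > 0 \<Longrightarrow> cnj (B r) = B r"
    and det: "a * d - b * c \<noteq> 0"
  shows "limit_circle \<alpha> A (\<lambda>r. a * y' r + b * z' r) B (\<lambda>r. c * y' r + d * z' r) ((a * d - b * c) * w)"
proof
  have sol: "zero_energy_solution \<alpha> F (\<lambda>r. k * y' r + l * z' r)" if F: "\<And>r. r > 0 \<Longrightarrow> F r = k * y r + l * z r" for F k l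
  proof -
    have "zero_energy_solution \<alpha> (\<lambda>r. k * y r + l * z r) (\<lambda>r. k * y' r + l * z' r)"
      by (rule zero_energy_solution_lincomb[OF y(1) z(1)])
    then show ?thesis
      unfolding zero_energy_solution_def
      using has_vector_derivative_cong_half_line[of F "\<lambda>r. k * y r + l * z r"] F by simp
  qed
  have sq: "(\<lambda>r. (cmod (F r))\<^sup>2) absolutely_integrable_on {0<..1}" if F: "\<And>r. r > 0 \<Longrightarrow> F r = k * y r + l * z r" for F k l
  proof (rule absolutely_integrable_spike[OF _ negligible_empty])
    show "(\<lambda>r. (cmod (k * y r + l * z r))\<^sup>2) absolutely_integrable_on {0<..1}"
      by (intro square_absolutely_integrable_lincomb y(2) z(2) zero_energy_solution_continuous(1)[OF y(1)]
          zero_energy_solution_continuous(1)[OF z(1)])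
  qed (use F in auto)
  show "zero_energy_solution \<alpha> A (\<lambda>r. a * y' r + b * z' r)" by (rule sol[OF A(1)])
  show "zero_energy_solution \<alpha> B (\<lambda>r. c * y' r + d * z' r)" by (rule sol[OF B(1)])
  show "(\<lambda>r. (cmod (A r))\<^sup>2) absolutely_integrable_on {0<..1}" by (rule sq[OF A(1)])
  show "(\<lambda>r. (cmod (B r))\<^sup>2) absolutely_integrable_on {0<..1}" by (rule sq[OF B(1)])
  show "A r * (c * y' r + d * z' r) - (a * y' r + b * z' r) * B r = (a * d - b * c) * w" if "r > 0" for r
  proof -
    have "A r * (c * y' r + d * z' r) - (a * y' r + b * z' r) * B r = (a * d - b * c) * (y r * z' r - y' r * z r)"
      using that by (simp add: A(1) B(1) algebra_simps)
    then show ?thesis using w(1)[OF that] by simp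
  qed
  show "(a * d - b * c) * w \<noteq> 0" using det w(2) by simp
qed (use A(2) B(2) in auto)

section \<open>Eigenfunctions at z = 0\<close>

definition u_coeff :: "complex \<Rightarrow> complex" where
  "u_coeff \<kappa> = 2 powr (- \<kappa>) * rGamma (\<kappa> + 1)"

text \<open>Only the term n = 0 of the power series survives.\<close>

lemma u_fun_0: "u_fun \<kappa> 0 r = u_coeff \<kappa> * of_real r powr (1 / 2 + \<kappa>)"
proof -
  have "X_fun \<kappa> 0 = u_coeff \<kappa>"
    unfolding X_fun_def u_coeff_def
    by (subst suminf_finite[of "{0}"]) (auto simp: power_0_left)
  then show ?thesis by (simp add: u_fun_def)
qed

text \<open>The reciprocal Gamma function vanishes only at 0, -1, -2 and so on. For \<alpha> < 1 the
  bound on the real part holds for both square roots of \<alpha>.\<close>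

lemma u_coeff_nonzero: "Re \<kappa> > - 1 \<Longrightarrow> u_coeff \<kappa> \<noteq> 0"
  by (auto simp: u_coeff_def rGamma_eq_zero_iff elim!: nonpos_Ints_cases' dest!: arg_cong[where f = Re])

lemma cnj_u_fun_0: "r > 0 \<Longrightarrow> cnj (u_fun \<kappa> 0 r) = u_fun (cnj \<kappa>) 0 r"
  by (simp add: u_fun_0 u_coeff_def cnj_rGamma cnj_powr)

text \<open>A square root of a real number is real or purely imaginary, so conjugation at most
  changes its sign; with the evenness in \<kappa> this makes \<open>A_fun\<close> and
  \<open>B_fun\<close> real.\<close>

lemma csqrt_real_cases:
  assumes "\<alpha> < 1" "\<kappa> = csqrt (of_real \<alpha>)"
  shows "0 \<le> Re \<kappa>" "Re \<kappa> < 1" "cnj \<kappa> = \<kappa> \<or> cnj \<kappa> = - \<kappa>"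
proof -
  have "Re \<kappa> < 1 \<and> (cnj \<kappa> = \<kappa> \<or> cnj \<kappa> = - \<kappa>)"
  proof (cases "\<alpha> \<ge> 0")
    case True
    then have k: "\<kappa> = of_real (sqrt \<alpha>)" using assms(2) by simp
    have "Re \<kappa> < 1" unfolding k Re_complex_of_real using assms(1) by simp
    moreover have "cnj \<kappa> = \<kappa>" unfolding k by (rule complex_cnj_complex_of_real)
    ultimately show ?thesis by blast
  next
    case False
    then have k: "\<kappa> = \<i> * of_real (sqrt (- \<alpha>))" using assms(2) by simp
    have "Re \<kappa> < 1" "cnj \<kappa> = - \<kappa>" unfolding k by simp_all
    then show ?thesis by blast
  qed
  then show "Re \<kappa> < 1" "cnj \<kappa> = \<kappa> \<or> cnj \<kappa> = - \<kappa>" by auto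
  show "0 \<le> Re \<kappa>" using csqrt_principal[of "of_real \<alpha>"] assms(2) by auto
qed

lemma cnj_csinc: "cnj (csinc z) = csinc (cnj z)"
  by (simp add: csinc_def cnj_sin)

lemma cnj_theta: "cnj (theta \<kappa>) = theta (cnj \<kappa>)"
  by (simp add: theta_def)

text \<open>\<open>A_fun\<close> and \<open>B_fun\<close> are multiples of the difference and the
  sum of the two eigenfunctions. The multiplier cos vanishes only if \<kappa> is an odd integer and
  sinc only if it is a nonzero even one; 0 \<le> Re \<kappa> < 1 excludes both.\<close>

lemma limit_circle_A_B_nonzero:
  assumes "\<alpha> < 1" "\<alpha> \<noteq> 0"
  shows "\<exists>A' B' w. limit_circle \<alpha> (A_fun (of_real \<alpha>) 0) A' (B_fun (of_real \<alpha>) 0) B' w"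
proof -
  define \<kappa> where "\<kappa> = csqrt (of_real \<alpha>)"
  note k = csqrt_real_cases[OF assms(1) \<kappa>_def]
  have k0: "\<kappa> \<noteq> 0" using assms(2) by (simp add: \<kappa>_def)
  have k2: "\<kappa> * \<kappa> = of_real \<alpha>" using power2_csqrt[of "of_real \<alpha>"] by (simp add: \<kappa>_def power2_eq_square)
  define y where "y r = complex_of_real r powr (1 / 2 + \<kappa>)" for r
  define y' where "y' r = (1 / 2 + \<kappa>) * complex_of_real r powr (1 / 2 + \<kappa> - 1)" for r
  define z where "z r = complex_of_real r powr (1 / 2 + - \<kappa>)" for r
  define z' where "z' r = (1 / 2 + - \<kappa>) * complex_of_real r powr (1 / 2 + - \<kappa> - 1)" for r
  define m where "m = cos (theta \<kappa>) / \<kappa>"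
  define n where "n = of_real pi / 2 * csinc (theta \<kappa>)"
  have y: "zero_energy_solution \<alpha> y y'" "(\<lambda>r. (cmod (y r))\<^sup>2) absolutely_integrable_on {0<..1}"
    unfolding y_def[abs_def] y'_def[abs_def]
    by (rule complex_powr_zero_energy_solution, use k2 in \<open>simp add: algebra_simps\<close>)
       (rule complex_powr_square_integrable_near_0, use k in simp)
  have z: "zero_energy_solution \<alpha> z z'" "(\<lambda>r. (cmod (z r))\<^sup>2) absolutely_integrable_on {0<..1}"
    unfolding z_def[abs_def] z'_def[abs_def]
    by (rule complex_powr_zero_energy_solution, use k2 in \<open>simp add: algebra_simps\<close>)
       (rule complex_powr_square_integrable_near_0, use k in simp)
  have w: "y r * z' r - y' r * z r = - 2 * \<kappa>" if "r > 0" for r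
  proof -
    have "complex_of_real r powr (1 / 2 + \<kappa>) * of_real r powr (1 / 2 + - \<kappa> - 1) = 1"
      "complex_of_real r powr (1 / 2 + \<kappa> - 1) * of_real r powr (1 / 2 + - \<kappa>) = 1"
      using that by (simp_all add: powr_add[symmetric])
    then show ?thesis by (simp add: y_def z_def y'_def z'_def algebra_simps)
  qed
  have A_eq: "A_fun (of_real \<alpha>) 0 r = a_fun_nonzero \<kappa> 0 r" for r
    using k0 by (simp add: A_fun_def \<kappa>_def[symmetric] a_fun_def)
  have B_eq: "B_fun (of_real \<alpha>) 0 r = b_fun \<kappa> 0 r" for r
    by (simp add: B_fun_def \<kappa>_def[symmetric])
  have real: "cnj (A_fun (of_real \<alpha>) 0 r) = A_fun (of_real \<alpha>) 0 r" "cnj (B_fun (of_real \<alpha>) 0 r) = B_fun (of_real \<alpha>) 0 r"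
    if r: "r > 0" for r
  proof -
    have a: "cnj (a_fun_nonzero \<kappa> 0 r) = a_fun_nonzero (cnj \<kappa>) 0 r"
      using r by (simp add: a_fun_nonzero_def cnj_u_fun_0 cnj_cos cnj_theta)
    have b: "cnj (b_fun \<kappa> 0 r) = b_fun (cnj \<kappa>) 0 r"
      using r by (simp add: b_fun_def cnj_u_fun_0 cnj_csinc cnj_theta)
    have a': "a_fun_nonzero (- \<kappa>) 0 r = a_fun_nonzero \<kappa> 0 r"
      using a_fun_minus[of \<kappa> 0 r] k0 by (simp add: a_fun_def)
    show "cnj (A_fun (of_real \<alpha>) 0 r) = A_fun (of_real \<alpha>) 0 r"
      unfolding A_eq a using k(3) a' by auto
    show "cnj (B_fun (of_real \<alpha>) 0 r) = B_fun (of_real \<alpha>) 0 r"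
      unfolding B_eq b using k(3) b_fun_minus[of \<kappa> 0 r] by auto
  qed
  have m0: "cos (theta \<kappa>) \<noteq> 0"
  proof
    assume "cos (theta \<kappa>) = 0"
    then obtain j :: int where "theta \<kappa> = of_real (j * pi) + of_real pi / 2" unfolding cos_eq_0 by blast
    then have "complex_of_real pi * \<kappa> = of_real pi * (2 * of_int j + 1)" by (simp add: theta_def field_simps)
    then have "\<kappa> = 2 * of_int j + 1" by simp
    then have "Re \<kappa> = 2 * of_int j + 1" by simp
    then have "0 \<le> 2 * real_of_int j + 1" "2 * real_of_int j + 1 < 1" using k by simp_all
    then have "0 \<le> 2 * j + 1" "2 * j + 1 < 1" by linarith+
    then show False by presburger
  qed
  have n0: "csinc (theta \<kappa>) \<noteq> 0"
  proof
    assume a: "csinc (theta \<kappa>) = 0"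
    have "theta \<kappa> \<noteq> 0" using k0 by (simp add: theta_def)
    then have "sin (theta \<kappa>) = 0" using a by (simp add: csinc_def)
    then obtain j :: int where "theta \<kappa> = of_real (j * pi)" unfolding sin_eq_0 by blast
    then have "complex_of_real pi * \<kappa> = of_real pi * (2 * of_int j)" by (simp add: theta_def field_simps)
    then have kj: "\<kappa> = 2 * of_int j" by simp
    then have "Re \<kappa> = 2 * of_int j" by simp
    then have "0 \<le> 2 * real_of_int j" "2 * real_of_int j < 1" using k by simp_all
    then have "j = 0" by linarith
    then show False using kj k0 by simp
  qed
  have "limit_circle \<alpha> (A_fun (of_real \<alpha>) 0) (\<lambda>r. (m * u_coeff \<kappa>) * y' r + (- (m * u_coeff (- \<kappa>))) * z' r)
     (B_fun (of_real \<alpha>) 0) (\<lambda>r. (n * u_coeff \<kappa>) * y' r + (n * u_coeff (- \<kappa>)) * z' r)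
     (((m * u_coeff \<kappa>) * (n * u_coeff (- \<kappa>)) - (- (m * u_coeff (- \<kappa>))) * (n * u_coeff \<kappa>)) * (- 2 * \<kappa>))"
  proof (rule limit_circle_lincomb[OF y z w])
    show "- 2 * \<kappa> \<noteq> 0" using k0 by simp
    show "A_fun (of_real \<alpha>) 0 r = (m * u_coeff \<kappa>) * y r + (- (m * u_coeff (- \<kappa>))) * z r" for r
      unfolding A_eq a_fun_nonzero_def u_fun_0 m_def y_def z_def
      using k0 by (simp add: field_simps)
    show "B_fun (of_real \<alpha>) 0 r = (n * u_coeff \<kappa>) * y r + (n * u_coeff (- \<kappa>)) * z r" for r
      unfolding B_eq b_fun_def u_fun_0 n_def y_def z_def by (simp add: algebra_simps)
    have "u_coeff \<kappa> \<noteq> 0" "u_coeff (- \<kappa>) \<noteq> 0" using k by (auto intro!: u_coeff_nonzero)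
    moreover have "m \<noteq> 0" "n \<noteq> 0" using m0 n0 k0 by (simp_all add: m_def n_def)
    moreover have "(m * u_coeff \<kappa>) * (n * u_coeff (- \<kappa>)) - (- (m * u_coeff (- \<kappa>))) * (n * u_coeff \<kappa>) =
        2 * (m * n * u_coeff \<kappa> * u_coeff (- \<kappa>))" by (simp add: algebra_simps)
    ultimately show "(m * u_coeff \<kappa>) * (n * u_coeff (- \<kappa>)) - (- (m * u_coeff (- \<kappa>))) * (n * u_coeff \<kappa>) \<noteq> 0" by simp
  qed (use real in auto)
  then show ?thesis by blast
qed

text \<open>The limit is that of a symmetric difference quotient, so it is twice the derivative of
  \<open>u_fun \<kappa> 0 r\<close> at \<kappa> = 0. The three terms stem from the power of r, from
  \<open>rGamma\<close>, whose logarithmic derivative at 1 is the Euler constant, and from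
  \<open>2 powr (- \<kappa>)\<close>.\<close>

lemma A_fun_0:
  assumes "r > 0"
  shows "A_fun 0 0 r = 2 * of_real (sqrt r * (ln r + (euler_mascheroni - ln 2)))"
proof -
  define F where "F \<kappa> = u_fun \<kappa> 0 r" for \<kappa>
  define D where "D = complex_of_real (sqrt r * (ln r + (euler_mascheroni - ln 2)))"
  have half: "complex_of_real r powr (1 / 2) = of_real (sqrt r)"
    using assms powr_of_real[of r "1 / 2"] by (simp add: powr_half_sqrt)
  have F0: "(F has_field_derivative D) (at 0)"
  proof -
    have rg: "(rGamma has_field_derivative - rGamma (0 + 1) * Digamma (0 + 1)) (at (0 + 1 :: complex))"
      by (rule has_field_derivative_rGamma_no_nonpos_int) (auto elim!: nonpos_Ints_cases' dest!: arg_cong[where f = Re])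
    have "((\<lambda>\<kappa>. rGamma (\<kappa> + 1)) has_field_derivative (- rGamma (0 + 1) * Digamma (0 + 1)) * 1) (at (0::complex))"
      by (rule DERIV_chain2[where f = rGamma and g = "\<lambda>\<kappa>. \<kappa> + 1"], rule rg) (auto intro!: derivative_eq_intros)
    moreover have "((\<lambda>\<kappa>. (2::complex) powr (- \<kappa>)) has_field_derivative (Ln 2 * 2 powr (- 0)) * (- 1)) (at 0)"
      by (rule DERIV_chain2[where f = "\<lambda>p. 2 powr p" and g = uminus], rule has_field_derivative_powr_right)
         (auto intro!: derivative_eq_intros)
    moreover have "((\<lambda>\<kappa>. complex_of_real r powr (1 / 2 + \<kappa>)) has_field_derivative (Ln (of_real r) * of_real r powr (1 / 2 + 0)) * 1) (at 0)"
      by (rule DERIV_chain2[where f = "\<lambda>p. of_real r powr p" and g = "\<lambda>\<kappa>. 1 / 2 + \<kappa>"], rule has_field_derivative_powr_right)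
         (use assms in \<open>auto intro!: derivative_eq_intros\<close>)
    ultimately have "((\<lambda>\<kappa>. (2 powr (- \<kappa>) * rGamma (\<kappa> + 1)) * of_real r powr (1 / 2 + \<kappa>)) has_field_derivative
       (((Ln 2 * 2 powr (- 0)) * (- 1)) * rGamma (0 + 1) + ((- rGamma (0 + 1) * Digamma (0 + 1)) * 1) * 2 powr (- 0)) * of_real r powr (1 / 2 + 0)
        + ((Ln (of_real r) * of_real r powr (1 / 2 + 0)) * 1) * (2 powr (- 0) * rGamma (0 + 1))) (at 0)"
      by (intro DERIV_mult)
    then show ?thesis
      unfolding F_def[abs_def] u_fun_0 u_coeff_def
    proof (rule DERIV_cong)
      have "Ln 2 = complex_of_real (ln 2)" using Ln_of_real[of 2] by simp
      then show "(((Ln 2 * 2 powr (- 0)) * (- 1)) * rGamma (0 + 1) + ((- rGamma (0 + 1) * Digamma (0 + 1)) * 1) * 2 powr (- 0)) * of_real r powr (1 / 2 + 0)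
        + ((Ln (of_real r) * of_real r powr (1 / 2 + 0)) * 1) * (2 powr (- 0) * rGamma (0 + 1)) = D"
        using assms by (simp add: D_def half Ln_of_real algebra_simps)
    qed
  qed
  have "((\<lambda>\<kappa>. F (- \<kappa>)) has_field_derivative D * (- 1)) (at 0)"
    by (rule DERIV_chain2[where g = uminus]) (use F0 in \<open>auto intro!: derivative_eq_intros\<close>)
  from DERIV_diff[OF F0 this] have "((\<lambda>\<kappa>. F \<kappa> - F (- \<kappa>)) has_field_derivative 2 * D) (at 0)" by simp
  then have "((\<lambda>\<kappa>. (F \<kappa> - F (- \<kappa>)) / \<kappa>) \<longlongrightarrow> 2 * D) (at 0)"
    by (simp add: has_field_derivative_iff)
  moreover have "((\<lambda>\<kappa>. cos (theta \<kappa>)) \<longlongrightarrow> cos (theta 0)) (at 0)"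
    unfolding theta_def by (intro tendsto_intros) auto
  ultimately have "((\<lambda>\<kappa>. (F \<kappa> - F (- \<kappa>)) / \<kappa> * cos (theta \<kappa>)) \<longlongrightarrow> (2 * D) * cos (theta 0)) (at 0)"
    by (rule tendsto_mult)
  then have "((\<lambda>\<kappa>. a_fun_nonzero \<kappa> 0 r) \<longlongrightarrow> 2 * D) (at 0)"
    by (simp add: a_fun_nonzero_def F_def theta_def)
  then have "Lim (at 0) (\<lambda>\<kappa>. a_fun_nonzero \<kappa> 0 r) = 2 * D" by (intro tendsto_Lim) auto
  then show ?thesis by (simp add: A_fun_def a_fun_def D_def)
qed

lemma B_fun_0:
  assumes "r > 0"
  shows "B_fun 0 0 r = of_real (pi * sqrt r)"
proof -
  have "complex_of_real r powr (1 / 2) = of_real (sqrt r)"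
    using assms powr_of_real[of r "1 / 2"] by (simp add: powr_half_sqrt)
  then show ?thesis by (simp add: B_fun_def b_fun_def u_fun_0 u_coeff_def csinc_def theta_def)
qed

text \<open>At \<alpha> = 0 the exponent 1/2 is a double root of the indicial equation, so the
  second basis solution carries a logarithm; it is still bounded near 0.\<close>

lemma limit_circle_A_B_zero: "\<exists>A' B' w. limit_circle 0 (A_fun 0 0) A' (B_fun 0 0) B' w"
proof -
  define y where "y r = complex_of_real (sqrt r)" for r
  define y' where "y' r = complex_of_real (1 / (2 * sqrt r))" for r
  define z where "z r = complex_of_real (sqrt r * ln r)" for r
  define z' where "z' r = complex_of_real ((ln r / 2 + 1) / sqrt r)" for r
  have y: "zero_energy_solution 0 y y'"
    unfolding zero_energy_solution_def
  proof (intro allI impI conjI)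
    fix x :: real assume x: "x > 0"
    have "(sqrt has_real_derivative 1 / (2 * sqrt x)) (at x)"
      using DERIV_real_sqrt[OF x] by (simp add: field_simps)
    then show "(y has_vector_derivative y' x) (at x)"
      unfolding y_def[abs_def] y'_def by (rule has_vector_derivative_of_real)
    have sx: "sqrt x * sqrt x = x" "sqrt x > 0" using x by auto
    have "((\<lambda>r. 1 / (2 * sqrt r)) has_real_derivative - (1 / 4) / x\<^sup>2 * sqrt x) (at x)"
    proof (rule DERIV_cong)
      show "((\<lambda>r. 1 / (2 * sqrt r)) has_real_derivative (0 * (2 * sqrt x) - 1 * (2 * (inverse (sqrt x) / 2))) / ((2 * sqrt x) * (2 * sqrt x))) (at x)"
        using x by (intro DERIV_divide DERIV_const DERIV_cmult DERIV_real_sqrt) auto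
      have e: "x\<^sup>2 = sqrt x ^ 4" using sx(1) by (metis power2_eq_square power4_eq_xxxx mult.assoc)
      show "(0 * (2 * sqrt x) - 1 * (2 * (inverse (sqrt x) / 2))) / ((2 * sqrt x) * (2 * sqrt x)) = - (1 / 4) / x\<^sup>2 * sqrt x"
        unfolding e using sx(2) by (simp add: field_simps eval_nat_numeral)
    qed
    from has_vector_derivative_of_real[OF this]
    show "(y' has_vector_derivative of_real ((0 - 1 / 4) / x\<^sup>2) * y x) (at x)"
      unfolding y_def y'_def[abs_def] by (simp only: of_real_mult diff_0)
  qed
  have z: "zero_energy_solution 0 z z'"
    unfolding zero_energy_solution_def
  proof (intro allI impI conjI)
    fix x :: real assume x: "x > 0"
    have sx: "sqrt x * sqrt x = x" "sqrt x > 0" using x by auto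
    have "((\<lambda>r. sqrt r * ln r) has_real_derivative (ln x / 2 + 1) / sqrt x) (at x)"
    proof (rule DERIV_cong)
      show "((\<lambda>r. sqrt r * ln r) has_real_derivative inverse (sqrt x) / 2 * ln x + 1 / x * sqrt x) (at x)"
        using x by (intro DERIV_mult DERIV_real_sqrt DERIV_ln_divide)
      have "1 / x * sqrt x = 1 / sqrt x" using sx by (simp add: field_simps)
      then show "inverse (sqrt x) / 2 * ln x + 1 / x * sqrt x = (ln x / 2 + 1) / sqrt x"
        using sx(2) by (simp add: field_simps)
    qed
    then show "(z has_vector_derivative z' x) (at x)"
      unfolding z_def[abs_def] z'_def by (rule has_vector_derivative_of_real)
    have "((\<lambda>r. (ln r / 2 + 1) / sqrt r) has_real_derivative - (1 / 4) / x\<^sup>2 * (sqrt x * ln x)) (at x)"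
    proof (rule DERIV_cong)
      show "((\<lambda>r. (ln r / 2 + 1) / sqrt r) has_real_derivative
          ((1 / x / 2 + 0) * sqrt x - (ln x / 2 + 1) * (inverse (sqrt x) / 2)) / (sqrt x * sqrt x)) (at x)"
        using x by (intro DERIV_divide DERIV_add DERIV_const DERIV_cdivide DERIV_real_sqrt DERIV_ln_divide) auto
      define t where "t = sqrt x"
      define l where "l = ln x"
      have t: "t > 0" "x = t * t" using sx by (auto simp: t_def)
      have "((1 / (t * t) / 2 + 0) * t - (l / 2 + 1) * (inverse t / 2)) / (t * t) = - (1 / 4) / (t * t)\<^sup>2 * (t * l)"
        using t(1) by (simp add: field_simps power2_eq_square)
      then show "((1 / x / 2 + 0) * sqrt x - (ln x / 2 + 1) * (inverse (sqrt x) / 2)) / (sqrt x * sqrt x) = - (1 / 4) / x\<^sup>2 * (sqrt x * ln x)"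
        unfolding t_def[symmetric] l_def[symmetric] by (simp only: t(2))
    qed
    from has_vector_derivative_of_real[OF this]
    show "(z' has_vector_derivative of_real ((0 - 1 / 4) / x\<^sup>2) * z x) (at x)"
      unfolding z_def z'_def[abs_def] by (simp only: of_real_mult diff_0)
  qed
  have bounded_sq: "(\<lambda>r. (cmod (f r))\<^sup>2) absolutely_integrable_on {0<..1}"
    if f: "continuous_on {0<..} f" "\<And>r. 0 < r \<Longrightarrow> r \<le> 1 \<Longrightarrow> cmod (f r) \<le> 2" for f :: "real \<Rightarrow> complex"
  proof (rule measurable_bounded_by_integrable_imp_absolutely_integrable)
    have "continuous_on {0<..} (\<lambda>r. (cmod (f r))\<^sup>2)" by (intro continuous_intros f(1))
    then show "(\<lambda>r. (cmod (f r))\<^sup>2) \<in> borel_measurable (lebesgue_on {0<..1})"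
      by (rule continuous_imp_measurable_on_sets_lebesgue[OF continuous_on_subset]) auto
    show "(\<lambda>_::real. 4::real) integrable_on {0<..1}" by (intro integrable_on_const Ioc_lmeasurable)
    fix r :: real assume "r \<in> {0<..1}"
    then have "(cmod (f r))\<^sup>2 \<le> 2\<^sup>2" using f(2)[of r] by (intro power_mono) auto
    then show "norm ((cmod (f r))\<^sup>2) \<le> 4" by simp
  qed auto
  have sqy: "(\<lambda>r. (cmod (y r))\<^sup>2) absolutely_integrable_on {0<..1}"
  proof (rule bounded_sq[OF zero_energy_solution_continuous(1)[OF y]])
    fix r :: real assume "0 < r" "r \<le> 1"
    then have "sqrt r \<le> 1" by simp
    moreover have "cmod (y r) = sqrt r" using \<open>0 < r\<close> by (simp add: y_def)
    ultimately show "cmod (y r) \<le> 2" by linarith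
  qed
  have sqz: "(\<lambda>r. (cmod (z r))\<^sup>2) absolutely_integrable_on {0<..1}"
  proof (rule bounded_sq[OF zero_energy_solution_continuous(1)[OF z]])
    fix r :: real assume r: "0 < r" "r \<le> 1"
    define t where "t = sqrt r"
    have t: "t > 0" "t \<le> 1" using r by (auto simp: t_def)
    have "ln r = 2 * ln t" using r by (simp add: t_def ln_sqrt)
    \<comment> \<open>The elementary bound ln x \<le> x - 1 at 1 / t, with t the square root of r,
      gives that the logarithm of r is at most 2 / t in modulus.\<close>
    moreover have "ln (1 / t) \<le> 1 / t - 1" using t by (intro ln_le_minus_one) auto
    then have "- ln t \<le> 1 / t" using t by (simp add: ln_div)
    moreover have "ln t \<le> 0" using t by simp
    ultimately have "\<bar>ln r\<bar> \<le> 2 / t" by simp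
    then have "t * \<bar>ln r\<bar> \<le> t * (2 / t)" using t by (intro mult_left_mono) auto
    then have "t * \<bar>ln r\<bar> \<le> 2" using t by simp
    then show "cmod (z r) \<le> 2" using t(1) by (simp add: z_def norm_mult abs_mult t_def[symmetric])
  qed
  \<comment> \<open>The coefficient of the square root in \<open>A_fun_0\<close>.\<close>
  define \<delta> where "\<delta> = complex_of_real (2 * (euler_mascheroni - ln 2))"
  have "limit_circle 0 (A_fun 0 0) (\<lambda>r. \<delta> * y' r + 2 * z' r) (B_fun 0 0) (\<lambda>r. of_real pi * y' r + 0 * z' r)
    ((\<delta> * 0 - 2 * of_real pi) * 1)"
  proof (rule limit_circle_lincomb[OF y sqy z sqz])
    fix r :: real assume r: "r > 0"
    have "y r * z' r - y' r * z r = of_real (sqrt r * ((ln r / 2 + 1) / sqrt r) - 1 / (2 * sqrt r) * (sqrt r * ln r))"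
      by (simp add: y_def z_def y'_def z'_def)
    also have "sqrt r * ((ln r / 2 + 1) / sqrt r) - 1 / (2 * sqrt r) * (sqrt r * ln r) = 1"
      using r by (simp add: field_simps)
    finally show "y r * z' r - y' r * z r = 1" by simp
    show "A_fun 0 0 r = \<delta> * y r + 2 * z r"
      using r by (simp add: A_fun_0 \<delta>_def y_def z_def algebra_simps)
    show "B_fun 0 0 r = of_real pi * y r + 0 * z r"
      using r by (simp add: B_fun_0 y_def)
    show "cnj (A_fun 0 0 r) = A_fun 0 0 r" using r
      by (simp only: A_fun_0 complex_cnj_mult complex_cnj_numeral complex_cnj_complex_of_real)
    show "cnj (B_fun 0 0 r) = B_fun 0 0 r" using r by (simp add: B_fun_0)
  qed auto
  then show ?thesis by blast
qed

theorem theorem1p1: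
  fixes \<alpha> :: real
  shows "(\<alpha> \<ge> 1 \<longrightarrow> self_adjoint (h_op \<alpha>)) \<and>
    (\<alpha> < 1 \<longrightarrow>
      (\<forall>\<theta>::real. self_adjoint (h_bc \<alpha> \<theta>) \<and> extends (h_bc \<alpha> \<theta>) (h_op \<alpha>)) \<and>
      (\<forall>T. self_adjoint T \<and> extends T (h_op \<alpha>) \<longrightarrow> (\<exists>\<theta>::real. T = h_bc \<alpha> \<theta>)) \<and>
      (\<forall>\<theta> \<theta>' :: real. h_bc \<alpha> \<theta> = h_bc \<alpha> \<theta>' \<longleftrightarrow> (\<exists>k::int. \<theta> - \<theta>' = pi * of_int k)))"
proof (intro conjI impI)
  show "self_adjoint (h_op \<alpha>)" if "\<alpha> \<ge> 1" using that by (rule h_op_self_adjoint)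
  assume "\<alpha> < 1"
  \<comment> \<open>The case \<alpha> = 0 is separate because there the two power solutions
    coincide.\<close>
  then have "\<exists>A' B' w. limit_circle \<alpha> (A_fun (of_real \<alpha>) 0) A' (B_fun (of_real \<alpha>) 0) B' w"
    using limit_circle_A_B_zero limit_circle_A_B_nonzero by (cases "\<alpha> = 0") auto
  then obtain A' B' w where "limit_circle \<alpha> (A_fun (of_real \<alpha>) 0) A' (B_fun (of_real \<alpha>) 0) B' w" by blast
  then interpret limit_circle \<alpha> "A_fun (of_real \<alpha>) 0" A' "B_fun (of_real \<alpha>) 0" B' w .
  have h: "h_bc \<alpha> \<theta> = H_op \<alpha> (bc_space (cos \<theta>) (sin \<theta>))" for \<theta> by (rule h_bc_eq[OF refl refl])
  have cs: "cos \<theta> \<noteq> 0 \<or> sin \<theta> \<noteq> 0" for \<theta> :: real using sin_zero_abs_cos_one[of \<theta>] by auto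
  show "\<forall>\<theta>::real. self_adjoint (h_bc \<alpha> \<theta>) \<and> extends (h_bc \<alpha> \<theta>) (h_op \<alpha>)"
    unfolding h using self_adjoint_bc[OF cs] bc_extends[OF cs] by blast
  show "\<forall>T. self_adjoint T \<and> extends T (h_op \<alpha>) \<longrightarrow> (\<exists>\<theta>::real. T = h_bc \<alpha> \<theta>)"
    unfolding h using self_adjoint_extension_is_bc by blast
  show "\<forall>\<theta> \<theta>' :: real. h_bc \<alpha> \<theta> = h_bc \<alpha> \<theta>' \<longleftrightarrow> (\<exists>k::int. \<theta> - \<theta>' = pi * of_int k)"
    unfolding h using bc_eq_iff by blast
qed

end
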